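(* Let $\varepsilon>0$ be fixed and let $\varphi\in \mathcal{G}^{\beta}\cap\mathcal{U}$ be a local minimizer of the problem of minimizing $J_l^{N,\varepsilon}$ over $\mathcal{G}^{\beta}\cap\mathcal{U}$, i.e., there exists $\delta>0$ such that $$J_l^{N,\varepsilon}(\vartheta)\ge J_l^{N,\varepsilon}(\varphi)\quad\text{for all }\vartheta\in\mathcal{G}^{\beta}\cap\mathcal{U}\text{ with }\|\vartheta-\varphi\|_{L^\infty(\Omega)}<\delta.$$ Suppose that the Neumann eigenvalues $\mu^{\varphi}_{i_1},\dots,\mu^{\varphi}_{i_l}$ are simple, and fix associated eigenfunctions $w^{N,\varphi}_{i_1},\dots,w^{N,\varphi}_{i_l}\in H^1_{(0),\varphi}(\Omega)$, normalized by $\int_\Omega c_\varepsilon(\varphi)|w^{N,\varphi}_{i_j}|^2\,dx=1$. Then the following holds. (1) For all $j\in\{1,\dots,l\}$ the state equation $$-\nabla\cdot\big[a_\varepsilon(\varphi)\nabla w^{N,\varphi}_{i_j}\big]=\mu^{\varphi}_{i_j}c_\varepsilon(\varphi)w^{N,\varphi}_{i_j}\ \text{ in }\Omega,\qquad \frac{\partial w^{N,\varphi}_{i_j}}{\partial\nu}=0\ \text{ on }\partial\Omega$$ is fulfilled in the weak sense ($\nu$ being the outer unit normal on $\partial\Omega$). (2) For all $\vartheta\in\mathcal{G}^{\beta}\cap\mathcal{U}$ the variational inequality $$\begin{aligned}0\le{}&\gamma\varepsilon\int_{\tilde\Omega}\nabla\varphi\cdot\nabla(\vartheta-\varphi)\,dx+\frac{\gamma}{\varepsilon}\int_{\tilde\Omega}\psi_0'(\varphi)(\vartheta-\varphi)\,dx\\&+\sum_{j=1}^{l}\partial_j\Psi(\mu^{\varphi}_{i_1},\dots,\mu^{\varphi}_{i_l})\Big(\int_\Omega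 a_\varepsilon'(\varphi)(\vartheta-\varphi)|\nabla w^{N,\varphi}_{i_j}|^2\,dx-\mu^{\varphi}_{i_j}\int_\Omega c_\varepsilon'(\varphi)(\vartheta-\varphi)|w^{N,\varphi}_{i_j}|^2\,dx\Big)\end{aligned}$$ is satisfied, where $\partial_j\Psi$ denotes the partial derivative of $\Psi$ with respect to its $j$-th argument.
   Context: Setting. $\Omega\subset\mathbb{R}^d$, $d\in\mathbb{N}$, is a bounded domain with Lipschitz boundary. $S_0,S_1\subset\Omega$ are disjoint measurable sets such that $\tilde\Omega:=\Omega\setminus(S_0\cup S_1)$ is a domain with Lipschitz boundary. $\beta_1,\beta_2\in(-1,1)$ with $\beta_1\le\beta_2$. Define $$\mathcal{U}=\{\varphi\in L^1(\Omega): \varphi=-1\text{ a.e. on }S_0,\ \varphi=1\text{ a.e. on }S_1\},$$ $$\mathcal{G}^\beta=\Big\{\varphi\in H^1(\tilde\Omega): |\varphi|\le1,\ \beta_1|\tilde\Omega|\le\int_{\tilde\Omega}\varphi\,dx\le\beta_2|\tilde\Omega|\Big\}.$$ $\mathcal{G}^\beta\cap\mathcal{U}$ is the set of $\varphi\in\mathcal{U}$ whose restriction to $\tilde\Omega$ lies in $\mathcal{G}^\beta$ (so $|\varphi|\le 1$ a.e. in $\Omega$). Coefficients. For the fixed $\varepsilon>0$, $a_\varepsilon,c_\varepsilon\in C^{1,1}_{loc}(\mathbb{R})$ with $a_\varepsilon,c_\varepsilon>C_\varepsilon>0$ on $\mathbb{R}$ for some constant $C_\varepsilon$. Eigenvalues.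 For $\varphi\in L^\infty(\Omega)$, a Neumann eigenvalue is a number $\mu$ for which there is $0\ne w\in H^1(\Omega)$ (an eigenfunction) with $$\int_\Omega a_\varepsilon(\varphi)\nabla w\cdot\nabla\eta\,dx=\mu\int_\Omega c_\varepsilon(\varphi)w\eta\,dx\quad\text{for all }\eta\in H^1(\Omega)$$ (this is the weak form of the state equation). The Neumann eigenvalues, repeated according to multiplicity, form a sequence $0=\mu_0^\varphi<\mu_1^\varphi\le\mu_2^\varphi\le\cdots\to\infty$. Eigenfunctions to non-trivial eigenvalues belong to $H^1_{(0),\varphi}(\Omega)=\{w\in H^1(\Omega):\int_\Omega c_\varepsilon(\varphi)w\,dx=0\}$. An eigenvalue is simple if its eigenspace is one-dimensional. Cost functional. $l\in\mathbb{N}$, $1\le i_1<\dots<i_l$ are fixed indices, $\Psi:(\mathbb{R}_{>0})^l\to\mathbb{R}$ is of class $C^1$, $\gamma>0$, and $$J_l^{N,\varepsilon}(\varphi)=\Psi(\mu^\varphi_{i_1},\dots,\mu^\varphi_{i_l})+\gamma E^\varepsilon_{GL}(\varphi),\qquad E^\varepsilon_{GL}(\varphi)=\int_{\tilde\Omega}\Big(\frac\varepsilon2|\nabla\varphi|^2+\frac1\varepsilon\psi(\varphi)\Big)dx.$$ The potential $\psi:\mathbb{R}\to\mathbb{R}\cup\{+\infty\}$ has exactly the two global minimum points $\pm1$, with $\min\psi=\psi(\pm1)=0$, and a local maximum point in between; moreover $\psi=\psi_0+I_{[-1,1]}$ with $\psi_0\in C^{1,1}_{loc}(\mathbb{R})$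 and $I_{[-1,1]}$ equal to $0$ on $[-1,1]$ and $+\infty$ elsewhere. *)

theory Defs
  imports "HOL-Analysis.Analysis" "HOL-Probability.Essential_Supremum"
begin

text \<open>
  Elements of Lebesgue and Sobolev spaces over a set \<open>\<Omega>\<close> are represented by functions on the whole
  space; only their values almost everywhere on \<open>\<Omega>\<close> matter, and all integrals are Bochner
  integrals with respect to \<open>lebesgue_on \<Omega>\<close>.
\<close>

subsection \<open>Domains and regularity classes\<close>

text \<open>
  Near each boundary point, \<open>\<Omega>\<close> is the strict subgraph, in some unit direction \<open>e\<close>, of a Lipschitz
  function on the hyperplane orthogonal to \<open>e\<close>. As \<open>U\<close> is open, it follows that the boundary
  inside \<open>U\<close> is the graph of that function.
\<close>

definition lipschitz_boundary :: "'a::euclidean_space set \<Rightarrow> bool" where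
  "lipschitz_boundary \<Omega> \<longleftrightarrow>
     (\<forall>p\<in>frontier \<Omega>. \<exists>U e L. \<exists>g :: 'a \<Rightarrow> real.
        open U \<and> p \<in> U \<and> norm e = 1 \<and> L-lipschitz_on {y. y \<bullet> e = 0} g \<and>
        \<Omega> \<inter> U = {x \<in> U. x \<bullet> e < g (x - (x \<bullet> e) *\<^sub>R e)})"

definition bounded_lipschitz_domain :: "'a::euclidean_space set \<Rightarrow> bool" where
  "bounded_lipschitz_domain \<Omega> \<longleftrightarrow>
     open \<Omega> \<and> connected \<Omega> \<and> \<Omega> \<noteq> {} \<and> bounded \<Omega> \<and> lipschitz_boundary \<Omega>"

text \<open>The class \<open>C\<^sup>k\<close>; meant for open \<open>S\<close>.\<close>

primrec Ck_on :: "nat \<Rightarrow> 'a::euclidean_space set \<Rightarrow> ('a \<Rightarrow> real) \<Rightarrow> bool" where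
  "Ck_on 0 S f \<longleftrightarrow> continuous_on S f"
| "Ck_on (Suc k) S f \<longleftrightarrow> (\<forall>x\<in>S. f differentiable (at x)) \<and>
     (\<forall>b\<in>Basis. Ck_on k S (\<lambda>x. frechet_derivative f (at x) b))"

definition partial_deriv :: "'n::finite \<Rightarrow> (real ^ 'n \<Rightarrow> real) \<Rightarrow> real ^ 'n \<Rightarrow> real" where
  "partial_deriv j f y = frechet_derivative f (at y) (axis j 1)"

definition C11_loc :: "(real \<Rightarrow> real) \<Rightarrow> bool" where
  "C11_loc f \<longleftrightarrow> (\<forall>x. f differentiable (at x)) \<and>
     (\<forall>K. compact K \<longrightarrow> (\<exists>L. L-lipschitz_on K (deriv f)))"


subsection \<open>The Sobolev space \<open>H\<^sup>1\<close>\<close>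

definition test_functions :: "'a::euclidean_space set \<Rightarrow> ('a \<Rightarrow> real) set" where
  "test_functions \<Omega> = {\<eta>. (\<forall>k. Ck_on k UNIV \<eta>) \<and>
     compact (closure {x. \<eta> x \<noteq> 0}) \<and> closure {x. \<eta> x \<noteq> 0} \<subseteq> \<Omega>}"

definition has_weak_gradient ::
    "'a::euclidean_space set \<Rightarrow> ('a \<Rightarrow> real) \<Rightarrow> ('a \<Rightarrow> 'a) \<Rightarrow> bool" where
  "has_weak_gradient \<Omega> u g \<longleftrightarrow>
     (\<forall>K. compact K \<and> K \<subseteq> \<Omega> \<longrightarrow>
        integrable (lebesgue_on K) u \<and> integrable (lebesgue_on K) g) \<and>
     (\<forall>\<eta>\<in>test_functions \<Omega>. \<forall>b\<in>Basis.
        (LINT x|lebesgue_on \<Omega>. u x * frechet_derivative \<eta> (at x) b) =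
        - (LINT x|lebesgue_on \<Omega>. (g x \<bullet> b) * \<eta> x))"

text \<open>The weak gradient is unique up to null sets; this picks a representative.\<close>

definition weak_grad :: "'a::euclidean_space set \<Rightarrow> ('a \<Rightarrow> real) \<Rightarrow> 'a \<Rightarrow> 'a" where
  "weak_grad \<Omega> u = (SOME g. has_weak_gradient \<Omega> u g)"

definition H1 :: "'a::euclidean_space set \<Rightarrow> ('a \<Rightarrow> real) set" where
  "H1 \<Omega> = {u. u \<in> borel_measurable (lebesgue_on \<Omega>) \<and>
     integrable (lebesgue_on \<Omega>) (\<lambda>x. (u x)\<^sup>2) \<and>
     (\<exists>g. has_weak_gradient \<Omega> u g \<and> g \<in> borel_measurable (lebesgue_on \<Omega>) \<and>
        integrable (lebesgue_on \<Omega>) (\<lambda>x. (norm (g x))\<^sup>2))}"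


subsection \<open>The admissible set\<close>

definition U_ad :: "'a::euclidean_space set \<Rightarrow> 'a set \<Rightarrow> 'a set \<Rightarrow> ('a \<Rightarrow> real) set" where
  "U_ad \<Omega> S0 S1 = {\<phi>. integrable (lebesgue_on \<Omega>) \<phi> \<and>
     (AE x in lebesgue_on S0. \<phi> x = - 1) \<and> (AE x in lebesgue_on S1. \<phi> x = 1)}"

definition G_ad :: "'a::euclidean_space set \<Rightarrow> real \<Rightarrow> real \<Rightarrow> ('a \<Rightarrow> real) set" where
  "G_ad \<Omega>t \<beta>1 \<beta>2 = {\<phi> \<in> H1 \<Omega>t. (AE x in lebesgue_on \<Omega>t. \<bar>\<phi> x\<bar> \<le> 1) \<and>
     \<beta>1 * measure lebesgue \<Omega>t \<le> (LINT x|lebesgue_on \<Omega>t. \<phi> x) \<and>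
     (LINT x|lebesgue_on \<Omega>t. \<phi> x) \<le> \<beta>2 * measure lebesgue \<Omega>t}"


subsection \<open>Neumann eigenvalues\<close>

text \<open>
  Weak form of \<open>- div (a(\<phi>) \<nabla>w) = \<mu> c(\<phi>) w\<close> in \<open>\<Omega>\<close> with homogeneous Neumann boundary condition.
\<close>

definition weak_state_equation ::
    "'a::euclidean_space set \<Rightarrow> (real \<Rightarrow> real) \<Rightarrow> (real \<Rightarrow> real) \<Rightarrow> ('a \<Rightarrow> real) \<Rightarrow> real
      \<Rightarrow> ('a \<Rightarrow> real) \<Rightarrow> bool" where
  "weak_state_equation \<Omega> a c \<phi> \<mu> w \<longleftrightarrow>
     (\<forall>\<eta>\<in>H1 \<Omega>. (LINT x|lebesgue_on \<Omega>. a (\<phi> x) * (weak_grad \<Omega> w x \<bullet> weak_grad \<Omega> \<eta> x)) =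
        \<mu> * (LINT x|lebesgue_on \<Omega>. c (\<phi> x) * w x * \<eta> x))"

definition neumann_eigenspace ::
    "'a::euclidean_space set \<Rightarrow> (real \<Rightarrow> real) \<Rightarrow> (real \<Rightarrow> real) \<Rightarrow> ('a \<Rightarrow> real) \<Rightarrow> real
      \<Rightarrow> ('a \<Rightarrow> real) set" where
  "neumann_eigenspace \<Omega> a c \<phi> \<mu> = {w \<in> H1 \<Omega>. weak_state_equation \<Omega> a c \<phi> \<mu> w}"

definition neumann_eigenfunction ::
    "'a::euclidean_space set \<Rightarrow> (real \<Rightarrow> real) \<Rightarrow> (real \<Rightarrow> real) \<Rightarrow> ('a \<Rightarrow> real) \<Rightarrow> real
      \<Rightarrow> ('a \<Rightarrow> real) \<Rightarrow> bool" where
  "neumann_eigenfunction \<Omega> a c \<phi> \<mu> w \<longleftrightarrow>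
     w \<in> neumann_eigenspace \<Omega> a c \<phi> \<mu> \<and> \<not> (AE x in lebesgue_on \<Omega>. w x = 0)"

text \<open>
  The space \<open>E\<close> of functions, taken modulo equality almost everywhere, has a basis of \<open>n\<close> elements.
\<close>

definition has_ae_dimension :: "'a measure \<Rightarrow> ('a \<Rightarrow> real) set \<Rightarrow> nat \<Rightarrow> bool" where
  "has_ae_dimension M E n \<longleftrightarrow> (\<exists>w :: nat \<Rightarrow> 'a \<Rightarrow> real.
     (\<forall>k<n. w k \<in> E) \<and>
     (\<forall>r. (AE x in M. (\<Sum>k<n. r k * w k x) = 0) \<longrightarrow> (\<forall>k<n. r k = 0)) \<and>
     (\<forall>v\<in>E. \<exists>r. AE x in M. v x = (\<Sum>k<n. r k * w k x)))"

definition neumann_multiplicity ::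
    "'a::euclidean_space set \<Rightarrow> (real \<Rightarrow> real) \<Rightarrow> (real \<Rightarrow> real) \<Rightarrow> ('a \<Rightarrow> real) \<Rightarrow> real
      \<Rightarrow> nat \<Rightarrow> bool" where
  "neumann_multiplicity \<Omega> a c \<phi> \<mu> n \<longleftrightarrow>
     has_ae_dimension (lebesgue_on \<Omega>) (neumann_eigenspace \<Omega> a c \<phi> \<mu>) n"

text \<open>
  \<open>m\<close> enumerates all Neumann eigenvalues in nondecreasing order, each as often as its multiplicity;
  a number that is not an eigenvalue has multiplicity \<open>0\<close> and is not listed. There is at most
  one such sequence.
\<close>

definition neumann_eigenvalue_sequence ::
    "'a::euclidean_space set \<Rightarrow> (real \<Rightarrow> real) \<Rightarrow> (real \<Rightarrow> real) \<Rightarrow> ('a \<Rightarrow> real)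
      \<Rightarrow> (nat \<Rightarrow> real) \<Rightarrow> bool" where
  "neumann_eigenvalue_sequence \<Omega> a c \<phi> m \<longleftrightarrow> incseq m \<and>
     (\<forall>\<mu>. finite {k. m k = \<mu>} \<and> neumann_multiplicity \<Omega> a c \<phi> \<mu> (card {k. m k = \<mu>}))"

definition neumann_eigenvalue ::
    "'a::euclidean_space set \<Rightarrow> (real \<Rightarrow> real) \<Rightarrow> (real \<Rightarrow> real) \<Rightarrow> ('a \<Rightarrow> real) \<Rightarrow> nat \<Rightarrow> real" where
  "neumann_eigenvalue \<Omega> a c \<phi> = (THE m. neumann_eigenvalue_sequence \<Omega> a c \<phi> m)"

definition simple_neumann_eigenvalue ::
    "'a::euclidean_space set \<Rightarrow> (real \<Rightarrow> real) \<Rightarrow> (real \<Rightarrow> real) \<Rightarrow> ('a \<Rightarrow> real) \<Rightarrow> real \<Rightarrow> bool" where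
  "simple_neumann_eigenvalue \<Omega> a c \<phi> \<mu> \<longleftrightarrow> neumann_multiplicity \<Omega> a c \<phi> \<mu> 1"

text \<open>The space \<open>H\<^sup>1\<^sub>(\<^sub>0\<^sub>)\<^sub>,\<^sub>\<phi>(\<Omega>)\<close>.\<close>

definition H1_mean_zero ::
    "'a::euclidean_space set \<Rightarrow> (real \<Rightarrow> real) \<Rightarrow> ('a \<Rightarrow> real) \<Rightarrow> ('a \<Rightarrow> real) set" where
  "H1_mean_zero \<Omega> c \<phi> = {w \<in> H1 \<Omega>. (LINT x|lebesgue_on \<Omega>. c (\<phi> x) * w x) = 0}"


subsection \<open>Cost functional and local minimizers\<close>

definition obstacle_potential :: "(real \<Rightarrow> ereal) \<Rightarrow> (real \<Rightarrow> real) \<Rightarrow> bool" where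
  "obstacle_potential \<psi> \<psi>0 \<longleftrightarrow>
     C11_loc \<psi>0 \<and> (\<forall>s. \<psi> s = ereal (\<psi>0 s) + (if s \<in> {-1..1} then 0 else \<infinity>)) \<and>
     {s. \<forall>t. \<psi> s \<le> \<psi> t} = {-1, 1} \<and> \<psi> (-1) = 0 \<and> \<psi> 1 = 0 \<and>
     (\<exists>s. -1 < s \<and> s < 1 \<and> (\<forall>\<^sub>F t in nhds s. \<psi> t \<le> \<psi> s))"

text \<open>
  The integrand is nonnegative because \<open>min \<psi> = 0\<close>, so \<open>e2ennreal\<close> cuts nothing off.
\<close>

definition GL_energy ::
    "'a::euclidean_space set \<Rightarrow> real \<Rightarrow> (real \<Rightarrow> ereal) \<Rightarrow> ('a \<Rightarrow> real) \<Rightarrow> ereal" where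
  "GL_energy \<Omega>t \<epsilon> \<psi> \<phi> = enn2ereal (\<integral>\<^sup>+x.
     e2ennreal (ereal (\<epsilon> / 2 * (norm (weak_grad \<Omega>t \<phi> x))\<^sup>2) + ereal (1 / \<epsilon>) * \<psi> (\<phi> x))
     \<partial>lebesgue_on \<Omega>t)"

text \<open>
  The vector of the eigenvalues \<open>\<mu>\<^bsub>i j\<^esub>\<close>. The positions \<open>1, \<dots>, l\<close> are the elements of a finite linearly
  ordered type.
\<close>

definition eigenvalue_vector ::
    "'a::euclidean_space set \<Rightarrow> (real \<Rightarrow> real) \<Rightarrow> (real \<Rightarrow> real) \<Rightarrow> ('l::finite \<Rightarrow> nat) \<Rightarrow> ('a \<Rightarrow> real)
      \<Rightarrow> real ^ 'l" where
  "eigenvalue_vector \<Omega> a c i \<phi> = (\<chi> j. neumann_eigenvalue \<Omega> a c \<phi> (i j))"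

definition neumann_cost ::
    "'a::euclidean_space set \<Rightarrow> 'a set \<Rightarrow> (real \<Rightarrow> real) \<Rightarrow> (real \<Rightarrow> real) \<Rightarrow> ('l::finite \<Rightarrow> nat)
      \<Rightarrow> (real ^ 'l \<Rightarrow> real) \<Rightarrow> real \<Rightarrow> real \<Rightarrow> (real \<Rightarrow> ereal) \<Rightarrow> ('a \<Rightarrow> real) \<Rightarrow> ereal" where
  "neumann_cost \<Omega> \<Omega>t a c i \<Psi> \<gamma> \<epsilon> \<psi> \<phi> =
     ereal (\<Psi> (eigenvalue_vector \<Omega> a c i \<phi>)) + ereal \<gamma> * GL_energy \<Omega>t \<epsilon> \<psi> \<phi>"

definition Linf_norm :: "'a::euclidean_space set \<Rightarrow> ('a \<Rightarrow> real) \<Rightarrow> ereal" where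
  "Linf_norm \<Omega> f = esssup (lebesgue_on \<Omega>) (\<lambda>x. ereal \<bar>f x\<bar>)"

definition Linf_local_minimizer ::
    "'a::euclidean_space set \<Rightarrow> ('a \<Rightarrow> real) set \<Rightarrow> (('a \<Rightarrow> real) \<Rightarrow> ereal) \<Rightarrow> ('a \<Rightarrow> real) \<Rightarrow> bool" where
  "Linf_local_minimizer \<Omega> A J \<phi> \<longleftrightarrow> \<phi> \<in> A \<and>
     (\<exists>\<delta>>0. \<forall>\<theta>\<in>A. Linf_norm \<Omega> (\<lambda>x. \<theta> x - \<phi> x) < ereal \<delta> \<longrightarrow> J \<phi> \<le> J \<theta>)"

end

theory Submission
  imports Defs "HOL-Library.Function_Algebras" "HOL-Probability.Probability_Measure"
    "HOL-Library.Diagonal_Subsequence"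
begin

text \<open>
  For \<open>\<theta>\<close> in the convex admissible set the points \<open>\<phi> + t (\<theta> - \<phi>)\<close> compete with \<open>\<phi>\<close> for small \<open>t > 0\<close>; dividing
  the cost difference by \<open>t\<close> and letting \<open>t \<rightarrow> 0\<close> gives the variational inequality once the eigenvalues are
  known to be differentiable along the segment. Eigenpairs exist by successive minimisation of the Rayleigh
  quotient, which rests on Rellich compactness for Lipschitz domains. The coefficients vary by a factor
  \<open>1 + O(t)\<close>, so the min-max principle gives continuity of the eigenvalues. Compactness then provides
  normalised eigenvectors converging to a normalised vector of the simple limit eigenspace, and testing the
  perturbed equation with the limit eigenfunction and dividing by \<open>t\<close> yields the derivative; no
  differentiability of the eigenfunctions is needed.
\<close>

subsection \<open>Eigenvalue sequences of pairs of quadratic forms\<close>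

text \<open>Functions are never identified modulo null sets, so every space carries only seminorms:
  independence, uniqueness and convergence are measured by the forms, and a zero seminorm stands for
  equality almost everywhere. Rellich compactness is reached in two moves. Poincare inequalities on
  small cubes control compact subsets of the domain by finitely many averages, and a boundary piece
  is pushed into such a subset by a short shift along its chart axis, at the cost of a small
  multiple of the gradient norm. Both moves rest on one formula, the integral of the weak gradient
  along a segment, obtained by duality from the fundamental lemma of the calculus of variations. All
  admissible functions take values in [-1,1], so \<open>C11_loc\<close> regularity gives constants
  valid along the whole segment. The eigenvector limit is v = b w with some nonzero b, which cancels
  in the quotient, so neither the sign nor the rate of the convergence has to be controlled.
  Simplicity acts twice: it identifies v, and it makes the eigenvalues positive, which places them
  in the open orthant where \<Psi> is differentiable.\<close>

instantiation "fun" :: (type, real_vector) real_vector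
begin

definition scaleR_fun :: "real \<Rightarrow> ('a \<Rightarrow> 'b) \<Rightarrow> 'a \<Rightarrow> 'b" where
  "scaleR_fun r f = (\<lambda>x. r *\<^sub>R f x)"

instance
  by standard (auto simp: scaleR_fun_def algebra_simps fun_eq_iff)

end

lemma scaleR_fun_apply [simp]: "(r *\<^sub>R f) x = r *\<^sub>R f x"
  by (simp add: scaleR_fun_def)

lemma sum_fun_apply: "(\<Sum>k\<in>A. f k) x = (\<Sum>k\<in>A. f k x)"
  for f :: "'k \<Rightarrow> 'a \<Rightarrow> 'b::real_vector"
  by (induction A rule: infinite_finite_induct) auto

section \<open>Dimension counting and uniqueness of the eigenvalue sequence\<close>

lemma nontrivial_relation:
  fixes A :: "nat \<Rightarrow> nat \<Rightarrow> real"
  assumes "n < N"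
  shows "\<exists>r. (\<exists>k<N. r k \<noteq> 0) \<and> (\<forall>j<n. (\<Sum>k<N. r k * A k j) = 0)"
proof -
  \<comment> \<open>Cutting the rows off at n puts all N of them into the span of n unit vectors,
    whatever \<open>A\<close> does beyond column n.\<close>
  define v :: "nat \<Rightarrow> nat \<Rightarrow> real" where "v k = (\<lambda>j. if j < n then A k j else 0)" for k
  define d :: "nat \<Rightarrow> nat \<Rightarrow> real" where "d j = (\<lambda>i. if i = j then 1 else 0)" for j
  have coords: "v k = (\<Sum>j<n. A k j *\<^sub>R d j)" for k
    by (auto simp: fun_eq_iff v_def d_def sum_fun_apply if_distrib[of "\<lambda>y. _ * y"] cong: if_cong)
  show ?thesis
  proof (cases "inj_on v {..<N}")
    case True
    have "v ` {..<N} \<subseteq> span (d ` {..<n})"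
    proof (rule image_subsetI)
      show "v k \<in> span (d ` {..<n})" for k
        unfolding coords by (intro span_sum span_scale) (auto intro: span_base)
    qed
    moreover have "card (d ` {..<n}) \<le> n"
      using card_image_le[of "{..<n}" d] by simp
    moreover have "card (v ` {..<N}) = N"
      using True by (simp add: card_image)
    ultimately have "dependent (v ` {..<N})"
      using independent_span_bound[of "d ` {..<n}" "v ` {..<N}"] assms by fastforce
    then obtain c where c: "\<exists>x\<in>v ` {..<N}. c x \<noteq> 0" "(\<Sum>x\<in>v ` {..<N}. c x *\<^sub>R x) = 0"
      using dependent_finite[of "v ` {..<N}"] by auto
    have "(\<Sum>k<N. c (v k) *\<^sub>R v k) = 0"
      using c(2) by (simp add: sum.reindex[OF True])
    then have "(\<Sum>k<N. c (v k) *\<^sub>R v k) j = 0" for j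
      by simp
    then have "(\<Sum>k<N. c (v k) * v k j) = 0" for j
      by (simp add: sum_fun_apply)
    moreover have "(\<Sum>k<N. c (v k) * v k j) = (\<Sum>k<N. c (v k) * A k j)" if "j < n" for j
      using that by (intro sum.cong) (auto simp: v_def[of _])
    ultimately have "(\<Sum>k<N. c (v k) * A k j) = 0" if "j < n" for j
      using that by metis
    then show ?thesis
      using c(1) by (intro exI[of _ "\<lambda>k. c (v k)"]) auto
  next
    \<comment> \<open>\<open>dependent\<close> speaks of a set of vectors, so repeated rows need a
      case of their own: the coefficients 1 and -1 on two equal rows.\<close>
    case False
    then obtain k l where kl: "k < N" "l < N" "k \<noteq> l" "v k = v l"
      by (auto simp: inj_on_def)
    define c :: "nat \<Rightarrow> real" where "c i = (if i = k then 1 else if i = l then - 1 else 0)" for i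
    have "(\<Sum>i<N. c i * A i j) = A k j - A l j" for j
    proof -
      have "(\<Sum>i<N. c i * A i j) = (\<Sum>i<N. (if i = k then A k j else 0) - (if i = l then A l j else 0))"
        using kl(3) by (intro sum.cong) (auto simp: c_def)
      then show ?thesis
        using kl by (simp add: sum_subtractf)
    qed
    moreover have "A k j = A l j" if "j < n" for j
      using kl(4) that by (metis v_def)
    ultimately show ?thesis
      using kl(1) by (intro exI[of _ c] conjI exI[of _ k]) (auto simp: c_def)
  qed
qed

text \<open>Exchange argument modulo null sets: the coordinates of N independent elements over n
  spanning ones satisfy n linear conditions, so N > n leaves a nontrivial combination that vanishes
  almost everywhere. Only finitely many exceptional sets are involved.\<close>

lemma has_ae_dimension_le:
  assumes "has_ae_dimension M E n" "has_ae_dimension M E N"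
  shows "N \<le> n"
proof (rule ccontr)
  assume "\<not> N \<le> n"
  then have "n < N" by simp
  obtain w where w: "\<And>v. v \<in> E \<Longrightarrow> \<exists>r. AE x in M. v x = (\<Sum>k<n. r k * w k x)"
    using assms(1) unfolding has_ae_dimension_def by blast
  obtain w' where w': "\<And>k. k < N \<Longrightarrow> w' k \<in> E"
    "\<And>r. (AE x in M. (\<Sum>k<N. r k * w' k x) = 0) \<Longrightarrow> \<forall>k<N. r k = (0::real)"
    using assms(2) unfolding has_ae_dimension_def by blast
  have "\<forall>k. \<exists>r. k < N \<longrightarrow> (AE x in M. w' k x = (\<Sum>j<n. r j * w j x))"
    using w w'(1) by meson
  from choice[OF this] obtain A where A: "\<And>k. k < N \<Longrightarrow> AE x in M. w' k x = (\<Sum>j<n. A k j * w j x)"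
    by blast
  obtain r where r: "\<exists>k<N. r k \<noteq> 0" "\<And>j. j < n \<Longrightarrow> (\<Sum>k<N. r k * A k j) = 0"
    using nontrivial_relation[OF \<open>n < N\<close>, of A] by blast
  have "AE x in M. \<forall>k\<in>{..<N}. w' k x = (\<Sum>j<n. A k j * w j x)"
    using A by (intro AE_finite_allI) auto
  then have "AE x in M. (\<Sum>k<N. r k * w' k x) = 0"
  proof eventually_elim
    case (elim x)
    have "(\<Sum>k<N. r k * w' k x) = (\<Sum>k<N. \<Sum>j<n. r k * A k j * w j x)"
      using elim by (simp add: sum_distrib_left mult.assoc)
    also have "\<dots> = (\<Sum>j<n. (\<Sum>k<N. r k * A k j) * w j x)"
      by (subst sum.swap) (simp add: sum_distrib_right)
    also have "\<dots> = 0"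
      using r(2) by simp
    finally show ?case .
  qed
  with w'(2) r(1) show False by blast
qed

lemma has_ae_dimension_unique:
  "has_ae_dimension M E n \<Longrightarrow> has_ae_dimension M E N \<Longrightarrow> N = n"
  by (simp add: has_ae_dimension_le antisym)

text \<open>Counting: if m' k < m k, every index at which m takes one of the values m' 0, ..., m' k
  lies below k, so there are at most k of them, while m' takes these values at the k + 1 indices up
  to k at least.\<close>

lemma incseq_eq_if_card_eq:
  fixes m m' :: "nat \<Rightarrow> real"
  assumes "incseq m" "incseq m'" and fin: "\<And>x. finite {k. m k = x}" "\<And>x. finite {k. m' k = x}"
    and card: "\<And>x. card {k. m k = x} = card {k. m' k = x}"
  shows "m = m'"
proof -
  have le: "m k \<le> m' k" if "incseq m" "incseq m'" "\<And>x. finite {k. m k = x}" "\<And>x. finite {k. m' k = x}"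
    "\<And>x. card {k. m k = x} = card {k. m' k = x}" for m m' :: "nat \<Rightarrow> real" and k
  proof (rule ccontr)
    assume "\<not> m k \<le> m' k"
    then have lt: "m' k < m k" by simp
    define X where "X = m' ` {..k}"
    have "(\<Union>x\<in>X. {i. m i = x}) \<subseteq> {..<k}"
    proof clarsimp
      fix i assume "m i \<in> X"
      then obtain j where "j \<le> k" "m i = m' j" by (auto simp: X_def)
      then have "m i < m k" using lt that(2) by (metis incseqD le_less_trans)
      then show "i < k" using that(1) by (meson incseqD not_less)
    qed
    then have "card (\<Union>x\<in>X. {i. m i = x}) \<le> k"
      by (metis card_lessThan card_mono finite_lessThan)
    moreover have "card (\<Union>x\<in>X. {i. m i = x}) = (\<Sum>x\<in>X. card {i. m i = x})"
      by (rule card_UN_disjoint) (use that in \<open>auto simp: X_def\<close>)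
    moreover have "card (\<Union>x\<in>X. {i. m' i = x}) = (\<Sum>x\<in>X. card {i. m' i = x})"
      by (rule card_UN_disjoint) (use that in \<open>auto simp: X_def\<close>)
    moreover have "{..k} \<subseteq> (\<Union>x\<in>X. {i. m' i = x})"
      by (auto simp: X_def)
    then have "card {..k} \<le> card (\<Union>x\<in>X. {i. m' i = x})"
      by (rule card_mono[rotated]) (use that in \<open>auto simp: X_def\<close>)
    ultimately show False using that(5) by simp
  qed
  show ?thesis
    using le[of m m'] le[of m' m] assms by (intro ext antisym) auto
qed

text \<open>\<open>neumann_eigenvalue\<close> is a definite description, hence informative only
  where a sequence exists; every eigensystem constructed below supplies one, and its values are then
  the eigenvalues.\<close>

lemma neumann_eigenvalue_eqI:
  assumes "neumann_eigenvalue_sequence \<Omega> a c \<phi> m"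
  shows "neumann_eigenvalue \<Omega> a c \<phi> = m"
  unfolding neumann_eigenvalue_def
proof (rule the_equality)
  fix m' assume "neumann_eigenvalue_sequence \<Omega> a c \<phi> m'"
  with assms show "m' = m"
    unfolding neumann_eigenvalue_sequence_def neumann_multiplicity_def
    by (intro incseq_eq_if_card_eq) (auto dest: has_ae_dimension_unique)
qed (fact assms)

text \<open>The laws are required on V only: for functions outside it the integrals defining the
  forms may be default values and fail to be additive. A form may vanish on nonzero vectors, so it
  yields a seminorm.\<close>

locale psd_form =
  fixes V :: "'v::real_vector set" and s :: "'v \<Rightarrow> 'v \<Rightarrow> real"
  assumes subspace: "subspace V"
    and add_left: "u \<in> V \<Longrightarrow> v \<in> V \<Longrightarrow> w \<in> V \<Longrightarrow> s (u + v) w = s u w + s v w"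
    and scale_left: "u \<in> V \<Longrightarrow> w \<in> V \<Longrightarrow> s (b *\<^sub>R u) w = b * s u w"
    and sym: "u \<in> V \<Longrightarrow> v \<in> V \<Longrightarrow> s u v = s v u"
    and nonneg: "u \<in> V \<Longrightarrow> 0 \<le> s u u"
begin

lemmas V_add = subspace_add[OF subspace]
lemmas V_diff = subspace_diff[OF subspace]
lemmas V_scale = subspace_scale[OF subspace]
lemmas V_0 = subspace_0[OF subspace]
lemmas V_sum = subspace_sum[OF subspace]

lemma add_right: "u \<in> V \<Longrightarrow> v \<in> V \<Longrightarrow> w \<in> V \<Longrightarrow> s w (u + v) = s w u + s w v"
  by (simp add: sym[of w] add_left V_add)

lemma scale_right: "u \<in> V \<Longrightarrow> w \<in> V \<Longrightarrow> s w (b *\<^sub>R u) = b * s w u"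
  by (simp add: sym[of w] scale_left V_scale)

lemma diff_left: "u \<in> V \<Longrightarrow> v \<in> V \<Longrightarrow> w \<in> V \<Longrightarrow> s (u - v) w = s u w - s v w"
  using add_left[of u "(-1) *\<^sub>R v" w] scale_left[of v w "-1"] V_scale[of v "-1"] by simp

lemma diff_right: "u \<in> V \<Longrightarrow> v \<in> V \<Longrightarrow> w \<in> V \<Longrightarrow> s w (u - v) = s w u - s w v"
  by (simp add: sym[of w] diff_left V_diff)

lemma zero_left: "w \<in> V \<Longrightarrow> s 0 w = 0"
  using scale_left[of 0 w 0] V_0 by simp

lemma sum_left:
  assumes "\<And>k. k \<in> A \<Longrightarrow> f k \<in> V" "w \<in> V"
  shows "s (\<Sum>k\<in>A. b k *\<^sub>R f k) w = (\<Sum>k\<in>A. b k * s (f k) w)"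
  using assms(1)
proof (induction A rule: infinite_finite_induct)
  case (insert k A)
  then have "(\<Sum>k\<in>A. b k *\<^sub>R f k) \<in> V"
    by (intro V_sum V_scale) auto
  then show ?case
    using insert assms(2) by (simp add: add_left V_scale scale_left)
qed (use assms(2) in \<open>auto simp: zero_left\<close>)

lemma sum_right:
  assumes "\<And>k. k \<in> A \<Longrightarrow> f k \<in> V" "w \<in> V"
  shows "s w (\<Sum>k\<in>A. b k *\<^sub>R f k) = (\<Sum>k\<in>A. b k * s w (f k))"
proof -
  have "s w (\<Sum>k\<in>A. b k *\<^sub>R f k) = (\<Sum>k\<in>A. b k * s (f k) w)"
    using assms by (subst sym) (auto simp: sum_left intro!: V_sum V_scale)
  also have "\<dots> = (\<Sum>k\<in>A. b k * s w (f k))"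
    using assms by (intro sum.cong) (auto simp: sym)
  finally show ?thesis .
qed

text \<open>Nonnegativity of the quadratic b -> s (u + b v) (u + b v). When s v v = 0 it degenerates
  to an affine function bounded below, whose slope must vanish.\<close>

lemma Cauchy_Schwarz:
  assumes "u \<in> V" "v \<in> V"
  shows "(s u v)\<^sup>2 \<le> s u u * s v v"
proof -
  have quad: "0 \<le> s u u + 2 * b * s u v + b\<^sup>2 * s v v" for b
  proof -
    have "0 \<le> s (u + b *\<^sub>R v) (u + b *\<^sub>R v)"
      by (intro nonneg V_add V_scale assms)
    also have "\<dots> = s u u + 2 * b * s u v + b\<^sup>2 * s v v"
      using assms sym[of v u]
      by (simp add: add_left add_right scale_left scale_right V_add V_scale power2_eq_square algebra_simps)
    finally show ?thesis .
  qed
  show ?thesis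
  proof (cases "s v v = 0")
    case True
    have "s u v = 0"
    proof (rule ccontr)
      assume "s u v \<noteq> 0"
      \<comment> \<open>This value of b makes the affine function equal to -1.\<close>
      then show False
        using quad[of "- (s u u + 1) / (2 * s u v)"] True by (simp add: field_simps)
    qed
    then show ?thesis using True by simp
  next
    case False
    then have pos: "s v v > 0" using nonneg[OF assms(2)] by simp
    have "0 \<le> s u u - (s u v)\<^sup>2 / s v v"
      using quad[of "- s u v / s v v"] pos by (simp add: power2_eq_square divide_simps)
    then show ?thesis using pos by (simp add: field_simps)
  qed
qed

lemma abs_le_sqrt: "u \<in> V \<Longrightarrow> v \<in> V \<Longrightarrow> \<bar>s u v\<bar> \<le> sqrt (s u u) * sqrt (s v v)"
  by (metis Cauchy_Schwarz real_sqrt_abs real_sqrt_le_iff real_sqrt_mult)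

text \<open>By Cauchy-Schwarz a vector of zero seminorm is orthogonal to everything. Applied to the
  semidefinite form q - l r, this turns a minimiser of the Rayleigh quotient into an
  eigenvector.\<close>

lemma null_left: "u \<in> V \<Longrightarrow> v \<in> V \<Longrightarrow> s u u = 0 \<Longrightarrow> s u v = 0"
  using abs_le_sqrt[of u v] by simp

lemma parallelogram:
  "u \<in> V \<Longrightarrow> v \<in> V \<Longrightarrow> s (u - v) (u - v) = 2 * s u u + 2 * s v v - s (u + v) (u + v)"
  by (simp add: add_left add_right diff_left diff_right V_add V_diff sym)

lemma diff_le: "u \<in> V \<Longrightarrow> v \<in> V \<Longrightarrow> s (u - v) (u - v) \<le> 2 * s u u + 2 * s v v"
  using parallelogram[of u v] nonneg[OF V_add[of u v]] by simp

lemma tendsto_left: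
  assumes "\<And>n. u n \<in> V" "v \<in> V" "w \<in> V" "(\<lambda>n. s (u n - v) (u n - v)) \<longlonglongrightarrow> 0"
  shows "(\<lambda>n. s (u n) w) \<longlonglongrightarrow> s v w"
proof -
  have "(\<lambda>n. sqrt (s (u n - v) (u n - v)) * sqrt (s w w)) \<longlonglongrightarrow> sqrt 0 * sqrt (s w w)"
    by (intro tendsto_intros assms)
  then have lim: "(\<lambda>n. sqrt (s (u n - v) (u n - v)) * sqrt (s w w)) \<longlonglongrightarrow> 0" by simp
  have "\<forall>n. norm (s (u n) w - s v w) \<le> sqrt (s (u n - v) (u n - v)) * sqrt (s w w)"
    using abs_le_sqrt[OF V_diff] assms(1-3) by (simp flip: diff_left)
  then have "(\<lambda>n. s (u n) w - s v w) \<longlonglongrightarrow> 0"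
    by (rule Lim_null_comparison[OF always_eventually lim])
  then show ?thesis by (simp add: LIM_zero_iff)
qed

lemma tendsto_self:
  assumes "\<And>n. u n \<in> V" "v \<in> V" "(\<lambda>n. s (u n - v) (u n - v)) \<longlonglongrightarrow> 0"
  shows "(\<lambda>n. s (u n) (u n)) \<longlonglongrightarrow> s v v"
proof -
  have "(\<lambda>n. s (u n - v) (u n - v) + 2 * s (u n) v - s v v) \<longlonglongrightarrow> 0 + 2 * s v v - s v v"
    by (intro tendsto_intros assms tendsto_left)
  moreover have "s (u n - v) (u n - v) + 2 * s (u n) v - s v v = s (u n) (u n)" for n
    using assms sym[of v "u n"] by (simp add: diff_left diff_right V_diff)
  ultimately show ?thesis by simp
qed

end

section \<open>Spectral theory by successive minimisation\<close>

definition form_Cauchy :: "('v::real_vector \<Rightarrow> 'v \<Rightarrow> real) \<Rightarrow> (nat \<Rightarrow> 'v) \<Rightarrow> bool" where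
  "form_Cauchy s u \<longleftrightarrow> (\<forall>e>0. \<exists>N. \<forall>m\<ge>N. \<forall>n\<ge>N. s (u m - u n) (u m - u n) < e)"

lemma form_CauchyD:
  "form_Cauchy s u \<Longrightarrow> e > 0 \<Longrightarrow> \<exists>N. \<forall>m\<ge>N. \<forall>n\<ge>N. s (u m - u n) (u m - u n) < e"
  by (simp add: form_Cauchy_def)

text \<open>The last clause records the construction: \<open>m k\<close> is the least Rayleigh
  quotient on the r-complement of the earlier vectors. The expansion of eigenvectors and the
  comparison of eigenvalues are both drawn from it.\<close>

definition eigensystem ::
    "'v::real_vector set \<Rightarrow> ('v \<Rightarrow> 'v \<Rightarrow> real) \<Rightarrow> ('v \<Rightarrow> 'v \<Rightarrow> real) \<Rightarrow> (nat \<Rightarrow> 'v) \<Rightarrow> (nat \<Rightarrow> real) \<Rightarrow> bool"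
  where "eigensystem V r q e m \<longleftrightarrow> incseq m \<and> (\<forall>k. e k \<in> V) \<and>
    (\<forall>j k. r (e j) (e k) = (if j = k then 1 else 0)) \<and>
    (\<forall>k. \<forall>v\<in>V. q (e k) v = m k * r (e k) v) \<and>
    (\<forall>k. \<forall>u\<in>V. (\<forall>j<k. r u (e j) = 0) \<longrightarrow> m k * r u u \<le> q u u)"

text \<open>Both forms are only semidefinite: vectors will be functions, not classes modulo equality a.e.\<close>

locale spectral_forms = r: psd_form V r + q: psd_form V q
  for V :: "'v::real_vector set" and r q :: "'v \<Rightarrow> 'v \<Rightarrow> real" +
  assumes null: "u \<in> V \<Longrightarrow> r u u = 0 \<Longrightarrow> q u u = 0"
    and compact: "(\<And>n. x n \<in> V) \<Longrightarrow> (\<And>n. r (x n) (x n) \<le> B) \<Longrightarrow> (\<And>n. q (x n) (x n) \<le> B) \<Longrightarrow>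
      \<exists>f. strict_mono (f :: nat \<Rightarrow> nat) \<and> form_Cauchy r (x \<circ> f)"
    and complete: "(\<And>n. x n \<in> V) \<Longrightarrow> form_Cauchy r x \<Longrightarrow> form_Cauchy q x \<Longrightarrow>
      \<exists>v\<in>V. (\<lambda>n. r (x n - v) (x n - v)) \<longlonglongrightarrow> 0 \<and> (\<lambda>n. q (x n - v) (x n - v)) \<longlonglongrightarrow> 0"
    and infinite_dim: "\<exists>f. (\<forall>k<n::nat. f k \<in> V) \<and>
      (\<forall>b. r (\<Sum>k<n. b k *\<^sub>R f k) (\<Sum>k<n. b k *\<^sub>R f k) = 0 \<longrightarrow> (\<forall>k<n. b k = 0))"
begin

text \<open>k orthogonality conditions on k + 1 coefficients have a nontrivial solution, and
  independence modulo r keeps its seminorm positive. The minimisation below is therefore over a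
  nonempty set.\<close>

lemma exists_orthogonal:
  fixes k :: nat
  assumes "\<And>j. j < k \<Longrightarrow> e j \<in> V"
  shows "\<exists>u\<in>V. (\<forall>j<k. r u (e j) = 0) \<and> r u u = 1"
proof -
  obtain f where f: "\<And>i. i < Suc k \<Longrightarrow> f i \<in> V"
    "\<And>b. r (\<Sum>i<Suc k. b i *\<^sub>R f i) (\<Sum>i<Suc k. b i *\<^sub>R f i) = 0 \<Longrightarrow> \<forall>i<Suc k. b i = 0"
    using infinite_dim[of "Suc k"] by blast
  obtain b where b: "\<exists>i<Suc k. b i \<noteq> 0" "\<And>j. j < k \<Longrightarrow> (\<Sum>i<Suc k. b i * r (f i) (e j)) = 0"
    using nontrivial_relation[of k "Suc k" "\<lambda>i j. r (f i) (e j)"] by blast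
  define u where "u = (\<Sum>i<Suc k. b i *\<^sub>R f i)"
  have uV: "u \<in> V"
    unfolding u_def using f(1) by (intro r.V_sum r.V_scale) auto
  have orth: "r u (e j) = 0" if "j < k" for j
    unfolding u_def using f(1) assms that by (subst r.sum_left) (auto simp: b(2)[OF that, simplified])
  have pos: "r u u > 0"
  proof -
    have "r u u \<noteq> 0" using f(2)[of b] b(1) unfolding u_def by blast
    then show ?thesis using r.nonneg[OF uV] by simp
  qed
  show ?thesis
  proof (intro bexI conjI allI impI)
    let ?v = "(1 / sqrt (r u u)) *\<^sub>R u"
    show "?v \<in> V" using uV by (rule r.V_scale)
    show "r ?v ?v = 1"
      using uV pos by (simp add: r.scale_left r.scale_right r.V_scale)
    show "r ?v (e j) = 0" if "j < k" for j
      using uV assms orth that by (simp add: r.scale_left)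
  qed
qed

text \<open>Direct method on the r-unit sphere of the complement W: \<open>compact\<close> makes a
  minimising sequence r-Cauchy, the parallelogram law upgrades this to q-Cauchy, and
  \<open>complete\<close> gives a minimiser. The eigenvalue equation holds first against W and then
  against all of V.\<close>

lemma exists_next_eigenvector:
  fixes k :: nat
  assumes eV: "\<And>j. j < k \<Longrightarrow> e j \<in> V"
    and orth: "\<And>i j. i < k \<Longrightarrow> j < k \<Longrightarrow> r (e i) (e j) = (if i = j then 1 else 0)"
    and eig: "\<And>j v. j < k \<Longrightarrow> v \<in> V \<Longrightarrow> q (e j) v = m j * r (e j) v"
  shows "\<exists>v l. v \<in> V \<and> r v v = 1 \<and> (\<forall>j<k. r v (e j) = 0) \<and> (\<forall>u\<in>V. q v u = l * r v u) \<and>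
    (\<forall>u\<in>V. (\<forall>j<k. r u (e j) = 0) \<longrightarrow> l * r u u \<le> q u u)"
proof -
  define W where "W = {u\<in>V. \<forall>j<k. r u (e j) = 0}"
  define S where "S = {q u u |u. u \<in> W \<and> r u u = 1}"
  define l where "l = Inf S"
  have WV: "u \<in> V" if "u \<in> W" for u using that by (simp add: W_def)
  have W: "subspace W"
    unfolding W_def using r.V_0 eV
    by (auto simp: subspace_def r.V_add r.V_scale r.zero_left r.add_left r.scale_left)
  have "S \<noteq> {}"
    using exists_orthogonal[of k e, OF eV] by (auto simp: S_def W_def)
  have "bdd_below S"
    using q.nonneg WV by (auto simp: S_def bdd_below_def)
  have l_le: "l * r u u \<le> q u u" if "u \<in> W" for u
  proof (cases "r u u = 0")
    case True
    then show ?thesis using q.nonneg WV[OF that] by simp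
  next
    case False
    then have pos: "r u u > 0" using r.nonneg[OF WV[OF that]] by simp
    let ?v = "(1 / sqrt (r u u)) *\<^sub>R u"
    have "?v \<in> W" using W that by (rule subspace_scale)
    moreover have "r ?v ?v = 1"
      using WV[OF that] pos by (simp add: r.scale_left r.scale_right r.V_scale)
    ultimately have "q ?v ?v \<in> S" by (auto simp: S_def)
    then have "l \<le> q ?v ?v" unfolding l_def using \<open>bdd_below S\<close> by (rule cInf_lower)
    also have "\<dots> = q u u / r u u"
      using WV[OF that] pos by (simp add: q.scale_left q.scale_right r.V_scale)
    finally show ?thesis using pos by (simp add: field_simps)
  qed
  have "\<exists>u. u \<in> W \<and> r u u = 1 \<and> q u u < l + 1 / real (Suc n)" for n
  proof -
    have "Inf S < l + 1 / real (Suc n)" by (simp add: l_def)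
    then show ?thesis
      using \<open>S \<noteq> {}\<close> by (auto simp: S_def dest!: cInf_lessD[rotated])
  qed
  then obtain u0 where u0: "\<And>n. u0 n \<in> W" "\<And>n. r (u0 n) (u0 n) = 1"
    "\<And>n. q (u0 n) (u0 n) < l + 1 / real (Suc n)" by metis
  \<comment> \<open>One bound for both forms, as \<open>compact\<close> demands: r equals 1 along
    the sequence and q is at most l + 1.\<close>
  have "q (u0 n) (u0 n) \<le> max 1 (l + 1)" for n
  proof -
    have "1 / real (Suc n) \<le> 1" by simp
    then show ?thesis using u0(3)[of n] by linarith
  qed
  then obtain f where f: "strict_mono (f :: nat \<Rightarrow> nat)" "form_Cauchy r (u0 \<circ> f)"
    using compact[of u0 "max 1 (l + 1)"] u0 WV by auto
  define u where "u = u0 \<circ> f"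
  have u: "u n \<in> W" "r (u n) (u n) = 1" "q (u n) (u n) < l + 1 / real (Suc n)" for n
  proof -
    show "u n \<in> W" "r (u n) (u n) = 1" using u0 by (auto simp: u_def)
    have "1 / real (Suc (f n)) \<le> 1 / real (Suc n)"
      using seq_suble[OF f(1), of n] by (intro divide_left_mono) auto
    then show "q (u n) (u n) < l + 1 / real (Suc n)"
      using u0(3)[of "f n"] by (simp add: u_def)
  qed
  have rC: "form_Cauchy r u" using f(2) by (simp add: u_def)
  \<comment> \<open>Since u i + u j lies in W, q (u i + u j) is at least l (4 - r (u i - u j)),
    writing each form on the diagonal. By the parallelogram law q (u i - u j) is then at most 2 (q
    (u i) - l) + 2 (q (u j) - l) + l r (u i - u j), split as d / 4 + d / 4 + d / 2.\<close>
  have qC: "form_Cauchy q u"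
    unfolding form_Cauchy_def
  proof (intro allI impI)
    fix d :: real assume "d > 0"
    then obtain N1 where N1: "\<And>i j. i \<ge> N1 \<Longrightarrow> j \<ge> N1 \<Longrightarrow> r (u i - u j) (u i - u j) < d / (2 * (\<bar>l\<bar> + 1))"
      using form_CauchyD[OF rC, of "d / (2 * (\<bar>l\<bar> + 1))"] by (auto simp: add_nonneg_pos)
    obtain N2 :: nat where N2: "8 / d < real N2" using reals_Archimedean2 by blast
    show "\<exists>N. \<forall>i\<ge>N. \<forall>j\<ge>N. q (u i - u j) (u i - u j) < d"
    proof (intro exI allI impI)
      fix i j assume ij: "max N1 N2 \<le> i" "max N1 N2 \<le> j"
      have small: "1 / real (Suc i) < d / 8" if "max N1 N2 \<le> i" for i
      proof -
        have "8 / d < real (Suc i)" using N2 that by linarith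
        then show ?thesis using \<open>d > 0\<close> by (simp add: field_simps)
      qed
      have "l * r (u i + u j) (u i + u j) \<le> q (u i + u j) (u i + u j)"
        using l_le subspace_add[OF W] u(1) by blast
      moreover have "r (u i + u j) (u i + u j) = 4 - r (u i - u j) (u i - u j)"
        using r.parallelogram[of "u i" "u j"] WV u by simp
      moreover have "q (u i - u j) (u i - u j) = 2 * q (u i) (u i) + 2 * q (u j) (u j) - q (u i + u j) (u i + u j)"
        using q.parallelogram[of "u i" "u j"] WV u by simp
      moreover have "q (u i) (u i) < l + d / 8" "q (u j) (u j) < l + d / 8"
        using u(3)[of i] u(3)[of j] small[OF ij(1)] small[OF ij(2)] by linarith+
      moreover have "l * r (u i - u j) (u i - u j) \<le> d / 2"
      proof -
        have rn: "0 \<le> r (u i - u j) (u i - u j)" by (intro r.nonneg r.V_diff WV u)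
        have "l * r (u i - u j) (u i - u j) \<le> (\<bar>l\<bar> + 1) * (d / (2 * (\<bar>l\<bar> + 1)))"
          using N1[of i j] ij rn by (intro mult_mono) auto
        also have "\<dots> = d / 2" by (simp add: field_simps)
        finally show ?thesis .
      qed
      ultimately show "q (u i - u j) (u i - u j) < d" by (simp add: algebra_simps)
    qed
  qed
  obtain v where v: "v \<in> V" "(\<lambda>n. r (u n - v) (u n - v)) \<longlonglongrightarrow> 0" "(\<lambda>n. q (u n - v) (u n - v)) \<longlonglongrightarrow> 0"
    using complete[OF _ rC qC] u WV by blast
  have r1: "r v v = 1"
  proof -
    have "(\<lambda>n. r (u n) (u n)) \<longlonglongrightarrow> r v v"
      using v u(1) WV by (intro r.tendsto_self) auto
    then show ?thesis using u(2) by (simp add: LIMSEQ_const_iff)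
  qed
  have vW: "v \<in> W"
  proof -
    have "r v (e j) = 0" if "j < k" for j
    proof -
      have "(\<lambda>n. r (u n) (e j)) \<longlonglongrightarrow> r v (e j)"
        using v u WV eV that by (intro r.tendsto_left) auto
      moreover have "r (u n) (e j) = 0" for n using u(1) that by (simp add: W_def)
      ultimately show ?thesis by (simp add: LIMSEQ_const_iff)
    qed
    with v(1) show ?thesis by (simp add: W_def)
  qed
  have qv: "q v v = l"
  proof (rule antisym)
    have "(\<lambda>n. q (u n) (u n)) \<longlonglongrightarrow> q v v"
      using v u WV by (intro q.tendsto_self) auto
    moreover have "(\<lambda>n. l + 1 / real (Suc n)) \<longlonglongrightarrow> l + 0"
      by (intro tendsto_intros LIMSEQ_Suc[OF lim_1_over_n])
    ultimately show "q v v \<le> l"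
      using u(3) by (intro LIMSEQ_le[where X = "\<lambda>n. q (u n) (u n)"]) (auto intro: less_imp_le)
    show "l \<le> q v v" using l_le[OF vW] r1 by simp
  qed
  \<comment> \<open>As l is the infimum, q - l r is semidefinite on W, and v is a null vector of
    it.\<close>
  have eigW: "q v h = l * r v h" if "h \<in> W" for h
  proof -
    interpret d: psd_form W "\<lambda>u v. q u v - l * r u v"
      using W WV l_le
      by unfold_locales (auto simp: q.add_left r.add_left q.scale_left r.scale_left q.sym r.sym algebra_simps)
    show ?thesis using d.null_left[OF vW that] qv r1 by simp
  qed
  \<comment> \<open>Subtracting the projection g onto the earlier eigenvectors moves h into W.
    Against g both forms vanish at v: r by orthogonality, q by symmetry and the eigenvalue equations
    of the e j.\<close>
  have eigV: "q v h = l * r v h" if "h \<in> V" for h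
  proof -
    define g where "g = (\<Sum>j<k. r h (e j) *\<^sub>R e j)"
    have gV: "g \<in> V" unfolding g_def using eV by (intro r.V_sum r.V_scale) auto
    have "r g (e i) = r h (e i)" if "i < k" for i
    proof -
      have "r g (e i) = (\<Sum>j<k. r h (e j) * r (e j) (e i))"
        unfolding g_def using eV that by (subst r.sum_left) auto
      also have "\<dots> = (\<Sum>j<k. if j = i then r h (e i) else 0)"
        using orth that by (intro sum.cong) auto
      finally show ?thesis using that by simp
    qed
    then have "h - g \<in> W"
      using gV that eV by (auto simp: W_def r.V_diff r.diff_left)
    moreover have ev: "r (e j) v = 0" if "j < k" for j
      using vW v(1) eV that r.sym[of v "e j"] by (simp add: W_def)
    have "r v g = 0"
      using v(1) eV ev unfolding g_def by (subst r.sum_right) (auto simp: r.sym[of v] intro!: sum.neutral)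
    moreover have "q v g = 0"
      using v(1) eV ev unfolding g_def
      by (subst q.sum_right) (auto simp: q.sym[of v] eig intro!: sum.neutral)
    ultimately show ?thesis
      using eigW[of "h - g"] v(1) that gV by (simp add: q.diff_right r.diff_right)
  qed
  show ?thesis
    using v(1) r1 vW eigV l_le by (intro exI[of _ v] exI[of _ l]) (auto simp: W_def)
qed

text \<open>Each vector depends on all earlier ones, so the choice is made along the well-order of
  the naturals, vector and value together; \<open>P\<close> looks only at the prefix below
  k.\<close>

theorem exists_eigensystem: "\<exists>e m. eigensystem V r q e m"
proof -
  define P where "P f k x \<longleftrightarrow> fst x \<in> V \<and> r (fst x) (fst x) = 1 \<and> (\<forall>j<k. r (fst x) (fst (f j)) = 0) \<and>
    (\<forall>u\<in>V. q (fst x) u = snd x * r (fst x) u) \<and>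
    (\<forall>u\<in>V. (\<forall>j<k. r u (fst (f j)) = 0) \<longrightarrow> snd x * r u u \<le> q u u)"
    for f :: "nat \<Rightarrow> 'v \<times> real" and k x
  have "\<exists>f. \<forall>k. P f k (f k)"
  proof (rule dependent_wellorder_choice)
    show "P f k x = P g k x" if "\<And>j. j < k \<Longrightarrow> f j = g j" for x f g k
      using that by (simp add: P_def)
    show "\<exists>x. P f k x" if *: "\<And>j. j < k \<Longrightarrow> P f j (f j)" for k f
    proof -
      have V: "fst (f j) \<in> V" if "j < k" for j
        using *[OF that] by (simp add: P_def)
      have orth: "r (fst (f i)) (fst (f j)) = (if i = j then 1 else 0)" if "i < k" "j < k" for i j
        using *[OF that(1)] *[OF that(2)] V that r.sym[of "fst (f i)" "fst (f j)"]
        by (cases i j rule: linorder_cases) (auto simp: P_def)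
      have "\<exists>v l. v \<in> V \<and> r v v = 1 \<and> (\<forall>j<k. r v (fst (f j)) = 0) \<and> (\<forall>u\<in>V. q v u = l * r v u) \<and>
          (\<forall>u\<in>V. (\<forall>j<k. r u (fst (f j)) = 0) \<longrightarrow> l * r u u \<le> q u u)"
        by (rule exists_next_eigenvector[where m = "\<lambda>j. snd (f j)"]) (use * V orth in \<open>auto simp: P_def\<close>)
      then show ?thesis by (auto simp: P_def)
    qed
  qed
  then obtain f where f: "\<And>k. P f k (f k)" by blast
  define e m where "e k = fst (f k)" and "m k = snd (f k)" for k
  have V: "e k \<in> V" and n: "r (e k) (e k) = 1" and o: "j < k \<Longrightarrow> r (e k) (e j) = 0"
    and eig: "u \<in> V \<Longrightarrow> q (e k) u = m k * r (e k) u"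
    and min: "u \<in> V \<Longrightarrow> \<forall>j<k. r u (e j) = 0 \<Longrightarrow> m k * r u u \<le> q u u" for k j u
    using f[of k] by (simp_all add: P_def e_def m_def)
  have "eigensystem V r q e m"
    unfolding eigensystem_def
  proof (intro conjI allI ballI impI)
    show "incseq m"
    proof (rule incseq_SucI)
      fix k
      \<comment> \<open>The next eigenvector is itself admissible in the k-th minimisation.\<close>
      have "m k * r (e (Suc k)) (e (Suc k)) \<le> q (e (Suc k)) (e (Suc k))"
        using V o by (intro min) auto
      then show "m k \<le> m (Suc k)" using V eig n by simp
    qed
    show "r (e j) (e k) = (if j = k then 1 else 0)" for j k
      using n o[of j k] o[of k j] V r.sym[of "e j" "e k"] by (cases j k rule: linorder_cases) auto
  qed (use V eig min in auto)
  then show ?thesis by blast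
qed

section \<open>Properties of an eigensystem\<close>

context
  fixes e m assumes sys: "eigensystem V r q e m"
begin

lemma e_in: "e k \<in> V" and e_orth: "r (e j) (e k) = (if j = k then 1 else 0)"
  and e_eig: "v \<in> V \<Longrightarrow> q (e k) v = m k * r (e k) v"
  and e_min: "u \<in> V \<Longrightarrow> (\<And>j. j < k \<Longrightarrow> r u (e j) = 0) \<Longrightarrow> m k * r u u \<le> q u u"
  and m_mono: "incseq m"
  using sys by (auto simp: eigensystem_def)

lemma m_nonneg: "0 \<le> m k"
  using q.nonneg[OF e_in[of k]] e_eig[OF e_in, of k k] e_orth[of k k] by simp

text \<open>Otherwise the orthonormal vectors e n would be bounded in both forms and have an
  r-Cauchy subsequence, although distinct ones are at squared distance 2.\<close>

lemma m_unbounded: "\<exists>k. B < m k"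
proof (rule ccontr)
  assume "\<not> ?thesis"
  then have le: "m k \<le> B" for k by (meson not_less)
  have "r (e n) (e n) \<le> max 1 B" "q (e n) (e n) \<le> max 1 B" for n
    using e_orth e_eig[OF e_in] le[of n] by auto
  then obtain f where f: "strict_mono (f :: nat \<Rightarrow> nat)" "form_Cauchy r (e \<circ> f)"
    using compact[of e, OF e_in] by blast
  obtain N where N: "\<And>i j. i \<ge> N \<Longrightarrow> j \<ge> N \<Longrightarrow> r (e (f i) - e (f j)) (e (f i) - e (f j)) < 1"
    using form_CauchyD[OF f(2), of 1] by auto
  have "f N \<noteq> f (Suc N)" using f(1) by (simp add: strict_mono_eq)
  then have "r (e (f N) - e (f (Suc N))) (e (f N) - e (f (Suc N))) = 2"
    using e_in by (simp add: r.diff_left r.diff_right r.V_diff e_orth)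
  then show False using N[of N "Suc N"] by simp
qed

lemma finite_eigenvalue: "finite {k. m k = l}"
proof -
  obtain K where "l < m K" using m_unbounded by blast
  then have "k < K" if "m k = l" for k
    using incseqD[OF m_mono, of K k] that by (meson leD not_le)
  then have "{k. m k = l} \<subseteq> {..<K}" by auto
  then show ?thesis using finite_subset by blast
qed

text \<open>The remainder v - g is orthogonal to every e i, to those with other eigenvalues by
  symmetry of q, and it again satisfies the eigenvalue equation for l. At an index K with l < m K
  the minimality clause then forces its seminorm to vanish.\<close>

lemma eigenvector_expansion:
  assumes v: "v \<in> V" "\<And>u. u \<in> V \<Longrightarrow> q v u = l * r v u"
  defines "g \<equiv> (\<Sum>k | m k = l. r v (e k) *\<^sub>R e k)"
  shows "r (v - g) (v - g) = 0"
proof -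
  have gV: "g \<in> V" unfolding g_def using e_in by (intro r.V_sum r.V_scale) auto
  have rg: "r g (e i) = (if m i = l then r v (e i) else 0)" for i
  proof -
    have "r g (e i) = (\<Sum>k | m k = l. r v (e k) * r (e k) (e i))"
      unfolding g_def using e_in by (subst r.sum_left) auto
    also have "\<dots> = (\<Sum>k | m k = l. if k = i then r v (e i) else 0)"
      by (intro sum.cong) (auto simp: e_orth)
    finally show ?thesis using finite_eigenvalue by simp
  qed
  have rv: "r v (e i) = 0" if "m i \<noteq> l" for i
    using v(2)[OF e_in[of i]] e_eig[OF v(1), of i] q.sym[OF v(1) e_in[of i]] r.sym[OF v(1) e_in[of i]] that
    by simp
  have orth: "r (v - g) (e i) = 0" for i
    using rg rv v(1) gV e_in by (simp add: r.diff_left)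
  have qg: "q g u = l * r g u" if "u \<in> V" for u
    using that e_in by (simp add: g_def q.sum_left r.sum_left e_eig sum_distrib_left mult.left_commute)
  have qq: "q (v - g) (v - g) = l * r (v - g) (v - g)"
    using v gV qg by (simp add: q.diff_left r.diff_left r.V_diff algebra_simps)
  obtain K where K: "l < m K" using m_unbounded by blast
  have "m K * r (v - g) (v - g) \<le> l * r (v - g) (v - g)"
    using e_min[of "v - g" K] orth v(1) gV qq by (simp add: r.V_diff)
  then show ?thesis
    using K r.nonneg[OF r.V_diff[OF v(1) gV]] by (simp add: mult_le_cancel_right)
qed

end

text \<open>Min-max trial vector: some nonzero combination of the first k + 1 eigenvectors of (r, q)
  is r'-orthogonal to the first k of (r', q'). Its Rayleigh quotient for (r, q) is at most m k, that
  for (r', q') at least m' k, and the form bounds relate the two.\<close>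

lemma eigenvalue_comparison:
  assumes sys: "eigensystem V r q e m" and "spectral_forms V r' q'" and sys': "eigensystem V r' q' e' m'"
    and q: "\<And>u. u \<in> V \<Longrightarrow> q' u u \<le> \<alpha> * q u u" and r: "\<And>u. u \<in> V \<Longrightarrow> r u u \<le> \<beta> * r' u u"
    and pos: "\<alpha> \<ge> 0" "\<beta> \<ge> 0"
  shows "m' k \<le> \<alpha> * \<beta> * m k"
proof -
  interpret s': spectral_forms V r' q' by fact
  obtain b where b: "\<exists>i<Suc k. b i \<noteq> 0" "\<And>j. j < k \<Longrightarrow> (\<Sum>i<Suc k. b i * r' (e i) (e' j)) = 0"
    using nontrivial_relation[of k "Suc k" "\<lambda>i j. r' (e i) (e' j)"] by blast
  define u where "u = (\<Sum>i<Suc k. b i *\<^sub>R e i)"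
  have uV: "u \<in> V"
    unfolding u_def by (intro r.V_sum r.V_scale e_in[OF sys])
  have orth: "r' u (e' j) = 0" if "j < k" for j
    unfolding u_def using e_in[OF sys] s'.e_in[OF sys'] b(2)[OF that] by (subst s'.r.sum_left) auto
  have re: "r (e i) u = (if i < Suc k then b i else 0)" for i
  proof -
    have "r (e i) u = (\<Sum>j<Suc k. b j * r (e j) (e i))"
      unfolding u_def using e_in[OF sys] by (subst r.sym) (auto intro!: r.V_sum r.V_scale simp del: sum.lessThan_Suc simp: r.sum_left)
    also have "\<dots> = (\<Sum>j<Suc k. if j = i then b i else 0)"
      by (intro sum.cong) (auto simp: e_orth[OF sys])
    finally show ?thesis by simp
  qed
  have ru: "r u u = (\<Sum>i<Suc k. (b i)\<^sup>2)"
  proof -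
    have "r u u = (\<Sum>i<Suc k. b i * r (e i) u)"
      using uV e_in[OF sys] by (subst (1) u_def) (auto simp del: sum.lessThan_Suc simp: r.sum_left)
    then show ?thesis by (simp del: sum.lessThan_Suc add: re power2_eq_square)
  qed
  have qu: "q u u = (\<Sum>i<Suc k. m i * (b i)\<^sup>2)"
  proof -
    have "q u u = (\<Sum>i<Suc k. b i * q (e i) u)"
      using uV e_in[OF sys] by (subst (1) u_def) (auto simp del: sum.lessThan_Suc simp: q.sum_left)
    then show ?thesis
      by (simp del: sum.lessThan_Suc add: re e_eig[OF sys uV] power2_eq_square algebra_simps)
  qed
  \<comment> \<open>The Rayleigh quotient of a combination of the eigenvectors up to index k is a
    weighted average of m 0, ..., m k.\<close>
  have le: "q u u \<le> m k * r u u"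
    unfolding qu ru sum_distrib_left
    using m_mono[OF sys] by (intro sum_mono mult_right_mono) (auto simp: incseq_def)
  have rpos: "r u u > 0"
  proof -
    obtain i where "i < Suc k" "b i \<noteq> 0" using b(1) by blast
    then show ?thesis
      unfolding ru by (intro sum_pos2[of _ i]) auto
  qed
  have "r' u u > 0"
    using r[OF uV] rpos pos s'.r.nonneg[OF uV] by (metis less_eq_real_def mult_zero_right not_less)
  have "m' k * r' u u \<le> q' u u" using s'.e_min[OF sys' uV orth] .
  also have "\<dots> \<le> \<alpha> * q u u" using q[OF uV] .
  also have "\<dots> \<le> \<alpha> * (m k * (\<beta> * r' u u))"
    using le r[OF uV] pos m_nonneg[OF sys, of k] by (meson mult_left_mono order_trans)
  finally have "m' k * r' u u \<le> (\<alpha> * \<beta> * m k) * r' u u" by (simp add: algebra_simps)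
  then show ?thesis using \<open>r' u u > 0\<close> by simp
qed

end

subsection \<open>Perturbed eigenvalues\<close>

text \<open>Contrapositive: if X stays at distance d from L infinitely often, enumerating those
  indices gives a subsequence no part of which converges to L. Eigenvectors converge only after
  extraction, so limits are first obtained along subsequences of subsequences.\<close>

lemma tendsto_if_subseq:
  fixes X :: "nat \<Rightarrow> 'a::metric_space"
  assumes "\<And>g. strict_mono (g :: nat \<Rightarrow> nat) \<Longrightarrow> \<exists>f. strict_mono (f :: nat \<Rightarrow> nat) \<and> (X \<circ> g \<circ> f) \<longlonglongrightarrow> L"
  shows "X \<longlonglongrightarrow> L"
proof (rule ccontr)
  assume "\<not> X \<longlonglongrightarrow> L"
  then obtain d where d: "d > 0" "\<And>N. \<exists>n\<ge>N. d \<le> dist (X n) L"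
    unfolding lim_sequentially by (meson not_less)
  have "infinite {n. d \<le> dist (X n) L}"
    unfolding infinite_nat_iff_unbounded_le using d(2) by auto
  from infinite_enumerate[OF this] obtain g :: "nat \<Rightarrow> nat"
    where g: "strict_mono g" "\<And>n. d \<le> dist (X (g n)) L" by auto
  obtain f where "(X \<circ> g \<circ> f) \<longlonglongrightarrow> L"
    using assms[OF g(1)] by blast
  then obtain n where "dist (X (g (f n))) L < d"
    using d(1) unfolding lim_sequentially by fastforce
  with g(2)[of "f n"] show False by simp
qed

text \<open>Errors are measured by the unperturbed seminorms, each form against its own: this is
  what pointwise errors of the coefficients give. The first-order bounds serve continuity, the
  second-order expansions the derivative. \<open>dr\<close> and \<open>dq\<close> may be indefinite;
  their bounds make them insensitive to null vectors.\<close>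

locale form_perturbation = spectral_forms V r q for V :: "'v::real_vector set" and r q +
  fixes rn qn :: "nat \<Rightarrow> 'v \<Rightarrow> 'v \<Rightarrow> real" and dr dq :: "'v \<Rightarrow> 'v \<Rightarrow> real"
    and t :: "nat \<Rightarrow> real" and K :: real
  assumes forms: "spectral_forms V (rn n) (qn n)"
    and t_pos: "t n > 0" and t_lim: "t \<longlonglongrightarrow> 0" and K_nonneg: "K \<ge> 0"
    and rn_bound: "u \<in> V \<Longrightarrow> v \<in> V \<Longrightarrow> \<bar>rn n u v - r u v\<bar> \<le> K * t n * (sqrt (r u u) * sqrt (r v v))"
    and qn_bound: "u \<in> V \<Longrightarrow> v \<in> V \<Longrightarrow> \<bar>qn n u v - q u v\<bar> \<le> K * t n * (sqrt (q u u) * sqrt (q v v))"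
    and rn_expand: "u \<in> V \<Longrightarrow> v \<in> V \<Longrightarrow>
      \<bar>rn n u v - r u v - t n * dr u v\<bar> \<le> K * (t n)\<^sup>2 * (sqrt (r u u) * sqrt (r v v))"
    and qn_expand: "u \<in> V \<Longrightarrow> v \<in> V \<Longrightarrow>
      \<bar>qn n u v - q u v - t n * dq u v\<bar> \<le> K * (t n)\<^sup>2 * (sqrt (q u u) * sqrt (q v v))"
    and dr_bound: "u \<in> V \<Longrightarrow> v \<in> V \<Longrightarrow> \<bar>dr u v\<bar> \<le> K * (sqrt (r u u) * sqrt (r v v))"
    and dq_bound: "u \<in> V \<Longrightarrow> v \<in> V \<Longrightarrow> \<bar>dq u v\<bar> \<le> K * (sqrt (q u u) * sqrt (q v v))"
    and dr_diff: "u \<in> V \<Longrightarrow> v \<in> V \<Longrightarrow> w \<in> V \<Longrightarrow> dr (u - v) w = dr u w - dr v w"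
    and dq_diff: "u \<in> V \<Longrightarrow> v \<in> V \<Longrightarrow> w \<in> V \<Longrightarrow> dq (u - v) w = dq u w - dq v w"
    and dr_scale: "u \<in> V \<Longrightarrow> w \<in> V \<Longrightarrow> dr (b *\<^sub>R u) w = b * dr u w"
    and dq_scale: "u \<in> V \<Longrightarrow> w \<in> V \<Longrightarrow> dq (b *\<^sub>R u) w = b * dq u w"
begin

text \<open>The setting survives thinning out, so the argument can be started along an arbitrary
  subsequence, as the subsequence criterion for limits demands.\<close>

lemma subsequence:
  assumes "strict_mono (g :: nat \<Rightarrow> nat)"
  shows "form_perturbation V r q (rn \<circ> g) (qn \<circ> g) dr dq (t \<circ> g) K"
  using LIMSEQ_subseq_LIMSEQ[OF t_lim assms]
  by (intro form_perturbation.intro form_perturbation_axioms.intro spectral_forms_axioms; unfold comp_def)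
    (assumption | rule forms t_pos K_nonneg rn_bound qn_bound rn_expand qn_expand dr_bound dq_bound
      dr_diff dq_diff dr_scale dq_scale)+

context
  fixes e en m mn
  assumes sys: "eigensystem V r q e m" and sysn: "\<And>n. eigensystem V (rn n) (qn n) (en n) (mn n)"
begin

lemma Kt_lim: "(\<lambda>n. K * t n) \<longlonglongrightarrow> 0"
  using tendsto_mult_left[OF t_lim, of K] by simp

lemma eventually_small: "eventually (\<lambda>n. K * t n < 1 / 2) sequentially"
  using order_tendstoD(2)[OF Kt_lim, of "1/2"] by simp

text \<open>The perturbed forms lie between 1 - K t and 1 + K t times the unperturbed ones, so
  comparison in both directions confines \<open>mn n k\<close> between m k times (1 - K t) / (1 + K
  t) and m k times the reciprocal factor. Once K t < 1 / 2 the divisors are positive.\<close>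

lemma eigenvalue_tendsto: "(\<lambda>n. mn n k) \<longlonglongrightarrow> m k"
proof -
  let ?x = "\<lambda>n. K * t n"
  have x0: "0 \<le> ?x n" for n using t_pos[of n] K_nonneg by simp
  have rb: "rn n u u \<le> (1 + ?x n) * r u u" "(1 - ?x n) * r u u \<le> rn n u u"
    and qb: "qn n u u \<le> (1 + ?x n) * q u u" "(1 - ?x n) * q u u \<le> qn n u u" if "u \<in> V" for n u
    using rn_bound[OF that that, of n] qn_bound[OF that that, of n] r.nonneg[OF that] q.nonneg[OF that]
    by (auto simp: algebra_simps abs_le_iff)
  have b1: "mn n k \<le> (1 + ?x n) * (1 / (1 - ?x n)) * m k" if "?x n < 1 / 2" for n
  proof (rule eigenvalue_comparison[OF sys forms sysn])
    show "qn n u u \<le> (1 + ?x n) * q u u" if "u \<in> V" for u using qb that by blast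
    show "r u u \<le> 1 / (1 - ?x n) * rn n u u" if "u \<in> V" for u
      using rb(2)[OF that, of n] \<open>?x n < 1/2\<close> by (simp add: field_simps)
  qed (use x0[of n] that in auto)
  have b2: "m k \<le> 1 / (1 - ?x n) * (1 + ?x n) * mn n k" if "?x n < 1 / 2" for n
  proof (rule spectral_forms.eigenvalue_comparison[OF forms sysn spectral_forms_axioms sys])
    show "q u u \<le> 1 / (1 - ?x n) * qn n u u" if "u \<in> V" for u
      using qb(2)[OF that, of n] \<open>?x n < 1/2\<close> by (simp add: field_simps)
    show "rn n u u \<le> (1 + ?x n) * r u u" if "u \<in> V" for u using rb that by blast
  qed (use x0[of n] that in auto)
  have l1: "(\<lambda>n. (1 + ?x n) * (1 / (1 - ?x n)) * m k) \<longlonglongrightarrow> (1 + 0) * (1 / (1 - 0)) * m k"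
    by (intro tendsto_intros Kt_lim) simp
  have l2: "(\<lambda>n. (1 - ?x n) / (1 + ?x n) * m k) \<longlonglongrightarrow> (1 - 0) / (1 + 0) * m k"
    by (intro tendsto_intros Kt_lim) simp
  have "eventually (\<lambda>n. (1 - ?x n) / (1 + ?x n) * m k \<le> mn n k) sequentially"
    using eventually_small
  proof eventually_elim
    case (elim n)
    then have "m k * (1 - ?x n) \<le> (1 + ?x n) * mn n k"
      using b2[of n] by (simp add: pos_le_divide_eq)
    then show ?case using x0[of n] by (simp add: pos_divide_le_eq mult.commute)
  qed
  moreover have "eventually (\<lambda>n. mn n k \<le> (1 + ?x n) * (1 / (1 - ?x n)) * m k) sequentially"
    using eventually_small by eventually_elim (rule b1)
  moreover have "(\<lambda>n. (1 - ?x n) / (1 + ?x n) * m k) \<longlonglongrightarrow> m k"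
    "(\<lambda>n. (1 + ?x n) * (1 / (1 - ?x n)) * m k) \<longlonglongrightarrow> m k"
    using l1 l2 by simp_all
  ultimately show ?thesis by (rule tendsto_sandwich)
qed

lemma abs_form_le:
  assumes "u \<in> V" "v \<in> V" "r u u \<le> B" "r v v \<le> B" "q u u \<le> B" "q v v \<le> B"
  shows "sqrt (r u u) * sqrt (r v v) \<le> B" "sqrt (q u u) * sqrt (q v v) \<le> B"
proof -
  have B: "0 \<le> B" using r.nonneg[OF assms(1)] assms(3) by simp
  have "sqrt (r u u) * sqrt (r v v) \<le> sqrt B * sqrt B" "sqrt (q u u) * sqrt (q v v) \<le> sqrt B * sqrt B"
    using assms r.nonneg q.nonneg B by (intro mult_mono; simp)+
  then show "sqrt (r u u) * sqrt (r v v) \<le> B" "sqrt (q u u) * sqrt (q v v) \<le> B"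
    using B by simp_all
qed

text \<open>A perturbed eigenvector satisfies the unperturbed equation up to O(t). Compactness
  yields only r-Cauchy subsequences; testing the near-equation with differences of the vectors makes
  them q-Cauchy as well, and the limit solves the exact equation.\<close>

lemma eigenvectors_subconverge:
  "\<exists>f v. strict_mono (f :: nat \<Rightarrow> nat) \<and> v \<in> V \<and>
    (\<lambda>n. r (en (f n) k - v) (en (f n) k - v)) \<longlonglongrightarrow> 0 \<and> (\<lambda>n. q (en (f n) k - v) (en (f n) k - v)) \<longlonglongrightarrow> 0 \<and>
    r v v = 1 \<and> (\<forall>h\<in>V. q v h = m k * r v h)"
proof -
  let ?x = "\<lambda>n. K * t n"
  have x0: "0 \<le> ?x n" for n using t_pos[of n] K_nonneg by simp
  \<comment> \<open>Beyond N the forms are comparable and the eigenvalues stay below m k + 1;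
    shifting all sequences by N makes the bounds uniform.\<close>
  obtain N where N: "\<And>n. n \<ge> N \<Longrightarrow> ?x n < 1 / 2" "\<And>n. n \<ge> N \<Longrightarrow> mn n k < m k + 1"
    using eventually_conj[OF eventually_small order_tendstoD(2)[OF eigenvalue_tendsto[of k], of "m k + 1"]]
    unfolding eventually_sequentially by auto
  define M where "M = m k + 1"
  \<comment> \<open>Absorbing x <= 1 / 2 in r <= 1 + x r and q <= l + x q gives r <= 2 and q <= 2 M,
    both at most B.\<close>
  define B where "B = 2 * (M + 1)"
  have M1: "1 \<le> M" using m_nonneg[OF sys, of k] by (simp add: M_def)
  define u where "u n = en (n + N) k" for n
  define l where "l n = mn (n + N) k" for n
  define x where "x n = ?x (n + N)" for n
  define R where "R n = rn (n + N)" for n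
  define Q where "Q n = qn (n + N)" for n
  have uV: "u n \<in> V" for n
    using spectral_forms.e_in[OF forms sysn] by (simp add: u_def)
  have Ru: "R n (u n) (u n) = 1" and Qu: "h \<in> V \<Longrightarrow> Q n (u n) h = l n * R n (u n) h" for n h
    using spectral_forms.e_orth[OF forms sysn] spectral_forms.e_eig[OF forms sysn]
    by (simp_all add: u_def R_def Q_def l_def)
  have lM: "0 \<le> l n" "l n \<le> M" for n
    using spectral_forms.m_nonneg[OF forms sysn] N(2)[of "n + N"] by (auto simp: l_def M_def)
  have xs: "0 \<le> x n" "x n < 1 / 2" for n
    using x0 N(1)[of "n + N"] by (auto simp: x_def)
  have x_lim: "x \<longlonglongrightarrow> 0"
    using LIMSEQ_ignore_initial_segment[OF Kt_lim, of N] by (simp add: x_def[abs_def])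
  have l_lim: "l \<longlonglongrightarrow> m k"
    using LIMSEQ_ignore_initial_segment[OF eigenvalue_tendsto[of k], of N] by (simp add: l_def[abs_def])
  have RB: "\<bar>R n a b - r a b\<bar> \<le> x n * (sqrt (r a a) * sqrt (r b b))"
    and QB: "\<bar>Q n a b - q a b\<bar> \<le> x n * (sqrt (q a a) * sqrt (q b b))" if "a \<in> V" "b \<in> V" for a b n
    using rn_bound[OF that] qn_bound[OF that] by (auto simp: R_def Q_def x_def)
  have rB: "r (u n) (u n) \<le> B" and qB: "q (u n) (u n) \<le> B" for n
  proof -
    have "r (u n) (u n) - 1 \<le> x n * r (u n) (u n)"
      using RB[OF uV uV, of n n n] r.nonneg[OF uV[of n]] Ru[of n] by (simp add: abs_le_iff)
    moreover have "x n * r (u n) (u n) \<le> 1 / 2 * r (u n) (u n)"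
      using xs[of n] r.nonneg[OF uV[of n]] by (intro mult_right_mono) auto
    ultimately show "r (u n) (u n) \<le> B" using M1 by (simp add: B_def)
    have "q (u n) (u n) - l n \<le> x n * q (u n) (u n)"
      using QB[OF uV uV, of n n n] q.nonneg[OF uV[of n]] Qu[OF uV, of n n] Ru[of n] by (simp add: abs_le_iff)
    moreover have "x n * q (u n) (u n) \<le> 1 / 2 * q (u n) (u n)"
      using xs[of n] q.nonneg[OF uV[of n]] by (intro mult_right_mono) auto
    ultimately show "q (u n) (u n) \<le> B" using M1 lM[of n] by (simp add: B_def)
  qed
  have B0: "0 \<le> B" using M1 by (simp add: B_def)
  \<comment> \<open>The error in the unperturbed equation is l (R - r) - (Q - q), tested with h. The
    bound 4 B is the one \<open>diff_le\<close> gives for differences of the vectors u n, which are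
    the h inserted later.\<close>
  have approx: "\<bar>q (u n) h - l n * r (u n) h\<bar> \<le> (M + 1) * x n * (4 * B)"
    if h: "h \<in> V" "r h h \<le> 4 * B" "q h h \<le> 4 * B" for n h
  proof -
    have s: "sqrt (r (u n) (u n)) * sqrt (r h h) \<le> 4 * B" "sqrt (q (u n) (u n)) * sqrt (q h h) \<le> 4 * B"
      using abs_form_le[OF uV[of n] h(1), of "4 * B"] h rB[of n] qB[of n] B0 by auto
    have "q (u n) h - l n * r (u n) h = l n * (R n (u n) h - r (u n) h) - (Q n (u n) h - q (u n) h)"
      using Qu[OF h(1), of n] by (simp add: algebra_simps)
    moreover have "\<bar>R n (u n) h - r (u n) h\<bar> \<le> x n * (4 * B)"
      using order_trans[OF RB[OF uV h(1), of n n] mult_left_mono[OF s(1) xs(1)]] .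
    then have "\<bar>l n * (R n (u n) h - r (u n) h)\<bar> \<le> M * (x n * (4 * B))"
      unfolding abs_mult using lM[of n] M1 by (intro mult_mono) auto
    moreover have "\<bar>Q n (u n) h - q (u n) h\<bar> \<le> x n * (4 * B)"
      using order_trans[OF QB[OF uV h(1), of n n] mult_left_mono[OF s(2) xs(1)]] .
    ultimately show ?thesis by (simp add: algebra_simps)
  qed
  obtain f where f: "strict_mono (f :: nat \<Rightarrow> nat)" "form_Cauchy r (u \<circ> f)"
    using compact[of u B, OF uV rB qB] by auto
  have diffB: "r (u i - u j) (u i - u j) \<le> 4 * B" "q (u i - u j) (u i - u j) \<le> 4 * B" for i j
    using r.diff_le[OF uV[of i] uV[of j]] q.diff_le[OF uV[of i] uV[of j]] rB[of i] rB[of j] qB[of i] qB[of j]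
    by auto
  \<comment> \<open>With h = u i - u j along the subsequence, q h h = q (u i) h - q (u j) h. Each
    term is within d / 8 of the corresponding l r (u i) h, which Cauchy-Schwarz makes at most d / 8
    because h is small in r.\<close>
  have qC: "form_Cauchy q (u \<circ> f)"
    unfolding form_Cauchy_def
  proof (intro allI impI)
    fix d :: real assume d: "d > 0"
    \<comment> \<open>Chosen so that M sqrt B sqrt c is at most d / 8; the added 1 keeps the divisor
      positive.\<close>
    define c where "c = (d / (8 * (M * sqrt B + 1)))\<^sup>2"
    have MB: "0 \<le> M * sqrt B" using M1 B0 by simp
    have c: "c > 0" using d MB unfolding c_def by (simp add: add_nonneg_eq_0_iff)
    obtain N1 where N1: "\<And>i j. i \<ge> N1 \<Longrightarrow> j \<ge> N1 \<Longrightarrow> r (u (f i) - u (f j)) (u (f i) - u (f j)) < c"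
      using form_CauchyD[OF f(2) c] by auto
    have "(\<lambda>n. (M + 1) * x n * (4 * B)) \<longlonglongrightarrow> (M + 1) * 0 * (4 * B)"
      by (intro tendsto_intros x_lim)
    then have "eventually (\<lambda>n. (M + 1) * x n * (4 * B) < d / 8) sequentially"
      using d by (intro order_tendstoD(2)) auto
    then obtain N2 where N2: "\<And>n. n \<ge> N2 \<Longrightarrow> (M + 1) * x n * (4 * B) < d / 8"
      by (auto simp: eventually_sequentially)
    show "\<exists>L. \<forall>i\<ge>L. \<forall>j\<ge>L. q ((u \<circ> f) i - (u \<circ> f) j) ((u \<circ> f) i - (u \<circ> f) j) < d"
    proof (intro exI allI impI)
      fix i j assume ij: "max N1 N2 \<le> i" "max N1 N2 \<le> j"
      define h where "h = u (f i) - u (f j)"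
      have hV: "h \<in> V" unfolding h_def by (intro r.V_diff uV)
      have part: "\<bar>q (u (f i')) h\<bar> < d / 4" if "max N1 N2 \<le> i'" for i'
      proof -
        have "\<bar>q (u (f i')) h - l (f i') * r (u (f i')) h\<bar> < d / 8"
        proof -
          have "\<bar>q (u (f i')) h - l (f i') * r (u (f i')) h\<bar> \<le> (M + 1) * x (f i') * (4 * B)"
            by (rule approx[OF hV]) (auto simp: h_def diffB)
          also have "\<dots> < d / 8"
            using N2[of "f i'"] seq_suble[OF f(1), of i'] that by simp
          finally show ?thesis .
        qed
        moreover have "\<bar>l (f i') * r (u (f i')) h\<bar> \<le> d / 8"
        proof -
          have "\<bar>r (u (f i')) h\<bar> \<le> sqrt (r (u (f i')) (u (f i'))) * sqrt (r h h)"
            by (rule r.abs_le_sqrt[OF uV hV])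
          also have "\<dots> \<le> sqrt B * sqrt c"
            using rB N1[of i j] ij r.nonneg[OF hV] r.nonneg[OF uV] B0
            by (intro mult_mono) (auto simp: h_def)
          finally have "\<bar>l (f i') * r (u (f i')) h\<bar> \<le> M * (sqrt B * sqrt c)"
            unfolding abs_mult using lM[of "f i'"] by (intro mult_mono) auto
          also have "\<dots> = M * sqrt B * (d / (8 * (M * sqrt B + 1)))"
            using d MB by (simp add: c_def)
          also have "\<dots> \<le> d / 8"
            using d MB by (simp add: field_simps)
          finally show ?thesis .
        qed
        ultimately show ?thesis by linarith
      qed
      have "q h h = q (u (f i)) h - q (u (f j)) h"
        by (subst (1) h_def) (simp add: q.diff_left uV hV)
      then show "q ((u \<circ> f) i - (u \<circ> f) j) ((u \<circ> f) i - (u \<circ> f) j) < d"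
        using part[OF ij(1)] part[OF ij(2)] d by (simp add: h_def)
    qed
  qed
  obtain v where v: "v \<in> V" "(\<lambda>n. r ((u \<circ> f) n - v) ((u \<circ> f) n - v)) \<longlonglongrightarrow> 0"
    "(\<lambda>n. q ((u \<circ> f) n - v) ((u \<circ> f) n - v)) \<longlonglongrightarrow> 0"
    using complete[OF _ f(2) qC] uV by auto
  have xf: "(\<lambda>n. x (f n)) \<longlonglongrightarrow> 0" and lf: "(\<lambda>n. l (f n)) \<longlonglongrightarrow> m k"
    using LIMSEQ_subseq_LIMSEQ[OF x_lim f(1)] LIMSEQ_subseq_LIMSEQ[OF l_lim f(1)] by (simp_all add: comp_def)
  have r1: "r v v = 1"
  proof -
    have "(\<lambda>n. r (u (f n)) (u (f n))) \<longlonglongrightarrow> r v v"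
      using v uV by (intro r.tendsto_self) auto
    moreover have "(\<lambda>n. r (u (f n)) (u (f n)) - 1) \<longlonglongrightarrow> 0"
    proof (rule Lim_null_comparison[OF always_eventually])
      show "\<forall>n. norm (r (u (f n)) (u (f n)) - 1) \<le> x (f n) * B"
      proof
        fix n
        have "\<bar>1 - r (u (f n)) (u (f n))\<bar> \<le> x (f n) * r (u (f n)) (u (f n))"
          using RB[OF uV uV, of "f n" "f n" "f n"] r.nonneg[OF uV[of "f n"]] by (simp add: Ru)
        also have "\<dots> \<le> x (f n) * B" using rB xs by (intro mult_left_mono) auto
        finally show "norm (r (u (f n)) (u (f n)) - 1) \<le> x (f n) * B" by simp
      qed
      show "(\<lambda>n. x (f n) * B) \<longlonglongrightarrow> 0" using tendsto_mult_right[OF xf, of B] by simp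
    qed
    then have "(\<lambda>n. r (u (f n)) (u (f n))) \<longlonglongrightarrow> 1" by (simp add: LIM_zero_iff)
    ultimately show ?thesis by (rule LIMSEQ_unique)
  qed
  have eig: "q v h = m k * r v h" if h: "h \<in> V" for h
  proof -
    have lim: "(\<lambda>n. q (u (f n)) h - l (f n) * r (u (f n)) h) \<longlonglongrightarrow> q v h - m k * r v h"
      using v uV h by (intro tendsto_intros lf q.tendsto_left r.tendsto_left) auto
    \<comment> \<open>The estimate \<open>approx\<close> again, now for a fixed arbitrary h, whose
      own seminorms enter the constant.\<close>
    have bnd: "\<bar>q (u n) h - l n * r (u n) h\<bar> \<le> (M + 1) * x n * (B + r h h + q h h)" for n
    proof -
      let ?B = "B + r h h + q h h"
      have B': "0 \<le> ?B" using B0 r.nonneg[OF h] q.nonneg[OF h] by simp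
      have s: "sqrt (r (u n) (u n)) * sqrt (r h h) \<le> ?B" "sqrt (q (u n) (u n)) * sqrt (q h h) \<le> ?B"
        using abs_form_le[OF uV[of n] h, of ?B] rB[of n] qB[of n] B0 r.nonneg[OF h] q.nonneg[OF h] by auto
      have "q (u n) h - l n * r (u n) h = l n * (R n (u n) h - r (u n) h) - (Q n (u n) h - q (u n) h)"
        using Qu[OF h, of n] by (simp add: algebra_simps)
      moreover have "\<bar>R n (u n) h - r (u n) h\<bar> \<le> x n * ?B"
        using order_trans[OF RB[OF uV h, of n n] mult_left_mono[OF s(1) xs(1)]] .
      then have "\<bar>l n * (R n (u n) h - r (u n) h)\<bar> \<le> M * (x n * ?B)"
        unfolding abs_mult using lM[of n] M1 by (intro mult_mono) auto
      moreover have "\<bar>Q n (u n) h - q (u n) h\<bar> \<le> x n * ?B"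
        using order_trans[OF QB[OF uV h, of n n] mult_left_mono[OF s(2) xs(1)]] .
      ultimately show ?thesis by (simp add: algebra_simps)
    qed
    have "(\<lambda>n. (M + 1) * x (f n) * (B + r h h + q h h)) \<longlonglongrightarrow> (M + 1) * 0 * (B + r h h + q h h)"
      by (intro tendsto_intros xf)
    then have lim0: "(\<lambda>n. (M + 1) * x (f n) * (B + r h h + q h h)) \<longlonglongrightarrow> 0" by simp
    have "(\<lambda>n. q (u (f n)) h - l (f n) * r (u (f n)) h) \<longlonglongrightarrow> 0"
      using bnd by (intro Lim_null_comparison[OF always_eventually lim0]) simp
    with lim show ?thesis using LIMSEQ_unique by fastforce
  qed
  have "strict_mono (\<lambda>n. f n + N)" using f(1) by (simp add: strict_mono_def)
  with v r1 eig show ?thesis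
    by (intro exI[of _ "\<lambda>n. f n + N"] exI[of _ v] conjI) (simp_all add: u_def comp_def)
qed

text \<open>Testing the perturbed equation of u n with w and the equation of w with u n, and
  subtracting, gives (mn - m) r (u n) w = (qn - q) (u n) w - mn (rn - r) (u n) w. After division by
  t the right side needs only the convergence of u n to v in the seminorms. As v is b w up to a null
  vector, the factor b cancels against the limit b of r (u n) w.\<close>

lemma eigenvalue_derivative_subseq:
  assumes w: "w \<in> V" "\<And>h. h \<in> V \<Longrightarrow> q w h = m k * r w h"
    and simple: "\<And>v. v \<in> V \<Longrightarrow> (\<And>h. h \<in> V \<Longrightarrow> q v h = m k * r v h) \<Longrightarrow> \<exists>b. r (v - b *\<^sub>R w) (v - b *\<^sub>R w) = 0"
    and r1: "r w w = 1"
  shows "\<exists>f. strict_mono (f :: nat \<Rightarrow> nat) \<and>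
    (\<lambda>n. (mn (f n) k - m k) / t (f n)) \<longlonglongrightarrow> dq w w - m k * dr w w"
proof -
  obtain f v where f: "strict_mono (f :: nat \<Rightarrow> nat)" and v: "v \<in> V"
    "(\<lambda>n. r (en (f n) k - v) (en (f n) k - v)) \<longlonglongrightarrow> 0" "(\<lambda>n. q (en (f n) k - v) (en (f n) k - v)) \<longlonglongrightarrow> 0"
    "r v v = 1" and eig: "\<And>h. h \<in> V \<Longrightarrow> q v h = m k * r v h"
    using eigenvectors_subconverge[of k] by blast
  define u where "u n = en (f n) k" for n
  have uV: "u n \<in> V" for n
    using spectral_forms.e_in[OF forms sysn] by (simp add: u_def)
  obtain b where b: "r (v - b *\<^sub>R w) (v - b *\<^sub>R w) = 0" using simple[OF v(1) eig] by blast
  have zV: "v - b *\<^sub>R w \<in> V" by (intro r.V_diff r.V_scale v w)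
  have qb: "q (v - b *\<^sub>R w) (v - b *\<^sub>R w) = 0" by (rule null[OF zV b])
  have rb: "r v h = b * r w h" if "h \<in> V" for h
    using r.null_left[OF zV that b] v(1) w(1) that by (simp add: r.diff_left r.V_scale r.scale_left)
  \<comment> \<open>The derivative forms are bounded by the seminorms, so they do not see the null
    vector v - b w.\<close>
  have drb: "dr v w = b * dr w w" and dqb: "dq v w = b * dq w w"
  proof -
    have "dr (v - b *\<^sub>R w) w = 0" "dq (v - b *\<^sub>R w) w = 0"
      using dr_bound[OF zV w(1)] dq_bound[OF zV w(1)] b qb by auto
    then show "dr v w = b * dr w w" "dq v w = b * dq w w"
      using v(1) w(1) by (simp_all add: dr_diff dq_diff dr_scale dq_scale r.V_scale)
  qed
  \<comment> \<open>With b = 0 the vector v would have r-seminorm 0, against its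
    normalisation.\<close>
  have "b \<noteq> 0" using rb[OF v(1)] v(4) by auto
  have rw: "r v w = b" using rb[OF w(1)] r1 by simp
  have tf: "(\<lambda>n. t (f n)) \<longlonglongrightarrow> 0" and mf: "(\<lambda>n. mn (f n) k) \<longlonglongrightarrow> m k"
    using LIMSEQ_subseq_LIMSEQ[OF t_lim f] LIMSEQ_subseq_LIMSEQ[OF eigenvalue_tendsto f] by (simp_all add: comp_def)
  \<comment> \<open>One argument for both forms: the second-order expansion replaces the quotient by
    ds (u n) w with error O(t), and the seminorm bound on ds allows passing from u n to v.\<close>
  have quot: "(\<lambda>n. (sn (f n) (u n) w - s (u n) w) / t (f n)) \<longlonglongrightarrow> ds v w"
    if "psd_form V s" and lim: "(\<lambda>n. s (u n - v) (u n - v)) \<longlonglongrightarrow> 0"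
      and ex: "\<And>n u w. u \<in> V \<Longrightarrow> w \<in> V \<Longrightarrow> \<bar>sn n u w - s u w - t n * ds u w\<bar> \<le> K * (t n)\<^sup>2 * (sqrt (s u u) * sqrt (s w w))"
      and bd: "\<And>u w. u \<in> V \<Longrightarrow> w \<in> V \<Longrightarrow> \<bar>ds u w\<bar> \<le> K * (sqrt (s u u) * sqrt (s w w))"
      and df: "\<And>u v w. u \<in> V \<Longrightarrow> v \<in> V \<Longrightarrow> w \<in> V \<Longrightarrow> ds (u - v) w = ds u w - ds v w"
    for s ds :: "'v \<Rightarrow> 'v \<Rightarrow> real" and sn
  proof -
    interpret s: psd_form V s by fact
    have ss: "(\<lambda>n. s (u n) (u n)) \<longlonglongrightarrow> s v v"
      using lim uV v(1) by (intro s.tendsto_self)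
    have "(\<lambda>n. K * (sqrt (s (u n - v) (u n - v)) * sqrt (s w w))) \<longlonglongrightarrow> K * (sqrt 0 * sqrt (s w w))"
      by (intro tendsto_intros lim)
    then have lim0: "(\<lambda>n. K * (sqrt (s (u n - v) (u n - v)) * sqrt (s w w))) \<longlonglongrightarrow> 0" by simp
    have "norm (ds (u n) w - ds v w) \<le> K * (sqrt (s (u n - v) (u n - v)) * sqrt (s w w))" for n
      using bd[OF s.V_diff[OF uV v(1)] w(1)] df[OF uV v(1) w(1)] by simp
    then have "(\<lambda>n. ds (u n) w - ds v w) \<longlonglongrightarrow> 0"
      by (intro Lim_null_comparison[OF always_eventually lim0] allI)
    moreover have "(\<lambda>n. (sn (f n) (u n) w - s (u n) w) / t (f n) - ds (u n) w) \<longlonglongrightarrow> 0"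
    proof (rule Lim_null_comparison[OF always_eventually])
      show "\<forall>n. norm ((sn (f n) (u n) w - s (u n) w) / t (f n) - ds (u n) w)
          \<le> K * t (f n) * (sqrt (s (u n) (u n)) * sqrt (s w w))"
      proof
        fix n
        have "(sn (f n) (u n) w - s (u n) w) / t (f n) - ds (u n) w =
            (sn (f n) (u n) w - s (u n) w - t (f n) * ds (u n) w) / t (f n)"
          using t_pos[of "f n"] by (simp add: diff_divide_distrib)
        then have "norm ((sn (f n) (u n) w - s (u n) w) / t (f n) - ds (u n) w) =
            \<bar>sn (f n) (u n) w - s (u n) w - t (f n) * ds (u n) w\<bar> / t (f n)"
          using t_pos[of "f n"] by simp
        also have "\<dots> \<le> K * (t (f n))\<^sup>2 * (sqrt (s (u n) (u n)) * sqrt (s w w)) / t (f n)"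
          using t_pos[of "f n"] ex[OF uV w(1), of "f n" n] by (intro divide_right_mono) auto
        also have "\<dots> = K * t (f n) * (sqrt (s (u n) (u n)) * sqrt (s w w))"
          using t_pos[of "f n"] by (simp add: power2_eq_square)
        finally show "norm ((sn (f n) (u n) w - s (u n) w) / t (f n) - ds (u n) w)
          \<le> K * t (f n) * (sqrt (s (u n) (u n)) * sqrt (s w w))" .
      qed
      have "(\<lambda>n. K * t (f n) * (sqrt (s (u n) (u n)) * sqrt (s w w))) \<longlonglongrightarrow> K * 0 * (sqrt (s v v) * sqrt (s w w))"
        by (intro tendsto_intros tf ss)
      then show "(\<lambda>n. K * t (f n) * (sqrt (s (u n) (u n)) * sqrt (s w w))) \<longlonglongrightarrow> 0" by simp
    qed
    ultimately have "(\<lambda>n. ((sn (f n) (u n) w - s (u n) w) / t (f n) - ds (u n) w) + (ds (u n) w - ds v w)) \<longlonglongrightarrow> 0 + 0"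
      by (intro tendsto_add)
    then show ?thesis by (simp add: LIM_zero_iff)
  qed
  have qq: "(\<lambda>n. (qn (f n) (u n) w - q (u n) w) / t (f n)) \<longlonglongrightarrow> b * dq w w"
    using quot[OF q.psd_form_axioms _ qn_expand dq_bound dq_diff] v(3) dqb by (simp add: u_def)
  have rr: "(\<lambda>n. (rn (f n) (u n) w - r (u n) w) / t (f n)) \<longlonglongrightarrow> b * dr w w"
    using quot[OF r.psd_form_axioms _ rn_expand dr_bound dr_diff] v(2) drb by (simp add: u_def)
  have ruw: "(\<lambda>n. r (u n) w) \<longlonglongrightarrow> b"
    using r.tendsto_left[of u v w] uV v w rw by (simp add: u_def)
  have id: "(mn (f n) k - m k) * r (u n) w =
      (qn (f n) (u n) w - q (u n) w) - mn (f n) k * (rn (f n) (u n) w - r (u n) w)" for n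
  proof -
    have "qn (f n) (u n) w = mn (f n) k * rn (f n) (u n) w"
      using spectral_forms.e_eig[OF forms sysn w(1)] by (simp add: u_def)
    moreover have "q (u n) w = m k * r (u n) w"
      using w(2)[OF uV[of n]] q.sym[OF w(1) uV[of n]] r.sym[OF w(1) uV[of n]] by simp
    ultimately show ?thesis by (simp add: algebra_simps)
  qed
  have "(\<lambda>n. ((qn (f n) (u n) w - q (u n) w) / t (f n) -
      mn (f n) k * ((rn (f n) (u n) w - r (u n) w) / t (f n))) / r (u n) w)
      \<longlonglongrightarrow> (b * dq w w - m k * (b * dr w w)) / b"
    using \<open>b \<noteq> 0\<close> by (intro tendsto_intros qq rr mf ruw)
  moreover have "eventually (\<lambda>n. ((qn (f n) (u n) w - q (u n) w) / t (f n) -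
      mn (f n) k * ((rn (f n) (u n) w - r (u n) w) / t (f n))) / r (u n) w = (mn (f n) k - m k) / t (f n)) sequentially"
  proof -
    have "eventually (\<lambda>n. r (u n) w \<noteq> 0) sequentially"
      using tendsto_imp_eventually_ne[OF ruw \<open>b \<noteq> 0\<close>] .
    then show ?thesis
    proof eventually_elim
      case (elim n)
      have "(qn (f n) (u n) w - q (u n) w) / t (f n) - mn (f n) k * ((rn (f n) (u n) w - r (u n) w) / t (f n))
          = (mn (f n) k - m k) * r (u n) w / t (f n)"
        unfolding id by (simp add: diff_divide_distrib right_diff_distrib)
      then show ?case using elim by simp
    qed
  qed
  ultimately have "(\<lambda>n. (mn (f n) k - m k) / t (f n)) \<longlonglongrightarrow> (b * dq w w - m k * (b * dr w w)) / b"
    by (rule Lim_transform_eventually)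
  moreover have "(b * dq w w - m k * (b * dr w w)) / b = dq w w - m k * dr w w"
    using \<open>b \<noteq> 0\<close> by (simp add: field_simps)
  ultimately show ?thesis using f by auto
qed

end

theorem eigenvalue_derivative:
  assumes sys: "eigensystem V r q e m" and sysn: "\<And>n. eigensystem V (rn n) (qn n) (en n) (mn n)"
    and w: "w \<in> V" "\<And>h. h \<in> V \<Longrightarrow> q w h = m k * r w h"
    and simple: "\<And>v. v \<in> V \<Longrightarrow> (\<And>h. h \<in> V \<Longrightarrow> q v h = m k * r v h) \<Longrightarrow> \<exists>b. r (v - b *\<^sub>R w) (v - b *\<^sub>R w) = 0"
    and r1: "r w w = 1"
  shows "(\<lambda>n. (mn n k - m k) / t n) \<longlonglongrightarrow> dq w w - m k * dr w w"
proof (rule tendsto_if_subseq)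
  fix g :: "nat \<Rightarrow> nat" assume "strict_mono g"
  then interpret g: form_perturbation V r q "rn \<circ> g" "qn \<circ> g" dr dq "t \<circ> g" K
    by (rule subsequence)
  show "\<exists>f. strict_mono (f :: nat \<Rightarrow> nat) \<and> ((\<lambda>n. (mn n k - m k) / t n) \<circ> g \<circ> f) \<longlonglongrightarrow> dq w w - m k * dr w w"
    using g.eigenvalue_derivative_subseq[OF sys, of "en \<circ> g" "mn \<circ> g" w k] sysn w simple r1
    by (auto simp: comp_def)
qed

end

subsection \<open>Smooth bumps and the fundamental lemma of the calculus of variations\<close>

text \<open>\<open>Ck_on\<close> recurses through \<open>frechet_derivative\<close>; with this rule
  an explicit derivative formula decides smoothness, one order at a time.\<close>

lemma Ck_on_SucI:
  assumes "\<And>x. (f has_derivative D x) (at x)" "\<And>b. b \<in> Basis \<Longrightarrow> Ck_on k UNIV (\<lambda>x. D x b)"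
  shows "Ck_on (Suc k) UNIV f"
proof -
  have "frechet_derivative f (at x) = D x" for x
    using frechet_derivative_at[OF assms(1)] by simp
  then show ?thesis using assms by (auto simp: differentiable_def)
qed

lemma Ck_on_has_derivative:
  "Ck_on (Suc k) UNIV f \<Longrightarrow> (f has_derivative frechet_derivative f (at x)) (at x)"
  by (simp add: frechet_derivative_works[symmetric])

lemma Ck_on_frechet: "Ck_on (Suc k) UNIV f \<Longrightarrow> b \<in> Basis \<Longrightarrow> Ck_on k UNIV (\<lambda>x. frechet_derivative f (at x) b)"
  by simp

lemma Ck_on_SucD: "Ck_on (Suc k) UNIV f \<Longrightarrow> Ck_on k UNIV f"
proof (induction k arbitrary: f)
  case 0
  then show ?case
    by (auto intro!: continuous_at_imp_continuous_on differentiable_imp_continuous_within)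
next
  case (Suc k)
  show ?case
    by (rule Ck_on_SucI[OF Ck_on_has_derivative[OF Suc.prems]]) (rule Suc.IH[OF Ck_on_frechet[OF Suc.prems]])
qed

lemma Ck_on_const: "Ck_on k UNIV (\<lambda>x. c)"
proof (induction k arbitrary: c)
  case (Suc k)
  show ?case by (rule Ck_on_SucI[OF has_derivative_const]) (rule Suc)
qed simp

lemma Ck_on_add: "Ck_on k UNIV f \<Longrightarrow> Ck_on k UNIV g \<Longrightarrow> Ck_on k UNIV (\<lambda>x. f x + g x)"
proof (induction k arbitrary: f g)
  case 0 then show ?case by (auto intro: continuous_on_add)
next
  case (Suc k)
  show ?case
    by (rule Ck_on_SucI[OF has_derivative_add[OF Ck_on_has_derivative[OF Suc.prems(1)] Ck_on_has_derivative[OF Suc.prems(2)]]])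
      (intro Suc.IH Ck_on_frechet[OF Suc.prems(1)] Ck_on_frechet[OF Suc.prems(2)])
qed

lemma Ck_on_mult: "Ck_on k UNIV f \<Longrightarrow> Ck_on k UNIV g \<Longrightarrow> Ck_on k UNIV (\<lambda>x. f x * g x)"
proof (induction k arbitrary: f g)
  case 0 then show ?case by (auto intro: continuous_on_mult)
next
  case (Suc k)
  show ?case
    by (rule Ck_on_SucI[OF has_derivative_mult[OF Ck_on_has_derivative[OF Suc.prems(1)] Ck_on_has_derivative[OF Suc.prems(2)]]])
      (intro Ck_on_add Suc.IH Ck_on_SucD[OF Suc.prems(1)] Ck_on_SucD[OF Suc.prems(2)]
        Ck_on_frechet[OF Suc.prems(1)] Ck_on_frechet[OF Suc.prems(2)])
qed

lemma Ck_on_prod: "(\<And>i. i \<in> A \<Longrightarrow> Ck_on k UNIV (f i)) \<Longrightarrow> Ck_on k UNIV (\<lambda>x. \<Prod>i\<in>A. f i x)"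
  by (induction A rule: infinite_finite_induct) (auto intro!: Ck_on_const Ck_on_mult)

lemma Ck_on_translate: "Ck_on k UNIV f \<Longrightarrow> Ck_on k UNIV (\<lambda>x. f (x - v))"
proof (induction k arbitrary: f)
  case 0 then show ?case by (auto intro!: continuous_on_compose2[of UNIV f] continuous_intros)
next
  case (Suc k)
  have "((\<lambda>x. f (x - v)) has_derivative frechet_derivative f (at (x - v))) (at x)" for x
  proof -
    have "(f \<circ> (\<lambda>x. x - v) has_derivative frechet_derivative f (at (x - v)) \<circ> (\<lambda>h. h - 0)) (at x)"
      by (intro diff_chain_at Ck_on_has_derivative[OF Suc.prems] has_derivative_diff
          has_derivative_ident has_derivative_const)
    then show ?thesis by (simp add: comp_def)
  qed
  then show ?case
    by (rule Ck_on_SucI) (rule Suc.IH[OF Ck_on_frechet[OF Suc.prems]])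
qed

text \<open>Ridge functions are closed under partial derivatives: differentiating in direction h
  moves from \<open>D n\<close> to \<open>D (Suc n)\<close> and puts the product of h and v into the
  constant. Hence the induction runs with arbitrary n and c.\<close>

lemma Ck_on_ridge:
  assumes "\<And>n s. (D n has_real_derivative D (Suc n) s) (at s)"
  shows "Ck_on k UNIV (\<lambda>x. c * D n (x \<bullet> v + d))"
proof (induction k arbitrary: n c)
  case 0
  have "continuous_on UNIV (D n)"
    using assms DERIV_continuous by (intro continuous_at_imp_continuous_on) blast
  then show ?case by (auto intro!: continuous_intros continuous_on_compose2[of UNIV "D n"])
next
  case (Suc k)
  have "((\<lambda>x. c * D n (x \<bullet> v + d)) has_derivative (\<lambda>h. (c * (h \<bullet> v)) * D (Suc n) (x \<bullet> v + d))) (at x)" for x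
  proof -
    have "((\<lambda>x. x \<bullet> v + d) has_derivative (\<lambda>h. h \<bullet> v)) (at x)"
      by (auto intro!: derivative_eq_intros)
    from has_derivative_mult_right[OF DERIV_compose_FDERIV[OF assms this], of c n] show ?thesis by (simp add: mult_ac)
  qed
  then show ?case by (rule Ck_on_SucI) (rule Suc.IH)
qed

section \<open>A smooth function vanishing exactly on a half-line, and bumps on boxes\<close>

primrec bump_poly :: "nat \<Rightarrow> real poly" where
  "bump_poly 0 = 1"
| "bump_poly (Suc n) = [:0, 0, 1:] * (bump_poly n - pderiv (bump_poly n))"

text \<open>For s > 0 the derivatives of exp(-1/s) have the form p(1/s) exp(-1/s), and
  differentiation maps p(y) to y^2 (p(y) - p'(y)), which is the recursion of
  \<open>bump_poly\<close>.\<close>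

definition bump_deriv :: "nat \<Rightarrow> real \<Rightarrow> real" where
  "bump_deriv n s = (if s > 0 then poly (bump_poly n) (1 / s) * exp (- (1 / s)) else 0)"

lemma poly_exp_tendsto_0: "((\<lambda>y. poly p y * exp (- y)) \<longlongrightarrow> (0::real)) at_top"
proof -
  have "((\<lambda>y. \<Sum>i\<le>degree p. coeff p i * (y ^ i / exp y)) \<longlongrightarrow> (\<Sum>i\<le>degree p. coeff p i * 0)) at_top"
    by (intro tendsto_intros tendsto_power_div_exp_0)
  then show ?thesis
    by (simp add: poly_altdef sum_distrib_right exp_minus divide_inverse mult.assoc)
qed

text \<open>Only s = 0 is delicate: with y = 1/h the difference quotient from the right is y p(y)
  exp(-y), which tends to 0, and from the left it is 0.\<close>

lemma DERIV_bump_deriv: "(bump_deriv n has_real_derivative bump_deriv (Suc n) s) (at s)"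
proof (cases s "0::real" rule: linorder_cases)
  case less
  have "((\<lambda>s. 0) has_real_derivative bump_deriv (Suc n) s) (at s)"
    using less by (simp add: bump_deriv_def)
  then show ?thesis
    by (rule has_field_derivative_transform_within_open[of _ _ _ "{..<0}"])
      (use less in \<open>auto simp: bump_deriv_def\<close>)
next
  case greater
  have "((\<lambda>s. poly (bump_poly n) (1 / s) * exp (- (1 / s))) has_real_derivative bump_deriv (Suc n) s) (at s)"
    using greater by (auto intro!: derivative_eq_intros poly_DERIV[THEN DERIV_chain2]
        simp: field_simps power2_eq_square bump_deriv_def)
  then show ?thesis
    by (rule has_field_derivative_transform_within_open[of _ _ _ "{0<..}"])
      (use greater in \<open>auto simp: bump_deriv_def\<close>)
next
  case equal
  let ?p = "[:0, 1:] * bump_poly n"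
  have "((\<lambda>h. poly ?p (inverse h) * exp (- inverse h)) \<longlongrightarrow> 0) (at_right 0)"
    using poly_exp_tendsto_0 filterlim_inverse_at_top_right by (rule filterlim_compose)
  moreover have "eventually (\<lambda>h. poly ?p (inverse h) * exp (- inverse h) = (bump_deriv n h - bump_deriv n 0) / (h - 0)) (at_right 0)"
    by (auto simp: eventually_at_filter bump_deriv_def field_simps)
  ultimately have "((\<lambda>h. (bump_deriv n h - bump_deriv n 0) / (h - 0)) \<longlongrightarrow> 0) (at_right 0)"
    by (rule Lim_transform_eventually)
  moreover have "((\<lambda>h. (bump_deriv n h - bump_deriv n 0) / (h - 0)) \<longlongrightarrow> 0) (at_left 0)"
    by (rule Lim_transform_eventually[OF tendsto_const])
      (auto simp: eventually_at_filter bump_deriv_def)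
  ultimately have "((\<lambda>h. (bump_deriv n h - bump_deriv n 0) / (h - 0)) \<longlongrightarrow> 0) (at 0)"
    by (intro filterlim_split_at)
  then show ?thesis using equal by (simp add: has_field_derivative_iff bump_deriv_def)
qed

text \<open>The parameter n steepens the profile: exp(-1/(n s)) increases to 1, so for growing n
  these functions, all with values in [0,1], tend to the indicator of the open box. Integrals over
  boxes can then be reached by dominated convergence.\<close>

definition box_bump :: "real \<Rightarrow> 'a::euclidean_space \<Rightarrow> 'a \<Rightarrow> 'a \<Rightarrow> real" where
  "box_bump n a b x = (\<Prod>i\<in>Basis. bump_deriv 0 (n * ((x - a) \<bullet> i)) * bump_deriv 0 (n * ((b - x) \<bullet> i)))"

lemma bump_deriv_0: "bump_deriv 0 s = (if s > 0 then exp (- (1 / s)) else 0)"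
  by (simp add: bump_deriv_def)

lemma Ck_on_box_bump: "Ck_on k UNIV (box_bump n a b)"
proof -
  have "Ck_on k UNIV (\<lambda>x. bump_deriv 0 (n * ((x - a) \<bullet> i)))" for i
    using Ck_on_ridge[of bump_deriv k 1 0 "n *\<^sub>R i" "- (n * (a \<bullet> i))", OF DERIV_bump_deriv]
    by (simp add: algebra_simps)
  moreover have "Ck_on k UNIV (\<lambda>x. bump_deriv 0 (n * ((b - x) \<bullet> i)))" for i
    using Ck_on_ridge[of bump_deriv k 1 0 "- (n *\<^sub>R i)" "n * (b \<bullet> i)", OF DERIV_bump_deriv]
    by (simp add: algebra_simps)
  ultimately show ?thesis
    unfolding box_bump_def[abs_def] by (intro Ck_on_prod Ck_on_mult)
qed

lemma bump_deriv_0_range: "0 \<le> bump_deriv 0 s" "bump_deriv 0 s \<le> 1"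
  by (auto simp: bump_deriv_0)

lemma box_bump_range: "0 \<le> box_bump n a b x" "box_bump n a b x \<le> 1"
  unfolding box_bump_def
  by (intro prod_nonneg prod_le_1 conjI mult_nonneg_nonneg mult_le_one bump_deriv_0_range)+

lemma box_bump_pos_iff: "n > 0 \<Longrightarrow> box_bump n a b x \<noteq> 0 \<longleftrightarrow> x \<in> box a b"
proof -
  assume n: "n > 0"
  have "bump_deriv 0 s \<noteq> 0 \<longleftrightarrow> s > 0" for s by (simp add: bump_deriv_0)
  then have "box_bump n a b x \<noteq> 0 \<longleftrightarrow> (\<forall>i\<in>Basis. 0 < n * ((x - a) \<bullet> i) \<and> 0 < n * ((b - x) \<bullet> i))"
    by (simp add: box_bump_def)
  then show ?thesis using n by (simp add: mem_box zero_less_mult_iff inner_diff_left)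
qed

lemma box_bump_tendsto:
  fixes a b x :: "'a::euclidean_space"
  shows "(\<lambda>n. box_bump (real (Suc n)) a b x) \<longlonglongrightarrow> indicator (box a b) x"
proof (cases "x \<in> box a b")
  case True
  have lim: "(\<lambda>n. bump_deriv 0 (real (Suc n) * s)) \<longlonglongrightarrow> 1" if "s > 0" for s
  proof -
    have "(\<lambda>n. exp (- (1 / real (Suc n) * (1 / s)))) \<longlonglongrightarrow> exp (- (0 * (1 / s)))"
      by (intro tendsto_intros LIMSEQ_Suc[OF lim_1_over_n])
    then show ?thesis using that by (simp add: bump_deriv_0)
  qed
  have "(\<lambda>n. box_bump (real (Suc n)) a b x) \<longlonglongrightarrow> (\<Prod>i\<in>(Basis :: 'a set). 1 * 1)"
    unfolding box_bump_def by (intro tendsto_prod tendsto_mult lim) (use True in \<open>auto simp: mem_box inner_diff_left\<close>)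
  then show ?thesis using True by simp
next
  case False
  then have "box_bump (real (Suc n)) a b x = 0" for n
    using box_bump_pos_iff[of "real (Suc n)" a b x] by simp
  then show ?thesis using False by simp
qed

lemma box_bump_test: "n > 0 \<Longrightarrow> cbox a b \<subseteq> U \<Longrightarrow> box_bump n a b \<in> test_functions U"
proof -
  assume *: "n > 0" "cbox a b \<subseteq> U"
  have "closure {x. box_bump n a b x \<noteq> 0} \<subseteq> cbox a b"
    using box_subset_cbox by (intro closure_minimal) (auto simp: box_bump_pos_iff[OF *(1)])
  moreover have "compact (closure {x. box_bump n a b x \<noteq> 0})"
    unfolding compact_closure using bounded_box by (simp add: box_bump_pos_iff[OF *(1)])
  ultimately show ?thesis
    using *(2) Ck_on_box_bump by (auto simp: test_functions_def)
qed

section \<open>Test functions\<close>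

lemma test_has_derivative:
  "\<eta> \<in> test_functions U \<Longrightarrow> (\<eta> has_derivative frechet_derivative \<eta> (at x)) (at x)"
  unfolding test_functions_def using Ck_on_has_derivative by blast

lemma test_continuous: "\<eta> \<in> test_functions U \<Longrightarrow> continuous_on UNIV \<eta>"
  unfolding test_functions_def by (metis (mono_tags, lifting) Ck_on.simps(1) mem_Collect_eq)

lemma test_zero_outside: "x \<notin> closure {x. \<eta> x \<noteq> 0} \<Longrightarrow> \<eta> x = 0"
  using subsetD[OF closure_subset, of x "{x. \<eta> x \<noteq> 0}"] by blast

lemma test_zero_outside_domain: "\<eta> \<in> test_functions U \<Longrightarrow> x \<notin> U \<Longrightarrow> \<eta> x = 0"
  using test_zero_outside[of x \<eta>] by (auto simp: test_functions_def)

lemma compact_closure_subset: "closure A \<subseteq> S \<Longrightarrow> compact S \<Longrightarrow> compact (closure A)"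
  by (metis compact_Int_closed closed_closure inf.absorb2)

lemma test_frechet:
  assumes "\<eta> \<in> test_functions U" "b \<in> Basis"
  shows "(\<lambda>x. frechet_derivative \<eta> (at x) b) \<in> test_functions U"
proof -
  define S where "S = closure {x. \<eta> x \<noteq> 0}"
  have S: "compact S" "S \<subseteq> U" "closed S"
    using assms by (auto simp: test_functions_def S_def)
  have zero: "\<eta> x = 0" if "x \<notin> S" for x using test_zero_outside[of x \<eta>] that S_def by simp
  have "frechet_derivative \<eta> (at x) b = 0" if "x \<notin> S" for x
  proof -
    have "((\<lambda>x. 0) has_derivative (\<lambda>h. 0)) (at x)" by simp
    then have "(\<eta> has_derivative (\<lambda>h. 0)) (at x)"
      by (rule has_derivative_transform_within_open[of _ _ _ _ "- S"])
        (use that zero S(3) in auto)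
    from frechet_derivative_at[OF this] show ?thesis by metis
  qed
  then have "{x. frechet_derivative \<eta> (at x) b \<noteq> 0} \<subseteq> S" by blast
  then have sub: "closure {x. frechet_derivative \<eta> (at x) b \<noteq> 0} \<subseteq> S"
    using S(3) by (rule closure_minimal)
  have Ck: "Ck_on k UNIV (\<lambda>x. frechet_derivative \<eta> (at x) b)" for k
  proof -
    have "Ck_on (Suc k) UNIV \<eta>" using assms(1) unfolding test_functions_def by blast
    then show ?thesis using assms(2) by (rule Ck_on_frechet)
  qed
  show ?thesis
    unfolding test_functions_def mem_Collect_eq
    using Ck compact_closure_subset[OF sub S(1)] order_trans[OF sub S(2)] by (intro conjI allI)
qed

lemma test_bounded:
  assumes "\<eta> \<in> test_functions U"
  shows "\<exists>B. \<forall>x. \<bar>\<eta> x\<bar> \<le> B"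
proof -
  define S where "S = closure {x. \<eta> x \<noteq> 0}"
  have zero: "\<eta> x = 0" if "x \<notin> S" for x using test_zero_outside[of x \<eta>] that S_def by simp
  have "compact (\<eta> ` S)"
    using assms by (intro compact_continuous_image)
      (auto simp: test_functions_def S_def intro: continuous_on_subset[OF test_continuous[OF assms]])
  then obtain B where B: "\<And>x. x \<in> S \<Longrightarrow> \<bar>\<eta> x\<bar> \<le> B"
    using compact_imp_bounded bounded_iff by (metis (no_types, lifting) image_eqI real_norm_def)
  have "\<bar>\<eta> x\<bar> \<le> \<bar>B\<bar>" for x
    using B[of x] zero[of x] by (cases "x \<in> S") auto
  then show ?thesis by blast
qed

lemma test_mult:
  assumes "\<eta> \<in> test_functions U" "\<zeta> \<in> test_functions U"
  shows "(\<lambda>x. \<eta> x * \<zeta> x) \<in> test_functions U"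
proof -
  have sub: "closure {x. \<eta> x * \<zeta> x \<noteq> 0} \<subseteq> closure {x. \<eta> x \<noteq> 0}"
    by (intro closure_mono) auto
  have \<eta>: "Ck_on k UNIV \<eta>" "compact (closure {x. \<eta> x \<noteq> 0})" "closure {x. \<eta> x \<noteq> 0} \<subseteq> U"
    and \<zeta>: "Ck_on k UNIV \<zeta>" for k
    using assms unfolding test_functions_def by blast+
  show ?thesis
    unfolding test_functions_def mem_Collect_eq
    by (intro conjI allI Ck_on_mult \<eta>(1) \<zeta> compact_closure_subset[OF sub \<eta>(2)] order_trans[OF sub \<eta>(3)])
qed

lemma borel_measurable_test: "\<eta> \<in> test_functions U \<Longrightarrow> \<eta> \<in> borel_measurable borel"
  using test_continuous borel_measurable_continuous_onI by blast

text \<open>Boxes are stable under intersection and generate the Borel sets, and the sets with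
  vanishing integral form a Dynkin system. Complements need the total integral to vanish; it is the
  integral over one large box because the support is bounded.\<close>

lemma integral_on_box_zero_imp_AE_zero:
  fixes f :: "'a::euclidean_space \<Rightarrow> real"
  assumes f: "integrable lborel f" and supp: "\<And>x. f x \<noteq> 0 \<Longrightarrow> x \<in> cbox c d"
    and box: "\<And>a b. (LINT x|lborel. indicator (box a b) x * f x) = 0"
  shows "AE x in lborel. f x = 0"
proof -
  have int: "integrable lborel (\<lambda>x. indicator A x * f x)" if "A \<in> sets borel" for A
    using integrable_mult_indicator[of A lborel f] that f by simp
  obtain e where e: "cbox c d \<subseteq> box (-e) e"
    using bounded_subset_box_symmetric[OF bounded_cbox] by blast
  have total: "(LINT x|lborel. f x) = 0"
  proof -
    have "f x = indicator (box (-e) e) x * f x" for x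
      using e supp[of x] by (auto simp: indicator_def)
    then show ?thesis using box[of "-e" e] by presburger
  qed
  have all: "(LINT x|lborel. indicator A x * f x) = 0" if "A \<in> sets borel" for A
  proof -
    have "Int_stable (range (\<lambda>(a, b). box a b :: 'a set))"
      by (auto simp: Int_stable_def box_Int_box)
    moreover have "range (\<lambda>(a, b). box a b :: 'a set) \<subseteq> Pow UNIV" by simp
    moreover have "A \<in> sigma_sets UNIV (range (\<lambda>(a, b). box a b :: 'a set))"
      using that unfolding borel_eq_box by simp
    ultimately show ?thesis
    proof (induction rule: sigma_sets_induct_disjoint)
      case (basic A) then show ?case using box by auto
    next
      case (compl A)
      then have A: "A \<in> sets borel" unfolding borel_eq_box by simp
      have "(LINT x|lborel. indicator (UNIV - A) x * f x) = (LINT x|lborel. f x - indicator A x * f x)"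
        by (intro Bochner_Integration.integral_cong) (auto simp: indicator_def)
      also have "\<dots> = 0"
        using compl total f int[OF A] by simp
      finally show ?case .
    next
      case (union A)
      then have A: "A i \<in> sets borel" for i unfolding borel_eq_box by auto
      have "(LINT x:(\<Union>i. A i)|lborel. f x) = (\<Sum>i. LINT x:A i|lborel. f x)"
        using A union(1) int[of "\<Union>i. A i"]
        by (intro lebesgue_integral_countable_add)
          (auto simp: set_integrable_def disjoint_family_on_def)
      then show ?case using union by (simp add: set_lebesgue_integral_def)
    qed (auto)
  qed
  have "AE x in lborel. f x = (\<lambda>x. 0) x"
    by (rule density_unique_real[OF f integrable_zero]) (use all in \<open>auto simp: set_lebesgue_integral_def\<close>)
  then show ?thesis by simp
qed

text \<open>Inside a closed box contained in U the indicators of open boxes are limits of test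
  functions, so f has zero integral over all of them and vanishes almost everywhere there; countably
  many such boxes exhaust U.\<close>

theorem fundamental_lemma_calculus_of_variations:
  fixes f :: "'a::euclidean_space \<Rightarrow> real"
  assumes U: "open U" and loc: "\<And>K. compact K \<Longrightarrow> K \<subseteq> U \<Longrightarrow> integrable (lebesgue_on K) f"
    and test: "\<And>\<eta>. \<eta> \<in> test_functions U \<Longrightarrow> (LINT x|lebesgue_on U. f x * \<eta> x) = 0"
  shows "AE x in lebesgue_on U. f x = 0"
proof -
  have UL: "U \<in> sets lebesgue" using U by simp
  have local: "AE x in lebesgue. x \<in> cbox c d \<longrightarrow> f x = 0" if cd: "cbox c d \<subseteq> U" for c d
  proof -
    define F where "F x = indicator (cbox c d) x * f x" for x
    have F: "integrable lebesgue F"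
      using loc[OF compact_cbox cd] by (simp add: integrable_restrict_space F_def[abs_def])
    \<comment> \<open>The second bump, on \<open>box c d\<close>, keeps the support of the product
      in \<open>cbox c d\<close> and hence in U; what it loses in the limit is the boundary of the
      box, a null set.\<close>
    have boxF: "(LINT x|lebesgue. indicator (box a b) x * F x) = 0" for a b
    proof -
      obtain a' b' where ab: "box a b \<inter> box c d = box a' b'" using box_Int_box[of a b c d] by blast
      have lim: "(\<lambda>n. LINT x|lebesgue. box_bump (real (Suc n)) a b x * (box_bump (real (Suc n)) c d x * F x))
          \<longlonglongrightarrow> (LINT x|lebesgue. indicator (box a b) x * (indicator (box c d) x * F x))"
      proof (rule integral_dominated_convergence[where w = "\<lambda>x. \<bar>F x\<bar>"])
        have bm: "box_bump n a b \<in> borel_measurable lebesgue" for n and a b :: 'a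
          using Ck_on_box_bump[of 0 n a b] by (auto intro!: measurable_completion borel_measurable_continuous_onI)
        show "(\<lambda>x. box_bump (real (Suc n)) a b x * (box_bump (real (Suc n)) c d x * F x)) \<in> borel_measurable lebesgue" for n
          using borel_measurable_integrable[OF F] by (intro borel_measurable_times bm)
        show "(\<lambda>x. indicator (box a b) x * (indicator (box c d) x * F x)) \<in> borel_measurable lebesgue"
          using borel_measurable_integrable[OF F] by (intro borel_measurable_times borel_measurable_indicator) auto
        show "integrable lebesgue (\<lambda>x. \<bar>F x\<bar>)" using F by simp
        show "AE x in lebesgue. (\<lambda>n. box_bump (real (Suc n)) a b x * (box_bump (real (Suc n)) c d x * F x))
           \<longlonglongrightarrow> indicator (box a b) x * (indicator (box c d) x * F x)"
          by (intro always_eventually allI tendsto_mult box_bump_tendsto tendsto_const)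
        show "AE x in lebesgue. norm (box_bump (real (Suc n)) a b x * (box_bump (real (Suc n)) c d x * F x)) \<le> \<bar>F x\<bar>" for n
        proof (intro always_eventually allI)
          fix x
          have "box_bump (real (Suc n)) a b x * box_bump (real (Suc n)) c d x \<le> 1"
            by (intro mult_le_one box_bump_range)
          then have "(box_bump (real (Suc n)) a b x * box_bump (real (Suc n)) c d x) * \<bar>F x\<bar> \<le> 1 * \<bar>F x\<bar>"
            by (rule mult_right_mono) simp
          then show "norm (box_bump (real (Suc n)) a b x * (box_bump (real (Suc n)) c d x * F x)) \<le> \<bar>F x\<bar>"
            by (simp add: abs_mult box_bump_range mult.assoc)
        qed
      qed
      have zero: "(LINT x|lebesgue. box_bump (real (Suc n)) a b x * (box_bump (real (Suc n)) c d x * F x)) = 0" for n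
      proof -
        let ?\<eta> = "\<lambda>x. box_bump (real (Suc n)) a b x * box_bump (real (Suc n)) c d x"
        have supp: "?\<eta> x \<noteq> 0 \<longleftrightarrow> x \<in> box a' b'" for x
          using box_bump_pos_iff[of "real (Suc n)" a b x] box_bump_pos_iff[of "real (Suc n)" c d x] ab by auto
        have sub: "closure (box a' b') \<subseteq> cbox c d"
          using ab box_subset_cbox[of c d] by (intro closure_minimal) auto
        have "compact (closure (box a' b'))" using bounded_box by simp
        then have "?\<eta> \<in> test_functions U"
          unfolding test_functions_def mem_Collect_eq supp
          using sub cd by (intro conjI allI Ck_on_mult Ck_on_box_bump) auto
        then have "(LINT x|lebesgue_on U. f x * ?\<eta> x) = 0" by (rule test)
        moreover have "(LINT x|lebesgue_on U. f x * ?\<eta> x) = (LINT x|lebesgue. indicator U x *\<^sub>R (f x * ?\<eta> x))"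
          using UL by (intro integral_restrict_space) auto
        moreover have eq: "indicator U x *\<^sub>R (f x * ?\<eta> x) = box_bump (real (Suc n)) a b x * (box_bump (real (Suc n)) c d x * F x)" for x
        proof (cases "?\<eta> x = 0")
          case False
          then have "x \<in> cbox c d" using supp ab box_subset_cbox[of c d] by blast
          then show ?thesis using cd by (auto simp: F_def indicator_def)
        qed auto
        ultimately show ?thesis unfolding eq by simp
      qed
      have "(LINT x|lebesgue. indicator (box a b) x * (indicator (box c d) x * F x)) = 0"
        using LIMSEQ_unique[OF lim] zero by simp
      moreover have "AE x in lebesgue. indicator (box a b) x * (indicator (box c d) x * F x) = indicator (box a b) x * F x"
      proof (rule AE_I')
        show "cbox c d - box c d \<in> null_sets lebesgue"
          using negligible_frontier_interval[of c d] by (simp add: negligible_iff_null_sets)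
        show "{x \<in> space lebesgue. indicator (box a b) x * (indicator (box c d) x * F x) \<noteq> indicator (box a b) x * F x} \<subseteq> cbox c d - box c d"
          by (auto simp: F_def indicator_def)
      qed
      ultimately show ?thesis
        using borel_measurable_integrable[OF F]
        by (subst integral_cong_AE[symmetric, where f = "\<lambda>x. indicator (box a b) x * (indicator (box c d) x * F x)"])
          (auto intro!: borel_measurable_times borel_measurable_indicator)
    qed
    \<comment> \<open>The box criterion is about Borel functions, so F is exchanged for a Borel
      function equal almost everywhere. It is cut off again because the criterion wants its support
      in the box everywhere.\<close>
    obtain G where G: "G \<in> borel_measurable lborel" "AE x in lborel. F x = G x"
      using completion_ex_borel_measurable_real[OF borel_measurable_integrable[OF F]] by auto
    define H where "H x = indicator (cbox c d) x * G x" for x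
    have H: "H \<in> borel_measurable lborel" unfolding H_def[abs_def] using G by measurable
    have FH: "AE x in lborel. F x = H x"
      using G(2) by eventually_elim (auto simp: F_def H_def indicator_def)
    then have FH': "AE x in lebesgue. F x = H x" by (rule AE_completion)
    have "integrable lebesgue H"
      using integrable_cong_AE[OF borel_measurable_integrable[OF F] measurable_completion[OF H] FH'] F by blast
    then have "integrable lborel H" using H by (simp add: integrable_completion)
    moreover have "(LINT x|lborel. indicator (box a b) x * H x) = 0" for a b
    proof -
      have "(LINT x|lborel. indicator (box a b) x * H x) = (LINT x|lebesgue. indicator (box a b) x * H x)"
        by (intro integral_completion[symmetric] borel_measurable_times borel_measurable_indicator H) simp
      also have "\<dots> = (LINT x|lebesgue. indicator (box a b) x * F x)"
        by (intro integral_cong_AE borel_measurable_times borel_measurable_indicator measurable_completion[OF H]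
            borel_measurable_integrable[OF F]) (use FH' in auto)
      finally show ?thesis using boxF by simp
    qed
    ultimately have "AE x in lborel. H x = 0"
      by (intro integral_on_box_zero_imp_AE_zero[of H c d]) (auto simp: H_def indicator_def split: if_splits)
    then have "AE x in lebesgue. H x = 0" by (rule AE_completion)
    with FH' show ?thesis
      by eventually_elim (auto simp: F_def)
  qed
  obtain \<D> where D: "countable \<D>" "\<D> \<subseteq> Pow U" "\<And>X. X \<in> \<D> \<Longrightarrow> \<exists>a b. X = cbox a b" "\<Union>\<D> = U"
    using open_countable_Union_open_cbox[OF U] by blast
  have "AE x in lebesgue. \<forall>X\<in>\<D>. x \<in> X \<longrightarrow> f x = 0"
  proof (rule AE_ball_countable'[OF _ D(1)])
    show "AE x in lebesgue. x \<in> X \<longrightarrow> f x = 0" if "X \<in> \<D>" for X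
      using D(3)[OF that] D(2) that local by blast
  qed
  then have "AE x in lebesgue. x \<in> U \<longrightarrow> f x = 0"
    by eventually_elim (use D(4) in blast)
  then show ?thesis using UL by (simp add: AE_restrict_space_iff)
qed

subsection \<open>Square-integrable functions and weak gradients\<close>

definition square_integrable :: "'a measure \<Rightarrow> ('a \<Rightarrow> 'b::euclidean_space) \<Rightarrow> bool" where
  "square_integrable M f \<longleftrightarrow> f \<in> borel_measurable M \<and> integrable M (\<lambda>x. (norm (f x))\<^sup>2)"

lemma square_integrable_measurable: "square_integrable M f \<Longrightarrow> f \<in> borel_measurable M"
  by (simp add: square_integrable_def)

lemma square_integrable_weighted_inner:
  assumes f: "square_integrable M f" and g: "square_integrable M g"
    and \<alpha>: "\<alpha> \<in> borel_measurable M" "AE x in M. \<bar>\<alpha> x\<bar> \<le> B"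
  shows "integrable M (\<lambda>x. \<alpha> x * (f x \<bullet> g x))"
proof (rule Bochner_Integration.integrable_bound)
  show "integrable M (\<lambda>x. \<bar>B\<bar> * ((norm (f x))\<^sup>2 + (norm (g x))\<^sup>2))"
    using f g by (auto simp: square_integrable_def)
  show "(\<lambda>x. \<alpha> x * (f x \<bullet> g x)) \<in> borel_measurable M"
    using f g \<alpha>(1) by (intro borel_measurable_times borel_measurable_inner) (auto simp: square_integrable_def)
  show "AE x in M. norm (\<alpha> x * (f x \<bullet> g x)) \<le> norm (\<bar>B\<bar> * ((norm (f x))\<^sup>2 + (norm (g x))\<^sup>2))"
    using \<alpha>(2)
  proof eventually_elim
    case (elim x)
    have "\<bar>f x \<bullet> g x\<bar> \<le> norm (f x) * norm (g x)" by (rule Cauchy_Schwarz_ineq2)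
    also have "\<dots> \<le> (norm (f x))\<^sup>2 + (norm (g x))\<^sup>2"
    proof -
      have "2 * norm (f x) * norm (g x) \<le> (norm (f x))\<^sup>2 + (norm (g x))\<^sup>2"
        by (rule sum_squares_bound)
      moreover have "0 \<le> norm (f x) * norm (g x)" by simp
      ultimately show ?thesis by linarith
    qed
    finally have "\<bar>\<alpha> x\<bar> * \<bar>f x \<bullet> g x\<bar> \<le> \<bar>B\<bar> * ((norm (f x))\<^sup>2 + (norm (g x))\<^sup>2)"
      using elim by (intro mult_mono) auto
    then show ?case by (simp add: abs_mult)
  qed
qed

lemma square_integrable_inner:
  "square_integrable M f \<Longrightarrow> square_integrable M g \<Longrightarrow> integrable M (\<lambda>x. f x \<bullet> g x)"
  using square_integrable_weighted_inner[of M f g "\<lambda>x. 1" 1] by simp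

lemma square_integrable_add:
  assumes "square_integrable M f" "square_integrable M g"
  shows "square_integrable M (\<lambda>x. f x + g x)"
proof -
  have "integrable M (\<lambda>x. (norm (f x))\<^sup>2 + 2 * (f x \<bullet> g x) + (norm (g x))\<^sup>2)"
    using assms square_integrable_inner[OF assms] by (auto simp: square_integrable_def)
  moreover have "(norm (f x))\<^sup>2 + 2 * (f x \<bullet> g x) + (norm (g x))\<^sup>2 = (norm (f x + g x))\<^sup>2" for x
    by (simp add: power2_norm_eq_inner inner_add inner_commute)
  ultimately show ?thesis
    using assms by (auto simp: square_integrable_def)
qed

lemma square_integrable_scale:
  "square_integrable M f \<Longrightarrow> square_integrable M (\<lambda>x. c *\<^sub>R f x)"
  by (auto simp: square_integrable_def power_mult_distrib)

lemma square_integrable_diff: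
  "square_integrable M f \<Longrightarrow> square_integrable M g \<Longrightarrow> square_integrable M (\<lambda>x. f x - g x)"
  using square_integrable_add[of M f "\<lambda>x. (-1) *\<^sub>R g x"] square_integrable_scale[of M g "-1"] by simp

lemma square_integrable_zero: "square_integrable M (\<lambda>x. 0)"
  by (simp add: square_integrable_def)

lemma square_integrable_norm: "square_integrable M f \<Longrightarrow> square_integrable M (\<lambda>x. norm (f x))"
  by (auto simp: square_integrable_def intro: borel_measurable_norm)

lemma square_integrable_bounded:
  assumes "finite_measure M" "f \<in> borel_measurable M" "AE x in M. norm (f x) \<le> B"
  shows "square_integrable M f"
proof -
  have "AE x in M. norm ((norm (f x))\<^sup>2) \<le> B\<^sup>2"
    using assms(3) by eventually_elim (simp add: power_mono)
  then have "integrable M (\<lambda>x. (norm (f x))\<^sup>2)"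
    using assms by (intro finite_measure.integrable_const_bound) auto
  then show ?thesis using assms by (simp add: square_integrable_def)
qed

lemma square_integrable_cong_AE:
  assumes "square_integrable M f" "g \<in> borel_measurable M" "AE x in M. f x = g x"
  shows "square_integrable M g"
proof -
  have "AE x in M. (norm (f x))\<^sup>2 = (norm (g x))\<^sup>2" using assms(3) by eventually_elim simp
  then have "integrable M (\<lambda>x. (norm (g x))\<^sup>2)"
    using assms integrable_cong_AE[of "\<lambda>x. (norm (f x))\<^sup>2" M "\<lambda>x. (norm (g x))\<^sup>2"]
    by (auto simp: square_integrable_def)
  then show ?thesis using assms by (simp add: square_integrable_def)
qed

text \<open>Puts square-integrable functions under \<open>psd_form\<close>, from which
  Cauchy-Schwarz and \<open>diff_le\<close> for integrals are taken.\<close>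

lemma psd_form_weighted_inner:
  assumes "\<alpha> \<in> borel_measurable M" "AE x in M. 0 \<le> \<alpha> x" "AE x in M. \<alpha> x \<le> B"
  shows "psd_form {f :: 'a \<Rightarrow> 'b::euclidean_space. square_integrable M f} (\<lambda>f g. LINT x|M. \<alpha> x * (f x \<bullet> g x))"
proof -
  have B: "AE x in M. \<bar>\<alpha> x\<bar> \<le> B" using assms(2,3) by eventually_elim auto
  note int = square_integrable_weighted_inner[OF _ _ assms(1) B]
  show ?thesis
  proof
    show "subspace {f :: 'a \<Rightarrow> 'b. square_integrable M f}"
      using square_integrable_add square_integrable_scale square_integrable_zero
      by (auto simp: subspace_def plus_fun_def scaleR_fun_def zero_fun_def)
    fix u v w :: "'a \<Rightarrow> 'b" and b :: real
    assume u: "u \<in> {f. square_integrable M f}"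
    show "0 \<le> (LINT x|M. \<alpha> x * (u x \<bullet> u x))"
      using assms(2) by (intro integral_nonneg_AE) (auto elim!: eventually_mono)
    assume w: "w \<in> {f. square_integrable M f}"
    show "(LINT x|M. \<alpha> x * ((b *\<^sub>R u) x \<bullet> w x)) = b * (LINT x|M. \<alpha> x * (u x \<bullet> w x))"
      by (simp add: mult.left_commute)
    show "(LINT x|M. \<alpha> x * (u x \<bullet> w x)) = (LINT x|M. \<alpha> x * (w x \<bullet> u x))"
      by (simp add: inner_commute)
    assume v: "v \<in> {f. square_integrable M f}"
    show "(LINT x|M. \<alpha> x * ((u + v) x \<bullet> w x)) = (LINT x|M. \<alpha> x * (u x \<bullet> w x)) + (LINT x|M. \<alpha> x * (v x \<bullet> w x))"
      using int[of u w] int[of v w] u v w by (simp add: inner_add_left distrib_left)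
  qed
qed

lemma psd_form_inner:
  "psd_form {f :: 'a \<Rightarrow> 'b::euclidean_space. square_integrable M f} (\<lambda>f g. LINT x|M. f x \<bullet> g x)"
  using psd_form_weighted_inner[of "\<lambda>x. 1" M 1] by simp

lemma Cauchy_Schwarz_integral:
  assumes "square_integrable M f" "square_integrable M g"
  shows "(LINT x|M. norm (f x) * norm (g x)) \<le> sqrt (LINT x|M. (norm (f x))\<^sup>2) * sqrt (LINT x|M. (norm (g x))\<^sup>2)"
proof -
  interpret psd_form "{f :: 'a \<Rightarrow> real. square_integrable M f}" "\<lambda>f g. LINT x|M. f x \<bullet> g x"
    by (rule psd_form_inner)
  show ?thesis
    using abs_le_sqrt[of "\<lambda>x. norm (f x)" "\<lambda>x. norm (g x)"] assms
    by (simp add: square_integrable_norm power2_eq_square)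
qed

lemma weighted_inner_bound:
  assumes f: "square_integrable M f" and g: "square_integrable M g"
    and \<alpha>: "\<alpha> \<in> borel_measurable M" "AE x in M. \<bar>\<alpha> x\<bar> \<le> B" and B: "0 \<le> B"
  shows "\<bar>LINT x|M. \<alpha> x * (f x \<bullet> g x)\<bar> \<le> B * (sqrt (LINT x|M. (norm (f x))\<^sup>2) * sqrt (LINT x|M. (norm (g x))\<^sup>2))"
proof -
  have int: "integrable M (\<lambda>x. norm (f x) * norm (g x))"
    using square_integrable_inner[OF square_integrable_norm[OF f] square_integrable_norm[OF g]] by simp
  have "\<bar>LINT x|M. \<alpha> x * (f x \<bullet> g x)\<bar> \<le> (LINT x|M. \<bar>\<alpha> x * (f x \<bullet> g x)\<bar>)"
    by (rule integral_abs_bound)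
  also have "\<dots> \<le> (LINT x|M. B * (norm (f x) * norm (g x)))"
  proof (rule integral_mono_AE)
    show "integrable M (\<lambda>x. \<bar>\<alpha> x * (f x \<bullet> g x)\<bar>)"
      using square_integrable_weighted_inner[OF f g \<alpha>] by simp
    show "AE x in M. \<bar>\<alpha> x * (f x \<bullet> g x)\<bar> \<le> B * (norm (f x) * norm (g x))"
      using \<alpha>(2) by eventually_elim (auto simp: abs_mult intro!: mult_mono Cauchy_Schwarz_ineq2 B)
  qed (use int in simp)
  also have "\<dots> \<le> B * (sqrt (LINT x|M. (norm (f x))\<^sup>2) * sqrt (LINT x|M. (norm (g x))\<^sup>2))"
    using Cauchy_Schwarz_integral[OF f g] B by (simp add: mult_left_mono)
  finally show ?thesis .
qed

lemma (in finite_measure) integral_norm_le_L2: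
  assumes "square_integrable M f"
  shows "(LINT x|M. norm (f x)) \<le> sqrt (measure M (space M)) * sqrt (LINT x|M. (norm (f x))\<^sup>2)"
proof -
  have "square_integrable M (\<lambda>x. 1 :: real)"
    by (rule square_integrable_bounded[where B = 1]) (unfold_locales, auto)
  from Cauchy_Schwarz_integral[OF this assms] show ?thesis by simp
qed

lemma (in finite_measure) integrable_if_square_integrable:
  assumes "square_integrable M f"
  shows "integrable M f"
proof -
  have "square_integrable M (\<lambda>x. 1 :: real)"
    by (rule square_integrable_bounded[where B = 1]) (unfold_locales, auto)
  from square_integrable_inner[OF this square_integrable_norm[OF assms]]
  have "integrable M (\<lambda>x. norm (f x))" by simp
  then show ?thesis using assms by (simp add: integrable_norm_iff square_integrable_def)
qed

text \<open>Riesz-Fischer on a finite measure space: L2-Cauchy sequences are L1-Cauchy and so have a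
  subsequence converging almost everywhere, and Fatou's lemma carries the Cauchy estimate over to
  its limit.\<close>

lemma (in finite_measure) square_integrable_complete:
  fixes f :: "nat \<Rightarrow> 'a \<Rightarrow> 'b::euclidean_space"
  assumes f: "\<And>n. square_integrable M (f n)"
    and Cauchy: "\<And>e. e > 0 \<Longrightarrow> \<exists>N. \<forall>m\<ge>N. \<forall>n\<ge>N. (LINT x|M. (norm (f m x - f n x))\<^sup>2) < e"
  shows "\<exists>g. square_integrable M g \<and> (\<lambda>n. LINT x|M. (norm (f n x - g x))\<^sup>2) \<longlonglongrightarrow> 0"
proof -
  have fm: "f n \<in> borel_measurable M" for n using f by (simp add: square_integrable_def)
  have "\<exists>N. \<forall>i\<ge>N. \<forall>j\<ge>N. (LINT x|M. norm (f i x - f j x)) < e" if e: "e > 0" for e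
  proof -
    \<comment> \<open>The L1 norm is at most the square root of the total mass times the L2 norm;
      adding 1 keeps c positive and the final inequality strict.\<close>
    define c where "c = sqrt (measure M (space M)) + 1"
    have c: "c > 0" by (auto simp: c_def intro: add_nonneg_pos)
    obtain N where N: "\<And>m n. m \<ge> N \<Longrightarrow> n \<ge> N \<Longrightarrow> (LINT x|M. (norm (f m x - f n x))\<^sup>2) < (e / c)\<^sup>2"
      using Cauchy[of "(e / c)\<^sup>2"] c e by auto
    have "(LINT x|M. norm (f i x - f j x)) < e" if "i \<ge> N" "j \<ge> N" for i j
    proof -
      have "(LINT x|M. norm (f i x - f j x)) \<le> sqrt (measure M (space M)) * sqrt (LINT x|M. (norm (f i x - f j x))\<^sup>2)"
        by (intro integral_norm_le_L2 square_integrable_diff f)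
      also have "\<dots> \<le> sqrt (measure M (space M)) * (e / c)"
      proof (intro mult_left_mono)
        have "sqrt (LINT x|M. (norm (f i x - f j x))\<^sup>2) \<le> sqrt ((e / c)\<^sup>2)"
          using real_sqrt_le_mono[OF less_imp_le[OF N[OF that]]] .
        then show "sqrt (LINT x|M. (norm (f i x - f j x))\<^sup>2) \<le> e / c"
          using c \<open>e > 0\<close> by simp
      qed simp
      also have "\<dots> < c * (e / c)"
        using c \<open>e > 0\<close> by (intro mult_strict_right_mono) (auto simp: c_def)
      also have "\<dots> = e" using c by simp
      finally show ?thesis .
    qed
    then show ?thesis by blast
  qed
  then obtain r where r: "strict_mono r" "AE x in M. Cauchy (\<lambda>i. f (r i) x)"
    using cauchy_L1_AE_cauchy_subseq[of M f] integrable_if_square_integrable[OF f] by blast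
  define g where "g x = lim (\<lambda>i. f (r i) x)" for x
  have gm: "g \<in> borel_measurable M"
    unfolding g_def[abs_def] using fm by (intro borel_measurable_lim_metric)
  have lim: "AE x in M. (\<lambda>i. f (r i) x) \<longlonglongrightarrow> g x"
    using r(2) by eventually_elim (simp add: g_def Cauchy_convergent_iff convergent_LIMSEQ_iff)
  have fatou: "(\<integral>\<^sup>+x. ennreal ((norm (f n x - g x))\<^sup>2) \<partial>M) \<le> ennreal e"
    if N: "\<And>m. m \<ge> N \<Longrightarrow> (LINT x|M. (norm (f n x - f m x))\<^sup>2) < e" for n N e
  proof -
    have "AE x in M. ennreal ((norm (f n x - g x))\<^sup>2) = liminf (\<lambda>i. ennreal ((norm (f n x - f (r i) x))\<^sup>2))"
      using lim
    proof eventually_elim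
      case (elim x)
      have "(\<lambda>i. ennreal ((norm (f n x - f (r i) x))\<^sup>2)) \<longlonglongrightarrow> ennreal ((norm (f n x - g x))\<^sup>2)"
        by (intro tendsto_intros elim)
      then show ?case by (rule lim_imp_Liminf[OF trivial_limit_sequentially, symmetric])
    qed
    then have "(\<integral>\<^sup>+x. ennreal ((norm (f n x - g x))\<^sup>2) \<partial>M) = (\<integral>\<^sup>+x. liminf (\<lambda>i. ennreal ((norm (f n x - f (r i) x))\<^sup>2)) \<partial>M)"
      by (rule nn_integral_cong_AE)
    also have "\<dots> \<le> liminf (\<lambda>i. \<integral>\<^sup>+x. ennreal ((norm (f n x - f (r i) x))\<^sup>2) \<partial>M)"
      using fm by (intro nn_integral_liminf) auto
    also have "\<dots> \<le> ennreal e"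
    proof (rule Liminf_le)
      show "eventually (\<lambda>i. (\<integral>\<^sup>+x. ennreal ((norm (f n x - f (r i) x))\<^sup>2) \<partial>M) \<le> ennreal e) sequentially"
        unfolding eventually_sequentially
      proof (intro exI allI impI)
        fix i assume "N \<le> i"
        then have "N \<le> r i" using seq_suble[OF r(1), of i] by simp
        have "(\<integral>\<^sup>+x. ennreal ((norm (f n x - f (r i) x))\<^sup>2) \<partial>M) = ennreal (LINT x|M. (norm (f n x - f (r i) x))\<^sup>2)"
          using square_integrable_diff[OF f f] by (intro nn_integral_eq_integral) (auto simp: square_integrable_def)
        also have "\<dots> \<le> ennreal e" using N[OF \<open>N \<le> r i\<close>] by (intro ennreal_leI) simp
        finally show "(\<integral>\<^sup>+x. ennreal ((norm (f n x - f (r i) x))\<^sup>2) \<partial>M) \<le> ennreal e" .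
      qed
    qed simp
    finally show ?thesis .
  qed
  have ex: "\<exists>N. \<forall>n\<ge>N. (\<integral>\<^sup>+x. ennreal ((norm (f n x - g x))\<^sup>2) \<partial>M) \<le> ennreal e" if "e > 0" for e
    using Cauchy[OF that] fatou by meson
  have sq: "square_integrable M (\<lambda>x. f n x - g x)" if "(\<integral>\<^sup>+x. ennreal ((norm (f n x - g x))\<^sup>2) \<partial>M) \<le> ennreal e" for n e
    using that gm fm by (auto simp: square_integrable_def integrable_iff_bounded intro: le_less_trans)
  obtain N where N: "\<forall>n\<ge>N. (\<integral>\<^sup>+x. ennreal ((norm (f n x - g x))\<^sup>2) \<partial>M) \<le> ennreal 1"
    using ex[of 1] by auto
  have "square_integrable M (\<lambda>x. f N x - (f N x - g x))"
    by (rule square_integrable_diff[OF f sq[where e = 1]]) (use N in auto)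
  then have g: "square_integrable M g" by simp
  have "(\<lambda>n. LINT x|M. (norm (f n x - g x))\<^sup>2) \<longlonglongrightarrow> 0"
    unfolding lim_sequentially
  proof (intro allI impI)
    fix e :: real assume "0 < e"
    then obtain N where N: "\<forall>n\<ge>N. (\<integral>\<^sup>+x. ennreal ((norm (f n x - g x))\<^sup>2) \<partial>M) \<le> ennreal (e / 2)"
      using ex[of "e / 2"] by auto
    show "\<exists>N. \<forall>n\<ge>N. dist (LINT x|M. (norm (f n x - g x))\<^sup>2) 0 < e"
    proof (intro exI allI impI)
      fix n assume "N \<le> n"
      have "ennreal (LINT x|M. (norm (f n x - g x))\<^sup>2) = (\<integral>\<^sup>+x. ennreal ((norm (f n x - g x))\<^sup>2) \<partial>M)"
        using square_integrable_diff[OF f g] by (intro nn_integral_eq_integral[symmetric]) (auto simp: square_integrable_def)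
      also have "\<dots> \<le> ennreal (e / 2)" using N \<open>N \<le> n\<close> by blast
      finally have "(LINT x|M. (norm (f n x - g x))\<^sup>2) \<le> e / 2"
        using \<open>0 < e\<close> by (simp add: ennreal_le_iff)
      then show "dist (LINT x|M. (norm (f n x - g x))\<^sup>2) 0 < e"
        using \<open>0 < e\<close> by (simp add: dist_real_def integral_nonneg_AE)
    qed
  qed
  with g show ?thesis by blast
qed

lemma complete_lebesgue_on: "S \<in> sets lebesgue \<Longrightarrow> complete_measure (lebesgue_on S)"
proof
  fix A B assume "S \<in> sets lebesgue" and *: "A \<subseteq> B" "B \<in> null_sets (lebesgue_on S)"
  then have "B \<in> null_sets lebesgue" "B \<subseteq> S"
    by (auto simp: null_sets_restrict_space)
  then have "A \<in> null_sets lebesgue" using * completion.complete2 by blast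
  then show "A \<in> sets (lebesgue_on S)"
    using \<open>B \<subseteq> S\<close> * \<open>S \<in> sets lebesgue\<close> by (auto simp: sets_restrict_space_iff)
qed

text \<open>The gradient picked by \<open>weak_grad\<close> is only known to equal a
  square-integrable one almost everywhere; completeness of Lebesgue measure on S is what makes it
  measurable.\<close>

lemma borel_measurable_lebesgue_on_AE:
  fixes f g :: "'a::euclidean_space \<Rightarrow> 'b::topological_space"
  assumes S: "S \<in> sets lebesgue" and f: "f \<in> borel_measurable (lebesgue_on S)"
    and eq: "AE x in lebesgue_on S. f x = g x"
  shows "g \<in> borel_measurable (lebesgue_on S)"
proof (rule measurableI)
  fix A :: "'b set" assume A: "A \<in> sets borel"
  have "AE x in lebesgue_on S. x \<in> f -` A \<inter> space (lebesgue_on S) \<longleftrightarrow> x \<in> g -` A \<inter> space (lebesgue_on S)"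
    using eq by eventually_elim auto
  then show "g -` A \<inter> space (lebesgue_on S) \<in> sets (lebesgue_on S)"
    by (rule complete_measure.in_sets_AE[OF complete_lebesgue_on[OF S]])
      (use measurable_sets[OF f A] in auto)
qed simp

lemma integrable_test_product:
  fixes f :: "'a::euclidean_space \<Rightarrow> real"
  assumes U: "open U" and f: "\<And>K. compact K \<Longrightarrow> K \<subseteq> U \<Longrightarrow> integrable (lebesgue_on K) f"
    and \<eta>: "\<eta> \<in> test_functions U"
  shows "integrable (lebesgue_on U) (\<lambda>x. f x * \<eta> x)"
proof -
  define K where "K = closure {x. \<eta> x \<noteq> 0}"
  have K: "compact K" "K \<subseteq> U" using \<eta> by (auto simp: test_functions_def K_def)
  obtain B where B: "\<And>x. \<bar>\<eta> x\<bar> \<le> B" using test_bounded[OF \<eta>] by blast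
  have "K \<in> sets lebesgue" using K(1) by (simp add: compact_imp_closed)
  then have fK: "integrable lebesgue (\<lambda>x. indicator K x *\<^sub>R f x)"
    using f[OF K] by (subst integrable_restrict_space[symmetric]) auto
  have "integrable lebesgue (\<lambda>x. indicator K x *\<^sub>R f x * \<eta> x)"
  proof (rule Bochner_Integration.integrable_bound)
    show "integrable lebesgue (\<lambda>x. B * (indicator K x *\<^sub>R f x))" using fK by simp
    show "(\<lambda>x. indicator K x *\<^sub>R f x * \<eta> x) \<in> borel_measurable lebesgue"
      using borel_measurable_integrable[OF fK] borel_measurable_test[OF \<eta>]
      by (intro borel_measurable_times) (auto intro: measurable_completion)
    show "AE x in lebesgue. norm (indicator K x *\<^sub>R f x * \<eta> x) \<le> norm (B * (indicator K x *\<^sub>R f x))"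
    proof (intro always_eventually allI)
      fix x
      have "\<bar>indicator K x * f x\<bar> * \<bar>\<eta> x\<bar> \<le> \<bar>indicator K x * f x\<bar> * \<bar>B\<bar>"
        using B[of x] by (intro mult_left_mono) auto
      then show "norm (indicator K x *\<^sub>R f x * \<eta> x) \<le> norm (B * (indicator K x *\<^sub>R f x))"
        by (simp add: abs_mult mult_ac)
    qed
  qed
  moreover have eq: "indicator K x *\<^sub>R f x * \<eta> x = indicator U x *\<^sub>R (f x * \<eta> x)" for x
  proof -
    have "\<eta> x = 0" if "x \<notin> K" using test_zero_outside[of x \<eta>] that by (simp add: K_def)
    then show ?thesis using K(2) by (auto simp: indicator_def)
  qed
  ultimately show ?thesis unfolding eq using U by (subst integrable_restrict_space) auto
qed

section \<open>Weak gradients on bounded open sets\<close>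

lemma has_weak_gradientD:
  "has_weak_gradient U u g \<Longrightarrow> \<eta> \<in> test_functions U \<Longrightarrow> b \<in> Basis \<Longrightarrow>
    (LINT x|lebesgue_on U. u x * frechet_derivative \<eta> (at x) b) = - (LINT x|lebesgue_on U. (g x \<bullet> b) * \<eta> x)"
  by (simp add: has_weak_gradient_def)

text \<open>The fundamental lemma applied to each component of the difference. It makes the choice
  hidden in \<open>weak_grad\<close> harmless.\<close>

lemma has_weak_gradient_unique:
  assumes U: "open U" and g: "has_weak_gradient U u g" and h: "has_weak_gradient U u h"
  shows "AE x in lebesgue_on U. g x = h x"
proof -
  have "AE x in lebesgue_on U. \<forall>b\<in>Basis. (g x - h x) \<bullet> b = 0"
  proof (intro AE_finite_allI finite_Basis)
    fix b :: 'a assume b: "b \<in> Basis"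
    have gK: "integrable (lebesgue_on K) (\<lambda>x. g x \<bullet> b)" and hK: "integrable (lebesgue_on K) (\<lambda>x. h x \<bullet> b)"
      if "compact K" "K \<subseteq> U" for K
      using g h that by (auto simp: has_weak_gradient_def)
    show "AE x in lebesgue_on U. (g x - h x) \<bullet> b = 0"
    proof (rule fundamental_lemma_calculus_of_variations[OF U])
      show "integrable (lebesgue_on K) (\<lambda>x. (g x - h x) \<bullet> b)" if "compact K" "K \<subseteq> U" for K
        using gK[OF that] hK[OF that] by (simp add: inner_diff_left)
      fix \<eta> assume \<eta>: "\<eta> \<in> test_functions U"
      have "- (LINT x|lebesgue_on U. (g x \<bullet> b) * \<eta> x) = - (LINT x|lebesgue_on U. (h x \<bullet> b) * \<eta> x)"
        using has_weak_gradientD[OF g \<eta> b] has_weak_gradientD[OF h \<eta> b] by simp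
      then show "(LINT x|lebesgue_on U. (g x - h x) \<bullet> b * \<eta> x) = 0"
        using integrable_test_product[OF U gK \<eta>] integrable_test_product[OF U hK \<eta>]
        by (simp add: inner_diff_left left_diff_distrib)
    qed
  qed
  then show ?thesis
  proof eventually_elim
    case (elim x)
    then have "g x \<bullet> b = h x \<bullet> b" if "b \<in> Basis" for b
      using that by (simp add: inner_diff_left)
    then show ?case by (rule euclidean_eqI)
  qed
qed

locale bounded_open =
  fixes \<Omega> :: "'a::euclidean_space set"
  assumes open_dom: "open \<Omega>" and bounded_dom: "bounded \<Omega>"
begin

abbreviation "\<Lambda> \<equiv> lebesgue_on \<Omega>"

lemma dom_sets [simp, intro]: "\<Omega> \<in> sets lebesgue"
  using open_dom by simp

lemma dom_lmeasurable: "\<Omega> \<in> lmeasurable"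
  using bounded_dom by (intro bounded_set_imp_lmeasurable) auto

lemma finite_measure_dom: "finite_measure \<Lambda>"
  by (rule finite_measure_lebesgue_on[OF dom_lmeasurable])

lemma integrable_dom: "square_integrable \<Lambda> f \<Longrightarrow> integrable \<Lambda> f"
  by (rule finite_measure.integrable_if_square_integrable[OF finite_measure_dom])

lemma measurable_test_dom: "\<eta> \<in> test_functions U \<Longrightarrow> \<eta> \<in> borel_measurable \<Lambda>"
  using borel_measurable_test by (auto intro!: measurable_restrict_space1 measurable_completion)

text \<open>Relates u to any of its square-integrable weak gradients. Linear combinations and limits
  are handled for this relation, and \<open>weak_pair_unique\<close> returns to the chosen
  gradient.\<close>

definition weak_pair :: "('a \<Rightarrow> real) \<Rightarrow> ('a \<Rightarrow> 'a) \<Rightarrow> bool" where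
  "weak_pair u g \<longleftrightarrow> square_integrable \<Lambda> u \<and> square_integrable \<Lambda> g \<and>
    (\<forall>\<eta>\<in>test_functions \<Omega>. \<forall>b\<in>Basis. (LINT x|\<Lambda>. u x * frechet_derivative \<eta> (at x) b) = - (LINT x|\<Lambda>. (g x \<bullet> b) * \<eta> x))"

lemma integrable_sub:
  fixes f :: "'a \<Rightarrow> 'b::euclidean_space"
  assumes "integrable \<Lambda> f" "compact K" "K \<subseteq> \<Omega>"
  shows "integrable (lebesgue_on K) f"
proof -
  have K: "K \<in> sets lebesgue" using assms(2) by (simp add: compact_imp_closed)
  have "integrable lebesgue (\<lambda>x. indicator \<Omega> x *\<^sub>R f x)"
    using assms(1) by (subst integrable_restrict_space[symmetric]) auto
  from integrable_mult_indicator[OF K this]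
  have "integrable lebesgue (\<lambda>x. indicator K x *\<^sub>R f x)"
    by (rule back_subst[of "integrable lebesgue"]) (use assms(3) in \<open>auto simp: indicator_def fun_eq_iff\<close>)
  then show ?thesis using K by (subst integrable_restrict_space) auto
qed

lemma weak_pair_has_weak_gradient:
  assumes "weak_pair u g"
  shows "has_weak_gradient \<Omega> u g"
proof -
  have "integrable \<Lambda> u" "integrable \<Lambda> g"
    using assms by (simp_all add: weak_pair_def integrable_dom)
  then show ?thesis
    using assms integrable_sub[of u] integrable_sub[of g] by (simp add: has_weak_gradient_def weak_pair_def)
qed

lemma weak_pair_H1:
  assumes "weak_pair u g"
  shows "u \<in> H1 \<Omega>"
  using assms weak_pair_has_weak_gradient[OF assms]
  by (auto simp: H1_def weak_pair_def square_integrable_def)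

lemma weak_pair_weak_grad:
  assumes "u \<in> H1 \<Omega>"
  shows "weak_pair u (weak_grad \<Omega> u)"
proof -
  obtain g where g: "has_weak_gradient \<Omega> u g" "square_integrable \<Lambda> g"
    using assms by (auto simp: H1_def square_integrable_def)
  have w: "has_weak_gradient \<Omega> u (weak_grad \<Omega> u)"
    unfolding weak_grad_def by (rule someI[where P = "has_weak_gradient \<Omega> u", OF g(1)])
  have eq: "AE x in \<Lambda>. g x = weak_grad \<Omega> u x"
    by (rule has_weak_gradient_unique[OF open_dom g(1) w])
  have "square_integrable \<Lambda> (weak_grad \<Omega> u)"
    using square_integrable_cong_AE[OF g(2) borel_measurable_lebesgue_on_AE[OF dom_sets _ eq] eq] g(2)
    by (simp add: square_integrable_def)
  then show ?thesis
    using w assms by (auto simp: weak_pair_def has_weak_gradient_def H1_def square_integrable_def)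
qed

lemma weak_pair_unique:
  assumes "weak_pair u g"
  shows "AE x in \<Lambda>. weak_grad \<Omega> u x = g x"
  by (rule has_weak_gradient_unique[OF open_dom weak_pair_has_weak_gradient weak_pair_has_weak_gradient])
    (use assms weak_pair_weak_grad weak_pair_H1 in auto)

lemma integrable_times_test:
  assumes "square_integrable \<Lambda> (f :: 'a \<Rightarrow> real)" "\<eta> \<in> test_functions \<Omega>"
  shows "integrable \<Lambda> (\<lambda>x. f x * \<eta> x)"
  by (rule integrable_test_product[OF open_dom integrable_sub assms(2)])
    (use finite_measure.integrable_if_square_integrable[OF finite_measure_dom assms(1)] in auto)

lemma square_integrable_component:
  "square_integrable M (g :: 'c \<Rightarrow> 'a) \<Longrightarrow> b \<in> Basis \<Longrightarrow> square_integrable M (\<lambda>x. g x \<bullet> b)"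
proof -
  assume g: "square_integrable M g" and b: "b \<in> Basis"
  have "integrable M (\<lambda>x. (g x \<bullet> b)\<^sup>2)"
  proof (rule Bochner_Integration.integrable_bound)
    show "integrable M (\<lambda>x. (norm (g x))\<^sup>2)" using g by (simp add: square_integrable_def)
    show "AE x in M. norm ((g x \<bullet> b)\<^sup>2) \<le> norm ((norm (g x))\<^sup>2)"
      using Basis_le_norm[OF b] by (intro always_eventually allI) (simp add: abs_le_square_iff[symmetric])
  qed (use g in \<open>auto simp: square_integrable_def intro!: borel_measurable_inner\<close>)
  then show ?thesis using g by (auto simp: square_integrable_def intro!: borel_measurable_inner)
qed

lemma weak_pair_add:
  assumes "weak_pair u g" "weak_pair v h"
  shows "weak_pair (\<lambda>x. u x + v x) (\<lambda>x. g x + h x)"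
  unfolding weak_pair_def
proof (intro conjI ballI)
  fix \<eta> b assume \<eta>: "\<eta> \<in> test_functions \<Omega>" and b: "b \<in> (Basis :: 'a set)"
  have i: "integrable \<Lambda> (\<lambda>x. u x * frechet_derivative \<eta> (at x) b)" "integrable \<Lambda> (\<lambda>x. v x * frechet_derivative \<eta> (at x) b)"
    "integrable \<Lambda> (\<lambda>x. g x \<bullet> b * \<eta> x)" "integrable \<Lambda> (\<lambda>x. h x \<bullet> b * \<eta> x)"
    using assms by (auto simp: weak_pair_def intro!: integrable_times_test \<eta> test_frechet[OF \<eta> b] square_integrable_component b)
  show "(LINT x|\<Lambda>. (u x + v x) * frechet_derivative \<eta> (at x) b) = - (LINT x|\<Lambda>. ((g x + h x) \<bullet> b) * \<eta> x)"
    using assms i \<eta> b by (simp add: weak_pair_def inner_add_left distrib_right)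
qed (use assms in \<open>auto simp: weak_pair_def intro!: square_integrable_add\<close>)

lemma weak_pair_scale:
  assumes "weak_pair u g"
  shows "weak_pair (\<lambda>x. c *\<^sub>R u x) (\<lambda>x. c *\<^sub>R g x)"
  unfolding weak_pair_def
proof (intro conjI ballI)
  fix \<eta> b assume \<eta>: "\<eta> \<in> test_functions \<Omega>" and b: "b \<in> (Basis :: 'a set)"
  show "(LINT x|\<Lambda>. c *\<^sub>R u x * frechet_derivative \<eta> (at x) b) = - (LINT x|\<Lambda>. ((c *\<^sub>R g x) \<bullet> b) * \<eta> x)"
    using assms \<eta> b by (simp add: weak_pair_def mult.assoc)
qed (use assms in \<open>auto simp: weak_pair_def simp del: real_scaleR_def intro!: square_integrable_scale\<close>)

lemma weak_grad_add:
  assumes "u \<in> H1 \<Omega>" "v \<in> H1 \<Omega>"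
  shows "u + v \<in> H1 \<Omega>" "AE x in \<Lambda>. weak_grad \<Omega> (u + v) x = weak_grad \<Omega> u x + weak_grad \<Omega> v x"
proof -
  have "weak_pair (u + v) (\<lambda>x. weak_grad \<Omega> u x + weak_grad \<Omega> v x)"
    unfolding plus_fun_def by (intro weak_pair_add weak_pair_weak_grad assms)
  then show "u + v \<in> H1 \<Omega>" "AE x in \<Lambda>. weak_grad \<Omega> (u + v) x = weak_grad \<Omega> u x + weak_grad \<Omega> v x"
    by (auto intro: weak_pair_H1 weak_pair_unique)
qed

lemma weak_grad_scale:
  assumes "u \<in> H1 \<Omega>"
  shows "c *\<^sub>R u \<in> H1 \<Omega>" "AE x in \<Lambda>. weak_grad \<Omega> (c *\<^sub>R u) x = c *\<^sub>R weak_grad \<Omega> u x"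
proof -
  have "weak_pair (c *\<^sub>R u) (\<lambda>x. c *\<^sub>R weak_grad \<Omega> u x)"
    unfolding scaleR_fun_def by (intro weak_pair_scale weak_pair_weak_grad assms)
  then show "c *\<^sub>R u \<in> H1 \<Omega>" "AE x in \<Lambda>. weak_grad \<Omega> (c *\<^sub>R u) x = c *\<^sub>R weak_grad \<Omega> u x"
    by (auto intro: weak_pair_H1 weak_pair_unique)
qed

lemma weak_pair_zero: "weak_pair (\<lambda>x. 0) (\<lambda>x. 0)"
  by (simp add: weak_pair_def square_integrable_def)

lemma subspace_H1: "subspace (H1 \<Omega>)"
  using weak_grad_add weak_grad_scale weak_pair_H1[OF weak_pair_zero]
  by (auto simp: subspace_def zero_fun_def)

text \<open>The weak gradient is a closed operator: a test function and its derivatives are bounded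
  and the domain has finite measure, so L2-convergence passes through the defining identity.
  Completeness of \<open>H1\<close> rests on it.\<close>

lemma weak_pair_limit:
  assumes ug: "\<And>n. weak_pair (u n) (g n)" and v: "square_integrable \<Lambda> v" and h: "square_integrable \<Lambda> h"
    and ulim: "(\<lambda>n. LINT x|\<Lambda>. (norm (u n x - v x))\<^sup>2) \<longlonglongrightarrow> 0"
    and glim: "(\<lambda>n. LINT x|\<Lambda>. (norm (g n x - h x))\<^sup>2) \<longlonglongrightarrow> 0"
  shows "weak_pair v h"
  unfolding weak_pair_def
proof (intro conjI ballI v h)
  fix \<eta> b assume \<eta>: "\<eta> \<in> test_functions \<Omega>" and b: "b \<in> (Basis :: 'a set)"
  interpret finite_measure \<Lambda> by (rule finite_measure_dom)
  have u: "square_integrable \<Lambda> (u n)" and g: "square_integrable \<Lambda> (g n)" for n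
    using ug by (auto simp: weak_pair_def)
  \<comment> \<open>Stated with an inner product so that it serves both sides of the identity: z = 1
    for the scalar functions, z = b for the gradients.\<close>
  have lim: "(\<lambda>n. LINT x|\<Lambda>. (f n x \<bullet> z) * \<zeta> x) \<longlonglongrightarrow> (LINT x|\<Lambda>. (k x \<bullet> z) * \<zeta> x)"
    if f: "\<And>n. square_integrable \<Lambda> (f n)" and k: "square_integrable \<Lambda> k" and \<zeta>: "\<zeta> \<in> test_functions \<Omega>" and z: "norm z = 1"
      and l: "(\<lambda>n. LINT x|\<Lambda>. (norm (f n x - k x))\<^sup>2) \<longlonglongrightarrow> 0"
    for f :: "nat \<Rightarrow> 'a \<Rightarrow> 'c::euclidean_space" and k \<zeta> z
  proof -
    obtain B where B: "\<And>x. \<bar>\<zeta> x\<bar> \<le> B" using test_bounded[OF \<zeta>] by blast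
    have B0: "0 \<le> B" using B[of 0] by linarith
    have \<zeta>m: "\<zeta> \<in> borel_measurable \<Lambda>" by (rule measurable_test_dom[OF \<zeta>])
    have one: "square_integrable \<Lambda> (\<lambda>x. z)"
      by (rule square_integrable_bounded[OF finite_measure_dom, where B = "norm z"]) auto
    have int: "integrable \<Lambda> (\<lambda>x. (F x \<bullet> z) * \<zeta> x)" if "square_integrable \<Lambda> F" for F
      using square_integrable_weighted_inner[OF that one \<zeta>m, of B] B by (simp add: mult.commute)
    have bd: "\<bar>(LINT x|\<Lambda>. (f n x \<bullet> z) * \<zeta> x) - (LINT x|\<Lambda>. (k x \<bullet> z) * \<zeta> x)\<bar> \<le>
       B * (sqrt (LINT x|\<Lambda>. (norm (f n x - k x))\<^sup>2) * sqrt (LINT x|\<Lambda>. (norm z)\<^sup>2))" for n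
      using weighted_inner_bound[OF square_integrable_diff[OF f k] one \<zeta>m _ B0, of n] B int[OF f, of n] int[OF k]
      by (simp add: mult.commute inner_diff_left right_diff_distrib)
    have "(\<lambda>n. B * (sqrt (LINT x|\<Lambda>. (norm (f n x - k x))\<^sup>2) * sqrt (LINT x|\<Lambda>. (norm z)\<^sup>2))) \<longlonglongrightarrow> B * (sqrt 0 * sqrt (LINT x|\<Lambda>. (norm z)\<^sup>2))"
      by (intro tendsto_intros l)
    then have lim0: "(\<lambda>n. B * (sqrt (LINT x|\<Lambda>. (norm (f n x - k x))\<^sup>2) * sqrt (LINT x|\<Lambda>. (norm z)\<^sup>2))) \<longlonglongrightarrow> 0"
      by simp
    have "(\<lambda>n. (LINT x|\<Lambda>. (f n x \<bullet> z) * \<zeta> x) - (LINT x|\<Lambda>. (k x \<bullet> z) * \<zeta> x)) \<longlonglongrightarrow> 0"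
      by (rule Lim_null_comparison[OF always_eventually lim0]) (use bd in \<open>simp add: real_norm_def\<close>)
    then show ?thesis by (simp add: LIM_zero_iff)
  qed
  have l1: "(\<lambda>n. LINT x|\<Lambda>. u n x * frechet_derivative \<eta> (at x) b) \<longlonglongrightarrow> (LINT x|\<Lambda>. v x * frechet_derivative \<eta> (at x) b)"
    using lim[OF u v test_frechet[OF \<eta> b], of 1] ulim by simp
  have l2: "(\<lambda>n. - (LINT x|\<Lambda>. (g n x \<bullet> b) * \<eta> x)) \<longlonglongrightarrow> - (LINT x|\<Lambda>. (h x \<bullet> b) * \<eta> x)"
    using lim[OF g h \<eta>, of b] glim b by (intro tendsto_minus) simp
  have "(LINT x|\<Lambda>. u n x * frechet_derivative \<eta> (at x) b) = - (LINT x|\<Lambda>. (g n x \<bullet> b) * \<eta> x)" for n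
    using ug \<eta> b by (simp add: weak_pair_def)
  then show "(LINT x|\<Lambda>. v x * frechet_derivative \<eta> (at x) b) = - (LINT x|\<Lambda>. (h x \<bullet> b) * \<eta> x)"
    using LIMSEQ_unique[OF l1] l2 by simp
qed

end

subsection \<open>Translation estimates\<close>

lemma lborel_integral_translate:
  fixes f :: "'a::euclidean_space \<Rightarrow> 'b::{banach, second_countable_topology}"
  assumes [measurable]: "f \<in> borel_measurable borel"
  shows "(LINT x|lborel. f (c + x)) = (LINT x|lborel. f x)"
proof -
  have "(LINT x|lborel. f x) = (LINT x|distr lborel borel ((+) c). f x)"
    by (simp add: lborel_distr_plus)
  also have "\<dots> = (LINT x|lborel. f (c + x))"
    by (rule integral_distr) measurable
  finally show ?thesis by simp
qed

lemma lborel_nn_integral_translate: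
  fixes f :: "'a::euclidean_space \<Rightarrow> ennreal"
  assumes [measurable]: "f \<in> borel_measurable borel"
  shows "(\<integral>\<^sup>+x. f (c + x) \<partial>lborel) = (\<integral>\<^sup>+x. f x \<partial>lborel)"
proof -
  have "(\<integral>\<^sup>+x. f x \<partial>lborel) = (\<integral>\<^sup>+x. f x \<partial>distr lborel borel ((+) c))"
    by (simp add: lborel_distr_plus)
  also have "\<dots> = (\<integral>\<^sup>+x. f (c + x) \<partial>lborel)"
    by (rule nn_integral_distr) measurable
  finally show ?thesis by simp
qed

lemma lborel_integrable_translate:
  fixes f :: "'a::euclidean_space \<Rightarrow> 'b::{banach, second_countable_topology}"
  assumes [measurable]: "integrable lborel f"
  shows "integrable lborel (\<lambda>x. f (c + x))"
proof -
  have "integrable (distr lborel borel ((+) c)) f"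
    using assms by (simp add: lborel_distr_plus)
  then show ?thesis by (subst (asm) integrable_distr_eq) auto
qed

text \<open>Averages over the segment parameter become expectations on the whole line, so Fubini
  against \<open>lborel\<close> and moment inequalities apply directly; that s lies in {0..1} is
  then an almost sure property.\<close>

definition unit_uniform :: "real measure" where
  "unit_uniform = uniform_measure lborel {0..1}"

lemma sets_unit_uniform [measurable_cong, simp]: "sets unit_uniform = sets borel"
  by (simp add: unit_uniform_def)

lemma space_unit_uniform [simp]: "space unit_uniform = UNIV"
  by (simp add: unit_uniform_def)

interpretation unit_uniform: prob_space unit_uniform
  unfolding unit_uniform_def by (rule prob_space_uniform_measure) auto

interpretation lborel_unit_uniform: pair_sigma_finite "lborel :: 'a::euclidean_space measure" unit_uniform ..

lemma measure_unit_uniform_UNIV [simp]: "measure unit_uniform UNIV = 1"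
  using unit_uniform.prob_space by simp

lemma AE_unit_uniform: "AE s in unit_uniform. s \<in> {0..1}"
  unfolding unit_uniform_def by (rule AE_uniform_measureI) auto

lemma unit_uniform_density: "unit_uniform = density lborel (\<lambda>s. ennreal (indicator {0..1} s))"
  by (simp add: unit_uniform_def uniform_measure_def divide_ennreal_def ennreal_indicator)

lemma integral_unit_uniform:
  fixes f :: "real \<Rightarrow> real"
  assumes "f \<in> borel_measurable borel"
  shows "(LINT s|unit_uniform. f s) = (LINT s|lborel. indicator {0..1} s *\<^sub>R f s)"
  unfolding unit_uniform_density using assms by (subst integral_density) auto

lemma FTC_unit_uniform:
  fixes F f :: "real \<Rightarrow> real"
  assumes "\<And>s. (F has_real_derivative f s) (at s)" "continuous_on UNIV f"
  shows "(LINT s|unit_uniform. f s) = F 1 - F 0"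
proof -
  have "f \<in> borel_measurable borel" using assms(2) by (rule borel_measurable_continuous_onI)
  moreover have "(LINT s|lborel. indicator {0..1} s *\<^sub>R f s) = F 1 - F 0"
  proof (rule integral_FTC_Icc)
    show "continuous_on {0..1} f" using assms(2) continuous_on_subset by blast
    show "(F has_vector_derivative f x) (at x within {0..1})" for x
      using assms(1) by (simp add: has_real_derivative_iff_has_vector_derivative has_vector_derivative_at_within)
  qed simp
  ultimately show ?thesis by (simp only: integral_unit_uniform)
qed

lemma integrable_shear:
  fixes f :: "'a::euclidean_space \<Rightarrow> real" and \<zeta> :: "'a \<Rightarrow> real"
  assumes f: "integrable lborel f" and \<zeta>: "\<zeta> \<in> borel_measurable borel" "\<And>x. \<bar>\<zeta> x\<bar> \<le> B"
  shows "integrable (lborel \<Otimes>\<^sub>M unit_uniform) (\<lambda>(x, s). f x * \<zeta> (x + s *\<^sub>R h))"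
proof (rule lborel_unit_uniform.Fubini_integrable)
  have [measurable]: "f \<in> borel_measurable borel" "\<zeta> \<in> borel_measurable borel"
    using borel_measurable_integrable[OF f] \<zeta>(1) by auto
  show "(\<lambda>(x, s). f x * \<zeta> (x + s *\<^sub>R h)) \<in> borel_measurable (lborel \<Otimes>\<^sub>M unit_uniform)"
    by measurable
  have B: "0 \<le> B" using \<zeta>(2)[of 0] by linarith
  have int: "integrable unit_uniform (\<lambda>s. f x * \<zeta> (x + s *\<^sub>R h))" for x
    by (rule unit_uniform.integrable_const_bound[where B = "\<bar>f x\<bar> * B"])
      (auto simp: abs_mult intro!: mult_left_mono \<zeta>)
  show "integrable lborel (\<lambda>x. LINT s|unit_uniform. norm (case (x, s) of (x, s) \<Rightarrow> f x * \<zeta> (x + s *\<^sub>R h)))"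
  proof (rule Bochner_Integration.integrable_bound)
    show "integrable lborel (\<lambda>x. B * f x)" using f by simp
    show "(\<lambda>x. LINT s|unit_uniform. norm (case (x, s) of (x, s) \<Rightarrow> f x * \<zeta> (x + s *\<^sub>R h))) \<in> borel_measurable lborel"
      by measurable
    have "(LINT s|unit_uniform. norm (f x * \<zeta> (x + s *\<^sub>R h))) \<le> (LINT s|unit_uniform. \<bar>f x\<bar> * B)" for x
      using int[of x] by (intro integral_mono) (auto simp: abs_mult intro!: mult_left_mono \<zeta>)
    then show "AE x in lborel. norm (LINT s|unit_uniform. norm (case (x, s) of (x, s) \<Rightarrow> f x * \<zeta> (x + s *\<^sub>R h))) \<le> norm (B * f x)"
      using B by (auto simp: abs_mult mult.commute)
  qed
  show "AE x in lborel. integrable unit_uniform (\<lambda>s. case (x, s) of (x, s) \<Rightarrow> f x * \<zeta> (x + s *\<^sub>R h))"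
    using int by simp
qed

text \<open>The integrated form of differentiating \<open>\<eta>(y - s h)\<close> in \<open>s\<close>; it replaces differentiation under the
  integral sign.\<close>

lemma integral_test_difference:
  fixes f :: "'a::euclidean_space \<Rightarrow> real"
  assumes f: "integrable lborel f" and \<eta>: "\<And>x. (\<eta> has_derivative D x) (at x)"
    and cont: "continuous_on UNIV (\<lambda>x. D x h)" and bound: "\<And>x. \<bar>D x h\<bar> \<le> B"
  shows "(LINT y|lborel. f y * (\<eta> (y - h) - \<eta> y)) = - (LINT s|unit_uniform. LINT y|lborel. f y * D (y - s *\<^sub>R h) h)"
proof -
  have Dm: "(\<lambda>x. D x h) \<in> borel_measurable borel" using cont by (rule borel_measurable_continuous_onI)
  have ftc: "(LINT s|unit_uniform. - D (y - s *\<^sub>R h) h) = \<eta> (y - h) - \<eta> y" for y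
  proof -
    have "((\<lambda>s. \<eta> (y - s *\<^sub>R h)) has_real_derivative - D (y - s *\<^sub>R h) h) (at s)" for s
    proof -
      have "(\<eta> \<circ> (\<lambda>s. y - s *\<^sub>R h) has_derivative D (y - s *\<^sub>R h) \<circ> (\<lambda>t. 0 - t *\<^sub>R h)) (at s)"
        by (intro diff_chain_at \<eta> derivative_intros)
      moreover have "D (y - s *\<^sub>R h) \<circ> (\<lambda>t. 0 - t *\<^sub>R h) = (*) (- D (y - s *\<^sub>R h) h)"
        using linear_scale[OF has_derivative_linear[OF \<eta>]] linear_neg[OF has_derivative_linear[OF \<eta>]]
        by (simp add: comp_def fun_eq_iff)
      ultimately show ?thesis
        by (simp add: has_field_derivative_def comp_def)
    qed
    moreover have "continuous_on UNIV (\<lambda>s. - D (y - s *\<^sub>R h) h)"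
      by (intro continuous_intros continuous_on_compose2[OF cont]) auto
    ultimately show ?thesis by (subst FTC_unit_uniform) auto
  qed
  have int: "integrable (lborel \<Otimes>\<^sub>M unit_uniform) (case_prod (\<lambda>y s. f y * - D (y - s *\<^sub>R h) h))"
    using integrable_shear[OF f, of "\<lambda>x. - D x h" B "- h"] Dm bound by simp
  have "(LINT y|lborel. f y * (\<eta> (y - h) - \<eta> y)) = (LINT y|lborel. LINT s|unit_uniform. f y * - D (y - s *\<^sub>R h) h)"
    by (simp only: ftc[symmetric] integral_mult_right_zero)
  also have "\<dots> = (LINT s|unit_uniform. LINT y|lborel. f y * - D (y - s *\<^sub>R h) h)"
    by (rule lborel_unit_uniform.Fubini_integral[OF int, symmetric])
  finally show ?thesis by simp
qed

lemma test_frechet_direction: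
  assumes \<eta>: "\<eta> \<in> test_functions U"
  shows "continuous_on UNIV (\<lambda>x. frechet_derivative \<eta> (at x) h)"
    and "\<exists>B. \<forall>x. \<bar>frechet_derivative \<eta> (at x) h\<bar> \<le> B"
    and "frechet_derivative \<eta> (at x) h = (\<Sum>b\<in>Basis. (h \<bullet> b) * frechet_derivative \<eta> (at x) b)"
proof -
  have lin: "frechet_derivative \<eta> (at x) h = (\<Sum>b\<in>Basis. (h \<bullet> b) * frechet_derivative \<eta> (at x) b)" for x
  proof -
    have "linear (frechet_derivative \<eta> (at x))"
      using test_has_derivative[OF \<eta>] has_derivative_linear by blast
    then have "frechet_derivative \<eta> (at x) (\<Sum>b\<in>Basis. (h \<bullet> b) *\<^sub>R b) = (\<Sum>b\<in>Basis. (h \<bullet> b) * frechet_derivative \<eta> (at x) b)"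
      by (simp add: linear_sum linear_scale)
    then show ?thesis by (simp add: euclidean_representation)
  qed
  then show "frechet_derivative \<eta> (at x) h = (\<Sum>b\<in>Basis. (h \<bullet> b) * frechet_derivative \<eta> (at x) b)" .
  show "continuous_on UNIV (\<lambda>x. frechet_derivative \<eta> (at x) h)"
    unfolding lin by (intro continuous_intros test_continuous[OF test_frechet[OF \<eta>]])
  have "\<forall>b\<in>Basis. \<exists>B. \<forall>x. \<bar>frechet_derivative \<eta> (at x) b\<bar> \<le> B"
    using test_bounded[OF test_frechet[OF \<eta>]] by blast
  then obtain B where B: "\<And>b x. b \<in> Basis \<Longrightarrow> \<bar>frechet_derivative \<eta> (at x) b\<bar> \<le> B b" by metis
  have "\<bar>frechet_derivative \<eta> (at x) h\<bar> \<le> (\<Sum>b\<in>Basis. \<bar>h \<bullet> b\<bar> * B b)" for x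
    unfolding lin using B by (intro order_trans[OF sum_abs] sum_mono) (auto simp: abs_mult intro: mult_left_mono)
  then show "\<exists>B. \<forall>x. \<bar>frechet_derivative \<eta> (at x) h\<bar> \<le> B" by blast
qed

lemma test_translate:
  assumes \<eta>: "\<eta> \<in> test_functions V" and sub: "\<And>x. x \<in> closure {x. \<eta> x \<noteq> 0} \<Longrightarrow> x + v \<in> U"
  shows "(\<lambda>x. \<eta> (x - v)) \<in> test_functions U"
    and "frechet_derivative (\<lambda>x. \<eta> (x - v)) (at x) = frechet_derivative \<eta> (at (x - v))"
proof -
  have \<eta>': "Ck_on k UNIV \<eta>" "compact (closure {x. \<eta> x \<noteq> 0})" for k
    using \<eta> unfolding test_functions_def by blast+
  have "{x. \<eta> (x - v) \<noteq> 0} = (+) v ` {x. \<eta> x \<noteq> 0}"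
  proof (intro set_eqI iffI)
    show "x \<in> (+) v ` {x. \<eta> x \<noteq> 0}" if "x \<in> {x. \<eta> (x - v) \<noteq> 0}" for x
      using that by (intro image_eqI[of _ _ "x - v"]) auto
  qed auto
  then have cl: "closure {x. \<eta> (x - v) \<noteq> 0} = (+) v ` closure {x. \<eta> x \<noteq> 0}"
    by (simp add: closure_translation)
  have c: "compact (closure {x. \<eta> (x - v) \<noteq> 0})"
    unfolding cl by (intro compact_translation \<eta>')
  moreover have "closure {x. \<eta> (x - v) \<noteq> 0} \<subseteq> U"
    unfolding cl using sub by (auto simp: add.commute)
  ultimately show "(\<lambda>x. \<eta> (x - v)) \<in> test_functions U"
    unfolding test_functions_def mem_Collect_eq using Ck_on_translate[OF \<eta>'(1)] by blast
  have "((\<lambda>x. \<eta> (x - v)) has_derivative frechet_derivative \<eta> (at (x - v))) (at x)"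
  proof -
    have "(\<eta> \<circ> (\<lambda>x. x - v) has_derivative frechet_derivative \<eta> (at (x - v)) \<circ> (\<lambda>h. h - 0)) (at x)"
      by (intro diff_chain_at test_has_derivative[OF \<eta>] has_derivative_diff has_derivative_ident has_derivative_const)
    then show ?thesis by (simp add: comp_def)
  qed
  from frechet_derivative_at[OF this]
  show "frechet_derivative (\<lambda>x. \<eta> (x - v)) (at x) = frechet_derivative \<eta> (at (x - v))" by simp
qed

lemma integrable_test_lborel:
  assumes \<eta>: "\<eta> \<in> test_functions (U :: 'a::euclidean_space set)"
  shows "integrable lborel \<eta>"
proof -
  define K where "K = closure {x. \<eta> x \<noteq> 0}"
  have K: "compact K" using \<eta> by (auto simp: test_functions_def K_def)
  have "integrable lborel (\<lambda>x. indicator K x *\<^sub>R \<eta> x)"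
    by (rule borel_integrable_compact[OF K continuous_on_subset[OF test_continuous[OF \<eta>]]]) simp
  moreover have eq: "indicator K x *\<^sub>R \<eta> x = \<eta> x" for x
    using test_zero_outside[of x \<eta>] by (auto simp: indicator_def K_def[symmetric])
  ultimately show ?thesis unfolding eq by simp
qed

text \<open>By translation invariance the integral of \<eta>(y - b) - \<eta>(y) is 0, and by
  \<open>integral_test_difference\<close> it is minus the average over s of the integrals of the
  translated derivative, which all coincide.\<close>

lemma integral_frechet_test_zero:
  assumes \<eta>: "\<eta> \<in> test_functions (U :: 'a::euclidean_space set)" and b: "b \<in> Basis"
  shows "(LINT x|lborel. frechet_derivative \<eta> (at x) b) = 0"
proof -
  let ?D = "\<lambda>x. frechet_derivative \<eta> (at x) b"
  obtain B where B: "\<And>x. \<bar>?D x\<bar> \<le> B" using test_frechet_direction(2)[OF \<eta>] by blast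
  have supp: "bounded (closure {x. \<eta> x \<noteq> 0})" "bounded (closure {x. ?D x \<noteq> 0})"
    using \<eta> test_frechet[OF \<eta> b] by (auto simp: test_functions_def intro: compact_imp_bounded simp del: compact_closure)
  then obtain R where R: "\<And>x. x \<in> closure {x. \<eta> x \<noteq> 0} \<Longrightarrow> norm x \<le> R" "\<And>x. x \<in> closure {x. ?D x \<noteq> 0} \<Longrightarrow> norm x \<le> R"
    by (metis bounded_Un bounded_iff UnCI)
  \<comment> \<open>\<open>integral_test_difference\<close> asks for an integrable factor. This
    indicator equals 1 on every translate of the supports along at most one unit vector, hence
    changes nothing.\<close>
  define f :: "'a \<Rightarrow> real" where "f = indicator (cball 0 (R + 1))"
  have f: "integrable lborel f"
    unfolding f_def using emeasure_lborel_cball_finite by (intro integrable_real_indicator) (auto simp: less_top)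
  have zero: "\<eta> x = 0" "?D x = 0" if "\<not> norm x \<le> R" for x
    using R[of x] that test_zero_outside[of x \<eta>] test_zero_outside[of x ?D] by blast+
  have f1: "f y * \<eta> (y - b) = \<eta> (y - b)" "f y * \<eta> y = \<eta> y" for y
  proof -
    have "norm y \<le> norm (y - b) + 1" using norm_triangle_ineq[of "y - b" b] b by simp
    then show "f y * \<eta> (y - b) = \<eta> (y - b)" "f y * \<eta> y = \<eta> y"
      using zero[of "y - b"] zero[of y] by (auto simp: f_def indicator_def)
  qed
  have f2: "f y * ?D (y - s *\<^sub>R b) = ?D (y - s *\<^sub>R b)" if "s \<in> {0..1}" for y s
  proof -
    have "norm y \<le> norm (y - s *\<^sub>R b) + s" using norm_triangle_ineq[of "y - s *\<^sub>R b" "s *\<^sub>R b"] b that by simp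
    then show ?thesis
      using zero[of "y - s *\<^sub>R b"] that by (auto simp: f_def indicator_def)
  qed
  have \<eta>m: "\<eta> \<in> borel_measurable borel" and Dm: "?D \<in> borel_measurable borel"
    using borel_measurable_test[OF \<eta>] borel_measurable_test[OF test_frechet[OF \<eta> b]] by auto
  have tr: "(LINT y|lborel. g (y - v)) = (LINT y|lborel. g y)" if "g \<in> borel_measurable borel" for g :: "'a \<Rightarrow> real" and v
    using lborel_integral_translate[OF that, of "- v"] by simp
  have "(LINT y|lborel. f y * (\<eta> (y - b) - \<eta> y)) = (LINT y|lborel. \<eta> (y - b) - \<eta> y)"
    by (simp add: right_diff_distrib f1)
  also have "\<dots> = (LINT y|lborel. \<eta> (y - b)) - (LINT y|lborel. \<eta> y)"
    using integrable_test_lborel[OF \<eta>] lborel_integrable_translate[OF integrable_test_lborel[OF \<eta>], of "- b"]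
    by (intro Bochner_Integration.integral_diff) auto
  also have "\<dots> = 0" using tr[OF \<eta>m, of b] by simp
  finally have 0: "(LINT y|lborel. f y * (\<eta> (y - b) - \<eta> y)) = 0" .
  have "(LINT s|unit_uniform. LINT y|lborel. f y * ?D (y - s *\<^sub>R b)) = (LINT s|unit_uniform. LINT y|lborel. ?D y)"
  proof (rule integral_cong_AE)
    show "AE s in unit_uniform. (LINT y|lborel. f y * ?D (y - s *\<^sub>R b)) = (LINT y|lborel. ?D y)"
      using AE_unit_uniform by eventually_elim (simp add: f2 tr[OF Dm])
  qed (use Dm borel_measurable_integrable[OF f] in measurable)
  then show ?thesis
    using integral_test_difference[OF f test_has_derivative[OF \<eta>] test_frechet_direction(1)[OF \<eta>] B] 0 by simp
qed

context bounded_open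
begin

lemma integral_dom_eq_lborel:
  assumes F: "F \<in> borel_measurable borel" "\<And>x. x \<notin> \<Omega> \<Longrightarrow> F x = 0"
  shows "(LINT x|\<Lambda>. F x) = (LINT x|lborel. (F x :: real))"
proof -
  have "(LINT x|\<Lambda>. F x) = (LINT x|lebesgue. indicator \<Omega> x *\<^sub>R F x)"
    by (rule integral_restrict_space) auto
  also have "\<dots> = (LINT x|lebesgue. F x)"
    using F(2) by (intro Bochner_Integration.integral_cong) (auto simp: indicator_def)
  also have "\<dots> = (LINT x|lborel. F x)" using F(1) by (intro integral_completion) auto
  finally show ?thesis .
qed

lemma integral_frechet_test_dom_zero:
  assumes "\<eta> \<in> test_functions \<Omega>" "b \<in> Basis"
  shows "(LINT x|\<Lambda>. frechet_derivative \<eta> (at x) b) = 0"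
  using integral_frechet_test_zero[OF assms] borel_measurable_test[OF test_frechet[OF assms]]
    test_zero_outside_domain[OF test_frechet[OF assms]]
  by (subst integral_dom_eq_lborel) auto

text \<open>The derivative of the test function \<zeta> \<eta> integrates to 0, which by the product
  rule is the integration by parts identity. The bumps that show \<open>H1\<close> to be
  infinite-dimensional enter through it.\<close>

lemma test_in_H1:
  assumes \<zeta>: "\<zeta> \<in> test_functions \<Omega>"
  shows "\<zeta> \<in> H1 \<Omega>"
proof -
  let ?g = "\<lambda>x. \<Sum>b\<in>Basis. frechet_derivative \<zeta> (at x) b *\<^sub>R b"
  have comp: "?g x \<bullet> b = frechet_derivative \<zeta> (at x) b" if "b \<in> Basis" for x b
    using that by simp
  obtain B where B: "\<And>x. \<bar>\<zeta> x\<bar> \<le> B" using test_bounded[OF \<zeta>] by blast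
  have s: "square_integrable \<Lambda> \<zeta>"
    by (rule square_integrable_bounded[OF finite_measure_dom measurable_test_dom[OF \<zeta>], where B = B]) (simp add: B)
  have "square_integrable \<Lambda> (\<lambda>x. frechet_derivative \<zeta> (at x) b *\<^sub>R b)" if b: "b \<in> Basis" for b
  proof -
    obtain B where B: "\<And>x. \<bar>frechet_derivative \<zeta> (at x) b\<bar> \<le> B" using test_bounded[OF test_frechet[OF \<zeta> b]] by blast
    show ?thesis
      by (rule square_integrable_bounded[OF finite_measure_dom, where B = B])
        (use b in \<open>auto simp: B intro!: borel_measurable_scaleR measurable_test_dom[OF test_frechet[OF \<zeta> b]]\<close>)
  qed
  note sq = this
  have "square_integrable \<Lambda> (\<lambda>x. \<Sum>b\<in>A. frechet_derivative \<zeta> (at x) b *\<^sub>R b)" if "finite A" "A \<subseteq> Basis" for A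
    using that by (induction A rule: finite_induct) (auto intro: sq square_integrable_zero square_integrable_add)
  then have sg: "square_integrable \<Lambda> ?g" by simp
  have "weak_pair \<zeta> ?g"
    unfolding weak_pair_def
  proof (intro conjI ballI s sg)
    fix \<eta> b assume \<eta>: "\<eta> \<in> test_functions \<Omega>" and b: "b \<in> (Basis :: 'a set)"
    note \<zeta>b = test_frechet[OF \<zeta> b] and \<eta>b = test_frechet[OF \<eta> b]
    obtain B' where B': "\<And>x. \<bar>frechet_derivative \<zeta> (at x) b\<bar> \<le> B'" using test_bounded[OF \<zeta>b] by blast
    have sb: "square_integrable \<Lambda> (\<lambda>x. frechet_derivative \<zeta> (at x) b)"
      by (rule square_integrable_bounded[OF finite_measure_dom measurable_test_dom[OF \<zeta>b], where B = B']) (simp add: B')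
    have der: "frechet_derivative (\<lambda>x. \<zeta> x * \<eta> x) (at x) b = \<zeta> x * frechet_derivative \<eta> (at x) b + frechet_derivative \<zeta> (at x) b * \<eta> x" for x
      using frechet_derivative_at[OF has_derivative_mult[OF test_has_derivative[OF \<zeta>] test_has_derivative[OF \<eta>]], of x, symmetric]
      by simp
    have "(LINT x|\<Lambda>. \<zeta> x * frechet_derivative \<eta> (at x) b + frechet_derivative \<zeta> (at x) b * \<eta> x) = 0"
      using integral_frechet_test_dom_zero[OF test_mult[OF \<zeta> \<eta>] b] unfolding der .
    then show "(LINT x|\<Lambda>. \<zeta> x * frechet_derivative \<eta> (at x) b) = - (LINT x|\<Lambda>. (?g x \<bullet> b) * \<eta> x)"
      unfolding comp[OF b] using integrable_times_test[OF s \<eta>b] integrable_times_test[OF sb \<eta>] by simp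
  qed
  then show ?thesis by (rule weak_pair_H1)
qed

end

section \<open>Differences along segments and the Poincare inequality\<close>

interpretation unit_uniform_lborel: pair_sigma_finite unit_uniform "lborel :: 'a::euclidean_space measure" ..

lemma integrable_mult_bounded:
  fixes f \<zeta> :: "'a::euclidean_space \<Rightarrow> real"
  assumes f: "integrable lborel f" and \<zeta>: "\<zeta> \<in> borel_measurable borel" "\<And>x. \<bar>\<zeta> x\<bar> \<le> B"
  shows "integrable lborel (\<lambda>x. f x * \<zeta> x)"
proof (rule Bochner_Integration.integrable_bound)
  show "integrable lborel (\<lambda>x. B * f x)" using f by simp
  show "(\<lambda>x. f x * \<zeta> x) \<in> borel_measurable lborel"
    using borel_measurable_integrable[OF f] \<zeta>(1) by measurable
  have "\<bar>\<zeta> x\<bar> * \<bar>f x\<bar> \<le> \<bar>B\<bar> * \<bar>f x\<bar>" for x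
    using \<zeta>(2)[of x] by (intro mult_right_mono) auto
  then show "AE x in lborel. norm (f x * \<zeta> x) \<le> norm (B * f x)"
    by (simp add: abs_mult mult.commute)
qed

text \<open>Jensen's inequality for the square. In \<open>ennreal\<close> it also covers an infinite
  second moment, so that no integrability along individual segments has to be established.\<close>

lemma (in prob_space) expectation_square_le:
  fixes f :: "'a \<Rightarrow> real"
  assumes f: "f \<in> borel_measurable M"
  shows "ennreal ((expectation f)\<^sup>2) \<le> (\<integral>\<^sup>+x. ennreal ((f x)\<^sup>2) \<partial>M)"
proof (cases "integrable M (\<lambda>x. (f x)\<^sup>2)")
  case True
  then have "square_integrable M f" using f by (simp add: square_integrable_def)
  from integral_norm_le_L2[OF this] have "expectation (\<lambda>x. \<bar>f x\<bar>) \<le> sqrt (expectation (\<lambda>x. (f x)\<^sup>2))"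
    by (simp add: prob_space)
  then have "\<bar>expectation f\<bar> \<le> sqrt (expectation (\<lambda>x. (f x)\<^sup>2))"
    using integral_abs_bound[of M f] by linarith
  then have "(expectation f)\<^sup>2 \<le> expectation (\<lambda>x. (f x)\<^sup>2)"
    by (rule sqrt_ge_absD)
  then show ?thesis using True by (simp add: nn_integral_eq_integral ennreal_leI)
next
  case False
  then have "(\<integral>\<^sup>+x. ennreal ((f x)\<^sup>2) \<partial>M) = \<infinity>"
    using f by (auto simp: integrable_iff_bounded less_top[symmetric])
  then show ?thesis by simp
qed

context bounded_open
begin

lemma AE_dom_iff: "(AE x in \<Lambda>. P x) \<longleftrightarrow> (AE x in lborel. x \<in> \<Omega> \<longrightarrow> P x)"
  by (simp add: AE_restrict_space_iff AE_completion_iff)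

text \<open>Composition with (x, s) -> x + s h is measurable for the product sigma-algebra when the
  function is Borel, so the Fubini arguments run on Borel representatives. Their vanishing outside
  \<Omega> turns integrals over \<Omega> into integrals over the whole space, where translations
  act.\<close>

lemma ex_borel_rep:
  fixes f :: "'a \<Rightarrow> 'b::euclidean_space"
  assumes f: "f \<in> borel_measurable \<Lambda>"
  shows "\<exists>f0\<in>borel_measurable borel. (\<forall>x. x \<notin> \<Omega> \<longrightarrow> f0 x = 0) \<and> (AE x in \<Lambda>. f x = f0 x)"
proof -
  have "\<exists>F. F \<in> borel_measurable borel \<and> (AE x in lborel. indicator \<Omega> x *\<^sub>R (f x \<bullet> b) = F x)" if "b \<in> Basis" for b
  proof -
    have "(\<lambda>x. f x \<bullet> b) \<in> borel_measurable \<Lambda>"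
      using f by (intro borel_measurable_inner) auto
    then have "(\<lambda>x. indicator \<Omega> x *\<^sub>R (f x \<bullet> b)) \<in> borel_measurable lebesgue"
      by (subst (asm) borel_measurable_restrict_space_iff) auto
    from completion_ex_borel_measurable_real[OF this] show ?thesis by auto
  qed
  then obtain F where F: "\<And>b. b \<in> Basis \<Longrightarrow> F b \<in> borel_measurable borel"
    "\<And>b. b \<in> Basis \<Longrightarrow> AE x in lborel. indicator \<Omega> x *\<^sub>R (f x \<bullet> b) = F b x" by metis
  define f0 where "f0 x = indicator \<Omega> x *\<^sub>R (\<Sum>b\<in>Basis. F b x *\<^sub>R b)" for x
  have "f0 \<in> borel_measurable borel"
    unfolding f0_def using open_dom
    by (intro borel_measurable_scaleR borel_measurable_sum F borel_measurable_indicator) auto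
  moreover have "AE x in lborel. \<forall>b\<in>Basis. indicator \<Omega> x *\<^sub>R (f x \<bullet> b) = F b x"
    by (intro AE_finite_allI F) auto
  then have "AE x in \<Lambda>. f x = f0 x"
    unfolding AE_dom_iff
    by eventually_elim (auto simp: f0_def intro!: euclidean_eqI[where 'a = 'b])
  ultimately show ?thesis by (intro bexI[of _ f0]) (auto simp: f0_def)
qed

lemma nn_integral_rep:
  assumes f: "square_integrable \<Lambda> f" and f0: "\<And>x. x \<notin> \<Omega> \<Longrightarrow> f0 x = 0" "AE x in \<Lambda>. f x = f0 x"
    and A: "A \<in> sets borel"
  shows "(\<integral>\<^sup>+x. indicator A x * ennreal ((norm (f0 x))\<^sup>2) \<partial>lborel) = ennreal (LINT x|\<Lambda>. indicator A x * (norm (f x))\<^sup>2)"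
proof -
  have A\<Lambda>: "indicator A \<in> borel_measurable \<Lambda>"
    using A by (intro measurable_restrict_space1 borel_measurable_indicator) auto
  have int: "integrable \<Lambda> (\<lambda>x. indicator A x * (norm (f x))\<^sup>2)"
  proof (rule Bochner_Integration.integrable_bound)
    show "integrable \<Lambda> (\<lambda>x. (norm (f x))\<^sup>2)" using f by (simp add: square_integrable_def)
    show "(\<lambda>x. indicator A x * (norm (f x))\<^sup>2) \<in> borel_measurable \<Lambda>"
      using f by (intro borel_measurable_times A\<Lambda>) (auto simp: square_integrable_def)
  qed (auto simp: indicator_def)
  have "ennreal (LINT x|\<Lambda>. indicator A x * (norm (f x))\<^sup>2) = (\<integral>\<^sup>+x. ennreal (indicator A x * (norm (f x))\<^sup>2) \<partial>\<Lambda>)"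
    by (rule nn_integral_eq_integral[OF int, symmetric]) auto
  also have "\<dots> = (\<integral>\<^sup>+x. indicator A x * ennreal ((norm (f0 x))\<^sup>2) \<partial>\<Lambda>)"
    using f0(2) by (intro nn_integral_cong_AE) (auto elim!: eventually_mono simp: indicator_def)
  also have "\<dots> = (\<integral>\<^sup>+x. indicator A x * ennreal ((norm (f0 x))\<^sup>2) * indicator \<Omega> x \<partial>lebesgue)"
    by (rule nn_integral_restrict_space) auto
  also have "\<dots> = (\<integral>\<^sup>+x. indicator A x * ennreal ((norm (f0 x))\<^sup>2) \<partial>lborel)"
    unfolding nn_integral_completion using f0(1) by (intro nn_integral_cong) (auto simp: indicator_def)
  finally show ?thesis by simp
qed

lemma integral_rep:
  fixes f f0 :: "'a \<Rightarrow> real"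
  assumes f0: "f0 \<in> borel_measurable borel" "\<And>x. x \<notin> \<Omega> \<Longrightarrow> f0 x = 0" "AE x in \<Lambda>. f x = f0 x"
    and f: "f \<in> borel_measurable \<Lambda>" and \<zeta>: "\<zeta> \<in> borel_measurable borel"
  shows "(LINT x|\<Lambda>. f x * \<zeta> x) = (LINT x|lborel. f0 x * \<zeta> x)"
proof -
  have \<zeta>': "\<zeta> \<in> borel_measurable \<Lambda>" "f0 \<in> borel_measurable \<Lambda>"
    using \<zeta> f0(1) by (auto intro!: measurable_restrict_space1 measurable_completion)
  have "(LINT x|\<Lambda>. f x * \<zeta> x) = (LINT x|\<Lambda>. f0 x * \<zeta> x)"
    using f0(3) f \<zeta>' by (intro integral_cong_AE) (auto elim!: eventually_mono)
  also have "\<dots> = (LINT x|lborel. f0 x * \<zeta> x)"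
    using f0 \<zeta> by (intro integral_dom_eq_lborel) auto
  finally show ?thesis .
qed

lemma integrable_rep:
  fixes f0 :: "'a \<Rightarrow> 'b::euclidean_space"
  assumes f: "square_integrable \<Lambda> f" and f0: "f0 \<in> borel_measurable borel" "\<And>x. x \<notin> \<Omega> \<Longrightarrow> f0 x = 0" "AE x in \<Lambda>. f x = f0 x"
  shows "integrable lborel f0"
proof -
  have "f0 \<in> borel_measurable \<Lambda>" using f0(1) by (auto intro!: measurable_restrict_space1 measurable_completion)
  then have "integrable \<Lambda> f0"
    using integrable_cong_AE[OF _ _ f0(3)] integrable_dom[OF f] f by (simp add: square_integrable_def)
  then have "integrable lebesgue (\<lambda>x. indicator \<Omega> x *\<^sub>R f0 x)"
    by (subst (asm) integrable_restrict_space) auto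
  moreover have "indicator \<Omega> x *\<^sub>R f0 x = f0 x" for x using f0(2)[of x] by (cases "x \<in> \<Omega>") auto
  ultimately show ?thesis using f0(1) by (simp add: integrable_completion)
qed

definition borel_weak_pair :: "('a \<Rightarrow> real) \<Rightarrow> ('a \<Rightarrow> 'a) \<Rightarrow> bool" where
  "borel_weak_pair u g \<longleftrightarrow> integrable lborel u \<and> integrable lborel g \<and>
    (\<forall>\<eta>\<in>test_functions \<Omega>. \<forall>b\<in>Basis. (LINT x|lborel. u x * frechet_derivative \<eta> (at x) b) = - (LINT x|lborel. (g x \<bullet> b) * \<eta> x))"

lemma weak_pair_borel_rep:
  assumes "weak_pair u g"
  shows "\<exists>u0 g0. borel_weak_pair u0 g0 \<and> (\<forall>x. x \<notin> \<Omega> \<longrightarrow> u0 x = 0) \<and> (\<forall>x. x \<notin> \<Omega> \<longrightarrow> g0 x = 0) \<and>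
    (AE x in \<Lambda>. u x = u0 x) \<and> (AE x in \<Lambda>. g x = g0 x)"
proof -
  have ug: "square_integrable \<Lambda> u" "square_integrable \<Lambda> g"
    and eq: "\<And>\<eta> b. \<eta> \<in> test_functions \<Omega> \<Longrightarrow> b \<in> Basis \<Longrightarrow> (LINT x|\<Lambda>. u x * frechet_derivative \<eta> (at x) b) = - (LINT x|\<Lambda>. (g x \<bullet> b) * \<eta> x)"
    using assms by (auto simp: weak_pair_def)
  obtain u0 where u0: "u0 \<in> borel_measurable borel" "\<And>x. x \<notin> \<Omega> \<Longrightarrow> u0 x = 0" "AE x in \<Lambda>. u x = u0 x"
    using ex_borel_rep[OF square_integrable_measurable[OF ug(1)]] by auto
  obtain g0 where g0: "g0 \<in> borel_measurable borel" "\<And>x. x \<notin> \<Omega> \<Longrightarrow> g0 x = 0" "AE x in \<Lambda>. g x = g0 x"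
    using ex_borel_rep[OF square_integrable_measurable[OF ug(2)]] by auto
  have "borel_weak_pair u0 g0"
    unfolding borel_weak_pair_def
  proof (intro conjI ballI)
    show "integrable lborel u0" using integrable_rep[OF ug(1) u0] .
    show "integrable lborel g0" using integrable_rep[OF ug(2) g0] .
    fix \<eta> b assume \<eta>: "\<eta> \<in> test_functions \<Omega>" and b: "b \<in> (Basis :: 'a set)"
    have "(LINT x|\<Lambda>. u x * frechet_derivative \<eta> (at x) b) = (LINT x|lborel. u0 x * frechet_derivative \<eta> (at x) b)"
      by (rule integral_rep[OF u0 square_integrable_measurable[OF ug(1)] borel_measurable_test[OF test_frechet[OF \<eta> b]]])
    moreover have "(LINT x|\<Lambda>. (g x \<bullet> b) * \<eta> x) = (LINT x|lborel. (g0 x \<bullet> b) * \<eta> x)"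
    proof (rule integral_rep)
      show "AE x in \<Lambda>. g x \<bullet> b = g0 x \<bullet> b" using g0(3) by eventually_elim simp
      show "(\<lambda>x. g x \<bullet> b) \<in> borel_measurable \<Lambda>"
        using ug(2) by (intro borel_measurable_inner) (auto simp: square_integrable_def)
    qed (use g0 borel_measurable_test[OF \<eta>] in auto)
    ultimately show "(LINT x|lborel. u0 x * frechet_derivative \<eta> (at x) b) = - (LINT x|lborel. (g0 x \<bullet> b) * \<eta> x)"
      using eq[OF \<eta> b] by simp
  qed
  then show ?thesis using u0 g0 by blast
qed

lemma borel_weak_pair_direction:
  assumes ug: "borel_weak_pair u g" and \<eta>: "\<eta> \<in> test_functions \<Omega>"
  shows "(LINT x|lborel. u x * frechet_derivative \<eta> (at x) h) = - (LINT x|lborel. (g x \<bullet> h) * \<eta> x)"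
proof -
  have u: "integrable lborel u" and g: "integrable lborel g"
    and id: "\<And>b. b \<in> Basis \<Longrightarrow> (LINT x|lborel. u x * frechet_derivative \<eta> (at x) b) = - (LINT x|lborel. (g x \<bullet> b) * \<eta> x)"
    using ug \<eta> by (auto simp: borel_weak_pair_def)
  obtain B where B: "\<And>x. \<bar>\<eta> x\<bar> \<le> B" using test_bounded[OF \<eta>] by blast
  have i1: "integrable lborel (\<lambda>x. u x * frechet_derivative \<eta> (at x) b)" if b: "b \<in> Basis" for b
  proof -
    obtain B where B: "\<And>x. \<bar>frechet_derivative \<eta> (at x) b\<bar> \<le> B" using test_bounded[OF test_frechet[OF \<eta> b]] by blast
    show ?thesis by (rule integrable_mult_bounded[OF u borel_measurable_test[OF test_frechet[OF \<eta> b]] B])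
  qed
  have i2: "integrable lborel (\<lambda>x. (g x \<bullet> b) * \<eta> x)" for b
    by (rule integrable_mult_bounded[OF _ borel_measurable_test[OF \<eta>] B]) (use g in auto)
  have "(LINT x|lborel. u x * frechet_derivative \<eta> (at x) h) = (LINT x|lborel. (\<Sum>b\<in>Basis. (h \<bullet> b) * (u x * frechet_derivative \<eta> (at x) b)))"
    unfolding test_frechet_direction(3)[OF \<eta>, of _ h] by (simp add: sum_distrib_left mult.left_commute)
  also have "\<dots> = (\<Sum>b\<in>Basis. (h \<bullet> b) * (LINT x|lborel. u x * frechet_derivative \<eta> (at x) b))"
    using i1 by simp
  also have "\<dots> = - (\<Sum>b\<in>Basis. (h \<bullet> b) * (LINT x|lborel. (g x \<bullet> b) * \<eta> x))"
    by (simp add: id sum_negf)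
  also have "(\<Sum>b\<in>Basis. (h \<bullet> b) * (LINT x|lborel. (g x \<bullet> b) * \<eta> x)) = (LINT x|lborel. (\<Sum>b\<in>Basis. (h \<bullet> b) * ((g x \<bullet> b) * \<eta> x)))"
    using i2 by simp
  also have "\<dots> = (LINT x|lborel. (g x \<bullet> h) * \<eta> x)"
  proof (intro Bochner_Integration.integral_cong refl)
    fix x
    have "g x \<bullet> h = (\<Sum>b\<in>Basis. (h \<bullet> b) * (g x \<bullet> b))"
      by (subst euclidean_inner) (simp add: mult.commute)
    then show "(\<Sum>b\<in>Basis. (h \<bullet> b) * ((g x \<bullet> b) * \<eta> x)) = (g x \<bullet> h) * \<eta> x"
      by (simp add: sum_distrib_right mult.assoc)
  qed
  finally show ?thesis .
qed

text \<open>The complement is the sum of the closed complement of \<Omega> and a compact segment,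
  hence closed.\<close>

lemma open_segment_domain: "open {x. \<forall>s\<in>{0..1}. x + s *\<^sub>R h \<in> \<Omega>}"
proof -
  have "compact ((\<lambda>s. - (s *\<^sub>R h)) ` {0..1::real})"
    by (intro compact_continuous_image continuous_intros) auto
  moreover have "closed (- \<Omega>)" using open_dom by (rule closed_Compl)
  ultimately have "closed (\<Union>x\<in>- \<Omega>. \<Union>y\<in>(\<lambda>s. - (s *\<^sub>R h)) ` {0..1}. {x + y})"
    by (intro closed_compact_sums)
  moreover have "(\<Union>x\<in>- \<Omega>. \<Union>y\<in>(\<lambda>s. - (s *\<^sub>R h)) ` {0..1}. {x + y}) = - {x. \<forall>s\<in>{0..1}. x + s *\<^sub>R h \<in> \<Omega>}"
  proof (intro set_eqI iffI)
    fix x assume "x \<in> - {x. \<forall>s\<in>{0..1}. x + s *\<^sub>R h \<in> \<Omega>}"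
    then obtain s where s: "s \<in> {0..1}" "x + s *\<^sub>R h \<notin> \<Omega>" by blast
    have "x = (x + s *\<^sub>R h) + - (s *\<^sub>R h)" by simp
    with s show "x \<in> (\<Union>x\<in>- \<Omega>. \<Union>y\<in>(\<lambda>s. - (s *\<^sub>R h)) ` {0..1}. {x + y})" by blast
  next
    fix x assume "x \<in> (\<Union>x\<in>- \<Omega>. \<Union>y\<in>(\<lambda>s. - (s *\<^sub>R h)) ` {0..1}. {x + y})"
    then obtain y s where s: "y \<notin> \<Omega>" "s \<in> {0..1}" "x = y + - (s *\<^sub>R h)" by blast
    then have "x + s *\<^sub>R h \<notin> \<Omega>" by simp
    with s(2) show "x \<in> - {x. \<forall>s\<in>{0..1}. x + s *\<^sub>R h \<in> \<Omega>}" by blast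
  qed
  ultimately show ?thesis by (simp only: open_closed)
qed

text \<open>By duality: for \<eta> supported where whole segments stay in \<Omega>, the translates
  of \<eta> along the segment are again test functions on \<Omega>, so testing u (x + h) - u x
  produces the averaged gradient. The fundamental lemma removes the test function.\<close>

lemma translation_formula:
  assumes ug: "borel_weak_pair u g"
  shows "AE x in lborel. (\<forall>s\<in>{0..1}. x + s *\<^sub>R h \<in> \<Omega>) \<longrightarrow> u (x + h) - u x = (LINT s|unit_uniform. g (x + s *\<^sub>R h) \<bullet> h)"
proof -
  define \<Omega>h where "\<Omega>h = {x. \<forall>s\<in>{0..1}. x + s *\<^sub>R h \<in> \<Omega>}"
  have sub: "\<Omega>h \<subseteq> \<Omega>" by (force simp: \<Omega>h_def dest: bspec[of _ _ 0])
  interpret h: bounded_open \<Omega>h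
    using open_segment_domain bounded_subset[OF bounded_dom sub] by unfold_locales (auto simp: \<Omega>h_def)
  have u: "integrable lborel u" and g: "integrable lborel g" using ug by (auto simp: borel_weak_pair_def)
  have um[measurable]: "u \<in> borel_measurable borel" and gm[measurable]: "g \<in> borel_measurable borel"
    using borel_measurable_integrable[OF u] borel_measurable_integrable[OF g] by auto
  have gh: "integrable lborel (\<lambda>x. g x \<bullet> h)" using g by simp
  have P: "integrable (unit_uniform \<Otimes>\<^sub>M lborel) (\<lambda>(s, x). g (x + s *\<^sub>R h) \<bullet> h)"
  proof (rule unit_uniform_lborel.Fubini_integrable)
    show "(\<lambda>(s, x). g (x + s *\<^sub>R h) \<bullet> h) \<in> borel_measurable (unit_uniform \<Otimes>\<^sub>M lborel)" by measurable
    have "(LINT x|lborel. norm (g (x + s *\<^sub>R h) \<bullet> h)) = (LINT x|lborel. norm (g x \<bullet> h))" for s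
      using lborel_integral_translate[of "\<lambda>x. norm (g x \<bullet> h)" "s *\<^sub>R h"] by (simp add: add.commute)
    then show "integrable unit_uniform (\<lambda>s. LINT x|lborel. norm (case (s, x) of (s, x) \<Rightarrow> g (x + s *\<^sub>R h) \<bullet> h))"
      by simp
    show "AE s in unit_uniform. integrable lborel (\<lambda>x. case (s, x) of (s, x) \<Rightarrow> g (x + s *\<^sub>R h) \<bullet> h)"
    proof (intro always_eventually allI)
      show "integrable lborel (\<lambda>x. case (s, x) of (s, x) \<Rightarrow> g (x + s *\<^sub>R h) \<bullet> h)" for s
        using lborel_integrable_translate[OF gh, of "s *\<^sub>R h"] by (simp add: add.commute)
    qed
  qed
  define A where "A x = (LINT s|unit_uniform. g (x + s *\<^sub>R h) \<bullet> h)" for x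
  have A: "integrable lborel A"
    unfolding A_def by (rule unit_uniform_lborel.integrable_snd) (use P in simp)
  have Am[measurable]: "A \<in> borel_measurable borel" using borel_measurable_integrable[OF A] by simp
  define F where "F x = u (x + h) - u x - A x" for x
  have uh: "integrable lborel (\<lambda>x. u (x + h))" using lborel_integrable_translate[OF u, of h] by (simp add: add.commute)
  have F: "integrable lborel F" unfolding F_def using uh u A by simp
  have Fm[measurable]: "F \<in> borel_measurable borel" using borel_measurable_integrable[OF F] by simp
  have "AE x in lebesgue_on \<Omega>h. F x = 0"
  proof (rule fundamental_lemma_calculus_of_variations[OF h.open_dom])
    fix K assume K: "compact K" "K \<subseteq> \<Omega>h"
    then have Kb: "K \<in> sets borel" by (simp add: compact_imp_closed)
    have "integrable lborel (\<lambda>x. indicator K x *\<^sub>R F x)"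
      using Kb by (intro integrable_mult_indicator F) simp
    then have "integrable lebesgue (\<lambda>x. indicator K x *\<^sub>R F x)"
      using Kb by (subst integrable_completion) auto
    then show "integrable (lebesgue_on K) F"
      using Kb by (subst integrable_restrict_space) auto
  next
    fix \<eta> assume \<eta>: "\<eta> \<in> test_functions \<Omega>h"
    have \<eta>m[measurable]: "\<eta> \<in> borel_measurable borel" by (rule borel_measurable_test[OF \<eta>])
    obtain B where B: "\<And>x. \<bar>\<eta> x\<bar> \<le> B" using test_bounded[OF \<eta>] by blast
    obtain B' where B': "\<And>x. \<bar>frechet_derivative \<eta> (at x) h\<bar> \<le> B'" using test_frechet_direction(2)[OF \<eta>] by blast
    have Dm[measurable]: "(\<lambda>x. frechet_derivative \<eta> (at x) h) \<in> borel_measurable borel"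
      using test_frechet_direction(1)[OF \<eta>] by (rule borel_measurable_continuous_onI)
    have iu: "integrable lborel (\<lambda>x. u (x + h) * \<eta> x)" "integrable lborel (\<lambda>x. u x * \<eta> x)" "integrable lborel (\<lambda>x. A x * \<eta> x)"
      "integrable lborel (\<lambda>x. u x * \<eta> (x - h))"
      by (auto intro!: integrable_mult_bounded[where B = B] uh u A B)
    have "(LINT x|lborel. (u (x + h) - u x) * \<eta> x) = (LINT x|lborel. u (x + h) * \<eta> x) - (LINT x|lborel. u x * \<eta> x)"
      using iu by (simp add: left_diff_distrib)
    also have "(LINT x|lborel. u (x + h) * \<eta> x) = (LINT x|lborel. u x * \<eta> (x - h))"
      using lborel_integral_translate[of "\<lambda>x. u x * \<eta> (x - h)" h] by (simp add: add.commute)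
    also have "\<dots> - (LINT x|lborel. u x * \<eta> x) = (LINT x|lborel. u x * (\<eta> (x - h) - \<eta> x))"
      using iu by (simp add: right_diff_distrib)
    also have "\<dots> = - (LINT s|unit_uniform. LINT y|lborel. u y * frechet_derivative \<eta> (at (y - s *\<^sub>R h)) h)"
      by (rule integral_test_difference[OF u test_has_derivative[OF \<eta>] test_frechet_direction(1)[OF \<eta>] B'])
    also have "\<dots> = - (LINT s|unit_uniform. - (LINT x|lborel. (g (x + s *\<^sub>R h) \<bullet> h) * \<eta> x))"
    proof -
      have "AE s in unit_uniform. (LINT y|lborel. u y * frechet_derivative \<eta> (at (y - s *\<^sub>R h)) h) = - (LINT x|lborel. (g (x + s *\<^sub>R h) \<bullet> h) * \<eta> x)"
        using AE_unit_uniform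
      proof eventually_elim
        case (elim s)
        \<comment> \<open>The support of \<eta> lies in \<open>\<Omega>h\<close>, so its shift by s
          h stays in \<Omega> for s in the unit interval and the weak gradient identity applies to
          the translate.\<close>
        have *: "x + s *\<^sub>R h \<in> \<Omega>" if "x \<in> closure {x. \<eta> x \<noteq> 0}" for x
          using that \<eta> elim by (auto simp: test_functions_def \<Omega>h_def)
        have "(LINT y|lborel. u y * frechet_derivative \<eta> (at (y - s *\<^sub>R h)) h) = - (LINT y|lborel. (g y \<bullet> h) * \<eta> (y - s *\<^sub>R h))"
          using borel_weak_pair_direction[OF ug test_translate(1)[OF \<eta> *], of h] test_translate(2)[OF \<eta> *] by simp
        also have "(LINT y|lborel. (g y \<bullet> h) * \<eta> (y - s *\<^sub>R h)) = (LINT x|lborel. (g (x + s *\<^sub>R h) \<bullet> h) * \<eta> x)"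
          using lborel_integral_translate[of "\<lambda>y. (g y \<bullet> h) * \<eta> (y - s *\<^sub>R h)" "s *\<^sub>R h"] by (simp add: add.commute)
        finally show ?case .
      qed
      then have "(LINT s|unit_uniform. LINT y|lborel. u y * frechet_derivative \<eta> (at (y - s *\<^sub>R h)) h) =
          (LINT s|unit_uniform. - (LINT x|lborel. (g (x + s *\<^sub>R h) \<bullet> h) * \<eta> x))"
        by (intro integral_cong_AE) measurable
      then show ?thesis by simp
    qed
    also have "\<dots> = (LINT s|unit_uniform. LINT x|lborel. (g (x + s *\<^sub>R h) \<bullet> h) * \<eta> x)" by simp
    also have "\<dots> = (LINT x|lborel. LINT s|unit_uniform. (g (x + s *\<^sub>R h) \<bullet> h) * \<eta> x)"
    proof (rule unit_uniform_lborel.Fubini_integral[symmetric])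
      show "integrable (unit_uniform \<Otimes>\<^sub>M lborel) (\<lambda>(s, x). (g (x + s *\<^sub>R h) \<bullet> h) * \<eta> x)"
      proof (rule Bochner_Integration.integrable_bound)
        show "integrable (unit_uniform \<Otimes>\<^sub>M lborel) (\<lambda>z. \<bar>B\<bar> * (case z of (s, x) \<Rightarrow> g (x + s *\<^sub>R h) \<bullet> h))"
          using P by simp
        have "\<bar>g (x + s *\<^sub>R h) \<bullet> h\<bar> * \<bar>\<eta> x\<bar> \<le> \<bar>g (x + s *\<^sub>R h) \<bullet> h\<bar> * \<bar>B\<bar>" for s x
          using B[of x] by (intro mult_left_mono) auto
        then show "AE z in unit_uniform \<Otimes>\<^sub>M lborel. norm (case z of (s, x) \<Rightarrow> (g (x + s *\<^sub>R h) \<bullet> h) * \<eta> x) \<le>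
            norm (\<bar>B\<bar> * (case z of (s, x) \<Rightarrow> g (x + s *\<^sub>R h) \<bullet> h))"
          by (auto simp: abs_mult mult.commute)
      qed measurable
    qed
    also have "\<dots> = (LINT x|lborel. A x * \<eta> x)" by (simp add: A_def)
    finally have "(LINT x|lborel. (u (x + h) - u x) * \<eta> x) = (LINT x|lborel. A x * \<eta> x)" .
    moreover have "(LINT x|lborel. (u (x + h) - u x) * \<eta> x - A x * \<eta> x) = (LINT x|lborel. (u (x + h) - u x) * \<eta> x) - (LINT x|lborel. A x * \<eta> x)"
      using iu by (intro Bochner_Integration.integral_diff) (auto simp: left_diff_distrib)
    ultimately have "(LINT x|lborel. F x * \<eta> x) = 0"
      by (simp add: F_def left_diff_distrib)
    then show "(LINT x|lebesgue_on \<Omega>h. F x * \<eta> x) = 0"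
      using test_zero_outside_domain[OF \<eta>] by (subst h.integral_dom_eq_lborel) auto
  qed
  then show ?thesis
    unfolding h.AE_dom_iff by eventually_elim (auto simp: \<Omega>h_def F_def A_def)
qed

text \<open>Jensen in s bounds the squared difference by |h|^2 times the average of |g|^2 over the
  segment. Integrating in x first, every s gives the same integral of |g|^2 over B by translation
  invariance.\<close>

lemma translation_estimate:
  assumes ug: "borel_weak_pair u g" and A[measurable]: "A \<in> sets borel" and B[measurable]: "B \<in> sets borel" "B \<subseteq> \<Omega>"
    and seg: "\<And>x s. x \<in> A \<Longrightarrow> s \<in> {0..1} \<Longrightarrow> x + s *\<^sub>R h \<in> B"
  shows "(\<integral>\<^sup>+x. indicator A x * ennreal ((u (x + h) - u x)\<^sup>2) \<partial>lborel) \<le>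
    ennreal ((norm h)\<^sup>2) * (\<integral>\<^sup>+x. indicator B x * ennreal ((norm (g x))\<^sup>2) \<partial>lborel)"
proof -
  have [measurable]: "u \<in> borel_measurable borel" "g \<in> borel_measurable borel"
    using ug by (auto simp: borel_weak_pair_def dest: borel_measurable_integrable)
  have "AE x in lborel. indicator A x * ennreal ((u (x + h) - u x)\<^sup>2) \<le>
      (\<integral>\<^sup>+s. ennreal ((norm h)\<^sup>2) * (indicator B (x + s *\<^sub>R h) * ennreal ((norm (g (x + s *\<^sub>R h)))\<^sup>2)) \<partial>unit_uniform)"
    using translation_formula[OF ug, of h]
  proof eventually_elim
    case (elim x)
    show ?case
    proof (cases "x \<in> A")
      case True
      then have "u (x + h) - u x = (LINT s|unit_uniform. g (x + s *\<^sub>R h) \<bullet> h)"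
        using elim seg B(2) by blast
      then have "ennreal ((u (x + h) - u x)\<^sup>2) \<le> (\<integral>\<^sup>+s. ennreal ((g (x + s *\<^sub>R h) \<bullet> h)\<^sup>2) \<partial>unit_uniform)"
        using unit_uniform.expectation_square_le[of "\<lambda>s. g (x + s *\<^sub>R h) \<bullet> h"] by simp
      also have "\<dots> \<le> (\<integral>\<^sup>+s. ennreal ((norm h)\<^sup>2) * (indicator B (x + s *\<^sub>R h) * ennreal ((norm (g (x + s *\<^sub>R h)))\<^sup>2)) \<partial>unit_uniform)"
      proof (rule nn_integral_mono_AE)
        show "AE s in unit_uniform. ennreal ((g (x + s *\<^sub>R h) \<bullet> h)\<^sup>2) \<le> ennreal ((norm h)\<^sup>2) * (indicator B (x + s *\<^sub>R h) * ennreal ((norm (g (x + s *\<^sub>R h)))\<^sup>2))"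
          using AE_unit_uniform
        proof eventually_elim
          case (elim s)
          have "(g (x + s *\<^sub>R h) \<bullet> h)\<^sup>2 \<le> (norm (g (x + s *\<^sub>R h)) * norm h)\<^sup>2"
            using Cauchy_Schwarz_ineq2[of "g (x + s *\<^sub>R h)" h] by (metis abs_ge_zero power2_abs power_mono)
          then show ?case
            using seg[OF True elim] by (simp add: power_mult_distrib mult.commute flip: ennreal_mult)
        qed
      qed
      finally show ?thesis using True by simp
    qed simp
  qed
  then have "(\<integral>\<^sup>+x. indicator A x * ennreal ((u (x + h) - u x)\<^sup>2) \<partial>lborel) \<le>
      (\<integral>\<^sup>+x. \<integral>\<^sup>+s. ennreal ((norm h)\<^sup>2) * (indicator B (x + s *\<^sub>R h) * ennreal ((norm (g (x + s *\<^sub>R h)))\<^sup>2)) \<partial>unit_uniform \<partial>lborel)"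
    by (rule nn_integral_mono_AE)
  also have "\<dots> = (\<integral>\<^sup>+s. \<integral>\<^sup>+x. ennreal ((norm h)\<^sup>2) * (indicator B (x + s *\<^sub>R h) * ennreal ((norm (g (x + s *\<^sub>R h)))\<^sup>2)) \<partial>lborel \<partial>unit_uniform)"
    by (rule lborel_unit_uniform.Fubini'[symmetric]) measurable
  also have "\<dots> = (\<integral>\<^sup>+s. \<integral>\<^sup>+x. ennreal ((norm h)\<^sup>2) * (indicator B x * ennreal ((norm (g x))\<^sup>2)) \<partial>lborel \<partial>unit_uniform)"
  proof -
    have "(\<integral>\<^sup>+x. ennreal ((norm h)\<^sup>2) * (indicator B (x + s *\<^sub>R h) * ennreal ((norm (g (x + s *\<^sub>R h)))\<^sup>2)) \<partial>lborel) =
        (\<integral>\<^sup>+x. ennreal ((norm h)\<^sup>2) * (indicator B x * ennreal ((norm (g x))\<^sup>2)) \<partial>lborel)" for s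
      using lborel_nn_integral_translate[of "\<lambda>x. ennreal ((norm h)\<^sup>2) * (indicator B x * ennreal ((norm (g x))\<^sup>2))" "s *\<^sub>R h"]
      by (simp add: add.commute)
    then show ?thesis by simp
  qed
  also have "\<dots> = ennreal ((norm h)\<^sup>2) * (\<integral>\<^sup>+x. indicator B x * ennreal ((norm (g x))\<^sup>2) \<partial>lborel)"
    using unit_uniform.emeasure_space_1 by (simp add: nn_integral_cmult)
  finally show ?thesis .
qed

text \<open>Averaging the translation estimate over all differences \<open>h = y - x\<close> of points of \<open>Q\<close> gives a
  Poincare inequality.\<close>

lemma double_integral_le:
  assumes ug: "borel_weak_pair u g" and Q[measurable]: "Q \<in> sets borel" "Q \<subseteq> \<Omega>" and H[measurable]: "H \<in> sets borel"
    and conv: "\<And>x h s. x \<in> Q \<Longrightarrow> x + h \<in> Q \<Longrightarrow> s \<in> {0..1} \<Longrightarrow> x + s *\<^sub>R h \<in> Q"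
    and diff: "\<And>x h. x \<in> Q \<Longrightarrow> x + h \<in> Q \<Longrightarrow> h \<in> H" and \<delta>: "\<And>h. h \<in> H \<Longrightarrow> norm h \<le> \<delta>"
  shows "(\<integral>\<^sup>+x. \<integral>\<^sup>+y. indicator Q x * indicator Q y * ennreal ((u y - u x)\<^sup>2) \<partial>lborel \<partial>lborel) \<le>
    emeasure lborel H * (ennreal (\<delta>\<^sup>2) * (\<integral>\<^sup>+x. indicator Q x * ennreal ((norm (g x))\<^sup>2) \<partial>lborel))"
proof -
  have [measurable]: "u \<in> borel_measurable borel" "g \<in> borel_measurable borel"
    using ug by (auto simp: borel_weak_pair_def dest: borel_measurable_integrable)
  let ?G = "\<integral>\<^sup>+x. indicator Q x * ennreal ((norm (g x))\<^sup>2) \<partial>lborel"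
  have "(\<integral>\<^sup>+y. indicator Q x * indicator Q y * ennreal ((u y - u x)\<^sup>2) \<partial>lborel) =
      (\<integral>\<^sup>+h. indicator Q x * indicator Q (x + h) * ennreal ((u (x + h) - u x)\<^sup>2) \<partial>lborel)" for x
    using lborel_nn_integral_translate[of "\<lambda>y. indicator Q x * indicator Q y * ennreal ((u y - u x)\<^sup>2)" x] by simp
  then have "(\<integral>\<^sup>+x. \<integral>\<^sup>+y. indicator Q x * indicator Q y * ennreal ((u y - u x)\<^sup>2) \<partial>lborel \<partial>lborel) =
      (\<integral>\<^sup>+x. \<integral>\<^sup>+h. indicator Q x * indicator Q (x + h) * ennreal ((u (x + h) - u x)\<^sup>2) \<partial>lborel \<partial>lborel)"
    by simp
  also have "\<dots> = (\<integral>\<^sup>+h. \<integral>\<^sup>+x. indicator Q x * indicator Q (x + h) * ennreal ((u (x + h) - u x)\<^sup>2) \<partial>lborel \<partial>lborel)"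
    by (rule lborel_pair.Fubini'[symmetric]) measurable
  also have "\<dots> \<le> (\<integral>\<^sup>+h. indicator H h * (ennreal (\<delta>\<^sup>2) * ?G) \<partial>lborel)"
  proof (rule nn_integral_mono)
    fix h :: 'a
    define A where "A = {x. x \<in> Q \<and> x + h \<in> Q}"
    have [measurable]: "A \<in> sets borel"
    proof -
      have "A = {x \<in> space borel. x \<in> Q \<and> x + h \<in> Q}" by (simp add: A_def)
      also have "\<dots> \<in> sets borel" by measurable
      finally show ?thesis .
    qed
    have eq: "indicator Q x * indicator Q (x + h) * ennreal ((u (x + h) - u x)\<^sup>2) = indicator A x * ennreal ((u (x + h) - u x)\<^sup>2)" for x
      by (auto simp: A_def indicator_def)
    show "(\<integral>\<^sup>+x. indicator Q x * indicator Q (x + h) * ennreal ((u (x + h) - u x)\<^sup>2) \<partial>lborel) \<le> indicator H h * (ennreal (\<delta>\<^sup>2) * ?G)"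
    proof (cases "h \<in> H")
      case True
      have "(\<integral>\<^sup>+x. indicator A x * ennreal ((u (x + h) - u x)\<^sup>2) \<partial>lborel) \<le> ennreal ((norm h)\<^sup>2) * ?G"
        using conv by (intro translation_estimate[OF ug]) (auto simp: A_def Q)
      also have "\<dots> \<le> ennreal (\<delta>\<^sup>2) * ?G"
        using \<delta>[OF True] by (intro mult_right_mono ennreal_leI power_mono) auto
      finally show ?thesis using True by (simp add: eq)
    next
      case False
      then have "A = {}" using diff by (auto simp: A_def)
      then show ?thesis by (simp add: eq)
    qed
  qed
  also have "\<dots> = emeasure lborel H * (ennreal (\<delta>\<^sup>2) * ?G)"
    by (subst nn_integral_multc) auto
  finally show ?thesis .
qed

text \<open>Expanding (u y - u x)^2 over Q x Q gives 2 |Q| times the integral of u^2 minus twice the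
  square of the integral of u; the factor 1 / 2 on the right is this common 2. The multiplied-out
  form avoids dividing by |Q|.\<close>

lemma Poincare_inequality:
  assumes ug: "weak_pair u g" and Q[measurable]: "Q \<in> sets borel" "Q \<subseteq> \<Omega>" and H: "H \<in> sets borel" "emeasure lborel H < \<infinity>"
    and conv: "\<And>x h s. x \<in> Q \<Longrightarrow> x + h \<in> Q \<Longrightarrow> s \<in> {0..1} \<Longrightarrow> x + s *\<^sub>R h \<in> Q"
    and diff: "\<And>x h. x \<in> Q \<Longrightarrow> x + h \<in> Q \<Longrightarrow> h \<in> H" and \<delta>: "\<And>h. h \<in> H \<Longrightarrow> norm h \<le> \<delta>"
  shows "measure lborel Q * (LINT x|\<Lambda>. indicator Q x * (u x)\<^sup>2) \<le> (LINT x|\<Lambda>. indicator Q x * u x)\<^sup>2 +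
    measure lborel H * \<delta>\<^sup>2 / 2 * (LINT x|\<Lambda>. indicator Q x * (norm (g x))\<^sup>2)"
proof -
  have su: "square_integrable \<Lambda> u" "square_integrable \<Lambda> g" using ug by (auto simp: weak_pair_def)
  obtain u0 g0 where bw: "borel_weak_pair u0 g0" and z: "\<And>x. x \<notin> \<Omega> \<Longrightarrow> u0 x = 0" "\<And>x. x \<notin> \<Omega> \<Longrightarrow> g0 x = 0"
    and eq: "AE x in \<Lambda>. u x = u0 x" "AE x in \<Lambda>. g x = g0 x"
    using weak_pair_borel_rep[OF ug] by blast
  have u0: "integrable lborel u0" using bw by (simp add: borel_weak_pair_def)
  have [measurable]: "u0 \<in> borel_measurable borel" using borel_measurable_integrable[OF u0] by simp
  have Qfin: "emeasure lborel Q < \<infinity>"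
    using emeasure_bounded_finite[OF bounded_subset[OF bounded_dom Q(2)]] by simp
  define m where "m = measure lborel Q"
  define I1 where "I1 = (LINT x|lborel. indicator Q x * u0 x)"
  define I2 where "I2 = (LINT x|lborel. indicator Q x * (u0 x)\<^sup>2)"
  have i0: "integrable lborel (indicator Q :: 'a \<Rightarrow> real)"
    using Qfin by (intro integrable_real_indicator) auto
  have i1: "integrable lborel (\<lambda>x. indicator Q x * u0 x)"
    using integrable_mult_indicator[OF _ u0, of Q] by simp
  have nn2: "(\<integral>\<^sup>+x. ennreal (indicator Q x * (u0 x)\<^sup>2) \<partial>lborel) = ennreal (LINT x|\<Lambda>. indicator Q x * (u x)\<^sup>2)"
    using nn_integral_rep[OF su(1) z(1) eq(1) Q(1)] by (simp add: ennreal_mult' ennreal_indicator)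
  have i2: "integrable lborel (\<lambda>x. indicator Q x * (u0 x)\<^sup>2)"
    using nn2 by (intro integrableI_nonneg) auto
  have I2: "I2 = (LINT x|\<Lambda>. indicator Q x * (u x)\<^sup>2)"
  proof -
    have "ennreal I2 = ennreal (LINT x|\<Lambda>. indicator Q x * (u x)\<^sup>2)"
      using nn2 nn_integral_eq_integral[OF i2] by (simp add: I2_def)
    then show ?thesis by (subst (asm) ennreal_inj) (auto simp: I2_def intro!: integral_nonneg_AE)
  qed
  have I1: "I1 = (LINT x|\<Lambda>. indicator Q x * u x)"
    using integral_rep[OF _ z(1) eq(1) square_integrable_measurable[OF su(1)], of "indicator Q"]
    by (simp add: I1_def mult.commute)
  \<comment> \<open>Expanding the square under the inner integral leaves a quadratic polynomial in
    u0 x whose coefficients are the measure m of Q and the moments \<open>I1\<close> and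
    \<open>I2\<close>.\<close>
  have inner: "(\<integral>\<^sup>+y. indicator Q x * indicator Q y * ennreal ((u0 y - u0 x)\<^sup>2) \<partial>lborel) =
      ennreal (indicator Q x * (I2 - 2 * u0 x * I1 + (u0 x)\<^sup>2 * m))" for x
  proof -
    have int: "integrable lborel (\<lambda>y. indicator Q x * (indicator Q y * (u0 y)\<^sup>2 - 2 * u0 x * (indicator Q y * u0 y) + (u0 x)\<^sup>2 * indicator Q y))"
      using i0 i1 i2 by (intro integrable_mult_right Bochner_Integration.integrable_add Bochner_Integration.integrable_diff) auto
    have e: "indicator Q x * (indicator Q y * (u0 y)\<^sup>2 - 2 * u0 x * (indicator Q y * u0 y) + (u0 x)\<^sup>2 * indicator Q y) =
        indicator Q x * indicator Q y * (u0 y - u0 x)\<^sup>2" for y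
      by (simp add: power2_diff algebra_simps)
    have "(\<integral>\<^sup>+y. indicator Q x * indicator Q y * ennreal ((u0 y - u0 x)\<^sup>2) \<partial>lborel) =
        (\<integral>\<^sup>+y. ennreal (indicator Q x * (indicator Q y * (u0 y)\<^sup>2 - 2 * u0 x * (indicator Q y * u0 y) + (u0 x)\<^sup>2 * indicator Q y)) \<partial>lborel)"
      unfolding e by (intro nn_integral_cong) (simp add: ennreal_mult' ennreal_indicator)
    also have "\<dots> = ennreal (LINT y|lborel. indicator Q x * (indicator Q y * (u0 y)\<^sup>2 - 2 * u0 x * (indicator Q y * u0 y) + (u0 x)\<^sup>2 * indicator Q y))"
      by (rule nn_integral_eq_integral[OF int]) (unfold e, simp)
    also have "(LINT y|lborel. indicator Q x * (indicator Q y * (u0 y)\<^sup>2 - 2 * u0 x * (indicator Q y * u0 y) + (u0 x)\<^sup>2 * indicator Q y)) =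
        indicator Q x * (I2 - 2 * u0 x * I1 + (u0 x)\<^sup>2 * m)"
      using i0 i1 i2 by (simp add: I1_def I2_def m_def)
    finally show ?thesis .
  qed
  have outer: "(\<integral>\<^sup>+x. ennreal (indicator Q x * (I2 - 2 * u0 x * I1 + (u0 x)\<^sup>2 * m)) \<partial>lborel) = ennreal (2 * m * I2 - 2 * I1\<^sup>2)"
  proof -
    have e: "indicator Q x * (I2 - 2 * u0 x * I1 + (u0 x)\<^sup>2 * m) = I2 * indicator Q x - 2 * I1 * (indicator Q x * u0 x) + m * (indicator Q x * (u0 x)\<^sup>2)" for x
      by (simp add: algebra_simps)
    have int: "integrable lborel (\<lambda>x. indicator Q x * (I2 - 2 * u0 x * I1 + (u0 x)\<^sup>2 * m))"
      unfolding e using i0 i1 i2 by (intro Bochner_Integration.integrable_add Bochner_Integration.integrable_diff) auto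
    have nn: "0 \<le> indicator Q x * (I2 - 2 * u0 x * I1 + (u0 x)\<^sup>2 * m)" for x
    proof -
      have "0 \<le> (LINT y|lborel. indicator Q y * (u0 y - u0 x)\<^sup>2)" by (intro integral_nonneg_AE) auto
      also have "\<dots> = (LINT y|lborel. indicator Q y * (u0 y)\<^sup>2 - 2 * u0 x * (indicator Q y * u0 y) + (u0 x)\<^sup>2 * indicator Q y)"
        by (intro Bochner_Integration.integral_cong) (auto simp: power2_diff algebra_simps)
      also have "\<dots> = I2 - 2 * u0 x * I1 + (u0 x)\<^sup>2 * m"
        using i0 i1 i2 by (simp add: I1_def I2_def m_def)
      finally show ?thesis by simp
    qed
    have "(\<integral>\<^sup>+x. ennreal (indicator Q x * (I2 - 2 * u0 x * I1 + (u0 x)\<^sup>2 * m)) \<partial>lborel) =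
        ennreal (LINT x|lborel. indicator Q x * (I2 - 2 * u0 x * I1 + (u0 x)\<^sup>2 * m))"
      by (rule nn_integral_eq_integral[OF int]) (simp add: nn)
    also have "(LINT x|lborel. indicator Q x * (I2 - 2 * u0 x * I1 + (u0 x)\<^sup>2 * m)) = 2 * m * I2 - 2 * I1\<^sup>2"
      proof -
      have "(LINT x|lborel. I2 * indicator Q x - 2 * I1 * (indicator Q x * u0 x) + m * (indicator Q x * (u0 x)\<^sup>2)) = I2 * m - 2 * I1 * I1 + m * I2"
        using i0 i1 i2 by (simp add: I1_def[symmetric] I2_def[symmetric] m_def[symmetric])
      then show ?thesis unfolding e by (simp add: power2_eq_square)
    qed
    finally show ?thesis .
  qed
  have "ennreal (2 * m * I2 - 2 * I1\<^sup>2) \<le> emeasure lborel H * (ennreal (\<delta>\<^sup>2) * (\<integral>\<^sup>+x. indicator Q x * ennreal ((norm (g0 x))\<^sup>2) \<partial>lborel))"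
    using double_integral_le[OF bw Q H(1) conv diff \<delta>] unfolding inner outer .
  also have "\<dots> = ennreal (measure lborel H * (\<delta>\<^sup>2 * (LINT x|\<Lambda>. indicator Q x * (norm (g x))\<^sup>2)))"
    using H(2) nn_integral_rep[OF su(2) z(2) eq(2) Q(1)]
    by (simp add: emeasure_eq_ennreal_measure ennreal_mult' less_top[symmetric])
  finally have "2 * m * I2 - 2 * I1\<^sup>2 \<le> measure lborel H * (\<delta>\<^sup>2 * (LINT x|\<Lambda>. indicator Q x * (norm (g x))\<^sup>2))"
    by (subst (asm) ennreal_le_iff) (auto intro!: mult_nonneg_nonneg integral_nonneg_AE)
  then show ?thesis by (simp add: I1 I2 m_def)
qed

end

subsection \<open>Rellich compactness\<close>

context bounded_open
begin

lemma integrable_indicator_power2: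
  fixes f :: "'a \<Rightarrow> 'b::euclidean_space"
  assumes f: "square_integrable \<Lambda> f" and A: "A \<in> sets borel"
  shows "integrable \<Lambda> (\<lambda>x. indicator A x * (norm (f x))\<^sup>2)"
proof (rule Bochner_Integration.integrable_bound)
  show "integrable \<Lambda> (\<lambda>x. (norm (f x))\<^sup>2)" using f by (simp add: square_integrable_def)
  have "indicator A \<in> borel_measurable \<Lambda>"
    using A by (intro measurable_restrict_space1 borel_measurable_indicator) auto
  then show "(\<lambda>x. indicator A x * (norm (f x))\<^sup>2) \<in> borel_measurable \<Lambda>"
    using f by (intro borel_measurable_times) (auto simp: square_integrable_def)
qed (auto simp: indicator_def)

lemma integrable_indicator_dom:
  fixes f :: "'a \<Rightarrow> real"
  assumes f: "square_integrable \<Lambda> f" and A: "A \<in> sets borel"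
  shows "integrable \<Lambda> (\<lambda>x. indicator A x * f x)"
proof (rule Bochner_Integration.integrable_bound[OF integrable_dom[OF f]])
  have "indicator A \<in> borel_measurable \<Lambda>"
    using A by (intro measurable_restrict_space1 borel_measurable_indicator) auto
  then show "(\<lambda>x. indicator A x * f x) \<in> borel_measurable \<Lambda>"
    using f by (intro borel_measurable_times) (auto simp: square_integrable_def)
qed (auto simp: indicator_def)

text \<open>The mass of u on A is compared with the mass on a set K containing the translate of A,
  which may lie well inside \<Omega>; the loss is of order |h|^2 times the gradient norm. This is
  how boundary pieces are reached.\<close>

lemma shift_estimate:
  assumes ug: "weak_pair u g" and A[measurable]: "A \<in> sets borel" and K[measurable]: "K \<in> sets borel"
    and seg: "\<And>x s. x \<in> A \<Longrightarrow> s \<in> {0..1} \<Longrightarrow> x + s *\<^sub>R h \<in> \<Omega>" and AK: "\<And>x. x \<in> A \<Longrightarrow> x + h \<in> K"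
  shows "(LINT x|\<Lambda>. indicator A x * (u x)\<^sup>2) \<le> 2 * (norm h)\<^sup>2 * (LINT x|\<Lambda>. (norm (g x))\<^sup>2) + 2 * (LINT x|\<Lambda>. indicator K x * (u x)\<^sup>2)"
proof -
  have su: "square_integrable \<Lambda> u" "square_integrable \<Lambda> g" using ug by (auto simp: weak_pair_def)
  obtain u0 g0 where bw: "borel_weak_pair u0 g0" and z: "\<And>x. x \<notin> \<Omega> \<Longrightarrow> u0 x = 0" "\<And>x. x \<notin> \<Omega> \<Longrightarrow> g0 x = 0"
    and eq: "AE x in \<Lambda>. u x = u0 x" "AE x in \<Lambda>. g x = g0 x"
    using weak_pair_borel_rep[OF ug] by blast
  have [measurable]: "u0 \<in> borel_measurable borel"
    using bw by (auto simp: borel_weak_pair_def dest: borel_measurable_integrable)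
  have [measurable]: "\<Omega> \<in> sets borel" using open_dom by simp
  have gO: "(LINT x|\<Lambda>. indicator \<Omega> x * (norm (g x))\<^sup>2) = (LINT x|\<Lambda>. (norm (g x))\<^sup>2)"
    by (intro Bochner_Integration.integral_cong) auto
  have "ennreal (LINT x|\<Lambda>. indicator A x * (u x)\<^sup>2) = (\<integral>\<^sup>+x. indicator A x * ennreal ((u0 x)\<^sup>2) \<partial>lborel)"
    using nn_integral_rep[OF su(1) z(1) eq(1) A] by simp
  also have "\<dots> \<le> (\<integral>\<^sup>+x. 2 * (indicator A x * ennreal ((u0 (x + h) - u0 x)\<^sup>2)) + 2 * (indicator K (x + h) * ennreal ((u0 (x + h))\<^sup>2)) \<partial>lborel)"
  proof (rule nn_integral_mono)
    fix x
    \<comment> \<open>The difference of the two sides is the square of 2 u0 (x + h) - u0 x.\<close>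
    have "(u0 x)\<^sup>2 \<le> 2 * (u0 (x + h) - u0 x)\<^sup>2 + 2 * (u0 (x + h))\<^sup>2"
      using zero_le_power2[of "2 * u0 (x + h) - u0 x"] by (simp add: power2_eq_square algebra_simps)
    then have "ennreal ((u0 x)\<^sup>2) \<le> ennreal (2 * (u0 (x + h) - u0 x)\<^sup>2 + 2 * (u0 (x + h))\<^sup>2)"
      by (rule ennreal_leI)
    also have "\<dots> = 2 * ennreal ((u0 (x + h) - u0 x)\<^sup>2) + 2 * ennreal ((u0 (x + h))\<^sup>2)"
      by (simp add: ennreal_mult')
    finally show "indicator A x * ennreal ((u0 x)\<^sup>2) \<le> 2 * (indicator A x * ennreal ((u0 (x + h) - u0 x)\<^sup>2)) + 2 * (indicator K (x + h) * ennreal ((u0 (x + h))\<^sup>2))"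
      using AK by (auto simp: indicator_def)
  qed
  also have "\<dots> = 2 * (\<integral>\<^sup>+x. indicator A x * ennreal ((u0 (x + h) - u0 x)\<^sup>2) \<partial>lborel) + 2 * (\<integral>\<^sup>+x. indicator K (x + h) * ennreal ((u0 (x + h))\<^sup>2) \<partial>lborel)"
    by (subst nn_integral_add) (auto simp: nn_integral_cmult)
  also have "(\<integral>\<^sup>+x. indicator K (x + h) * ennreal ((u0 (x + h))\<^sup>2) \<partial>lborel) = (\<integral>\<^sup>+x. indicator K x * ennreal ((u0 x)\<^sup>2) \<partial>lborel)"
    using lborel_nn_integral_translate[of "\<lambda>x. indicator K x * ennreal ((u0 x)\<^sup>2)" h] by (simp add: add.commute)
  also have "\<dots> = ennreal (LINT x|\<Lambda>. indicator K x * (u x)\<^sup>2)"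
    using nn_integral_rep[OF su(1) z(1) eq(1) K] by simp
  also have "(\<integral>\<^sup>+x. indicator A x * ennreal ((u0 (x + h) - u0 x)\<^sup>2) \<partial>lborel) \<le> ennreal ((norm h)\<^sup>2 * (LINT x|\<Lambda>. (norm (g x))\<^sup>2))"
  proof -
    have "(\<integral>\<^sup>+x. indicator A x * ennreal ((u0 (x + h) - u0 x)\<^sup>2) \<partial>lborel) \<le> ennreal ((norm h)\<^sup>2) * (\<integral>\<^sup>+x. indicator \<Omega> x * ennreal ((norm (g0 x))\<^sup>2) \<partial>lborel)"
      by (rule translation_estimate[OF bw]) (use seg in auto)
    then show ?thesis
      using nn_integral_rep[OF su(2) z(2) eq(2), of \<Omega>] gO by (simp add: ennreal_mult')
  qed
  finally have "ennreal (LINT x|\<Lambda>. indicator A x * (u x)\<^sup>2) \<le> 2 * ennreal ((norm h)\<^sup>2 * (LINT x|\<Lambda>. (norm (g x))\<^sup>2)) + 2 * ennreal (LINT x|\<Lambda>. indicator K x * (u x)\<^sup>2)"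
    by (simp add: add_right_mono mult_left_mono)
  also have "\<dots> = ennreal (2 * (norm h)\<^sup>2 * (LINT x|\<Lambda>. (norm (g x))\<^sup>2) + 2 * (LINT x|\<Lambda>. indicator K x * (u x)\<^sup>2))"
    by (subst ennreal_plus) (auto simp: ennreal_mult' mult.assoc intro!: mult_nonneg_nonneg integral_nonneg_AE)
  finally show ?thesis
    by (subst (asm) ennreal_le_iff) (auto intro!: add_nonneg_nonneg mult_nonneg_nonneg integral_nonneg_AE)
qed

text \<open>If \<open>\<Omega>\<close> has this property, then boundedness in \<open>H\<^sup>1\<close> and convergence of finitely many averages, for each
  \<open>\<epsilon>\<close>, force convergence in \<open>L\<^sup>2\<close>.\<close>

definition mean_controlled :: "'a set \<Rightarrow> bool" where
  "mean_controlled A \<longleftrightarrow> A \<in> sets borel \<and> (\<forall>\<epsilon>>0. \<exists>\<Q> C. finite \<Q> \<and> 0 \<le> C \<and> \<Q> \<subseteq> sets borel \<and>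
    (\<forall>u g. weak_pair u g \<longrightarrow> (LINT x|\<Lambda>. indicator A x * (u x)\<^sup>2) \<le>
      C * (\<Sum>Q\<in>\<Q>. (LINT x|\<Lambda>. indicator Q x * u x)\<^sup>2) + \<epsilon> * (LINT x|\<Lambda>. (norm (g x))\<^sup>2)))"

lemma mean_controlledD:
  assumes "mean_controlled A" "\<epsilon> > 0"
  obtains \<Q> C where "finite \<Q>" "0 \<le> C" "\<Q> \<subseteq> sets borel"
    "\<And>u g. weak_pair u g \<Longrightarrow> (LINT x|\<Lambda>. indicator A x * (u x)\<^sup>2) \<le>
      C * (\<Sum>Q\<in>\<Q>. (LINT x|\<Lambda>. indicator Q x * u x)\<^sup>2) + \<epsilon> * (LINT x|\<Lambda>. (norm (g x))\<^sup>2)"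
  using assms unfolding mean_controlled_def by meson

lemma mean_controlled_mono:
  assumes B: "mean_controlled B" and AB: "A \<subseteq> B" and A: "A \<in> sets borel"
  shows "mean_controlled A"
  unfolding mean_controlled_def
proof (intro conjI A allI impI)
  fix \<epsilon> :: real assume "\<epsilon> > 0"
  from mean_controlledD[OF B this] obtain \<Q> C where \<Q>: "finite \<Q>" "0 \<le> C" "\<Q> \<subseteq> sets borel"
    "\<And>u g. weak_pair u g \<Longrightarrow> (LINT x|\<Lambda>. indicator B x * (u x)\<^sup>2) \<le>
      C * (\<Sum>Q\<in>\<Q>. (LINT x|\<Lambda>. indicator Q x * u x)\<^sup>2) + \<epsilon> * (LINT x|\<Lambda>. (norm (g x))\<^sup>2)"
    by blast
  have "(LINT x|\<Lambda>. indicator A x * (u x)\<^sup>2) \<le> (LINT x|\<Lambda>. indicator B x * (u x)\<^sup>2)" if "weak_pair u g" for u g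
  proof (rule integral_mono)
    have u: "square_integrable \<Lambda> u" using that by (simp add: weak_pair_def)
    show "integrable \<Lambda> (\<lambda>x. indicator A x * (u x)\<^sup>2)" "integrable \<Lambda> (\<lambda>x. indicator B x * (u x)\<^sup>2)"
      using integrable_indicator_power2[OF u] A B by (auto simp: mean_controlled_def)
  qed (use AB in \<open>auto simp: indicator_def\<close>)
  note le = this
  have "(LINT x|\<Lambda>. indicator A x * (u x)\<^sup>2) \<le>
      C * (\<Sum>Q\<in>\<Q>. (LINT x|\<Lambda>. indicator Q x * u x)\<^sup>2) + \<epsilon> * (LINT x|\<Lambda>. (norm (g x))\<^sup>2)"
    if "weak_pair u g" for u g
    using order_trans[OF le[OF that] \<Q>(4)[OF that]] .
  then show "\<exists>\<Q> C. finite \<Q> \<and> 0 \<le> C \<and> \<Q> \<subseteq> sets borel \<and>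
    (\<forall>u g. weak_pair u g \<longrightarrow> (LINT x|\<Lambda>. indicator A x * (u x)\<^sup>2) \<le>
      C * (\<Sum>Q\<in>\<Q>. (LINT x|\<Lambda>. indicator Q x * u x)\<^sup>2) + \<epsilon> * (LINT x|\<Lambda>. (norm (g x))\<^sup>2))"
    using \<Q>(1-3) by (intro exI[of _ \<Q>] exI[of _ C]) auto
qed

lemma mean_controlled_Un:
  assumes A: "mean_controlled A" and B: "mean_controlled B"
  shows "mean_controlled (A \<union> B)"
  unfolding mean_controlled_def
proof (intro conjI allI impI)
  have Ab: "A \<in> sets borel" and Bb: "B \<in> sets borel" using A B by (auto simp: mean_controlled_def)
  then show "A \<union> B \<in> sets borel" by simp
  fix \<epsilon> :: real assume "\<epsilon> > 0"
  then have e: "\<epsilon> / 2 > 0" by simp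
  obtain \<Q> C where \<Q>: "finite \<Q>" "0 \<le> C" "\<Q> \<subseteq> sets borel"
    "\<And>u g. weak_pair u g \<Longrightarrow> (LINT x|\<Lambda>. indicator A x * (u x)\<^sup>2) \<le>
      C * (\<Sum>Q\<in>\<Q>. (LINT x|\<Lambda>. indicator Q x * u x)\<^sup>2) + \<epsilon> / 2 * (LINT x|\<Lambda>. (norm (g x))\<^sup>2)"
    using mean_controlledD[OF A e] by blast
  obtain \<Q>' C' where \<Q>': "finite \<Q>'" "0 \<le> C'" "\<Q>' \<subseteq> sets borel"
    "\<And>u g. weak_pair u g \<Longrightarrow> (LINT x|\<Lambda>. indicator B x * (u x)\<^sup>2) \<le>
      C' * (\<Sum>Q\<in>\<Q>'. (LINT x|\<Lambda>. indicator Q x * u x)\<^sup>2) + \<epsilon> / 2 * (LINT x|\<Lambda>. (norm (g x))\<^sup>2)"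
    using mean_controlledD[OF B e] by blast
  have "(LINT x|\<Lambda>. indicator (A \<union> B) x * (u x)\<^sup>2) \<le>
      (C + C') * (\<Sum>Q\<in>\<Q> \<union> \<Q>'. (LINT x|\<Lambda>. indicator Q x * u x)\<^sup>2) + \<epsilon> * (LINT x|\<Lambda>. (norm (g x))\<^sup>2)"
    if ug: "weak_pair u g" for u g
  proof -
    have u: "square_integrable \<Lambda> u" using ug by (simp add: weak_pair_def)
    note int = integrable_indicator_power2[OF u, simplified]
    have "(LINT x|\<Lambda>. indicator (A \<union> B) x * (u x)\<^sup>2) \<le> (LINT x|\<Lambda>. indicator A x * (u x)\<^sup>2 + indicator B x * (u x)\<^sup>2)"
      using Ab Bb by (intro integral_mono Bochner_Integration.integrable_add int) (auto simp: indicator_def)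
    also have "\<dots> = (LINT x|\<Lambda>. indicator A x * (u x)\<^sup>2) + (LINT x|\<Lambda>. indicator B x * (u x)\<^sup>2)"
      using Ab Bb by (intro Bochner_Integration.integral_add int)
    also have "\<dots> \<le> (C * (\<Sum>Q\<in>\<Q>. (LINT x|\<Lambda>. indicator Q x * u x)\<^sup>2) + \<epsilon> / 2 * (LINT x|\<Lambda>. (norm (g x))\<^sup>2)) +
        (C' * (\<Sum>Q\<in>\<Q>'. (LINT x|\<Lambda>. indicator Q x * u x)\<^sup>2) + \<epsilon> / 2 * (LINT x|\<Lambda>. (norm (g x))\<^sup>2))"
      by (intro add_mono \<Q>(4)[OF ug] \<Q>'(4)[OF ug])
    also have "C * (\<Sum>Q\<in>\<Q>. (LINT x|\<Lambda>. indicator Q x * u x)\<^sup>2) \<le> C * (\<Sum>Q\<in>\<Q> \<union> \<Q>'. (LINT x|\<Lambda>. indicator Q x * u x)\<^sup>2)"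
      using \<Q> \<Q>' by (intro mult_left_mono sum_mono2) auto
    also have "C' * (\<Sum>Q\<in>\<Q>'. (LINT x|\<Lambda>. indicator Q x * u x)\<^sup>2) \<le> C' * (\<Sum>Q\<in>\<Q> \<union> \<Q>'. (LINT x|\<Lambda>. indicator Q x * u x)\<^sup>2)"
      using \<Q> \<Q>' by (intro mult_left_mono sum_mono2) auto
    finally show ?thesis by (simp add: algebra_simps)
  qed
  then show "\<exists>\<Q> C. finite \<Q> \<and> 0 \<le> C \<and> \<Q> \<subseteq> sets borel \<and>
    (\<forall>u g. weak_pair u g \<longrightarrow> (LINT x|\<Lambda>. indicator (A \<union> B) x * (u x)\<^sup>2) \<le>
      C * (\<Sum>Q\<in>\<Q>. (LINT x|\<Lambda>. indicator Q x * u x)\<^sup>2) + \<epsilon> * (LINT x|\<Lambda>. (norm (g x))\<^sup>2))"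
    using \<Q> \<Q>' by (intro exI[of _ "\<Q> \<union> \<Q>'"] exI[of _ "C + C'"]) auto
qed

lemma mean_controlled_Union:
  assumes "finite I" "\<And>i. i \<in> I \<Longrightarrow> mean_controlled (A i)"
  shows "mean_controlled (\<Union>i\<in>I. A i)"
  using assms
proof (induction I rule: finite_induct)
  case empty
  show ?case
    unfolding mean_controlled_def
    by (intro conjI allI impI exI[of _ "{}"] exI[of _ 0]) (auto intro!: mult_nonneg_nonneg integral_nonneg_AE)
next
  case (insert i I)
  then show ?case by (simp add: mean_controlled_Un)
qed

text \<open>The shift costs 2 |h|^2 <= \<epsilon> / 2 of the gradient term; the control of K with
  \<epsilon> / 4, doubled by \<open>shift_estimate\<close>, uses the other half.\<close>

lemma mean_controlled_shift:
  assumes A: "A \<in> sets borel"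
    and shift: "\<And>\<tau>. \<tau> > 0 \<Longrightarrow> \<exists>h K. norm h \<le> \<tau> \<and> mean_controlled K \<and> (\<forall>x\<in>A. x + h \<in> K \<and> (\<forall>s\<in>{0..1}. x + s *\<^sub>R h \<in> \<Omega>))"
  shows "mean_controlled A"
  unfolding mean_controlled_def
proof (intro conjI A allI impI)
  fix \<epsilon> :: real assume "\<epsilon> > 0"
  then have "sqrt (\<epsilon> / 4) > 0" by simp
  then obtain h K where h: "norm h \<le> sqrt (\<epsilon> / 4)" and K: "mean_controlled K"
    and AK: "\<And>x. x \<in> A \<Longrightarrow> x + h \<in> K" "\<And>x s. x \<in> A \<Longrightarrow> s \<in> {0..1} \<Longrightarrow> x + s *\<^sub>R h \<in> \<Omega>"
    using shift by meson
  have e4: "\<epsilon> / 4 > 0" using \<open>\<epsilon> > 0\<close> by simp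
  obtain \<Q> C where \<Q>: "finite \<Q>" "0 \<le> C" "\<Q> \<subseteq> sets borel"
    "\<And>u g. weak_pair u g \<Longrightarrow> (LINT x|\<Lambda>. indicator K x * (u x)\<^sup>2) \<le>
      C * (\<Sum>Q\<in>\<Q>. (LINT x|\<Lambda>. indicator Q x * u x)\<^sup>2) + \<epsilon> / 4 * (LINT x|\<Lambda>. (norm (g x))\<^sup>2)"
    using mean_controlledD[OF K e4] by blast
  have h2: "(norm h)\<^sup>2 \<le> \<epsilon> / 4"
    using power_mono[OF h, of 2] \<open>\<epsilon> > 0\<close> by simp
  have Kb: "K \<in> sets borel" using K by (simp add: mean_controlled_def)
  have "(LINT x|\<Lambda>. indicator A x * (u x)\<^sup>2) \<le>
      2 * C * (\<Sum>Q\<in>\<Q>. (LINT x|\<Lambda>. indicator Q x * u x)\<^sup>2) + \<epsilon> * (LINT x|\<Lambda>. (norm (g x))\<^sup>2)"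
    if ug: "weak_pair u g" for u g
  proof -
    have "2 * (norm h)\<^sup>2 * (LINT x|\<Lambda>. (norm (g x))\<^sup>2) \<le> 2 * (\<epsilon> / 4) * (LINT x|\<Lambda>. (norm (g x))\<^sup>2)"
      using h2 by (intro mult_right_mono integral_nonneg_AE) auto
    then show ?thesis
      using shift_estimate[OF ug A Kb AK(2,1)] \<Q>(4)[OF ug] by (simp add: algebra_simps)
  qed
  then show "\<exists>\<Q> C. finite \<Q> \<and> 0 \<le> C \<and> \<Q> \<subseteq> sets borel \<and>
    (\<forall>u g. weak_pair u g \<longrightarrow> (LINT x|\<Lambda>. indicator A x * (u x)\<^sup>2) \<le>
      C * (\<Sum>Q\<in>\<Q>. (LINT x|\<Lambda>. indicator Q x * u x)\<^sup>2) + \<epsilon> * (LINT x|\<Lambda>. (norm (g x))\<^sup>2))"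
    using \<Q> by (intro exI[of _ \<Q>] exI[of _ "2 * C"]) auto
qed

end

section \<open>Cells of a cubic lattice\<close>

definition lattice_corner :: "real \<Rightarrow> 'a::euclidean_space \<Rightarrow> 'a" where
  "lattice_corner s x = (\<Sum>b\<in>Basis. of_int \<lfloor>x \<bullet> b / s\<rfloor> *\<^sub>R b)"

lemma lattice_corner_inner: "b \<in> Basis \<Longrightarrow> lattice_corner s x \<bullet> b = of_int \<lfloor>x \<bullet> b / s\<rfloor>"
  by (simp add: lattice_corner_def)

lemma lattice_corner_eq_iff:
  assumes "s > 0"
  shows "lattice_corner s y = lattice_corner s x \<longleftrightarrow>
    (\<forall>b\<in>Basis. (lattice_corner s x \<bullet> b) * s \<le> y \<bullet> b \<and> y \<bullet> b < (lattice_corner s x \<bullet> b + 1) * s)"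
proof -
  have "lattice_corner s y = lattice_corner s x \<longleftrightarrow> (\<forall>b\<in>Basis. \<lfloor>y \<bullet> b / s\<rfloor> = \<lfloor>x \<bullet> b / s\<rfloor>)"
    by (subst euclidean_eq_iff) (auto simp: lattice_corner_inner)
  also have "\<dots> \<longleftrightarrow> (\<forall>b\<in>Basis. (lattice_corner s x \<bullet> b) * s \<le> y \<bullet> b \<and> y \<bullet> b < (lattice_corner s x \<bullet> b + 1) * s)"
    using assms by (intro ball_cong refl) (simp add: lattice_corner_inner floor_eq_iff pos_le_divide_eq pos_divide_less_eq)
  finally show ?thesis .
qed

text \<open>Half-open cubes of side s, pairwise disjoint and covering the space. The label z has
  integer coordinates, the corner itself being s z; any other z labels the empty cell.\<close>

definition lattice_cell :: "real \<Rightarrow> 'a::euclidean_space \<Rightarrow> 'a set" where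
  "lattice_cell s z = {x. lattice_corner s x = z}"

lemma lattice_cell_borel [measurable]: "lattice_cell s z \<in> sets borel"
proof -
  have [measurable]: "lattice_corner s \<in> borel_measurable borel"
    unfolding lattice_corner_def[abs_def] by measurable
  have "lattice_corner s -` {z} \<inter> space borel \<in> sets borel" by measurable
  then show ?thesis by (simp add: lattice_cell_def vimage_def)
qed

lemma lattice_cell_segment:
  assumes s: "s > 0" and x: "x \<in> lattice_cell s z" "x + h \<in> lattice_cell s z" and t: "t \<in> {0..1}"
  shows "x + t *\<^sub>R h \<in> lattice_cell s z"
proof -
  have z: "z = lattice_corner s x" using x by (simp add: lattice_cell_def)
  have "lattice_corner s (x + t *\<^sub>R h) = lattice_corner s x"
    unfolding lattice_corner_eq_iff[OF s]
  proof
    fix b :: 'a assume b: "b \<in> Basis"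
    let ?c = "lattice_corner s x \<bullet> b"
    have 1: "?c * s \<le> x \<bullet> b" "x \<bullet> b < (?c + 1) * s"
      using lattice_corner_eq_iff[OF s, of x x] b by auto
    have 2: "?c * s \<le> x \<bullet> b + h \<bullet> b" "x \<bullet> b + h \<bullet> b < (?c + 1) * s"
      using lattice_corner_eq_iff[OF s, of "x + h" x] b x by (auto simp: lattice_cell_def inner_add_left)
    have e: "(x + t *\<^sub>R h) \<bullet> b = (1 - t) * (x \<bullet> b) + t * (x \<bullet> b + h \<bullet> b)"
      by (simp add: inner_add_left algebra_simps)
    have "convex {?c * s..<(?c + 1) * s}" by simp
    then show "?c * s \<le> (x + t *\<^sub>R h) \<bullet> b \<and> (x + t *\<^sub>R h) \<bullet> b < (?c + 1) * s"
      using convexD_alt[of "{?c * s..<(?c + 1) * s}" "x \<bullet> b" "x \<bullet> b + h \<bullet> b" t] 1 2 t unfolding e by simp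
  qed
  then show ?thesis by (simp add: lattice_cell_def z)
qed

lemma lattice_cell_diff:
  assumes s: "s > 0" and x: "x \<in> lattice_cell s z" "x + h \<in> lattice_cell s z"
  shows "h \<in> cbox (- (s *\<^sub>R One)) (s *\<^sub>R One)"
  unfolding mem_box
proof
  fix b :: 'a assume b: "b \<in> Basis"
  let ?c = "lattice_corner s x \<bullet> b"
  have 1: "?c * s \<le> x \<bullet> b" "x \<bullet> b < (?c + 1) * s"
    using lattice_corner_eq_iff[OF s, of x x] b by auto
  have 2: "?c * s \<le> x \<bullet> b + h \<bullet> b" "x \<bullet> b + h \<bullet> b < (?c + 1) * s"
    using lattice_corner_eq_iff[OF s, of "x + h" x] b x by (auto simp: lattice_cell_def inner_add_left)
  have "(?c + 1) * s = ?c * s + s" by (simp add: algebra_simps)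
  then show "- (s *\<^sub>R One) \<bullet> b \<le> h \<bullet> b \<and> h \<bullet> b \<le> s *\<^sub>R One \<bullet> b"
    using 1 2 b by simp
qed

lemma norm_le_cube:
  fixes h :: "'a::euclidean_space"
  assumes "h \<in> cbox (- (s *\<^sub>R One)) (s *\<^sub>R One)"
  shows "norm h \<le> s * DIM('a)"
proof -
  have "norm h \<le> (\<Sum>b\<in>Basis. \<bar>h \<bullet> b\<bar>)" by (rule norm_le_l1)
  also have "\<dots> \<le> (\<Sum>b\<in>(Basis::'a set). s)"
    using assms by (intro sum_mono) (auto simp: mem_box abs_le_iff)
  finally show ?thesis by (simp add: mult.commute)
qed

lemma measure_lattice_cell_ge:
  fixes x :: "'a::euclidean_space"
  assumes s: "s > 0" and fin: "emeasure lborel (lattice_cell s (lattice_corner s x)) < \<infinity>"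
  shows "s ^ DIM('a) \<le> measure lborel (lattice_cell s (lattice_corner s x))"
proof -
  let ?z = "lattice_corner s x"
  have sub: "box (s *\<^sub>R ?z) (s *\<^sub>R (?z + One)) \<subseteq> lattice_cell s ?z"
  proof
    fix y assume y: "y \<in> box (s *\<^sub>R ?z) (s *\<^sub>R (?z + One))"
    have "lattice_corner s y = ?z"
      unfolding lattice_corner_eq_iff[OF s] using y
      by (auto simp: mem_box inner_add_left mult.commute less_imp_le)
    then show "y \<in> lattice_cell s ?z" by (simp add: lattice_cell_def)
  qed
  have "measure lborel (box (s *\<^sub>R ?z) (s *\<^sub>R (?z + One))) = (\<Prod>b\<in>Basis. (s *\<^sub>R (?z + One) - s *\<^sub>R ?z) \<bullet> b)"
    by (rule measure_lborel_box) (use s in \<open>auto simp: inner_add_left\<close>)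
  also have "\<dots> = (\<Prod>b\<in>(Basis :: 'a set). s)"
    by (intro prod.cong) (auto simp: algebra_simps inner_diff_left inner_add_left)
  finally have "measure lborel (box (s *\<^sub>R ?z) (s *\<^sub>R (?z + One))) = s ^ DIM('a)" by simp
  moreover have "measure lborel (box (s *\<^sub>R ?z) (s *\<^sub>R (?z + One))) \<le> measure lborel (lattice_cell s ?z)"
    using sub fin by (intro measure_mono_fmeasurable) (auto simp: fmeasurable_def)
  ultimately show ?thesis by simp
qed

lemma finite_lattice_corner_image:
  fixes K :: "'a::euclidean_space set"
  assumes "bounded K"
  shows "finite (lattice_corner s ` K)"
proof -
  obtain R where R: "\<And>x. x \<in> K \<Longrightarrow> norm x \<le> R" using assms bounded_iff by blast
  define N where "N = \<lceil>R / \<bar>s\<bar>\<rceil> + 1"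
  have "lattice_corner s ` K \<subseteq> (\<lambda>f. \<Sum>b\<in>Basis. of_int (f b) *\<^sub>R b) ` (\<Pi>\<^sub>E b\<in>(Basis :: 'a set). {-N..N})"
  proof
    fix z assume "z \<in> lattice_corner s ` K"
    then obtain x where x: "x \<in> K" "z = lattice_corner s x" by blast
    have "\<lfloor>x \<bullet> b / s\<rfloor> \<in> {-N..N}" if "b \<in> Basis" for b
    proof -
      have "\<bar>x \<bullet> b / s\<bar> \<le> R / \<bar>s\<bar>"
        using R[OF x(1)] Basis_le_norm[OF that, of x] by (simp add: abs_divide divide_right_mono)
      then have "- (R / \<bar>s\<bar>) \<le> x \<bullet> b / s" "x \<bullet> b / s \<le> R / \<bar>s\<bar>" by (simp_all only: abs_le_iff) linarith+
      then have "real_of_int \<lfloor>x \<bullet> b / s\<rfloor> \<le> real_of_int \<lceil>R / \<bar>s\<bar>\<rceil>"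
        "real_of_int (- \<lceil>R / \<bar>s\<bar>\<rceil> - 1) \<le> real_of_int \<lfloor>x \<bullet> b / s\<rfloor>"
        using of_int_floor_le[of "x \<bullet> b / s"] le_of_int_ceiling[of "R / \<bar>s\<bar>"] real_of_int_floor_gt_diff_one[of "x \<bullet> b / s"]
        by linarith+
      then show ?thesis unfolding N_def of_int_le_iff by simp
    qed
    then show "z \<in> (\<lambda>f. \<Sum>b\<in>Basis. of_int (f b) *\<^sub>R b) ` (\<Pi>\<^sub>E b\<in>(Basis :: 'a set). {-N..N})"
      unfolding x(2) lattice_corner_def
      by (intro image_eqI[where x = "restrict (\<lambda>b. \<lfloor>x \<bullet> b / s\<rfloor>) Basis"]) auto
  qed
  moreover have "finite ((\<lambda>f. \<Sum>b\<in>Basis. of_int (f b) *\<^sub>R b) ` (\<Pi>\<^sub>E b\<in>(Basis :: 'a set). {-N..N}) :: 'a set)"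
    by (intro finite_imageI finite_PiE) auto
  ultimately show ?thesis by (rule finite_subset)
qed

context bounded_open
begin

text \<open>Poincare inequalities on the finitely many lattice cells meeting K. The cells are
  disjoint and contained in \<Omega>, so their gradient terms sum to at most the full gradient
  norm.\<close>

lemma mean_controlled_compact:
  assumes K: "compact K" "K \<subseteq> \<Omega>"
  shows "mean_controlled K"
  unfolding mean_controlled_def
proof (intro conjI allI impI)
  show Kb: "K \<in> sets borel" using K(1) by (simp add: compact_imp_closed)
  fix \<epsilon> :: real assume \<epsilon>: "\<epsilon> > 0"
  let ?n = "DIM('a)"
  obtain d where d: "d > 0" "(\<Union>x\<in>K. ball x d) \<subseteq> \<Omega>"
    using compact_subset_open_imp_ball_epsilon_subset[OF K(1) open_dom K(2)] by blast
  \<comment> \<open>The first bound keeps cells that meet K within distance d of it, hence inside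
    \<Omega>. The second makes 2^n (s n)^2 <= \<epsilon>: the Poincare constant is |H| (s n)^2 / 2
    with |H| = (2 s)^n, to be divided by the cell volume s^n.\<close>
  define s where "s = min (d / (2 * ?n)) (sqrt (\<epsilon> / (2 ^ ?n)) / ?n)"
  have n: "real ?n > 0" by simp
  have s: "s > 0" using d \<epsilon> n by (simp add: s_def)
  have sd: "s * ?n < d"
  proof -
    have "s * ?n \<le> d / (2 * ?n) * ?n" by (intro mult_right_mono) (auto simp: s_def)
    also have "\<dots> < d" using d(1) by simp
    finally show ?thesis .
  qed
  have s\<epsilon>: "2 ^ ?n * (s * ?n)\<^sup>2 \<le> \<epsilon>"
  proof -
    have "s * ?n \<le> sqrt (\<epsilon> / (2 ^ ?n)) / ?n * ?n" by (intro mult_right_mono) (auto simp: s_def)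
    then have "s * ?n \<le> sqrt (\<epsilon> / (2 ^ ?n))" by simp
    then have "(s * ?n)\<^sup>2 \<le> (sqrt (\<epsilon> / (2 ^ ?n)))\<^sup>2" using s by (intro power_mono) auto
    then show ?thesis using \<epsilon> by (simp add: field_simps)
  qed
  define Z where "Z = lattice_corner s ` K"
  have Z: "finite Z" unfolding Z_def by (rule finite_lattice_corner_image) (use K compact_imp_bounded in blast)
  define H where "H = cbox (- (s *\<^sub>R One)) (s *\<^sub>R One :: 'a)"
  have H: "emeasure lborel H < \<infinity>" "measure lborel H = (2 * s) ^ ?n"
  proof -
    show "emeasure lborel H < \<infinity>" by (simp add: H_def emeasure_lborel_cbox_eq)
    have "measure lborel H = (\<Prod>b\<in>(Basis :: 'a set). (s *\<^sub>R One - - (s *\<^sub>R One)) \<bullet> b)"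
      unfolding H_def by (rule measure_lborel_cbox) (use s in auto)
    also have "\<dots> = (\<Prod>b\<in>(Basis :: 'a set). 2 * s)"
      by (intro prod.cong) (auto simp: inner_add_left)
    finally show "measure lborel H = (2 * s) ^ ?n" by simp
  qed
  have sub: "lattice_cell s z \<subseteq> \<Omega>" if z: "z \<in> Z" for z
  proof
    fix y assume y: "y \<in> lattice_cell s z"
    obtain x where x: "x \<in> K" "z = lattice_corner s x" using z by (auto simp: Z_def)
    have "y - x \<in> H"
      unfolding H_def by (rule lattice_cell_diff[OF s, of x z]) (use x y in \<open>auto simp: lattice_cell_def\<close>)
    then have "norm (y - x) < d" using norm_le_cube[of "y - x" s] sd unfolding H_def by linarith
    then have "y \<in> ball x d" by (simp add: dist_norm norm_minus_commute)
    then show "y \<in> \<Omega>" using d(2) x(1) by blast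
  qed
  have inj: "inj_on (lattice_cell s) Z"
  proof (rule inj_onI)
    fix z z' assume "z \<in> Z" "z' \<in> Z" "lattice_cell s z = lattice_cell s z'"
    moreover from this obtain x where "z = lattice_corner s x" by (auto simp: Z_def)
    then have "x \<in> lattice_cell s z" by (simp add: lattice_cell_def)
    ultimately show "z = z'" by (auto simp: lattice_cell_def)
  qed
  \<comment> \<open>The cells are disjoint, so their indicators add up to an indicator and no point
    is counted twice.\<close>
  have sum1: "(\<Sum>z\<in>Z. indicator (lattice_cell s z) x) = (indicator {x. lattice_corner s x \<in> Z} x :: real)" for x
    using Z by (simp add: indicator_def lattice_cell_def sum.delta')
  have main: "(LINT x|\<Lambda>. indicator K x * (u x)\<^sup>2) \<le>
      (1 / s ^ ?n) * (\<Sum>Q\<in>lattice_cell s ` Z. (LINT x|\<Lambda>. indicator Q x * u x)\<^sup>2) + \<epsilon> * (LINT x|\<Lambda>. (norm (g x))\<^sup>2)"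
    if ug: "weak_pair u g" for u g
  proof -
    have u: "square_integrable \<Lambda> u" and g: "square_integrable \<Lambda> g" using ug by (auto simp: weak_pair_def)
    note intu = integrable_indicator_power2[OF u, simplified] and intg = integrable_indicator_power2[OF g]
    have gK: "integrable \<Lambda> (\<lambda>x. (norm (g x))\<^sup>2)" using g by (simp add: square_integrable_def)
    have cell: "(LINT x|\<Lambda>. indicator (lattice_cell s z) x * (u x)\<^sup>2) \<le>
        (1 / s ^ ?n) * (LINT x|\<Lambda>. indicator (lattice_cell s z) x * u x)\<^sup>2 +
        \<epsilon> * (LINT x|\<Lambda>. indicator (lattice_cell s z) x * (norm (g x))\<^sup>2)" if "z \<in> Z" for z
    proof -
      let ?Q = "lattice_cell s z"
      let ?I = "LINT x|\<Lambda>. indicator ?Q x * (u x)\<^sup>2" and ?G = "LINT x|\<Lambda>. indicator ?Q x * (norm (g x))\<^sup>2"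
      obtain x where x: "z = lattice_corner s x" using \<open>z \<in> Z\<close> by (auto simp: Z_def)
      have I0: "0 \<le> ?I" and G0: "0 \<le> ?G" by (auto intro!: integral_nonneg_AE)
      have "emeasure lborel ?Q < \<infinity>"
        using emeasure_bounded_finite[OF bounded_subset[OF bounded_dom sub[OF \<open>z \<in> Z\<close>]]] by simp
      then have "s ^ ?n * ?I \<le> measure lborel ?Q * ?I"
        unfolding x by (intro mult_right_mono measure_lattice_cell_ge[OF s]) (use I0 x in auto)
      also have "\<dots> \<le> (LINT x|\<Lambda>. indicator ?Q x * u x)\<^sup>2 + measure lborel H * (s * ?n)\<^sup>2 / 2 * ?G"
      proof (rule Poincare_inequality[OF ug lattice_cell_borel sub[OF \<open>z \<in> Z\<close>] _ H(1)])
        show "H \<in> sets borel" by (simp add: H_def)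
        show "x + t *\<^sub>R h \<in> ?Q" if "x \<in> ?Q" "x + h \<in> ?Q" "t \<in> {0..1}" for x h t
          using lattice_cell_segment[OF s that] .
        show "h \<in> H" if "x \<in> ?Q" "x + h \<in> ?Q" for x h
          using lattice_cell_diff[OF s that] by (simp add: H_def)
        show "norm h \<le> s * ?n" if "h \<in> H" for h using norm_le_cube that by (simp add: H_def)
      qed
      also have "measure lborel H * (s * ?n)\<^sup>2 / 2 * ?G \<le> s ^ ?n * (\<epsilon> * ?G)"
      proof -
        have "measure lborel H * (s * ?n)\<^sup>2 / 2 = s ^ ?n * (2 ^ ?n * (s * ?n)\<^sup>2) / 2"
          by (simp add: H(2) power_mult_distrib)
        also have "\<dots> \<le> s ^ ?n * \<epsilon>"
        proof -
          have "s ^ ?n * (2 ^ ?n * (s * ?n)\<^sup>2) \<le> s ^ ?n * \<epsilon>" using s s\<epsilon> by (intro mult_left_mono) auto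
          moreover have "0 \<le> s ^ ?n * (2 ^ ?n * (s * ?n)\<^sup>2)" using s by simp
          ultimately show ?thesis by linarith
        qed
        finally have "measure lborel H * (s * ?n)\<^sup>2 / 2 * ?G \<le> s ^ ?n * \<epsilon> * ?G"
          using G0 by (rule mult_right_mono)
        then show ?thesis by (simp add: mult.assoc)
      qed
      finally have "s ^ ?n * ?I \<le> (LINT x|\<Lambda>. indicator ?Q x * u x)\<^sup>2 + s ^ ?n * (\<epsilon> * ?G)" by simp
      moreover have "0 < s ^ ?n" using s by simp
      moreover have "I \<le> (1 / c) * U + E" if "c * I \<le> U + c * E" "0 < c" for c I U E :: real
      proof -
        have "I \<le> (U + c * E) / c" using that by (simp add: pos_le_divide_eq mult.commute)
        then show ?thesis using that by (simp add: add_divide_distrib)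
      qed
      ultimately show ?thesis by blast
    qed
    have "(LINT x|\<Lambda>. indicator K x * (u x)\<^sup>2) \<le> (LINT x|\<Lambda>. (\<Sum>z\<in>Z. indicator (lattice_cell s z) x * (u x)\<^sup>2))"
    proof (rule integral_mono)
      show "indicator K x * (u x)\<^sup>2 \<le> (\<Sum>z\<in>Z. indicator (lattice_cell s z) x * (u x)\<^sup>2)" for x
        unfolding sum_distrib_right[symmetric] sum1 by (auto simp: indicator_def Z_def)
    qed (use Kb in \<open>auto intro!: intu\<close>)
    also have "\<dots> = (\<Sum>z\<in>Z. LINT x|\<Lambda>. indicator (lattice_cell s z) x * (u x)\<^sup>2)"
      by (intro Bochner_Integration.integral_sum intu) auto
    also have "\<dots> \<le> (\<Sum>z\<in>Z. (1 / s ^ ?n) * (LINT x|\<Lambda>. indicator (lattice_cell s z) x * u x)\<^sup>2 +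
        \<epsilon> * (LINT x|\<Lambda>. indicator (lattice_cell s z) x * (norm (g x))\<^sup>2))"
      by (intro sum_mono cell)
    also have "\<dots> = (1 / s ^ ?n) * (\<Sum>z\<in>Z. (LINT x|\<Lambda>. indicator (lattice_cell s z) x * u x)\<^sup>2) +
        \<epsilon> * (\<Sum>z\<in>Z. LINT x|\<Lambda>. indicator (lattice_cell s z) x * (norm (g x))\<^sup>2)"
      by (simp add: sum.distrib sum_distrib_left)
    also have "(\<Sum>z\<in>Z. LINT x|\<Lambda>. indicator (lattice_cell s z) x * (norm (g x))\<^sup>2) = (LINT x|\<Lambda>. (\<Sum>z\<in>Z. indicator (lattice_cell s z) x * (norm (g x))\<^sup>2))"
      by (intro Bochner_Integration.integral_sum[symmetric] intg) auto
    also have "\<dots> \<le> (LINT x|\<Lambda>. (norm (g x))\<^sup>2)"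
    proof (rule integral_mono)
      show "(\<Sum>z\<in>Z. indicator (lattice_cell s z) x * (norm (g x))\<^sup>2) \<le> (norm (g x))\<^sup>2" for x
        unfolding sum_distrib_right[symmetric] sum1 by (auto simp: indicator_def)
    qed (auto intro!: intg gK)
    finally show ?thesis
      using \<epsilon> by (simp add: sum.reindex[OF inj] mult_left_mono)
  qed
  show "\<exists>\<Q> C. finite \<Q> \<and> 0 \<le> C \<and> \<Q> \<subseteq> sets borel \<and>
    (\<forall>u g. weak_pair u g \<longrightarrow> (LINT x|\<Lambda>. indicator K x * (u x)\<^sup>2) \<le>
      C * (\<Sum>Q\<in>\<Q>. (LINT x|\<Lambda>. indicator Q x * u x)\<^sup>2) + \<epsilon> * (LINT x|\<Lambda>. (norm (g x))\<^sup>2))"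
    using main Z s by (intro exI[of _ "lattice_cell s ` Z"] exI[of _ "1 / s ^ ?n"]) auto
qed

text \<open>Near a boundary point the strict subgraph is shifted into its interior along the axis of the chart.\<close>

lemma mean_controlled_boundary:
  assumes lip: "lipschitz_boundary \<Omega>" and p: "p \<in> frontier \<Omega>"
  shows "\<exists>r>0. mean_controlled (\<Omega> \<inter> ball p r)"
proof -
  obtain U e L and g :: "'a \<Rightarrow> real" where U: "open U" "p \<in> U" and e: "norm e = 1"
    and g: "L-lipschitz_on {y. y \<bullet> e = 0} g" and graph: "\<Omega> \<inter> U = {x \<in> U. x \<bullet> e < g (x - (x \<bullet> e) *\<^sub>R e)}"
    using bspec[OF lip[unfolded lipschitz_boundary_def] p] by (elim exE conjE) (rule that)
  obtain r0 where r0: "r0 > 0" "ball p r0 \<subseteq> U" using U open_contains_ball by blast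
  define r where "r = r0 / 2"
  have r: "r > 0" "r < r0" using r0 by (auto simp: r_def)
  have ee: "e \<bullet> e = 1" using e by (simp add: norm_eq_1)
  define P where "P x = x - (x \<bullet> e) *\<^sub>R e" for x
  have P: "P x \<bullet> e = 0" "P (x + t *\<^sub>R e) = P x" for x t
    by (auto simp: P_def inner_diff_left inner_add_left ee algebra_simps)
  have cont: "continuous_on UNIV (\<lambda>x. g (P x))"
    by (rule continuous_on_compose2[OF lipschitz_on_continuous_on[OF g]])
      (auto simp: P intro!: continuous_intros simp flip: P_def, auto simp: P_def[abs_def] intro!: continuous_intros)
  have mem: "x \<in> \<Omega> \<longleftrightarrow> x \<bullet> e < g (P x)" if "x \<in> U" for x
    using graph that unfolding P_def by blast
  have "mean_controlled (\<Omega> \<inter> ball p r)"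
  proof (rule mean_controlled_shift)
    show "\<Omega> \<inter> ball p r \<in> sets borel" using open_dom by simp
    fix \<tau> :: real assume "\<tau> > 0"
    \<comment> \<open>With r = r0 / 2 and t <= r / 2, the whole shift of a point of
      \<open>cball p r\<close> stays in \<open>ball p r0\<close>, where the chart is valid; t <=
      \<tau> makes the shift as short as demanded.\<close>
    define t where "t = min \<tau> (r / 2)"
    have t: "t > 0" "t \<le> \<tau>" "t < r" using \<open>\<tau> > 0\<close> r by (auto simp: t_def)
    define h where "h = (- t) *\<^sub>R e"
    define K where "K = (+) h ` closure (\<Omega> \<inter> ball p r)"
    have "compact (closure (\<Omega> \<inter> ball p r))"
      using bounded_subset[OF bounded_ball] by (simp add: bounded_Int)
    then have Kc: "compact K" unfolding K_def by (intro compact_translation)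
    have U': "x + s *\<^sub>R h \<in> U" if "x \<in> cball p r" "s \<in> {0..1}" for x s
    proof -
      have "norm (s *\<^sub>R h) \<le> t" using that(2) t e by (simp add: h_def mult_left_le_one_le)
      moreover have "dist p (x + s *\<^sub>R h) \<le> dist p x + norm (s *\<^sub>R h)"
        using dist_triangle[of p "x + s *\<^sub>R h" x] by (simp add: dist_norm)
      ultimately have "dist p (x + s *\<^sub>R h) < r0" using that(1) t r by (simp add: r_def)
      then show ?thesis using r0(2) by auto
    qed
    have shift_mem: "x + s *\<^sub>R h \<in> \<Omega>" if "x \<in> cball p r" "s \<in> {0..1}" "x \<bullet> e - s * t < g (P x)" for x s
    proof -
      have "x + s *\<^sub>R h = x + (- (s * t)) *\<^sub>R e" by (simp add: h_def)
      then have "(x + s *\<^sub>R h) \<bullet> e = x \<bullet> e - s * t" "P (x + s *\<^sub>R h) = P x"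
        using P(2)[of x "- (s * t)"] by (simp_all add: inner_diff_left ee)
      then show ?thesis using mem[OF U'[OF that(1,2)]] that(3) by simp
    qed
    \<comment> \<open>Taking the closure can weaken the strict inequality only to x . e <= g (P x),
      and the shift by -t e restores strictness; so the shifted closure is a compact subset of
      \<Omega>.\<close>
    have cl: "x \<bullet> e \<le> g (P x) \<and> x \<in> cball p r" if "x \<in> closure (\<Omega> \<inter> ball p r)" for x
    proof -
      have "closed {x. x \<bullet> e \<le> g (P x)}"
        by (intro closed_Collect_le cont continuous_intros)
      then have "closed ({x. x \<bullet> e \<le> g (P x)} \<inter> cball p r)" by (rule closed_Int[OF _ closed_cball])
      moreover have "\<Omega> \<inter> ball p r \<subseteq> {x. x \<bullet> e \<le> g (P x)} \<inter> cball p r"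
      proof
        fix x assume x: "x \<in> \<Omega> \<inter> ball p r"
        then have "x \<in> U" using r0(2) r by auto
        then show "x \<in> {x. x \<bullet> e \<le> g (P x)} \<inter> cball p r" using mem[of x] x by auto
      qed
      ultimately show ?thesis using closure_minimal that by blast
    qed
    have "K \<subseteq> \<Omega>"
    proof
      fix y assume "y \<in> K"
      then obtain x where x: "x \<in> closure (\<Omega> \<inter> ball p r)" "y = x + 1 *\<^sub>R h" by (auto simp: K_def add.commute)
      show "y \<in> \<Omega>" unfolding x(2) by (rule shift_mem) (use cl[OF x(1)] t in auto)
    qed
    then have "mean_controlled K" by (rule mean_controlled_compact[OF Kc])
    moreover have "norm h \<le> \<tau>" using t e by (simp add: h_def)
    moreover have "x + h \<in> K" if "x \<in> \<Omega> \<inter> ball p r" for x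
      using subsetD[OF closure_subset that] by (auto simp: K_def add.commute)
    moreover have "x + s *\<^sub>R h \<in> \<Omega>" if "x \<in> \<Omega> \<inter> ball p r" "s \<in> {0..1}" for x s
    proof (rule shift_mem)
      have "x \<in> U" using that r0(2) r by auto
      then have "x \<bullet> e < g (P x)" using mem that by blast
      moreover have "0 \<le> s * t" using that t by simp
      ultimately show "x \<bullet> e - s * t < g (P x)" by linarith
    qed (use that in auto)
    ultimately show "\<exists>h K. norm h \<le> \<tau> \<and> mean_controlled K \<and>
        (\<forall>x\<in>\<Omega> \<inter> ball p r. x + h \<in> K \<and> (\<forall>s\<in>{0..1}. x + s *\<^sub>R h \<in> \<Omega>))"
      by blast
  qed
  with r(1) show ?thesis by blast
qed

text \<open>Compactness of the closure leaves finitely many balls, each inside \<Omega> or around a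
  boundary point in a chart.\<close>

lemma mean_controlled_dom:
  assumes lip: "lipschitz_boundary \<Omega>"
  shows "mean_controlled \<Omega>"
proof -
  have "\<exists>r>0. mean_controlled (\<Omega> \<inter> ball p r)" if p: "p \<in> closure \<Omega>" for p
  proof (cases "p \<in> \<Omega>")
    case True
    then obtain r where r: "r > 0" "cball p r \<subseteq> \<Omega>" using open_dom open_contains_cball by blast
    have "mean_controlled (\<Omega> \<inter> ball p r)"
      by (rule mean_controlled_mono[OF mean_controlled_compact[OF compact_cball r(2)]]) (use open_dom in auto)
    then show ?thesis using r by blast
  next
    case False
    then have "p \<in> frontier \<Omega>" using p open_dom by (simp add: frontier_def interior_open)
    then show ?thesis by (rule mean_controlled_boundary[OF lip])
  qed
  then obtain r where r: "\<And>p. p \<in> closure \<Omega> \<Longrightarrow> r p > 0 \<and> mean_controlled (\<Omega> \<inter> ball p (r p))" by metis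
  have cpt: "compact (closure \<Omega>)" using bounded_dom by simp
  have cov: "closure \<Omega> \<subseteq> (\<Union>p\<in>closure \<Omega>. ball p (r p))" using r by force
  obtain I where I: "I \<subseteq> closure \<Omega>" "finite I" "closure \<Omega> \<subseteq> (\<Union>p\<in>I. ball p (r p))"
    by (rule compactE_image[OF cpt _ cov]) auto
  have "mean_controlled (\<Union>p\<in>I. \<Omega> \<inter> ball p (r p))"
    using I r by (intro mean_controlled_Union) auto
  moreover have "(\<Union>p\<in>I. \<Omega> \<inter> ball p (r p)) = \<Omega>" using I(3) closure_subset by blast
  ultimately show ?thesis by simp
qed

end

section \<open>Extraction of convergent subsequences\<close>

lemma finite_family_convergent_subsequence:
  fixes a :: "'i \<Rightarrow> nat \<Rightarrow> real"
  assumes "finite I" "\<And>i. i \<in> I \<Longrightarrow> bounded (range (a i))"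
  shows "\<exists>f. strict_mono (f :: nat \<Rightarrow> nat) \<and> (\<forall>i\<in>I. convergent (a i \<circ> f))"
  using assms
proof (induction I rule: finite_induct)
  case empty
  then show ?case by (auto intro: exI[of _ id] simp: strict_mono_def)
next
  case (insert i I)
  then obtain f where f: "strict_mono (f :: nat \<Rightarrow> nat)" "\<And>j. j \<in> I \<Longrightarrow> convergent (a j \<circ> f)" by blast
  have "bounded (range (a i \<circ> f))"
    using insert.prems[of i] by (auto intro: bounded_subset)
  from bounded_imp_convergent_subsequence[OF this]
  obtain l g where g: "strict_mono (g :: nat \<Rightarrow> nat)" "((a i \<circ> f) \<circ> g) \<longlonglongrightarrow> l" by blast
  have "convergent (a j \<circ> (f \<circ> g))" if j: "j \<in> insert i I" for j
  proof (cases "j = i")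
    case True
    then show ?thesis using g(2) by (auto simp: convergent_def comp_assoc)
  next
    case False
    then obtain l' where "(a j \<circ> f) \<longlonglongrightarrow> l'" using f(2)[of j] j by (auto simp: convergent_def)
    from LIMSEQ_subseq_LIMSEQ[OF this g(1)] show ?thesis by (auto simp: convergent_def comp_assoc)
  qed
  then show ?case
    using strict_mono_o[OF f(1) g(1)] by (intro exI[of _ "f \<circ> g"] conjI ballI)
qed

context bounded_open
begin

text \<open>For a fixed e only finitely many averages have to converge, which a subsequence
  achieves; mean control applied to differences then makes every pairwise distance small once an
  initial segment is dropped.\<close>

lemma Rellich_small_oscillation:
  assumes mc: "mean_controlled \<Omega>" and ug: "\<And>n. weak_pair (u n) (g n)"
    and uB: "\<And>n. (LINT x|\<Lambda>. (u n x)\<^sup>2) \<le> B" and gB: "\<And>n. (LINT x|\<Lambda>. (norm (g n x))\<^sup>2) \<le> B" and e: "e > 0"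
  shows "\<exists>f. strict_mono (f :: nat \<Rightarrow> nat) \<and> (\<forall>m n. (LINT x|\<Lambda>. (u (f m) x - u (f n) x)\<^sup>2) < e)"
proof -
  interpret finite_measure \<Lambda> by (rule finite_measure_dom)
  have su: "square_integrable \<Lambda> (u n)" and sg: "square_integrable \<Lambda> (g n)" for n
    using ug by (auto simp: weak_pair_def)
  have B: "0 \<le> B" using order_trans[OF _ uB[of 0], of 0] by (simp add: integral_nonneg_AE)
  \<comment> \<open>Squared gradient norms of differences are at most 4 B, so the gradient term
    stays below e / 2; the added 1 keeps the divisor positive.\<close>
  define \<epsilon> where "\<epsilon> = e / (8 * (B + 1))"
  have \<epsilon>: "\<epsilon> > 0" using e B by (simp add: \<epsilon>_def)
  obtain \<Q> C where \<Q>: "finite \<Q>" "0 \<le> C" "\<Q> \<subseteq> sets borel"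
    "\<And>u g. weak_pair u g \<Longrightarrow> (LINT x|\<Lambda>. indicator \<Omega> x * (u x)\<^sup>2) \<le>
      C * (\<Sum>Q\<in>\<Q>. (LINT x|\<Lambda>. indicator Q x * u x)\<^sup>2) + \<epsilon> * (LINT x|\<Lambda>. (norm (g x))\<^sup>2)"
    using mean_controlledD[OF mc \<epsilon>] by blast
  define a where "a Q n = (LINT x|\<Lambda>. indicator Q x * u n x)" for Q n
  have ai: "integrable \<Lambda> (\<lambda>x. indicator Q x * u n x)" if "Q \<in> \<Q>" for Q n
    using integrable_indicator_dom[OF su] \<Q>(3) that by blast
  have "bounded (range (a Q))" if Q: "Q \<in> \<Q>" for Q
  proof -
    have "\<bar>a Q n\<bar> \<le> sqrt (measure \<Lambda> (space \<Lambda>)) * sqrt B" for n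
    proof -
      have "\<bar>a Q n\<bar> \<le> (LINT x|\<Lambda>. \<bar>indicator Q x * u n x\<bar>)" unfolding a_def by (rule integral_abs_bound)
      also have "\<dots> \<le> (LINT x|\<Lambda>. norm (u n x))"
        using ai[OF Q] integrable_dom[OF su] by (intro integral_mono) (auto simp: indicator_def)
      also have "\<dots> \<le> sqrt (measure \<Lambda> (space \<Lambda>)) * sqrt (LINT x|\<Lambda>. (norm (u n x))\<^sup>2)"
        by (rule integral_norm_le_L2[OF su])
      also have "\<dots> \<le> sqrt (measure \<Lambda> (space \<Lambda>)) * sqrt B"
        using uB[of n] by (intro mult_left_mono) auto
      finally show ?thesis .
    qed
    then show ?thesis unfolding bounded_iff by auto
  qed
  then obtain f where f: "strict_mono (f :: nat \<Rightarrow> nat)" "\<And>Q. Q \<in> \<Q> \<Longrightarrow> convergent (a Q \<circ> f)"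
    using finite_family_convergent_subsequence[OF \<Q>(1), of a] by blast
  \<comment> \<open>The share of one average: the sum over all of \<Q>, weighted by C, is then at
    most e / 4. The added ones keep the divisor positive.\<close>
  define d where "d = e / (4 * (C + 1) * (real (card \<Q>) + 1))"
  have d: "d > 0" using e \<Q>(2) by (simp add: d_def)
  have "\<exists>N. \<forall>m\<ge>N. \<forall>n\<ge>N. (a Q (f m) - a Q (f n))\<^sup>2 < d" if "Q \<in> \<Q>" for Q
  proof -
    have "Cauchy (a Q \<circ> f)" using f(2)[OF that] convergent_Cauchy by blast
    moreover have "sqrt d > 0" using d by simp
    ultimately obtain N where N: "\<And>m n. m \<ge> N \<Longrightarrow> n \<ge> N \<Longrightarrow> dist ((a Q \<circ> f) m) ((a Q \<circ> f) n) < sqrt d"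
      unfolding Cauchy_def by blast
    have "(a Q (f m) - a Q (f n))\<^sup>2 < d" if "m \<ge> N" "n \<ge> N" for m n
    proof -
      have "\<bar>a Q (f m) - a Q (f n)\<bar> < sqrt d" using N[OF that] by (simp add: dist_real_def)
      then have "\<bar>a Q (f m) - a Q (f n)\<bar>\<^sup>2 < (sqrt d)\<^sup>2" by (intro power_strict_mono) auto
      then show ?thesis using d by simp
    qed
    then show ?thesis by blast
  qed
  then obtain N where N: "\<And>Q m n. Q \<in> \<Q> \<Longrightarrow> m \<ge> N Q \<Longrightarrow> n \<ge> N Q \<Longrightarrow> (a Q (f m) - a Q (f n))\<^sup>2 < d" by metis
  define M where "M = (\<Sum>Q\<in>\<Q>. N Q)"
  have M: "N Q \<le> M" if "Q \<in> \<Q>" for Q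
    unfolding M_def using \<Q>(1) that by (simp add: member_le_sum)
  have small: "(LINT x|\<Lambda>. (u (f (m + M)) x - u (f (n + M)) x)\<^sup>2) < e" for m n
  proof -
    let ?m = "f (m + M)" and ?n = "f (n + M)"
    have wp: "weak_pair (\<lambda>x. u ?m x - u ?n x) (\<lambda>x. g ?m x - g ?n x)"
      using weak_pair_add[OF ug[of ?m] weak_pair_scale[OF ug[of ?n], of "-1"]] by simp
    have "(LINT x|\<Lambda>. (u ?m x - u ?n x)\<^sup>2) = (LINT x|\<Lambda>. indicator \<Omega> x * (u ?m x - u ?n x)\<^sup>2)"
      by (intro Bochner_Integration.integral_cong) auto
    also have "\<dots> \<le> C * (\<Sum>Q\<in>\<Q>. (LINT x|\<Lambda>. indicator Q x * (u ?m x - u ?n x))\<^sup>2) + \<epsilon> * (LINT x|\<Lambda>. (norm (g ?m x - g ?n x))\<^sup>2)"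
      by (rule \<Q>(4)[OF wp])
    also have "(\<Sum>Q\<in>\<Q>. (LINT x|\<Lambda>. indicator Q x * (u ?m x - u ?n x))\<^sup>2) \<le> (\<Sum>Q\<in>\<Q>. d)"
    proof (rule sum_mono)
      fix Q assume Q: "Q \<in> \<Q>"
      have "(LINT x|\<Lambda>. indicator Q x * (u ?m x - u ?n x)) = a Q ?m - a Q ?n"
        using ai[OF Q] by (simp add: a_def right_diff_distrib)
      then show "(LINT x|\<Lambda>. indicator Q x * (u ?m x - u ?n x))\<^sup>2 \<le> d"
        using N[OF Q, of "m + M" "n + M"] M[OF Q] by simp
    qed
    also have "(LINT x|\<Lambda>. (norm (g ?m x - g ?n x))\<^sup>2) \<le> 4 * B"
    proof -
      interpret i: psd_form "{f :: 'a \<Rightarrow> 'a. square_integrable \<Lambda> f}" "\<lambda>f g. LINT x|\<Lambda>. f x \<bullet> g x"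
        by (rule psd_form_inner)
      have "(LINT x|\<Lambda>. (g ?m - g ?n) x \<bullet> (g ?m - g ?n) x) \<le> 2 * (LINT x|\<Lambda>. g ?m x \<bullet> g ?m x) + 2 * (LINT x|\<Lambda>. g ?n x \<bullet> g ?n x)"
        using sg by (intro i.diff_le) auto
      then show ?thesis
        using gB[of ?m] gB[of ?n] by (simp add: power2_norm_eq_inner)
    qed
    finally have "(LINT x|\<Lambda>. (u ?m x - u ?n x)\<^sup>2) \<le> C * (\<Sum>Q\<in>\<Q>. d) + \<epsilon> * (4 * B)"
      using \<Q>(2) \<epsilon> by (simp add: mult_left_mono)
    also have "C * (\<Sum>Q\<in>\<Q>. d) \<le> e / 4"
    proof -
      have "C * (\<Sum>Q\<in>\<Q>. d) \<le> (C + 1) * ((real (card \<Q>) + 1) * d)"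
        using \<Q>(2) d by (simp add: mult_mono)
      also have "\<dots> = e / 4"
      proof -
        have "A * (L * (e / (4 * A * L))) = e / 4" if "A \<noteq> 0" "L \<noteq> 0" for A L :: real
          using that by simp
        from this[of "C + 1" "real (card \<Q>) + 1"] show ?thesis
          using \<Q>(2) by (simp add: d_def add_nonneg_eq_0_iff)
      qed
      finally show ?thesis .
    qed
    also have "\<epsilon> * (4 * B) \<le> e / 2"
    proof -
      have "\<epsilon> * (4 * B) \<le> \<epsilon> * (4 * (B + 1))" using \<epsilon> by simp
      also have "\<dots> = e / 2" using B by (simp add: \<epsilon>_def field_simps)
      finally show ?thesis .
    qed
    finally show ?thesis using e by simp
  qed
  have "strict_mono (\<lambda>n. f (n + M))" using f(1) by (simp add: strict_mono_def)
  then show ?thesis using small by blast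
qed

text \<open>The subsequence of the preceding lemma depends on e; a diagonal sequence through the
  tolerances 1 / (k + 1) is Cauchy, since beyond index k it runs inside the k-th
  subsequence.\<close>

theorem Rellich:
  assumes lip: "lipschitz_boundary \<Omega>" and ug: "\<And>n. weak_pair (u n) (g n)"
    and uB: "\<And>n. (LINT x|\<Lambda>. (u n x)\<^sup>2) \<le> B" and gB: "\<And>n. (LINT x|\<Lambda>. (norm (g n x))\<^sup>2) \<le> B"
  shows "\<exists>f. strict_mono (f :: nat \<Rightarrow> nat) \<and>
    (\<forall>e>0. \<exists>N. \<forall>m\<ge>N. \<forall>n\<ge>N. (LINT x|\<Lambda>. (u (f m) x - u (f n) x)\<^sup>2) < e)"
proof -
  define P where "P k s \<longleftrightarrow> (\<forall>m n. (LINT x|\<Lambda>. (u (s m) x - u (s n) x)\<^sup>2) < 1 / real (Suc k))" for k and s :: "nat \<Rightarrow> nat"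
  interpret subseqs P
  proof
    fix k and s :: "nat \<Rightarrow> nat"
    have "\<exists>f. strict_mono (f :: nat \<Rightarrow> nat) \<and> (\<forall>m n. (LINT x|\<Lambda>. (u (s (f m)) x - u (s (f n)) x)\<^sup>2) < 1 / real (Suc k))"
      by (rule Rellich_small_oscillation[OF mean_controlled_dom[OF lip], of "\<lambda>n. u (s n)" "\<lambda>n. g (s n)"]) (auto intro: ug uB gB)
    then show "\<exists>r. strict_mono r \<and> P k (s \<circ> r)" by (simp add: P_def)
  qed
  have PD: "(LINT x|\<Lambda>. (u (s m) x - u (s n) x)\<^sup>2) < 1 / real (Suc k)" if "P k s" for k s m n
    using that by (simp add: P_def)
  have hold: "P k (diagseq \<circ> (+) (Suc k))" for k
    by (rule diagseq_holds) (simp add: P_def)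
  have "\<exists>N. \<forall>m\<ge>N. \<forall>n\<ge>N. (LINT x|\<Lambda>. (u (diagseq m) x - u (diagseq n) x)\<^sup>2) < e" if e: "e > 0" for e
  proof -
    obtain k where k: "1 / real (Suc k) < e" by (rule nat_approx_posE[OF e])
    have "(LINT x|\<Lambda>. (u (diagseq m) x - u (diagseq n) x)\<^sup>2) < e" if "m \<ge> Suc k" "n \<ge> Suc k" for m n
    proof -
      have "m = Suc k + (m - Suc k)" "n = Suc k + (n - Suc k)" using that by auto
      then have "(LINT x|\<Lambda>. (u (diagseq m) x - u (diagseq n) x)\<^sup>2) < 1 / real (Suc k)"
        using PD[OF hold[of k], of "m - Suc k" "n - Suc k"] by simp
      then show ?thesis using k by simp
    qed
    then show ?thesis by blast
  qed
  with subseq_diagseq show ?thesis by blast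
qed

end

subsection \<open>The Neumann forms\<close>

lemma square_integrable_norm2_measurable:
  "square_integrable M f \<Longrightarrow> (\<lambda>x. (norm (f x))\<^sup>2) \<in> borel_measurable M"
  by (auto simp: square_integrable_def)

context bounded_open
begin

text \<open>The weight is an arbitrary function on \<Omega>, so the same form serves for the
  coefficients and, with an indefinite weight, for their derivatives along the segment.\<close>

definition mass_form :: "('a \<Rightarrow> real) \<Rightarrow> ('a \<Rightarrow> real) \<Rightarrow> ('a \<Rightarrow> real) \<Rightarrow> real" where
  "mass_form \<kappa> u v = (LINT x|\<Lambda>. \<kappa> x * u x * v x)"

definition stiffness_form :: "('a \<Rightarrow> real) \<Rightarrow> ('a \<Rightarrow> real) \<Rightarrow> ('a \<Rightarrow> real) \<Rightarrow> real" where
  "stiffness_form \<alpha> u v = (LINT x|\<Lambda>. \<alpha> x * (weak_grad \<Omega> u x \<bullet> weak_grad \<Omega> v x))"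

lemma mass_form_inner: "mass_form \<kappa> u v = (LINT x|\<Lambda>. \<kappa> x * (u x \<bullet> v x))"
  by (simp add: mass_form_def mult.assoc)

lemma H1_square_integrable:
  "u \<in> H1 \<Omega> \<Longrightarrow> square_integrable \<Lambda> u" "u \<in> H1 \<Omega> \<Longrightarrow> square_integrable \<Lambda> (weak_grad \<Omega> u)"
  using weak_pair_weak_grad by (auto simp: weak_pair_def)

lemma weak_grad_diff:
  assumes "u \<in> H1 \<Omega>" "v \<in> H1 \<Omega>"
  shows "AE x in \<Lambda>. weak_grad \<Omega> (u - v) x = weak_grad \<Omega> u x - weak_grad \<Omega> v x"
proof -
  have "u - v = u + (-1) *\<^sub>R v" by (simp add: fun_eq_iff)
  then show ?thesis
    using weak_grad_add(2)[OF assms(1) weak_grad_scale(1)[OF assms(2), of "-1"]] weak_grad_scale(2)[OF assms(2), of "-1"]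
    by (auto elim!: eventually_elim2)
qed

lemma measurable_H1_inner:
  assumes "\<alpha> \<in> borel_measurable \<Lambda>" "u \<in> H1 \<Omega>" "v \<in> H1 \<Omega>"
  shows "(\<lambda>x. \<alpha> x * (weak_grad \<Omega> u x \<bullet> weak_grad \<Omega> v x)) \<in> borel_measurable \<Lambda>"
  using assms H1_square_integrable
  by (intro borel_measurable_times borel_measurable_inner) (auto simp: square_integrable_def)

lemma stiffness_form_add_left:
  assumes \<alpha>: "\<alpha> \<in> borel_measurable \<Lambda>" "AE x in \<Lambda>. \<bar>\<alpha> x\<bar> \<le> B" and u: "u \<in> H1 \<Omega>" and v: "v \<in> H1 \<Omega>" and w: "w \<in> H1 \<Omega>"
  shows "stiffness_form \<alpha> (u + v) w = stiffness_form \<alpha> u w + stiffness_form \<alpha> v w"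
proof -
  note int = square_integrable_weighted_inner[OF _ _ \<alpha>]
  have "stiffness_form \<alpha> (u + v) w = (LINT x|\<Lambda>. \<alpha> x * (weak_grad \<Omega> u x \<bullet> weak_grad \<Omega> w x) + \<alpha> x * (weak_grad \<Omega> v x \<bullet> weak_grad \<Omega> w x))"
    unfolding stiffness_form_def
  proof (rule integral_cong_AE)
    show "AE x in \<Lambda>. \<alpha> x * (weak_grad \<Omega> (u + v) x \<bullet> weak_grad \<Omega> w x) =
        \<alpha> x * (weak_grad \<Omega> u x \<bullet> weak_grad \<Omega> w x) + \<alpha> x * (weak_grad \<Omega> v x \<bullet> weak_grad \<Omega> w x)"
      using weak_grad_add(2)[OF u v] by eventually_elim (simp add: inner_add_left distrib_left)
  qed (use \<alpha>(1) u v w weak_grad_add(1) in \<open>auto intro!: measurable_H1_inner borel_measurable_add\<close>)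
  also have "\<dots> = stiffness_form \<alpha> u w + stiffness_form \<alpha> v w"
    unfolding stiffness_form_def using u v w H1_square_integrable by (intro Bochner_Integration.integral_add int) auto
  finally show ?thesis .
qed

lemma stiffness_form_scale_left:
  assumes \<alpha>: "\<alpha> \<in> borel_measurable \<Lambda>" and u: "u \<in> H1 \<Omega>" and w: "w \<in> H1 \<Omega>"
  shows "stiffness_form \<alpha> (b *\<^sub>R u) w = b * stiffness_form \<alpha> u w"
proof -
  have "stiffness_form \<alpha> (b *\<^sub>R u) w = (LINT x|\<Lambda>. b * (\<alpha> x * (weak_grad \<Omega> u x \<bullet> weak_grad \<Omega> w x)))"
    unfolding stiffness_form_def
  proof (rule integral_cong_AE)
    show "AE x in \<Lambda>. \<alpha> x * (weak_grad \<Omega> (b *\<^sub>R u) x \<bullet> weak_grad \<Omega> w x) = b * (\<alpha> x * (weak_grad \<Omega> u x \<bullet> weak_grad \<Omega> w x))"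
      using weak_grad_scale(2)[OF u, of b] by eventually_elim simp
  qed (use \<alpha> u w weak_grad_scale(1) in \<open>auto intro!: measurable_H1_inner borel_measurable_times[OF borel_measurable_const]\<close>)
  then show ?thesis by (simp add: stiffness_form_def)
qed

lemma mass_form_add_left:
  assumes \<alpha>: "\<alpha> \<in> borel_measurable \<Lambda>" "AE x in \<Lambda>. \<bar>\<alpha> x\<bar> \<le> B" and u: "u \<in> H1 \<Omega>" and v: "v \<in> H1 \<Omega>" and w: "w \<in> H1 \<Omega>"
  shows "mass_form \<alpha> (u + v) w = mass_form \<alpha> u w + mass_form \<alpha> v w"
proof -
  have "mass_form \<alpha> (u + v) w = (LINT x|\<Lambda>. \<alpha> x * (u x \<bullet> w x) + \<alpha> x * (v x \<bullet> w x))"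
    by (simp add: mass_form_inner distrib_left distrib_right)
  also have "\<dots> = mass_form \<alpha> u w + mass_form \<alpha> v w"
    unfolding mass_form_inner using u v w H1_square_integrable
    by (intro Bochner_Integration.integral_add square_integrable_weighted_inner[OF _ _ \<alpha>]) auto
  finally show ?thesis .
qed

lemma mass_form_scale_left: "mass_form \<alpha> (b *\<^sub>R u) w = b * mass_form \<alpha> u w"
  by (simp add: mass_form_def mult.assoc mult.left_commute)

end

text \<open>The bounds C and B are to be shared by the unperturbed and all perturbed coefficients.
  They compare both forms with the plain L2 norms of u and its gradient, which transfers Rellich
  compactness and completeness to the forms.\<close>

locale elliptic_coefficients = bounded_open \<Omega> for \<Omega> :: "'a::euclidean_space set" +
  fixes \<alpha> \<kappa> :: "'a \<Rightarrow> real" and C B :: real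
  assumes lip: "lipschitz_boundary \<Omega>" and nonempty: "\<Omega> \<noteq> {}" and C_pos: "C > 0"
    and \<alpha>_meas: "\<alpha> \<in> borel_measurable \<Lambda>" and \<kappa>_meas: "\<kappa> \<in> borel_measurable \<Lambda>"
    and \<alpha>_bounds: "AE x in \<Lambda>. C \<le> \<alpha> x \<and> \<alpha> x \<le> B"
    and \<kappa>_bounds: "AE x in \<Lambda>. C \<le> \<kappa> x \<and> \<kappa> x \<le> B"
begin

lemma abs_bounds: "AE x in \<Lambda>. \<bar>\<alpha> x\<bar> \<le> B" "AE x in \<Lambda>. \<bar>\<kappa> x\<bar> \<le> B"
proof -
  show "AE x in \<Lambda>. \<bar>\<alpha> x\<bar> \<le> B" using \<alpha>_bounds by eventually_elim (use C_pos in auto)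
  show "AE x in \<Lambda>. \<bar>\<kappa> x\<bar> \<le> B" using \<kappa>_bounds by eventually_elim (use C_pos in auto)
qed

lemma weighted_norm_bounds:
  fixes f :: "'a \<Rightarrow> 'b::euclidean_space"
  assumes w: "w \<in> borel_measurable \<Lambda>" "AE x in \<Lambda>. C \<le> w x \<and> w x \<le> B" and f: "square_integrable \<Lambda> f"
  shows "C * (LINT x|\<Lambda>. (norm (f x))\<^sup>2) \<le> (LINT x|\<Lambda>. w x * (f x \<bullet> f x))"
    and "(LINT x|\<Lambda>. w x * (f x \<bullet> f x)) \<le> B * (LINT x|\<Lambda>. (norm (f x))\<^sup>2)"
proof -
  have "AE x in \<Lambda>. \<bar>w x\<bar> \<le> B" using w(2) by eventually_elim (use C_pos in auto)
  then have int: "integrable \<Lambda> (\<lambda>x. w x * (f x \<bullet> f x))"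
    by (rule square_integrable_weighted_inner[OF f f w(1)])
  have w2: "AE x in \<Lambda>. C \<le> w x" "AE x in \<Lambda>. w x \<le> B" using w(2) by auto
  have int2: "integrable \<Lambda> (\<lambda>x. (norm (f x))\<^sup>2)" using f by (simp add: square_integrable_def)
  have "(LINT x|\<Lambda>. C * (norm (f x))\<^sup>2) \<le> (LINT x|\<Lambda>. w x * (f x \<bullet> f x))"
    using int int2 w2(1) by (intro integral_mono_AE) (auto elim!: eventually_mono simp: power2_norm_eq_inner mult_right_mono)
  then show "C * (LINT x|\<Lambda>. (norm (f x))\<^sup>2) \<le> (LINT x|\<Lambda>. w x * (f x \<bullet> f x))" by simp
  have "(LINT x|\<Lambda>. w x * (f x \<bullet> f x)) \<le> (LINT x|\<Lambda>. B * (norm (f x))\<^sup>2)"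
    using int int2 w2(2) by (intro integral_mono_AE) (auto elim!: eventually_mono simp: power2_norm_eq_inner mult_right_mono)
  then show "(LINT x|\<Lambda>. w x * (f x \<bullet> f x)) \<le> B * (LINT x|\<Lambda>. (norm (f x))\<^sup>2)" by simp
qed

lemma mass_bounds:
  assumes "u \<in> H1 \<Omega>"
  shows "C * (LINT x|\<Lambda>. (u x)\<^sup>2) \<le> mass_form \<kappa> u u" "mass_form \<kappa> u u \<le> B * (LINT x|\<Lambda>. (u x)\<^sup>2)"
  using weighted_norm_bounds[OF \<kappa>_meas \<kappa>_bounds H1_square_integrable(1)[OF assms]]
  by (simp_all add: mass_form_inner)

lemma stiffness_bounds:
  assumes "u \<in> H1 \<Omega>"
  shows "C * (LINT x|\<Lambda>. (norm (weak_grad \<Omega> u x))\<^sup>2) \<le> stiffness_form \<alpha> u u"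
    "stiffness_form \<alpha> u u \<le> B * (LINT x|\<Lambda>. (norm (weak_grad \<Omega> u x))\<^sup>2)"
  using weighted_norm_bounds[OF \<alpha>_meas \<alpha>_bounds H1_square_integrable(2)[OF assms]]
  by (simp_all add: stiffness_form_def)

lemma mass_zero_iff:
  assumes u: "u \<in> H1 \<Omega>"
  shows "mass_form \<kappa> u u = 0 \<longleftrightarrow> (AE x in \<Lambda>. u x = 0)"
proof
  assume "mass_form \<kappa> u u = 0"
  then have "C * (LINT x|\<Lambda>. (u x)\<^sup>2) \<le> C * 0" using mass_bounds(1)[OF u] by simp
  then have "(LINT x|\<Lambda>. (u x)\<^sup>2) \<le> 0" using C_pos by (simp only: mult_le_cancel_left_pos)
  moreover have "0 \<le> (LINT x|\<Lambda>. (u x)\<^sup>2)" by (intro integral_nonneg_AE) auto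
  ultimately have "(LINT x|\<Lambda>. (u x)\<^sup>2) = 0" by simp
  then have "AE x in \<Lambda>. (u x)\<^sup>2 = 0"
    using H1_square_integrable(1)[OF u] by (subst (asm) integral_nonneg_eq_0_iff_AE) (auto simp: square_integrable_def)
  then show "AE x in \<Lambda>. u x = 0" by eventually_elim simp
next
  assume "AE x in \<Lambda>. u x = 0"
  then have "AE x in \<Lambda>. \<kappa> x * u x * u x = 0" by eventually_elim simp
  then show "mass_form \<kappa> u u = 0" unfolding mass_form_def by (rule integral_eq_zero_AE)
qed

lemma psd_mass: "psd_form (H1 \<Omega>) (mass_form \<kappa>)"
proof (unfold_locales, rule subspace_H1)
  fix u v w :: "'a \<Rightarrow> real" and b :: real
  show "u \<in> H1 \<Omega> \<Longrightarrow> v \<in> H1 \<Omega> \<Longrightarrow> w \<in> H1 \<Omega> \<Longrightarrow> mass_form \<kappa> (u + v) w = mass_form \<kappa> u w + mass_form \<kappa> v w"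
    by (rule mass_form_add_left[OF \<kappa>_meas abs_bounds(2)])
  show "mass_form \<kappa> (b *\<^sub>R u) w = b * mass_form \<kappa> u w" by (rule mass_form_scale_left)
  show "mass_form \<kappa> u v = mass_form \<kappa> v u" by (simp add: mass_form_def mult_ac)
  show "0 \<le> mass_form \<kappa> u u"
    unfolding mass_form_def using \<kappa>_bounds C_pos by (intro integral_nonneg_AE) (auto elim!: eventually_mono simp: mult.assoc)
qed

lemma psd_stiffness: "psd_form (H1 \<Omega>) (stiffness_form \<alpha>)"
proof (unfold_locales, rule subspace_H1)
  fix u v w :: "'a \<Rightarrow> real" and b :: real
  show "u \<in> H1 \<Omega> \<Longrightarrow> v \<in> H1 \<Omega> \<Longrightarrow> w \<in> H1 \<Omega> \<Longrightarrow> stiffness_form \<alpha> (u + v) w = stiffness_form \<alpha> u w + stiffness_form \<alpha> v w"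
    by (rule stiffness_form_add_left[OF \<alpha>_meas abs_bounds(1)])
  show "u \<in> H1 \<Omega> \<Longrightarrow> w \<in> H1 \<Omega> \<Longrightarrow> stiffness_form \<alpha> (b *\<^sub>R u) w = b * stiffness_form \<alpha> u w"
    by (rule stiffness_form_scale_left[OF \<alpha>_meas])
  show "stiffness_form \<alpha> u v = stiffness_form \<alpha> v u" by (simp add: stiffness_form_def inner_commute)
  show "0 \<le> stiffness_form \<alpha> u u"
    unfolding stiffness_form_def using \<alpha>_bounds C_pos by (intro integral_nonneg_AE) (auto elim!: eventually_mono)
qed

text \<open>A nonempty open set is not null, so the bounds C <= \<alpha> x <= B hold at some
  point.\<close>

lemma B_pos: "0 < B"
proof -
  have "\<not> (AE x in \<Lambda>. False)"
  proof
    assume "AE x in \<Lambda>. False"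
    then have "AE x in lborel. x \<notin> \<Omega>" by (simp add: AE_dom_iff)
    then have "\<Omega> \<in> null_sets lborel" using open_dom by (simp add: AE_iff_null_sets)
    then have "negligible \<Omega>" by (simp add: negligible_iff_null_sets null_sets_completionI)
    then show False using open_not_negligible[OF open_dom nonempty] by simp
  qed
  moreover have "AE x in \<Lambda>. 0 < B" using \<alpha>_bounds by eventually_elim (use C_pos in auto)
  ultimately show ?thesis by (cases "0 < B") auto
qed

lemma mass_compact:
  assumes x: "\<And>n. x n \<in> H1 \<Omega>" and r: "\<And>n. mass_form \<kappa> (x n) (x n) \<le> D" and q: "\<And>n. stiffness_form \<alpha> (x n) (x n) \<le> D"
  shows "\<exists>f. strict_mono (f :: nat \<Rightarrow> nat) \<and> form_Cauchy (mass_form \<kappa>) (x \<circ> f)"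
proof -
  have le: "I \<le> D / C" if "C * I \<le> D" for I using that C_pos by (simp add: pos_le_divide_eq mult.commute)
  have "(LINT y|\<Lambda>. (x n y)\<^sup>2) \<le> D / C" "(LINT y|\<Lambda>. (norm (weak_grad \<Omega> (x n) y))\<^sup>2) \<le> D / C" for n
    using mass_bounds(1)[OF x, of n] stiffness_bounds(1)[OF x, of n] r[of n] q[of n] by (auto intro!: le)
  from Rellich[where u = x, OF lip weak_pair_weak_grad[OF x] this] obtain f where f: "strict_mono (f :: nat \<Rightarrow> nat)"
    "\<forall>e>0. \<exists>N. \<forall>m\<ge>N. \<forall>n\<ge>N. (LINT y|\<Lambda>. (x (f m) y - x (f n) y)\<^sup>2) < e"
    by (elim exE conjE)
  have "form_Cauchy (mass_form \<kappa>) (x \<circ> f)"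
    unfolding form_Cauchy_def
  proof (intro allI impI)
    fix e :: real assume "e > 0"
    then have "e / B > 0" using B_pos by simp
    from f(2)[rule_format, OF this] obtain N where N: "\<And>m n. m \<ge> N \<Longrightarrow> n \<ge> N \<Longrightarrow> (LINT y|\<Lambda>. (x (f m) y - x (f n) y)\<^sup>2) < e / B" by blast
    have "mass_form \<kappa> ((x \<circ> f) m - (x \<circ> f) n) ((x \<circ> f) m - (x \<circ> f) n) < e" if "m \<ge> N" "n \<ge> N" for m n
    proof -
      have "mass_form \<kappa> (x (f m) - x (f n)) (x (f m) - x (f n)) \<le> B * (LINT y|\<Lambda>. (x (f m) y - x (f n) y)\<^sup>2)"
        using mass_bounds(2)[OF subspace_diff[OF subspace_H1 x x], of "f m" "f n"] by simp
      also have "\<dots> < B * (e / B)" using N[OF that] B_pos by (intro mult_strict_left_mono)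
      finally show ?thesis using B_pos by simp
    qed
    then show "\<exists>N. \<forall>m\<ge>N. \<forall>n\<ge>N. mass_form \<kappa> ((x \<circ> f) m - (x \<circ> f) n) ((x \<circ> f) m - (x \<circ> f) n) < e" by blast
  qed
  with f(1) show ?thesis by blast
qed

text \<open>A sequence Cauchy in both forms has functions and gradients Cauchy in L2; the two limits
  belong together because the weak gradient is closed.\<close>

lemma form_complete:
  assumes x: "\<And>n. x n \<in> H1 \<Omega>" and r: "form_Cauchy (mass_form \<kappa>) x" and q: "form_Cauchy (stiffness_form \<alpha>) x"
  shows "\<exists>v\<in>H1 \<Omega>. (\<lambda>n. mass_form \<kappa> (x n - v) (x n - v)) \<longlonglongrightarrow> 0 \<and> (\<lambda>n. stiffness_form \<alpha> (x n - v) (x n - v)) \<longlonglongrightarrow> 0"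
proof -
  interpret finite_measure \<Lambda> by (rule finite_measure_dom)
  let ?g = "\<lambda>n. weak_grad \<Omega> (x n)"
  have xd: "x m - x n \<in> H1 \<Omega>" for m n by (intro subspace_diff[OF subspace_H1] x)
  have gd: "(LINT y|\<Lambda>. (norm (weak_grad \<Omega> (u - v) y))\<^sup>2) = (LINT y|\<Lambda>. (norm (weak_grad \<Omega> u y - weak_grad \<Omega> v y))\<^sup>2)"
    if "u \<in> H1 \<Omega>" "v \<in> H1 \<Omega>" for u v
  proof (rule integral_cong_AE)
    show "AE y in \<Lambda>. (norm (weak_grad \<Omega> (u - v) y))\<^sup>2 = (norm (weak_grad \<Omega> u y - weak_grad \<Omega> v y))\<^sup>2"
      using weak_grad_diff[OF that] by eventually_elim simp
    show "(\<lambda>y. (norm (weak_grad \<Omega> (u - v) y))\<^sup>2) \<in> borel_measurable \<Lambda>"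
      by (intro square_integrable_norm2_measurable H1_square_integrable(2) subspace_diff[OF subspace_H1] that)
    show "(\<lambda>y. (norm (weak_grad \<Omega> u y - weak_grad \<Omega> v y))\<^sup>2) \<in> borel_measurable \<Lambda>"
      by (intro square_integrable_norm2_measurable square_integrable_diff H1_square_integrable(2) that)
  qed
  have C1: "\<exists>N. \<forall>m\<ge>N. \<forall>n\<ge>N. (LINT y|\<Lambda>. (norm (x m y - x n y))\<^sup>2) < e" if "e > 0" for e
  proof -
    have "C * e > 0" using C_pos that by simp
    from form_CauchyD[OF r this] obtain N where N: "\<And>m n. m \<ge> N \<Longrightarrow> n \<ge> N \<Longrightarrow> mass_form \<kappa> (x m - x n) (x m - x n) < C * e" by blast
    have "(LINT y|\<Lambda>. (norm (x m y - x n y))\<^sup>2) < e" if "m \<ge> N" "n \<ge> N" for m n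
    proof -
      have "C * (LINT y|\<Lambda>. (norm (x m y - x n y))\<^sup>2) < C * e"
        using mass_bounds(1)[OF xd, of m n] N[OF that] by simp
      then show ?thesis using C_pos by (simp only: mult_less_cancel_left_pos)
    qed
    then show ?thesis by blast
  qed
  have C2: "\<exists>N. \<forall>m\<ge>N. \<forall>n\<ge>N. (LINT y|\<Lambda>. (norm (?g m y - ?g n y))\<^sup>2) < e" if "e > 0" for e
  proof -
    have "C * e > 0" using C_pos that by simp
    from form_CauchyD[OF q this] obtain N where N: "\<And>m n. m \<ge> N \<Longrightarrow> n \<ge> N \<Longrightarrow> stiffness_form \<alpha> (x m - x n) (x m - x n) < C * e" by blast
    have "(LINT y|\<Lambda>. (norm (?g m y - ?g n y))\<^sup>2) < e" if "m \<ge> N" "n \<ge> N" for m n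
    proof -
      have "C * (LINT y|\<Lambda>. (norm (?g m y - ?g n y))\<^sup>2) < C * e"
        using stiffness_bounds(1)[OF xd, of m n] N[OF that] unfolding gd[OF x x] by linarith
      then show ?thesis using C_pos by (simp only: mult_less_cancel_left_pos)
    qed
    then show ?thesis by blast
  qed
  obtain v where v: "square_integrable \<Lambda> v" "(\<lambda>n. LINT y|\<Lambda>. (norm (x n y - v y))\<^sup>2) \<longlonglongrightarrow> 0"
    using square_integrable_complete[of x, OF H1_square_integrable(1)[OF x] C1] by blast
  obtain h where h: "square_integrable \<Lambda> h" "(\<lambda>n. LINT y|\<Lambda>. (norm (?g n y - h y))\<^sup>2) \<longlonglongrightarrow> 0"
    using square_integrable_complete[of ?g, OF H1_square_integrable(2)[OF x] C2] by blast
  have vh: "weak_pair v h"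
    by (rule weak_pair_limit[OF weak_pair_weak_grad[OF x] v(1) h(1) v(2) h(2)])
  then have vH: "v \<in> H1 \<Omega>" by (rule weak_pair_H1)
  have xv: "x n - v \<in> H1 \<Omega>" for n by (intro subspace_diff[OF subspace_H1] x vH)
  have gl: "(LINT y|\<Lambda>. (norm (weak_grad \<Omega> (x n - v) y))\<^sup>2) = (LINT y|\<Lambda>. (norm (?g n y - h y))\<^sup>2)" for n
    unfolding gd[OF x vH]
  proof (rule integral_cong_AE)
    show "AE y in \<Lambda>. (norm (?g n y - weak_grad \<Omega> v y))\<^sup>2 = (norm (?g n y - h y))\<^sup>2"
      using weak_pair_unique[OF vh] by eventually_elim simp
    show "(\<lambda>y. (norm (?g n y - weak_grad \<Omega> v y))\<^sup>2) \<in> borel_measurable \<Lambda>"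
      by (intro square_integrable_norm2_measurable square_integrable_diff H1_square_integrable(2) x vH)
    show "(\<lambda>y. (norm (?g n y - h y))\<^sup>2) \<in> borel_measurable \<Lambda>"
      by (intro square_integrable_norm2_measurable square_integrable_diff H1_square_integrable(2) x h(1))
  qed
  have "(\<lambda>n. mass_form \<kappa> (x n - v) (x n - v)) \<longlonglongrightarrow> 0"
  proof (rule tendsto_sandwich[OF always_eventually always_eventually])
    show "\<forall>n. 0 \<le> mass_form \<kappa> (x n - v) (x n - v)" using psd_form.nonneg[OF psd_mass xv] by simp
    show "\<forall>n. mass_form \<kappa> (x n - v) (x n - v) \<le> B * (LINT y|\<Lambda>. (norm (x n y - v y))\<^sup>2)" using mass_bounds(2)[OF xv] by simp
    show "(\<lambda>n. B * (LINT y|\<Lambda>. (norm (x n y - v y))\<^sup>2)) \<longlonglongrightarrow> 0" using tendsto_mult_left[OF v(2), of B] by simp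
  qed simp
  moreover have "(\<lambda>n. stiffness_form \<alpha> (x n - v) (x n - v)) \<longlonglongrightarrow> 0"
  proof (rule tendsto_sandwich[OF always_eventually always_eventually])
    show "\<forall>n. 0 \<le> stiffness_form \<alpha> (x n - v) (x n - v)" using psd_form.nonneg[OF psd_stiffness xv] by simp
    show "\<forall>n. stiffness_form \<alpha> (x n - v) (x n - v) \<le> B * (LINT y|\<Lambda>. (norm (?g n y - h y))\<^sup>2)"
      using stiffness_bounds(2)[OF xv] unfolding gl by simp
    show "(\<lambda>n. B * (LINT y|\<Lambda>. (norm (?g n y - h y))\<^sup>2)) \<longlonglongrightarrow> 0" using tendsto_mult_left[OF h(2), of B] by simp
  qed simp
  ultimately show ?thesis using vH by blast
qed

text \<open>Bumps on the boxes of a diagonal chain \<open>p + t\<^sub>k One\<close>, \<open>t\<^sub>0 < t\<^sub>1 < \<dots>\<close>, have disjoint supports.\<close>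

lemma H1_infinite_dim:
  "\<exists>f. (\<forall>k<n. f k \<in> H1 \<Omega>) \<and> (\<forall>b. mass_form \<kappa> (\<Sum>k<n. b k *\<^sub>R f k) (\<Sum>k<n. b k *\<^sub>R f k) = 0 \<longrightarrow> (\<forall>k<n::nat. b k = 0))"
proof -
  obtain p where "p \<in> \<Omega>" using nonempty by blast
  then obtain r where r: "r > 0" "cball p r \<subseteq> \<Omega>" using open_dom open_contains_cball by blast
  \<comment> \<open>Coordinates within \<rho> of those of p give l1-distance at most r, so the whole
    diagonal chain lies in \<open>cball p r\<close>.\<close>
  define \<rho> where "\<rho> = r / DIM('a)"
  have \<rho>: "\<rho> > 0" using r by (simp add: \<rho>_def)
  define t where "t k = \<rho> * (real k / real (n + 1))" for k
  define a where "a k = p + t k *\<^sub>R One" for k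
  define f where "f k = box_bump 1 (a k) (a (Suc k))" for k
  have t_mono: "t j \<le> t k" if "j \<le> k" for j k
    using \<rho> that unfolding t_def by (intro mult_left_mono divide_right_mono) auto
  have t_less: "t k < t (Suc k)" for k
    using \<rho> unfolding t_def by (intro mult_strict_left_mono divide_strict_right_mono) auto
  have t_range: "0 \<le> t k" for k using \<rho> by (simp add: t_def)
  have t_le: "t (Suc k) \<le> \<rho>" if "k < n" for k
    using \<rho> that mult_left_mono[of "real (Suc k) / real (n + 1)" 1 \<rho>] unfolding t_def by simp
  have test: "f k \<in> test_functions \<Omega>" if "k < n" for k
    unfolding f_def
  proof (rule box_bump_test)
    show "cbox (a k) (a (Suc k)) \<subseteq> \<Omega>"
    proof
      fix x assume x: "x \<in> cbox (a k) (a (Suc k))"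
      have "norm (x - p) \<le> (\<Sum>b\<in>Basis. \<bar>(x - p) \<bullet> b\<bar>)" by (rule norm_le_l1)
      also have "\<dots> \<le> (\<Sum>b\<in>(Basis :: 'a set). \<rho>)"
      proof (rule sum_mono)
        fix b :: 'a assume b: "b \<in> Basis"
        have "t k \<le> (x - p) \<bullet> b" "(x - p) \<bullet> b \<le> t (Suc k)"
          using x b by (auto simp: mem_box a_def inner_add_left inner_diff_left)
        then show "\<bar>(x - p) \<bullet> b\<bar> \<le> \<rho>" using t_range[of k] t_le[OF that] by linarith
      qed
      also have "\<dots> = r" by (simp add: \<rho>_def)
      finally show "x \<in> \<Omega>" using r(2) by (auto simp: dist_norm norm_minus_commute)
    qed
  qed simp
  have disj: "f j x = 0" if "f k x \<noteq> 0" "j \<noteq> k" for j k x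
  proof (rule ccontr)
    assume "f j x \<noteq> 0"
    then have xj: "x \<in> box (a j) (a (Suc j))" and xk: "x \<in> box (a k) (a (Suc k))"
      using that(1) by (auto simp: f_def box_bump_pos_iff)
    obtain b :: 'a where b: "b \<in> Basis" using nonempty_Basis by blast
    have "t j < (x - p) \<bullet> b" "(x - p) \<bullet> b < t (Suc j)" "t k < (x - p) \<bullet> b" "(x - p) \<bullet> b < t (Suc k)"
      using xj xk b by (auto simp: mem_box a_def inner_add_left inner_diff_left)
    then show False
      using that(2) t_mono[of "Suc j" k] t_mono[of "Suc k" j] by (cases j k rule: linorder_cases) auto
  qed
  have fH: "f k \<in> H1 \<Omega>" if "k < n" for k by (rule test_in_H1[OF test[OF that]])
  have "b k = 0" if 0: "mass_form \<kappa> (\<Sum>k<n. b k *\<^sub>R f k) (\<Sum>k<n. b k *\<^sub>R f k) = 0" and k: "k < n" for b k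
  proof (rule ccontr)
    assume bk: "b k \<noteq> 0"
    have "(\<Sum>k<n. b k *\<^sub>R f k) \<in> H1 \<Omega>"
      using fH by (intro subspace_sum[OF subspace_H1] subspace_scale[OF subspace_H1]) auto
    then have "AE x in \<Lambda>. (\<Sum>k<n. b k *\<^sub>R f k) x = 0" using 0 mass_zero_iff by blast
    then have "AE x in lborel. x \<notin> box (a k) (a (Suc k))"
      unfolding AE_dom_iff
    proof eventually_elim
      case (elim x)
      show ?case
      proof
        assume x: "x \<in> box (a k) (a (Suc k))"
        then have fk: "f k x \<noteq> 0" by (simp add: f_def box_bump_pos_iff)
        then have "x \<in> \<Omega>" using test_zero_outside_domain[OF test[OF k]] by blast
        then have "0 = (\<Sum>j<n. b j * f j x)" using elim by (simp add: sum_fun_apply)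
        also have "\<dots> = (\<Sum>j<n. if j = k then b k * f k x else 0)"
          using disj[OF fk] by (intro sum.cong) auto
        also have "\<dots> = b k * f k x" using k by simp
        finally show False using bk fk by simp
      qed
    qed
    then have "box (a k) (a (Suc k)) \<in> null_sets lborel"
      by (simp add: AE_iff_null_sets)
    then have "negligible (box (a k) (a (Suc k)))" by (simp add: negligible_iff_null_sets null_sets_completionI)
    moreover have "box (a k) (a (Suc k)) \<noteq> {}"
      using t_less by (simp add: box_ne_empty a_def inner_add_left)
    ultimately show False using open_not_negligible[OF open_box] by blast
  qed
  then show ?thesis using fH by (intro exI[of _ f]) blast
qed

text \<open>Compactness, completeness and infinite dimension are already available. The null
  condition holds because a function vanishing almost everywhere has 0 as a weak gradient, and weak
  gradients are unique.\<close>

sublocale spectral_forms "H1 \<Omega>" "mass_form \<kappa>" "stiffness_form \<alpha>"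
proof (intro spectral_forms.intro psd_mass psd_stiffness spectral_forms_axioms.intro)
  fix u assume u: "u \<in> H1 \<Omega>" "mass_form \<kappa> u u = 0"
  then have 0: "AE x in \<Lambda>. u x = 0" using mass_zero_iff by blast
  have "weak_pair u (\<lambda>x. 0)"
    unfolding weak_pair_def
  proof (intro conjI ballI H1_square_integrable u(1) square_integrable_zero)
    fix \<eta> b
    have "AE x in \<Lambda>. u x * frechet_derivative \<eta> (at x) b = 0" using 0 by eventually_elim simp
    from integral_eq_zero_AE[OF this]
    show "(LINT x|\<Lambda>. u x * frechet_derivative \<eta> (at x) b) = - (LINT x|\<Lambda>. (0 \<bullet> b) * \<eta> x)"
      by simp
  qed
  from weak_pair_unique[OF this]
  have "AE x in \<Lambda>. \<alpha> x * (weak_grad \<Omega> u x \<bullet> weak_grad \<Omega> u x) = 0" by eventually_elim simp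
  then show "stiffness_form \<alpha> u u = 0" unfolding stiffness_form_def by (rule integral_eq_zero_AE)
qed (rule mass_compact form_complete H1_infinite_dim; assumption)+

end

subsection \<open>Derivatives of eigenvalues and of the Ginzburg-Landau energy\<close>

context bounded_open
begin

lemma neumann_eigenspace_iff:
  "w \<in> neumann_eigenspace \<Omega> a c \<phi> \<mu> \<longleftrightarrow> w \<in> H1 \<Omega> \<and>
    (\<forall>\<eta>\<in>H1 \<Omega>. stiffness_form (\<lambda>x. a (\<phi> x)) w \<eta> = \<mu> * mass_form (\<lambda>x. c (\<phi> x)) w \<eta>)"
  by (simp add: neumann_eigenspace_def weak_state_equation_def stiffness_form_def mass_form_def)

end

lemma (in elliptic_coefficients) mass_diff_zero_iff:
  assumes "u \<in> H1 \<Omega>" "v \<in> H1 \<Omega>"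
  shows "mass_form \<kappa> (u - v) (u - v) = 0 \<longleftrightarrow> (AE x in \<Lambda>. u x = v x)"
  using mass_zero_iff[OF r.V_diff[OF assms]] by simp

text \<open>The e k with \<open>m k = \<mu>\<close> are a basis of the eigenspace modulo null sets:
  r-orthonormality gives independence, \<open>eigenvector_expansion\<close> gives spanning. For
  \<mu> not among the m k this shows the eigenspace to be trivial.\<close>

lemma eigensystem_neumann_eigenvalue_sequence:
  assumes ec: "elliptic_coefficients \<Omega> (\<lambda>x. a (\<phi> x)) (\<lambda>x. c (\<phi> x)) C B"
    and sys: "eigensystem (H1 \<Omega>) (bounded_open.mass_form \<Omega> (\<lambda>x. c (\<phi> x))) (bounded_open.stiffness_form \<Omega> (\<lambda>x. a (\<phi> x))) e m"
  shows "neumann_eigenvalue_sequence \<Omega> a c \<phi> m"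
proof -
  interpret elliptic_coefficients \<Omega> "\<lambda>x. a (\<phi> x)" "\<lambda>x. c (\<phi> x)" C B by (rule ec)
  let ?r = "mass_form (\<lambda>x. c (\<phi> x))"
  have "neumann_multiplicity \<Omega> a c \<phi> \<mu> (card {k. m k = \<mu>})" for \<mu>
  proof -
    let ?S = "{k. m k = \<mu>}"
    have fin: "finite ?S" by (rule finite_eigenvalue[OF sys])
    obtain b where b: "bij_betw b {0..<card ?S} ?S" using ex_bij_betw_nat_finite[OF fin] by blast
    have b': "bij_betw b {..<card ?S} ?S" using b by (simp add: atLeast0LessThan)
    have eH: "e k \<in> H1 \<Omega>" for k by (rule e_in[OF sys])
    have mb: "m (b k) = \<mu>" if "k < card ?S" for k
      using bij_betwE[OF b'] that by blast
    have "has_ae_dimension \<Lambda> (neumann_eigenspace \<Omega> a c \<phi> \<mu>) (card ?S)"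
      unfolding has_ae_dimension_def
    proof (intro exI[of _ "\<lambda>k. e (b k)"] conjI allI impI ballI)
      show "e (b k) \<in> neumann_eigenspace \<Omega> a c \<phi> \<mu>" if "k < card ?S" for k
        using e_eig[OF sys, of _ "b k"] eH mb[OF that] by (simp add: neumann_eigenspace_iff)
    next
      fix d k assume 0: "AE x in \<Lambda>. (\<Sum>k<card ?S. d k * e (b k) x) = 0" and k: "k < card ?S"
      define u where "u = (\<Sum>k<card ?S. d k *\<^sub>R e (b k))"
      have uH: "u \<in> H1 \<Omega>" unfolding u_def using eH by (intro r.V_sum r.V_scale) auto
      have "AE x in \<Lambda>. u x = 0" using 0 by (simp add: u_def sum_fun_apply)
      then have "?r u u = 0" using mass_zero_iff[OF uH] by blast
      then have "?r u (e (b k)) = 0" by (rule r.null_left[OF uH eH])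
      moreover have "?r u (e (b k)) = (\<Sum>j<card ?S. d j * ?r (e (b j)) (e (b k)))"
        unfolding u_def using eH by (intro r.sum_left) auto
      moreover have "\<dots> = (\<Sum>j<card ?S. if j = k then d k else 0)"
      proof (rule sum.cong)
        fix j assume "j \<in> {..<card ?S}"
        then have "b j = b k \<longleftrightarrow> j = k" using b' k by (auto simp: bij_betw_def inj_on_eq_iff)
        then show "d j * ?r (e (b j)) (e (b k)) = (if j = k then d k else 0)" by (simp add: e_orth[OF sys])
      qed simp
      ultimately show "d k = 0" using k by simp
    next
      fix v assume "v \<in> neumann_eigenspace \<Omega> a c \<phi> \<mu>"
      then have v: "v \<in> H1 \<Omega>" "\<And>u. u \<in> H1 \<Omega> \<Longrightarrow> stiffness_form (\<lambda>x. a (\<phi> x)) v u = \<mu> * ?r v u"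
        by (auto simp: neumann_eigenspace_iff)
      define g where "g = (\<Sum>k\<in>?S. ?r v (e k) *\<^sub>R e k)"
      have gH: "g \<in> H1 \<Omega>" unfolding g_def using eH by (intro r.V_sum r.V_scale)
      have "?r (v - g) (v - g) = 0"
        unfolding g_def by (rule eigenvector_expansion[OF sys v])
      then have "AE x in \<Lambda>. v x = g x" using mass_diff_zero_iff[OF v(1) gH] by blast
      moreover have "g x = (\<Sum>k<card ?S. ?r v (e (b k)) * e (b k) x)" for x
        unfolding g_def sum_fun_apply using sum.reindex_bij_betw[OF b', of "\<lambda>k. ?r v (e k) * e k x"] by simp
      ultimately show "\<exists>d. AE x in \<Lambda>. v x = (\<Sum>k<card ?S. d k * e (b k) x)"
        by (intro exI[of _ "\<lambda>k. ?r v (e (b k))"]) simp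
    qed
    then show ?thesis by (simp add: neumann_multiplicity_def)
  qed
  then show ?thesis
    using m_mono[OF sys] finite_eigenvalue[OF sys] by (simp add: neumann_eigenvalue_sequence_def)
qed

text \<open>\<open>m 0\<close> is the least value, so m k = 0 with k >= 1 would give 0 at least
  multiplicity two. Positivity places the eigenvalue vector in the open orthant where \<Psi> is
  differentiable.\<close>

lemma simple_eigenvalue_pos:
  assumes seq: "neumann_eigenvalue_sequence \<Omega> a c \<phi> m" and nonneg: "\<And>k. 0 \<le> m k"
    and simple: "simple_neumann_eigenvalue \<Omega> a c \<phi> (m k)" and k: "k \<ge> 1"
  shows "0 < m k"
proof (rule ccontr)
  assume "\<not> 0 < m k"
  then have mk: "m k = 0" using nonneg[of k] by simp
  have "m 0 \<le> m k" using seq by (simp add: neumann_eigenvalue_sequence_def incseq_def)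
  then have m0: "m 0 = 0" using mk nonneg[of 0] by simp
  have fin: "finite {j. m j = 0}" and "neumann_multiplicity \<Omega> a c \<phi> 0 (card {j. m j = 0})"
    using seq by (auto simp: neumann_eigenvalue_sequence_def)
  then have "card {j. m j = 0} = 1"
    using simple mk has_ae_dimension_unique unfolding simple_neumann_eigenvalue_def neumann_multiplicity_def by metis
  moreover have "card {0, k} \<le> card {j. m j = 0}" using fin mk m0 by (intro card_mono) auto
  ultimately show False using k by simp
qed

text \<open>Cauchy-Schwarz with weight \<delta> bounds both forms by D times plain L2 norms, and the
  lower bound C of the coefficients turns these into the unperturbed seminorms; hence the factor D /
  C.\<close>

lemma (in elliptic_coefficients) stiffness_coefficient_bound:
  assumes \<delta>: "\<delta> \<in> borel_measurable \<Lambda>" "AE x in \<Lambda>. \<bar>\<delta> x\<bar> \<le> D" and D: "0 \<le> D" and u: "u \<in> H1 \<Omega>" and v: "v \<in> H1 \<Omega>"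
  shows "\<bar>stiffness_form \<delta> u v\<bar> \<le> D / C * (sqrt (stiffness_form \<alpha> u u) * sqrt (stiffness_form \<alpha> v v))"
    and "\<bar>mass_form \<delta> u v\<bar> \<le> D / C * (sqrt (mass_form \<kappa> u u) * sqrt (mass_form \<kappa> v v))"
proof -
  have aux: "D * (sqrt X * sqrt Y) \<le> D / C * (sqrt P * sqrt R)" if "C * X \<le> P" "C * Y \<le> R" "0 \<le> X" "0 \<le> Y" for X Y P R
  proof -
    have "0 \<le> P" using that C_pos by (intro order_trans[OF _ that(1)]) auto
    then have "sqrt (C * X) * sqrt (C * Y) \<le> sqrt P * sqrt R"
      using that C_pos by (intro mult_mono real_sqrt_le_mono) auto
    moreover have "sqrt (C * X) * sqrt (C * Y) = C * (sqrt X * sqrt Y)"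
      using C_pos by (simp add: real_sqrt_mult)
    ultimately have "sqrt X * sqrt Y \<le> sqrt P * sqrt R / C"
      using C_pos by (simp add: pos_le_divide_eq mult.commute)
    then have "D * (sqrt X * sqrt Y) \<le> D * (sqrt P * sqrt R / C)" using D by (rule mult_left_mono)
    then show ?thesis by simp
  qed
  show "\<bar>stiffness_form \<delta> u v\<bar> \<le> D / C * (sqrt (stiffness_form \<alpha> u u) * sqrt (stiffness_form \<alpha> v v))"
    unfolding stiffness_form_def[of \<delta>]
    by (rule order_trans[OF weighted_inner_bound[OF H1_square_integrable(2)[OF u] H1_square_integrable(2)[OF v] \<delta> D] aux])
      (use stiffness_bounds(1)[OF u] stiffness_bounds(1)[OF v] in \<open>auto intro!: integral_nonneg_AE\<close>)
  show "\<bar>mass_form \<delta> u v\<bar> \<le> D / C * (sqrt (mass_form \<kappa> u u) * sqrt (mass_form \<kappa> v v))"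
    unfolding mass_form_inner[of \<delta>]
    by (rule order_trans[OF weighted_inner_bound[OF H1_square_integrable(1)[OF u] H1_square_integrable(1)[OF v] \<delta> D] aux])
      (use mass_bounds(1)[OF u] mass_bounds(1)[OF v] in \<open>auto intro!: integral_nonneg_AE\<close>)
qed

lemma (in bounded_open) form_coefficient_linear:
  assumes p: "p \<in> borel_measurable \<Lambda>" "AE x in \<Lambda>. \<bar>p x\<bar> \<le> A" and q: "q \<in> borel_measurable \<Lambda>" "AE x in \<Lambda>. \<bar>q x\<bar> \<le> A'"
    and u: "u \<in> H1 \<Omega>" and v: "v \<in> H1 \<Omega>"
  shows "stiffness_form (\<lambda>x. p x - s * q x) u v = stiffness_form p u v - s * stiffness_form q u v"
    and "mass_form (\<lambda>x. p x - s * q x) u v = mass_form p u v - s * mass_form q u v"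
proof -
  note i = square_integrable_weighted_inner[OF H1_square_integrable(2)[OF u] H1_square_integrable(2)[OF v]]
  note j = square_integrable_weighted_inner[OF H1_square_integrable(1)[OF u] H1_square_integrable(1)[OF v]]
  show "stiffness_form (\<lambda>x. p x - s * q x) u v = stiffness_form p u v - s * stiffness_form q u v"
    using i[OF p] i[OF q] by (simp add: stiffness_form_def left_diff_distrib mult.assoc)
  show "mass_form (\<lambda>x. p x - s * q x) u v = mass_form p u v - s * mass_form q u v"
    using j[OF p] j[OF q] by (simp add: mass_form_def left_diff_distrib mult.assoc)
qed

text \<open>The forms are linear in their coefficient, so pointwise first and second order bounds on
  the coefficients become the bounds of \<open>form_perturbation\<close>.\<close>

lemma (in elliptic_coefficients) form_perturbationI:
  assumes n: "\<And>n. elliptic_coefficients \<Omega> (\<alpha>n n) (\<kappa>n n) C B"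
    and t: "\<And>n. t n > 0" "t \<longlonglongrightarrow> 0" and D: "0 \<le> D"
    and d\<alpha>: "d\<alpha> \<in> borel_measurable \<Lambda>" "AE x in \<Lambda>. \<bar>d\<alpha> x\<bar> \<le> D"
    and d\<kappa>: "d\<kappa> \<in> borel_measurable \<Lambda>" "AE x in \<Lambda>. \<bar>d\<kappa> x\<bar> \<le> D"
    and \<alpha>1: "\<And>n. AE x in \<Lambda>. \<bar>\<alpha>n n x - \<alpha> x\<bar> \<le> D * t n" and \<kappa>1: "\<And>n. AE x in \<Lambda>. \<bar>\<kappa>n n x - \<kappa> x\<bar> \<le> D * t n"
    and \<alpha>2: "\<And>n. AE x in \<Lambda>. \<bar>\<alpha>n n x - \<alpha> x - t n * d\<alpha> x\<bar> \<le> D * (t n)\<^sup>2"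
    and \<kappa>2: "\<And>n. AE x in \<Lambda>. \<bar>\<kappa>n n x - \<kappa> x - t n * d\<kappa> x\<bar> \<le> D * (t n)\<^sup>2"
  shows "form_perturbation (H1 \<Omega>) (mass_form \<kappa>) (stiffness_form \<alpha>) (\<lambda>n. mass_form (\<kappa>n n)) (\<lambda>n. stiffness_form (\<alpha>n n))
    (mass_form d\<kappa>) (stiffness_form d\<alpha>) t (D / C)"
proof (intro form_perturbation.intro form_perturbation_axioms.intro spectral_forms_axioms)
  have meas: "\<alpha>n n \<in> borel_measurable \<Lambda>" "\<kappa>n n \<in> borel_measurable \<Lambda>" for n
    using elliptic_coefficients.\<alpha>_meas[OF n] elliptic_coefficients.\<kappa>_meas[OF n] by auto
  have bnd: "AE x in \<Lambda>. \<bar>\<alpha>n n x\<bar> \<le> B" "AE x in \<Lambda>. \<bar>\<kappa>n n x\<bar> \<le> B" for n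
    using elliptic_coefficients.abs_bounds[OF n] by auto
  have lin1: "stiffness_form (\<alpha>n n) u v - stiffness_form \<alpha> u v = stiffness_form (\<lambda>x. \<alpha>n n x - \<alpha> x) u v"
    "mass_form (\<kappa>n n) u v - mass_form \<kappa> u v = mass_form (\<lambda>x. \<kappa>n n x - \<kappa> x) u v"
    if "u \<in> H1 \<Omega>" "v \<in> H1 \<Omega>" for n u v
    using form_coefficient_linear(1)[OF meas(1) bnd(1) \<alpha>_meas abs_bounds(1) that, of n 1]
      form_coefficient_linear(2)[OF meas(2) bnd(2) \<kappa>_meas abs_bounds(2) that, of n 1] by simp_all
  have d1: "(\<lambda>x. \<alpha>n n x - \<alpha> x) \<in> borel_measurable \<Lambda>" "(\<lambda>x. \<kappa>n n x - \<kappa> x) \<in> borel_measurable \<Lambda>" for n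
    by (intro borel_measurable_diff meas \<alpha>_meas \<kappa>_meas)+
  have d2: "(\<lambda>x. \<alpha>n n x - \<alpha> x - t n * d\<alpha> x) \<in> borel_measurable \<Lambda>" "(\<lambda>x. \<kappa>n n x - \<kappa> x - t n * d\<kappa> x) \<in> borel_measurable \<Lambda>" for n
    by (intro borel_measurable_diff borel_measurable_times borel_measurable_const d1 d\<alpha> d\<kappa>)+
  fix k :: nat and u v w :: "'a \<Rightarrow> real" and b :: real
  show "spectral_forms (H1 \<Omega>) (mass_form (\<kappa>n k)) (stiffness_form (\<alpha>n k))"
  proof -
    interpret e: elliptic_coefficients \<Omega> "\<alpha>n k" "\<kappa>n k" C B by (rule n)
    show ?thesis by (rule e.spectral_forms_axioms)
  qed
  show "t k > 0" "t \<longlonglongrightarrow> 0" "0 \<le> D / C" using t D C_pos by auto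
  assume u: "u \<in> H1 \<Omega>"
  show "mass_form d\<kappa> (b *\<^sub>R u) w = b * mass_form d\<kappa> u w" by (rule mass_form_scale_left)
  have t2: "0 \<le> D * t k" "0 \<le> D * (t k)\<^sup>2" using D t(1)[of k] by auto
  {
    assume v: "v \<in> H1 \<Omega>"
    show "\<bar>mass_form (\<kappa>n k) u v - mass_form \<kappa> u v\<bar> \<le> D / C * t k * (sqrt (mass_form \<kappa> u u) * sqrt (mass_form \<kappa> v v))"
      using stiffness_coefficient_bound(2)[OF d1(2) \<kappa>1 t2(1) u v] by (simp add: lin1 u v)
    show "\<bar>stiffness_form (\<alpha>n k) u v - stiffness_form \<alpha> u v\<bar> \<le> D / C * t k * (sqrt (stiffness_form \<alpha> u u) * sqrt (stiffness_form \<alpha> v v))"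
      using stiffness_coefficient_bound(1)[OF d1(1) \<alpha>1 t2(1) u v] by (simp add: lin1 u v)
    have "AE x in \<Lambda>. \<bar>\<kappa>n k x - \<kappa> x\<bar> \<le> D * t k" "AE x in \<Lambda>. \<bar>\<alpha>n k x - \<alpha> x\<bar> \<le> D * t k" by (rule \<kappa>1 \<alpha>1)+
    then have lin2: "mass_form (\<kappa>n k) u v - mass_form \<kappa> u v - t k * mass_form d\<kappa> u v = mass_form (\<lambda>x. \<kappa>n k x - \<kappa> x - t k * d\<kappa> x) u v"
      "stiffness_form (\<alpha>n k) u v - stiffness_form \<alpha> u v - t k * stiffness_form d\<alpha> u v = stiffness_form (\<lambda>x. \<alpha>n k x - \<alpha> x - t k * d\<alpha> x) u v"
      using form_coefficient_linear(2)[OF d1(2) _ d\<kappa> u v, of k "D * t k" "t k"]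
        form_coefficient_linear(1)[OF d1(1) _ d\<alpha> u v, of k "D * t k" "t k"] lin1[OF u v, of k] by simp_all
    show "\<bar>mass_form (\<kappa>n k) u v - mass_form \<kappa> u v - t k * mass_form d\<kappa> u v\<bar> \<le> D / C * (t k)\<^sup>2 * (sqrt (mass_form \<kappa> u u) * sqrt (mass_form \<kappa> v v))"
      unfolding lin2 using stiffness_coefficient_bound(2)[OF d2(2) \<kappa>2 t2(2) u v] by simp
    show "\<bar>stiffness_form (\<alpha>n k) u v - stiffness_form \<alpha> u v - t k * stiffness_form d\<alpha> u v\<bar> \<le> D / C * (t k)\<^sup>2 * (sqrt (stiffness_form \<alpha> u u) * sqrt (stiffness_form \<alpha> v v))"
      unfolding lin2 using stiffness_coefficient_bound(1)[OF d2(1) \<alpha>2 t2(2) u v] by simp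
    show "\<bar>mass_form d\<kappa> u v\<bar> \<le> D / C * (sqrt (mass_form \<kappa> u u) * sqrt (mass_form \<kappa> v v))"
      by (rule stiffness_coefficient_bound(2)[OF d\<kappa> D u v])
    show "\<bar>stiffness_form d\<alpha> u v\<bar> \<le> D / C * (sqrt (stiffness_form \<alpha> u u) * sqrt (stiffness_form \<alpha> v v))"
      by (rule stiffness_coefficient_bound(1)[OF d\<alpha> D u v])
    assume w: "w \<in> H1 \<Omega>"
    have uv: "u - v = u + (-1) *\<^sub>R v" by (simp add: fun_eq_iff)
    have v': "(-1) *\<^sub>R v \<in> H1 \<Omega>" by (rule r.V_scale[OF v])
    show "mass_form d\<kappa> (u - v) w = mass_form d\<kappa> u w - mass_form d\<kappa> v w"
      unfolding uv mass_form_add_left[OF d\<kappa> u v' w] by (simp add: mass_form_scale_left del: scaleR_minus_left scaleR_minus1_left)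
    show "stiffness_form d\<alpha> (u - v) w = stiffness_form d\<alpha> u w - stiffness_form d\<alpha> v w"
      unfolding uv stiffness_form_add_left[OF d\<alpha> u v' w] by (simp add: stiffness_form_scale_left[OF d\<alpha>(1) v w] del: scaleR_minus_left scaleR_minus1_left)
  }
  show "w \<in> H1 \<Omega> \<Longrightarrow> stiffness_form d\<alpha> (b *\<^sub>R u) w = b * stiffness_form d\<alpha> u w"
    by (rule stiffness_form_scale_left[OF d\<alpha>(1) u])
qed

section \<open>Taylor bounds from locally Lipschitz derivatives\<close>

lemma C11_loc_lipschitz: "C11_loc f \<Longrightarrow> compact K \<Longrightarrow> \<exists>L. L-lipschitz_on K (deriv f)"
  by (simp add: C11_loc_def)

lemma C11_loc_continuous_deriv:
  assumes "C11_loc f"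
  shows "continuous_on UNIV (deriv f)"
proof (intro continuous_at_imp_continuous_on ballI)
  fix x :: real
  obtain L where "L-lipschitz_on (cball x 1) (deriv f)"
    using C11_loc_lipschitz[OF assms compact_cball, of x 1] by (elim exE)
  then have "continuous_on (cball x 1) (deriv f)" by (rule lipschitz_on_continuous_on)
  then show "isCont (deriv f) x" by (rule continuous_on_interior) simp
qed

lemma C11_loc_has_derivative: "C11_loc f \<Longrightarrow> (f has_real_derivative deriv f x) (at x)"
  by (simp add: C11_loc_def DERIV_deriv_iff_real_differentiable)

lemma C11_loc_measurable:
  assumes "C11_loc f"
  shows "f \<in> borel_measurable borel" "deriv f \<in> borel_measurable borel"
proof -
  have "continuous_on UNIV f"
    using C11_loc_has_derivative[OF assms] DERIV_continuous by (intro continuous_at_imp_continuous_on) blast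
  then show "f \<in> borel_measurable borel" by (rule borel_measurable_continuous_onI)
  show "deriv f \<in> borel_measurable borel"
    by (rule borel_measurable_continuous_onI[OF C11_loc_continuous_deriv[OF assms]])
qed

text \<open>A single K for all estimates on [-1,1], where every admissible function takes its
  values. The Taylor remainder is (f' z - f' x) (y - x) with z from the mean value theorem, and f'
  is Lipschitz there.\<close>

lemma C11_loc_expansion:
  assumes "C11_loc f"
  shows "\<exists>K\<ge>0. \<forall>x\<in>{-1..1}. \<forall>y\<in>{-1..1}. \<bar>f y - f x\<bar> \<le> K * \<bar>y - x\<bar> \<and>
    \<bar>f y - f x - deriv f x * (y - x)\<bar> \<le> K * (y - x)\<^sup>2 \<and> \<bar>deriv f x\<bar> \<le> K \<and> \<bar>f x\<bar> \<le> K"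
proof -
  obtain L where L: "L-lipschitz_on {-1..1} (deriv f)"
    using C11_loc_lipschitz[OF assms compact_Icc, of "-1" 1] by (elim exE)
  have L0: "0 \<le> L" by (rule lipschitz_on_nonneg[OF L])
  have bd: "\<exists>M. \<forall>x\<in>{-1..1}. \<bar>g x\<bar> \<le> M" if "continuous_on UNIV g" for g :: "real \<Rightarrow> real"
  proof -
    have "compact (g ` {-1..1})"
      using that by (intro compact_continuous_image) (auto intro: continuous_on_subset)
    from compact_imp_bounded[OF this] show ?thesis unfolding bounded_iff by fastforce
  qed
  obtain M where M: "\<And>x. x \<in> {-1..1} \<Longrightarrow> \<bar>deriv f x\<bar> \<le> M"
    using bd[OF C11_loc_continuous_deriv[OF assms]] by blast
  have "continuous_on UNIV f"
    using C11_loc_has_derivative[OF assms] DERIV_continuous by (intro continuous_at_imp_continuous_on) blast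
  from bd[OF this] obtain M' where M': "\<And>x. x \<in> {-1..1} \<Longrightarrow> \<bar>f x\<bar> \<le> M'" by blast
  have M0: "0 \<le> M" "0 \<le> M'" using M[of 0] M'[of 0] by auto
  define K where "K = L + M + M'"
  have mvt: "\<exists>z\<in>{-1..1}. f y - f x = deriv f z * (y - x) \<and> \<bar>z - x\<bar> \<le> \<bar>y - x\<bar>"
    if "x \<in> {-1..1}" "y \<in> {-1..1}" for x y
  proof (cases x y rule: linorder_cases)
    case less
    from MVT2[OF less C11_loc_has_derivative[OF assms]] obtain z
      where "x < z" "z < y" "f y - f x = (y - x) * deriv f z" by blast
    then show ?thesis using that by (intro bexI[of _ z]) auto
  next
    case greater
    from MVT2[OF greater C11_loc_has_derivative[OF assms]] obtain z
      where "y < z" "z < x" "f x - f y = (x - y) * deriv f z" by blast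
    then show ?thesis using that by (intro bexI[of _ z]) (auto simp: algebra_simps)
  qed (use that in auto)
  have "\<bar>f y - f x\<bar> \<le> K * \<bar>y - x\<bar> \<and> \<bar>f y - f x - deriv f x * (y - x)\<bar> \<le> K * (y - x)\<^sup>2 \<and> \<bar>deriv f x\<bar> \<le> K \<and> \<bar>f x\<bar> \<le> K"
    if x: "x \<in> {-1..1}" and y: "y \<in> {-1..1}" for x y
  proof -
    obtain z where z: "z \<in> {-1..1}" "f y - f x = deriv f z * (y - x)" "\<bar>z - x\<bar> \<le> \<bar>y - x\<bar>"
      using mvt[OF x y] by blast
    have 1: "\<bar>f y - f x\<bar> \<le> K * \<bar>y - x\<bar>"
      unfolding z(2) abs_mult using M[OF z(1)] L0 M0 by (intro mult_right_mono) (auto simp: K_def)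
    have "\<bar>deriv f z - deriv f x\<bar> \<le> L * \<bar>z - x\<bar>"
      using lipschitz_onD[OF L z(1) x] by (simp add: dist_real_def)
    also have "\<dots> \<le> K * \<bar>y - x\<bar>" using z(3) L0 M0 by (intro mult_mono) (auto simp: K_def)
    finally have "\<bar>deriv f z - deriv f x\<bar> * \<bar>y - x\<bar> \<le> K * \<bar>y - x\<bar> * \<bar>y - x\<bar>" by (rule mult_right_mono) simp
    moreover have "f y - f x - deriv f x * (y - x) = (deriv f z - deriv f x) * (y - x)"
      unfolding z(2) by (simp add: algebra_simps)
    moreover have "K * \<bar>y - x\<bar> * \<bar>y - x\<bar> = K * (y - x)\<^sup>2"
      by (simp add: power2_eq_square)
    ultimately have 2: "\<bar>f y - f x - deriv f x * (y - x)\<bar> \<le> K * (y - x)\<^sup>2"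
      by (simp only: abs_mult)
    show ?thesis using 1 2 M[OF x] M'[OF x] L0 M0 by (auto simp: K_def)
  qed
  then show ?thesis using L0 M0 by (intro exI[of _ K]) (auto simp: K_def)
qed

text \<open>Chain rule along a sequence: converging quotients make y n - x of order t n, so the
  differentiability remainder is o(t n). The eigenvalue vectors are followed only along such a
  sequence.\<close>

lemma difference_quotient_tendsto:
  fixes f :: "'v::real_normed_vector \<Rightarrow> real"
  assumes f: "(f has_derivative D) (at x)" and t: "\<And>n. t n > (0::real)" "t \<longlonglongrightarrow> 0"
    and v: "(\<lambda>n. (1 / t n) *\<^sub>R (y n - x)) \<longlonglongrightarrow> v"
  shows "(\<lambda>n. (f (y n) - f x) / t n) \<longlonglongrightarrow> D v"
proof -
  have D: "bounded_linear D" and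
    alt: "\<And>e. e > 0 \<Longrightarrow> \<exists>d>0. \<forall>y. norm (y - x) < d \<longrightarrow> norm (f y - f x - D (y - x)) \<le> e * norm (y - x)"
    using f by (auto simp: has_derivative_at_alt)
  interpret D: bounded_linear D by (rule D)
  define w where "w n = (1 / t n) *\<^sub>R (y n - x)" for n
  have wv: "w \<longlonglongrightarrow> v" using v by (simp add: w_def[abs_def])
  have yx: "y n - x = t n *\<^sub>R w n" for n using t(1)[of n] by (simp add: w_def)
  have "(\<lambda>n. t n *\<^sub>R w n) \<longlonglongrightarrow> 0 *\<^sub>R v" by (intro tendsto_intros t wv)
  then have "(\<lambda>n. t n *\<^sub>R w n) \<longlonglongrightarrow> 0" by simp
  then have y0: "(\<lambda>n. norm (y n - x)) \<longlonglongrightarrow> 0" unfolding yx by (rule tendsto_norm_zero)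
  obtain M where M: "M > 0" "\<And>n. norm (w n) \<le> M"
    using convergent_imp_Bseq[of w] wv by (auto simp: convergent_def Bseq_def)
  have rem: "(\<lambda>n. (f (y n) - f x) / t n - D (w n)) \<longlonglongrightarrow> 0"
    unfolding lim_sequentially
  proof (intro allI impI)
    fix e :: real assume "e > 0"
    then have "e / (2 * M) > 0" using M by simp
    from alt[OF this] obtain d where d: "d > 0" "\<And>y. norm (y - x) < d \<Longrightarrow> norm (f y - f x - D (y - x)) \<le> e / (2 * M) * norm (y - x)"
      by blast
    obtain N where N: "\<And>n. n \<ge> N \<Longrightarrow> norm (y n - x) < d"
      using order_tendstoD(2)[OF y0 d(1)] by (auto simp: eventually_sequentially)
    show "\<exists>N. \<forall>n\<ge>N. dist ((f (y n) - f x) / t n - D (w n)) 0 < e"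
    proof (intro exI allI impI)
      fix n assume "N \<le> n"
      have "(f (y n) - f x) / t n - D (w n) = (f (y n) - f x - D (y n - x)) / t n"
        unfolding yx D.scaleR using t(1)[of n] by (simp add: diff_divide_distrib)
      then have "\<bar>(f (y n) - f x) / t n - D (w n)\<bar> = \<bar>f (y n) - f x - D (y n - x)\<bar> / t n"
        using t(1)[of n] by simp
      also have "\<dots> \<le> e / (2 * M) * norm (y n - x) / t n"
        using d(2)[OF N[OF \<open>N \<le> n\<close>]] t(1)[of n] by (intro divide_right_mono) auto
      also have "\<dots> = e / (2 * M) * norm (w n)"
        unfolding yx using t(1)[of n] by simp
      also have "\<dots> \<le> e / (2 * M) * M"
        using M \<open>e > 0\<close> by (intro mult_left_mono) auto
      also have "\<dots> < e" using M \<open>e > 0\<close> by simp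
      finally show "dist ((f (y n) - f x) / t n - D (w n)) 0 < e" by (simp add: dist_real_def)
    qed
  qed
  have "(\<lambda>n. ((f (y n) - f x) / t n - D (w n)) + D (w n)) \<longlonglongrightarrow> 0 + D v"
    by (intro tendsto_add rem D.tendsto wv)
  then show ?thesis by simp
qed

section \<open>The Ginzburg-Landau energy along a segment\<close>

context bounded_open
begin

text \<open>The energy with the finite part \<open>\<psi>0\<close> in place of the potential: both
  agree for values in [-1,1], and a real number can be differentiated in t.\<close>

definition GL_value :: "real \<Rightarrow> (real \<Rightarrow> real) \<Rightarrow> ('a \<Rightarrow> real) \<Rightarrow> real" where
  "GL_value \<epsilon> \<psi>0 u = (LINT x|\<Lambda>. \<epsilon> / 2 * (norm (weak_grad \<Omega> u x))\<^sup>2 + 1 / \<epsilon> * \<psi>0 (u x))"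

lemma integrable_compose_bounded:
  fixes u :: "'a \<Rightarrow> real" and f :: "real \<Rightarrow> real"
  assumes u: "u \<in> borel_measurable \<Lambda>" "AE x in \<Lambda>. \<bar>u x\<bar> \<le> 1" and f: "f \<in> borel_measurable borel" "\<And>s. s \<in> {-1..1} \<Longrightarrow> \<bar>f s\<bar> \<le> K"
  shows "integrable \<Lambda> (\<lambda>x. f (u x))"
proof (rule finite_measure.integrable_const_bound[OF finite_measure_dom, of _ K])
  show "AE x in \<Lambda>. norm (f (u x)) \<le> K" using u(2)
  proof eventually_elim
    case (elim x)
    then show ?case using f(2)[of "u x"] by (auto simp: abs_le_iff)
  qed
  show "(\<lambda>x. f (u x)) \<in> borel_measurable \<Lambda>" using measurable_compose[OF u(1) f(1)] .
qed

text \<open>Where |u| <= 1 the indicator part of the potential is 0, and \<open>\<psi>0\<close> is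
  nonnegative there because the potential has minimum value 0; so the nonnegative integral is a
  Bochner integral.\<close>

lemma GL_energy_eq:
  assumes \<psi>: "obstacle_potential \<psi> \<psi>0" and \<epsilon>: "\<epsilon> > 0" and u: "u \<in> H1 \<Omega>" "AE x in \<Lambda>. \<bar>u x\<bar> \<le> 1"
  shows "GL_energy \<Omega> \<epsilon> \<psi> u = ereal (GL_value \<epsilon> \<psi>0 u)"
proof -
  have C11: "C11_loc \<psi>0" and \<psi>_eq: "\<And>s. \<psi> s = ereal (\<psi>0 s) + (if s \<in> {-1..1} then 0 else \<infinity>)"
    and min: "{s. \<forall>t. \<psi> s \<le> \<psi> t} = {-1, 1}" and \<psi>1: "\<psi> (-1) = 0"
    using \<psi> unfolding obstacle_potential_def by blast+
  have "-1 \<in> {s. \<forall>t. \<psi> s \<le> \<psi> t}" unfolding min by simp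
  then have "0 \<le> \<psi> s" for s using \<psi>1 by simp
  then have nn: "0 \<le> \<psi>0 s" if "s \<in> {-1..1}" for s using \<psi>_eq[of s] that by (metis add.right_neutral ereal_less_eq(5))
  obtain K where K: "\<And>s. s \<in> {-1..1} \<Longrightarrow> \<bar>\<psi>0 s\<bar> \<le> K" using C11_loc_expansion[OF C11] by blast
  have um: "u \<in> borel_measurable \<Lambda>" using u(1) H1_square_integrable(1) by (auto simp: square_integrable_def)
  have i1: "integrable \<Lambda> (\<lambda>x. \<psi>0 (u x))" by (rule integrable_compose_bounded[OF um u(2) C11_loc_measurable(1)[OF C11] K])
  have i2: "integrable \<Lambda> (\<lambda>x. (norm (weak_grad \<Omega> u x))\<^sup>2)" using H1_square_integrable(2)[OF u(1)] by (simp add: square_integrable_def)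
  let ?F = "\<lambda>x. \<epsilon> / 2 * (norm (weak_grad \<Omega> u x))\<^sup>2 + 1 / \<epsilon> * \<psi>0 (u x)"
  have iF: "integrable \<Lambda> ?F" using i1 i2 by auto
  have nnF: "AE x in \<Lambda>. 0 \<le> ?F x"
    using u(2)
  proof eventually_elim
    case (elim x)
    then have "0 \<le> \<psi>0 (u x)" by (intro nn) (auto simp: abs_le_iff)
    then show ?case using \<epsilon> by simp
  qed
  have "(\<integral>\<^sup>+x. e2ennreal (ereal (\<epsilon> / 2 * (norm (weak_grad \<Omega> u x))\<^sup>2) + ereal (1 / \<epsilon>) * \<psi> (u x)) \<partial>\<Lambda>) = (\<integral>\<^sup>+x. ennreal (?F x) \<partial>\<Lambda>)"
  proof (rule nn_integral_cong_AE)
    show "AE x in \<Lambda>. e2ennreal (ereal (\<epsilon> / 2 * (norm (weak_grad \<Omega> u x))\<^sup>2) + ereal (1 / \<epsilon>) * \<psi> (u x)) = ennreal (?F x)"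
      using u(2)
    proof eventually_elim
      case (elim x)
      then have "\<psi> (u x) = ereal (\<psi>0 (u x))" using \<psi>_eq[of "u x"] by (auto simp: abs_le_iff)
      then have "ereal (\<epsilon> / 2 * (norm (weak_grad \<Omega> u x))\<^sup>2) + ereal (1 / \<epsilon>) * \<psi> (u x) = ereal (?F x)" by simp
      then show ?case by (simp only: e2ennreal_ereal)
    qed
  qed
  also have "\<dots> = ennreal (GL_value \<epsilon> \<psi>0 u)"
    unfolding GL_value_def by (rule nn_integral_eq_integral[OF iF nnF])
  finally show ?thesis
    unfolding GL_energy_def using integral_nonneg_AE[OF nnF] by (simp add: GL_value_def)
qed

text \<open>The gradient part is an exact quadratic polynomial in t. For the potential, |v - u| <= 2
  bounds the Taylor remainder by 4 K t^2, which on a domain of finite measure is O(t) after division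
  by t.\<close>

lemma GL_value_derivative:
  assumes C11: "C11_loc \<psi>0" and u: "u \<in> H1 \<Omega>" "AE x in \<Lambda>. \<bar>u x\<bar> \<le> 1" and v: "v \<in> H1 \<Omega>" "AE x in \<Lambda>. \<bar>v x\<bar> \<le> 1"
    and t: "\<And>n. 0 < t n" "\<And>n. t n \<le> 1" "t \<longlonglongrightarrow> 0"
  shows "(\<lambda>n. (GL_value \<epsilon> \<psi>0 (u + t n *\<^sub>R (v - u)) - GL_value \<epsilon> \<psi>0 u) / t n) \<longlonglongrightarrow>
    \<epsilon> * (LINT x|\<Lambda>. weak_grad \<Omega> u x \<bullet> weak_grad \<Omega> (v - u) x) + 1 / \<epsilon> * (LINT x|\<Lambda>. deriv \<psi>0 (u x) * (v x - u x))"
proof -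
  let ?h = "v - u" and ?G = "weak_grad \<Omega> u" and ?H = "weak_grad \<Omega> (v - u)"
  have hH: "?h \<in> H1 \<Omega>" by (rule subspace_diff[OF subspace_H1 v(1) u(1)])
  have wH: "u + t n *\<^sub>R ?h \<in> H1 \<Omega>" for n by (intro weak_grad_add(1) weak_grad_scale(1) u(1) hH)
  have um: "u \<in> borel_measurable \<Lambda>" and vm: "v \<in> borel_measurable \<Lambda>"
    using u(1) v(1) H1_square_integrable(1) by (auto simp: square_integrable_def)
  have sG: "square_integrable \<Lambda> ?G" and sH: "square_integrable \<Lambda> ?H"
    using H1_square_integrable(2) u(1) hH by auto
  obtain K where K: "0 \<le> K" "\<And>x y. x \<in> {-1..1} \<Longrightarrow> y \<in> {-1..1} \<Longrightarrow> \<bar>\<psi>0 y - \<psi>0 x - deriv \<psi>0 x * (y - x)\<bar> \<le> K * (y - x)\<^sup>2"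
    "\<And>x. x \<in> {-1..1} \<Longrightarrow> \<bar>deriv \<psi>0 x\<bar> \<le> K" "\<And>x. x \<in> {-1..1} \<Longrightarrow> \<bar>\<psi>0 x\<bar> \<le> K"
    using C11_loc_expansion[OF C11] by blast
  have wb: "AE x in \<Lambda>. \<bar>u x\<bar> \<le> 1 \<and> \<bar>v x\<bar> \<le> 1 \<and> \<bar>(u + t n *\<^sub>R ?h) x\<bar> \<le> 1" for n
    using u(2) v(2)
  proof eventually_elim
    case (elim x)
    have "(u + t n *\<^sub>R ?h) x = (1 - t n) * u x + t n * v x" by (simp add: algebra_simps)
    moreover have "convex {-1..1::real}" by simp
    ultimately show ?case
      using convexD_alt[of "{-1..1::real}" "u x" "v x" "t n"] elim t(1)[of n] t(2)[of n] by (auto simp: abs_le_iff)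
  qed
  have iw: "integrable \<Lambda> (\<lambda>x. \<psi>0 ((u + t n *\<^sub>R ?h) x))" for n
  proof (rule integrable_compose_bounded[OF _ _ C11_loc_measurable(1)[OF C11] K(4)])
    show "u + t n *\<^sub>R ?h \<in> borel_measurable \<Lambda>" using H1_square_integrable(1)[OF wH] by (simp add: square_integrable_def)
    show "AE x in \<Lambda>. \<bar>(u + t n *\<^sub>R ?h) x\<bar> \<le> 1" using wb[of n] by eventually_elim simp
  qed
  have iu: "integrable \<Lambda> (\<lambda>x. \<psi>0 (u x))" by (rule integrable_compose_bounded[OF um u(2) C11_loc_measurable(1)[OF C11] K(4)])
  have id: "integrable \<Lambda> (\<lambda>x. deriv \<psi>0 (u x) * (v x - u x))"
  proof (rule finite_measure.integrable_const_bound[OF finite_measure_dom, of _ "K * 2"])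
    show "AE x in \<Lambda>. norm (deriv \<psi>0 (u x) * (v x - u x)) \<le> K * 2"
      using u(2) v(2) by eventually_elim (auto simp: abs_mult intro!: mult_mono K(1,3))
    show "(\<lambda>x. deriv \<psi>0 (u x) * (v x - u x)) \<in> borel_measurable \<Lambda>"
      by (intro borel_measurable_times borel_measurable_diff um vm measurable_compose[OF um C11_loc_measurable(2)[OF C11]])
  qed
  define P where "P = (LINT x|\<Lambda>. (norm (?H x))\<^sup>2)"
  define S where "S = (LINT x|\<Lambda>. ?G x \<bullet> ?H x)"
  define R where "R = (LINT x|\<Lambda>. deriv \<psi>0 (u x) * (v x - u x))"
  have iG: "integrable \<Lambda> (\<lambda>x. (norm (?G x))\<^sup>2)" "integrable \<Lambda> (\<lambda>x. (norm (?H x))\<^sup>2)" "integrable \<Lambda> (\<lambda>x. ?G x \<bullet> ?H x)"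
    using sG sH square_integrable_inner[OF sG sH] by (auto simp: square_integrable_def)
  have grad: "(LINT x|\<Lambda>. (norm (weak_grad \<Omega> (u + t n *\<^sub>R ?h) x))\<^sup>2) = (LINT x|\<Lambda>. (norm (?G x))\<^sup>2) + 2 * t n * S + (t n)\<^sup>2 * P" for n
  proof -
    have "(LINT x|\<Lambda>. (norm (weak_grad \<Omega> (u + t n *\<^sub>R ?h) x))\<^sup>2) = (LINT x|\<Lambda>. (norm (?G x))\<^sup>2 + 2 * t n * (?G x \<bullet> ?H x) + (t n)\<^sup>2 * (norm (?H x))\<^sup>2)"
    proof (rule integral_cong_AE)
      show "AE x in \<Lambda>. (norm (weak_grad \<Omega> (u + t n *\<^sub>R ?h) x))\<^sup>2 = (norm (?G x))\<^sup>2 + 2 * t n * (?G x \<bullet> ?H x) + (t n)\<^sup>2 * (norm (?H x))\<^sup>2"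
        using weak_grad_add(2)[OF u(1) weak_grad_scale(1)[OF hH, of "t n"]] weak_grad_scale(2)[OF hH, of "t n"]
      proof eventually_elim
        case (elim x)
        have "(norm (y + s *\<^sub>R z))\<^sup>2 = (norm y)\<^sup>2 + 2 * s * (y \<bullet> z) + s\<^sup>2 * (norm z)\<^sup>2" for y z :: 'a and s
          unfolding power2_norm_eq_inner
          by (simp add: inner_add_left inner_add_right inner_commute power2_eq_square algebra_simps)
        then show ?case unfolding elim .
      qed
      show "(\<lambda>x. (norm (weak_grad \<Omega> (u + t n *\<^sub>R ?h) x))\<^sup>2) \<in> borel_measurable \<Lambda>"
        by (intro square_integrable_norm2_measurable H1_square_integrable(2) wH)
      show "(\<lambda>x. (norm (?G x))\<^sup>2 + 2 * t n * (?G x \<bullet> ?H x) + (t n)\<^sup>2 * (norm (?H x))\<^sup>2) \<in> borel_measurable \<Lambda>"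
        using iG by (intro borel_measurable_add borel_measurable_times[OF borel_measurable_const]) auto
    qed
    then show ?thesis using iG by (simp add: S_def P_def)
  qed
  have val: "GL_value \<epsilon> \<psi>0 w = \<epsilon> / 2 * (LINT x|\<Lambda>. (norm (weak_grad \<Omega> w x))\<^sup>2) + 1 / \<epsilon> * (LINT x|\<Lambda>. \<psi>0 (w x))"
    if "w \<in> H1 \<Omega>" "integrable \<Lambda> (\<lambda>x. \<psi>0 (w x))" for w
    using H1_square_integrable(2)[OF that(1)] that(2) unfolding GL_value_def by (simp add: square_integrable_def)
  define q where "q n = ((LINT x|\<Lambda>. \<psi>0 ((u + t n *\<^sub>R ?h) x)) - (LINT x|\<Lambda>. \<psi>0 (u x))) / t n" for n
  have quot: "(GL_value \<epsilon> \<psi>0 (u + t n *\<^sub>R ?h) - GL_value \<epsilon> \<psi>0 u) / t n = \<epsilon> * S + \<epsilon> / 2 * t n * P + 1 / \<epsilon> * q n" for n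
  proof -
    have "((\<epsilon> / 2 * (G + 2 * \<tau> * S + \<tau>\<^sup>2 * P) + k * X) - (\<epsilon> / 2 * G + k * Y)) / \<tau> = \<epsilon> * S + \<epsilon> / 2 * \<tau> * P + k * ((X - Y) / \<tau>)"
      if "\<tau> > 0" for \<tau> G k X Y :: real
      using that by (simp add: field_simps power2_eq_square)
    from this[OF t(1)] show ?thesis unfolding val[OF wH iw] val[OF u(1) iu] grad q_def .
  qed
  have qlim: "q \<longlonglongrightarrow> R"
  proof -
    have "norm (q n - R) \<le> 4 * K * measure \<Lambda> (space \<Lambda>) * t n" for n
    proof -
      have "q n - R = (LINT x|\<Lambda>. \<psi>0 ((u + t n *\<^sub>R ?h) x) - \<psi>0 (u x) - t n * (deriv \<psi>0 (u x) * (v x - u x))) / t n"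
        using iw[of n] iu id t(1)[of n] by (simp add: q_def R_def diff_divide_distrib)
      then have "norm (q n - R) = \<bar>LINT x|\<Lambda>. \<psi>0 ((u + t n *\<^sub>R ?h) x) - \<psi>0 (u x) - t n * (deriv \<psi>0 (u x) * (v x - u x))\<bar> / t n"
        using t(1)[of n] by simp
      also have "\<dots> \<le> (LINT x|\<Lambda>. 4 * K * (t n)\<^sup>2) / t n"
      proof (rule divide_right_mono)
        have "\<bar>LINT x|\<Lambda>. \<psi>0 ((u + t n *\<^sub>R ?h) x) - \<psi>0 (u x) - t n * (deriv \<psi>0 (u x) * (v x - u x))\<bar> \<le>
            (LINT x|\<Lambda>. \<bar>\<psi>0 ((u + t n *\<^sub>R ?h) x) - \<psi>0 (u x) - t n * (deriv \<psi>0 (u x) * (v x - u x))\<bar>)"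
          by (rule integral_abs_bound)
        also have "\<dots> \<le> (LINT x|\<Lambda>. 4 * K * (t n)\<^sup>2)"
        proof (rule integral_mono_AE)
          show "integrable \<Lambda> (\<lambda>x. \<bar>\<psi>0 ((u + t n *\<^sub>R ?h) x) - \<psi>0 (u x) - t n * (deriv \<psi>0 (u x) * (v x - u x))\<bar>)"
            by (intro integrable_abs Bochner_Integration.integrable_diff iw iu integrable_mult_right id)
          show "integrable \<Lambda> (\<lambda>x. 4 * K * (t n)\<^sup>2)"
            by (rule finite_measure.integrable_const[OF finite_measure_dom])
          show "AE x in \<Lambda>. \<bar>\<psi>0 ((u + t n *\<^sub>R ?h) x) - \<psi>0 (u x) - t n * (deriv \<psi>0 (u x) * (v x - u x))\<bar> \<le> 4 * K * (t n)\<^sup>2"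
            using wb[of n]
          proof eventually_elim
            case (elim x)
            have "\<bar>\<psi>0 ((u + t n *\<^sub>R ?h) x) - \<psi>0 (u x) - deriv \<psi>0 (u x) * ((u + t n *\<^sub>R ?h) x - u x)\<bar> \<le> K * ((u + t n *\<^sub>R ?h) x - u x)\<^sup>2"
              using elim by (intro K(2)) (auto simp: abs_le_iff)
            also have "\<dots> = K * (t n)\<^sup>2 * (v x - u x)\<^sup>2" by (simp add: power_mult_distrib)
            also have "\<dots> \<le> K * (t n)\<^sup>2 * 4"
            proof -
              have "\<bar>v x - u x\<bar> \<le> 2" using elim by linarith
              then have "(v x - u x)\<^sup>2 \<le> 2\<^sup>2" by (metis abs_ge_zero power2_abs power_mono)
              then show ?thesis using K(1) by (intro mult_left_mono) auto
            qed
            finally show ?case by (simp add: algebra_simps)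
          qed
        qed
        finally show "\<bar>LINT x|\<Lambda>. \<psi>0 ((u + t n *\<^sub>R ?h) x) - \<psi>0 (u x) - t n * (deriv \<psi>0 (u x) * (v x - u x))\<bar> \<le> (LINT x|\<Lambda>. 4 * K * (t n)\<^sup>2)" .
      qed (use t(1)[of n] in simp)
      also have "\<dots> = 4 * K * measure \<Lambda> (space \<Lambda>) * t n"
        using t(1)[of n] by (simp add: power2_eq_square)
      finally show ?thesis .
    qed
    then have bd: "\<forall>n. norm (q n - R) \<le> 4 * K * measure \<Lambda> (space \<Lambda>) * t n" by blast
    have "(\<lambda>n. 4 * K * measure \<Lambda> (space \<Lambda>) * t n) \<longlonglongrightarrow> 0"
      using tendsto_mult_left[OF t(3), of "4 * K * measure \<Lambda> (space \<Lambda>)"] by simp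
    then have "(\<lambda>n. q n - R) \<longlonglongrightarrow> 0"
      by (rule Lim_null_comparison[OF always_eventually[OF bd]])
    then show ?thesis by (simp add: LIM_zero_iff)
  qed
  have "(\<lambda>n. \<epsilon> * S + \<epsilon> / 2 * t n * P + 1 / \<epsilon> * q n) \<longlonglongrightarrow> \<epsilon> * S + \<epsilon> / 2 * 0 * P + 1 / \<epsilon> * R"
    by (intro tendsto_add tendsto_mult tendsto_const t(3) qlim)
  then show ?thesis unfolding quot S_def R_def by simp
qed

end

subsection \<open>First-order optimality\<close>

lemma (in bounded_open) elliptic_coefficients_compose:
  assumes dom: "lipschitz_boundary \<Omega>" "\<Omega> \<noteq> {}" and C: "C > 0" "\<And>s. a s > C" "\<And>s. c s > C"
    and a: "C11_loc a" "\<And>s. s \<in> {-1..1} \<Longrightarrow> \<bar>a s\<bar> \<le> B" and c: "C11_loc c" "\<And>s. s \<in> {-1..1} \<Longrightarrow> \<bar>c s\<bar> \<le> B"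
    and v: "v \<in> borel_measurable \<Lambda>" "AE x in \<Lambda>. \<bar>v x\<bar> \<le> 1"
  shows "elliptic_coefficients \<Omega> (\<lambda>x. a (v x)) (\<lambda>x. c (v x)) C B"
proof
  show "(\<lambda>x. a (v x)) \<in> borel_measurable \<Lambda>" "(\<lambda>x. c (v x)) \<in> borel_measurable \<Lambda>"
    using measurable_compose[OF v(1) C11_loc_measurable(1)] a(1) c(1) by auto
  show "AE x in \<Lambda>. C \<le> a (v x) \<and> a (v x) \<le> B"
    using v(2)
  proof eventually_elim
    case (elim x)
    then show ?case using a(2)[of "v x"] C(2)[of "v x"] by (auto simp: abs_le_iff)
  qed
  show "AE x in \<Lambda>. C \<le> c (v x) \<and> c (v x) \<le> B"
    using v(2)
  proof eventually_elim
    case (elim x)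
    then show ?case using c(2)[of "v x"] C(3)[of "v x"] by (auto simp: abs_le_iff)
  qed
qed (use dom C(1) in auto)

text \<open>Since |y - x| <= 2, the first-order bound is 2 K t, the second-order bound 4 K t^2 and
  the derivative bound 2 K; any D >= 4 K covers all three.\<close>

lemma expansion_along_segment:
  fixes f :: "real \<Rightarrow> real"
  assumes f: "\<And>x y. x \<in> {-1..1} \<Longrightarrow> y \<in> {-1..1} \<Longrightarrow> \<bar>f y - f x\<bar> \<le> K * \<bar>y - x\<bar> \<and>
      \<bar>f y - f x - deriv f x * (y - x)\<bar> \<le> K * (y - x)\<^sup>2 \<and> \<bar>deriv f x\<bar> \<le> K \<and> \<bar>f x\<bar> \<le> K"
    and K: "0 \<le> K" "4 * K \<le> D" and x: "\<bar>x\<bar> \<le> 1" and y: "\<bar>y\<bar> \<le> 1" and t: "0 < t" "t \<le> 1"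
  shows "\<bar>f (x + t * (y - x)) - f x\<bar> \<le> D * t"
    and "\<bar>f (x + t * (y - x)) - f x - t * (deriv f x * (y - x))\<bar> \<le> D * t\<^sup>2"
    and "\<bar>deriv f x * (y - x)\<bar> \<le> D"
proof -
  let ?z = "x + t * (y - x)"
  have xy: "\<bar>y - x\<bar> \<le> 2" using x y by linarith
  have "?z = (1 - t) * x + t * y" by (simp add: algebra_simps)
  then have z: "?z \<in> {-1..1}"
    using convexD_alt[of "{-1..1::real}" x y t] x y t by (auto simp: abs_le_iff)
  have x': "x \<in> {-1..1}" using x by (auto simp: abs_le_iff)
  note b = f[OF x' z]
  have "\<bar>f ?z - f x\<bar> \<le> K * (t * \<bar>y - x\<bar>)" using b t by (simp add: abs_mult)
  also have "\<dots> \<le> K * (t * 2)" using K t xy by (intro mult_left_mono) auto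
  also have "\<dots> \<le> D * t"
  proof -
    have "(2 * K) * t \<le> D * t" using K t by (intro mult_right_mono) auto
    then show ?thesis by (simp add: algebra_simps)
  qed
  finally show "\<bar>f ?z - f x\<bar> \<le> D * t" .
  have "\<bar>f ?z - f x - t * (deriv f x * (y - x))\<bar> \<le> K * (t\<^sup>2 * (y - x)\<^sup>2)"
    using b by (simp add: power_mult_distrib mult.left_commute)
  also have "(y - x)\<^sup>2 \<le> 4"
    using power_mono[OF xy, of 2] by simp
  then have "K * (t\<^sup>2 * (y - x)\<^sup>2) \<le> K * (t\<^sup>2 * 4)" using K by (intro mult_left_mono) auto
  also have "K * (t\<^sup>2 * 4) \<le> D * t\<^sup>2"
  proof -
    have "(4 * K) * t\<^sup>2 \<le> D * t\<^sup>2" using K by (intro mult_right_mono) auto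
    then show ?thesis by (simp add: algebra_simps)
  qed
  finally show "\<bar>f ?z - f x - t * (deriv f x * (y - x))\<bar> \<le> D * t\<^sup>2" .
  have "\<bar>deriv f x\<bar> * \<bar>y - x\<bar> \<le> K * 2" using b K xy by (intro mult_mono) auto
  then show "\<bar>deriv f x * (y - x)\<bar> \<le> D" using K by (simp add: abs_mult)
qed

theorem theorem3p10:
  fixes \<Omega> \<Omega>t S0 S1 :: "(real ^ 'd) set"
    and a c \<psi>0 :: "real \<Rightarrow> real"
    and \<psi> :: "real \<Rightarrow> ereal"
    and \<epsilon> \<gamma> \<beta>1 \<beta>2 C :: real
    and i :: "'l::{finite,linorder} \<Rightarrow> nat"
    and \<Psi> :: "(real, 'l) vec \<Rightarrow> real"
    and \<phi> :: "real ^ 'd \<Rightarrow> real"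
    and w :: "'l \<Rightarrow> real ^ 'd \<Rightarrow> real"
  assumes "bounded_lipschitz_domain \<Omega>"
    and "S0 \<in> sets lebesgue" "S1 \<in> sets lebesgue"
    and "S0 \<subseteq> \<Omega>" "S1 \<subseteq> \<Omega>" "S0 \<inter> S1 = {}"
    and "\<Omega>t = \<Omega> - (S0 \<union> S1)" "bounded_lipschitz_domain \<Omega>t"
    and "\<beta>1 \<in> {-1<..<1}" "\<beta>2 \<in> {-1<..<1}" "\<beta>1 \<le> \<beta>2"
    and "\<epsilon> > 0" "\<gamma> > 0"
    and "C11_loc a" "C11_loc c" "C > 0" "\<And>s. a s > C" "\<And>s. c s > C"
    and "obstacle_potential \<psi> \<psi>0"
    and "strict_mono i" "\<And>j. i j \<ge> 1"
    and "Ck_on 1 {y. \<forall>j. y $ j > 0} \<Psi>"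
    and "Linf_local_minimizer \<Omega> (G_ad \<Omega>t \<beta>1 \<beta>2 \<inter> U_ad \<Omega> S0 S1)
           (neumann_cost \<Omega> \<Omega>t a c i \<Psi> \<gamma> \<epsilon> \<psi>) \<phi>"
    and "\<And>j. simple_neumann_eigenvalue \<Omega> a c \<phi> (neumann_eigenvalue \<Omega> a c \<phi> (i j))"
    and "\<And>j. neumann_eigenfunction \<Omega> a c \<phi> (neumann_eigenvalue \<Omega> a c \<phi> (i j)) (w j)"
    and "\<And>j. w j \<in> H1_mean_zero \<Omega> c \<phi>"
    and "\<And>j. (LINT x|lebesgue_on \<Omega>. c (\<phi> x) * (w j x)\<^sup>2) = 1"
  shows "(\<forall>j. weak_state_equation \<Omega> a c \<phi> (neumann_eigenvalue \<Omega> a c \<phi> (i j)) (w j))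
    \<and> (\<forall>\<theta> \<in> G_ad \<Omega>t \<beta>1 \<beta>2 \<inter> U_ad \<Omega> S0 S1.
      0 \<le> \<gamma> * \<epsilon> * (LINT x|lebesgue_on \<Omega>t. weak_grad \<Omega>t \<phi> x \<bullet> weak_grad \<Omega>t (\<lambda>y. \<theta> y - \<phi> y) x)
        + \<gamma> / \<epsilon> * (LINT x|lebesgue_on \<Omega>t. deriv \<psi>0 (\<phi> x) * (\<theta> x - \<phi> x))
        + (\<Sum>j\<in>UNIV. partial_deriv j \<Psi> (eigenvalue_vector \<Omega> a c i \<phi>) *
            ((LINT x|lebesgue_on \<Omega>. deriv a (\<phi> x) * (\<theta> x - \<phi> x) * (norm (weak_grad \<Omega> (w j) x))\<^sup>2)
             - neumann_eigenvalue \<Omega> a c \<phi> (i j) *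
               (LINT x|lebesgue_on \<Omega>. deriv c (\<phi> x) * (\<theta> x - \<phi> x) * (w j x)\<^sup>2))))"
proof (intro conjI allI ballI)
  note min = assms(23) and simple = assms(24) and eigenfun = assms(25) and normalized = assms(27)
    and a = assms(14) and c = assms(15) and C_pos = assms(16) and aC = assms(17) and cC = assms(18)
    and \<psi> = assms(19) and \<epsilon> = assms(12) and \<gamma> = assms(13) and \<Psi> = assms(22)
  show "weak_state_equation \<Omega> a c \<phi> (neumann_eigenvalue \<Omega> a c \<phi> (i j)) (w j)" for j
    using eigenfun[of j] by (simp add: neumann_eigenfunction_def neumann_eigenspace_def)
  fix \<theta> assume \<theta>: "\<theta> \<in> G_ad \<Omega>t \<beta>1 \<beta>2 \<inter> U_ad \<Omega> S0 S1"
  interpret O: bounded_open \<Omega>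
    using assms(1) by unfold_locales (auto simp: bounded_lipschitz_domain_def)
  interpret T: bounded_open \<Omega>t
    using assms(8) by unfold_locales (auto simp: bounded_lipschitz_domain_def)
  have lip: "lipschitz_boundary \<Omega>" "\<Omega> \<noteq> {}"
    using assms(1) by (auto simp: bounded_lipschitz_domain_def)
  obtain \<delta> where \<phi>: "\<phi> \<in> G_ad \<Omega>t \<beta>1 \<beta>2 \<inter> U_ad \<Omega> S0 S1" and \<delta>: "\<delta> > 0"
    and le: "\<And>\<zeta>. \<zeta> \<in> G_ad \<Omega>t \<beta>1 \<beta>2 \<inter> U_ad \<Omega> S0 S1 \<Longrightarrow> Linf_norm \<Omega> (\<lambda>x. \<zeta> x - \<phi> x) < ereal \<delta> \<Longrightarrow>
      neumann_cost \<Omega> \<Omega>t a c i \<Psi> \<gamma> \<epsilon> \<psi> \<phi> \<le> neumann_cost \<Omega> \<Omega>t a c i \<Psi> \<gamma> \<epsilon> \<psi> \<zeta>"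
    using min unfolding Linf_local_minimizer_def by blast
  have meas: "v \<in> borel_measurable O.\<Lambda>" if "v \<in> G_ad \<Omega>t \<beta>1 \<beta>2 \<inter> U_ad \<Omega> S0 S1" for v
    using that by (auto simp: U_ad_def)
  have bound_t: "AE x in T.\<Lambda>. \<bar>v x\<bar> \<le> 1" and H1_t: "v \<in> H1 \<Omega>t" if "v \<in> G_ad \<Omega>t \<beta>1 \<beta>2 \<inter> U_ad \<Omega> S0 S1" for v
    using that by (auto simp: G_ad_def)
  \<comment> \<open>\<open>U_ad\<close> fixes the values -1 and 1 on \<open>S0\<close> and
    \<open>S1\<close>, so the bound from \<open>G_ad\<close> extends from \<open>\<Omega>t\<close>
    to all of \<Omega>, where the coefficients are evaluated.\<close>
  have bound: "AE x in O.\<Lambda>. \<bar>v x\<bar> \<le> 1" if v: "v \<in> G_ad \<Omega>t \<beta>1 \<beta>2 \<inter> U_ad \<Omega> S0 S1" for v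
  proof -
    have "AE x in lebesgue. x \<in> \<Omega>t \<longrightarrow> \<bar>v x\<bar> \<le> 1"
      using bound_t[OF v] by (simp add: AE_restrict_space_iff)
    moreover have "AE x in lebesgue. x \<in> S0 \<longrightarrow> v x = - 1" "AE x in lebesgue. x \<in> S1 \<longrightarrow> v x = 1"
      using v assms(2,3) by (auto simp: U_ad_def AE_restrict_space_iff)
    ultimately have "AE x in lebesgue. x \<in> \<Omega> \<longrightarrow> \<bar>v x\<bar> \<le> 1"
      by eventually_elim (use assms(7) in auto)
    then show ?thesis by (simp add: AE_restrict_space_iff)
  qed
  \<comment> \<open>Since |\<theta> - \<phi>| <= 2, parameters up to \<delta> / 4 stay within
    \<delta> / 2 in the supremum norm; the cap 1 keeps the competitors convex combinations.\<close>
  define \<tau> where "\<tau> = min 1 (\<delta> / 4)"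
  define t where "t n = \<tau> / real (Suc n)" for n
  have \<tau>: "0 < \<tau>" "\<tau> \<le> 1" "\<tau> \<le> \<delta> / 4" using \<delta> by (auto simp: \<tau>_def)
  have t_le: "t n \<le> \<tau>" for n using \<tau> by (simp add: t_def divide_le_eq)
  have t: "0 < t n" "t n \<le> 1" "t n * 2 < \<delta>" for n
  proof -
    show "0 < t n" using \<tau> by (simp add: t_def)
    show "t n \<le> 1" "t n * 2 < \<delta>" using t_le[of n] \<tau> by linarith+
  qed
  have t_lim: "t \<longlonglongrightarrow> 0"
    using tendsto_mult_left[OF LIMSEQ_Suc[OF lim_1_over_n], of \<tau>] by (simp add: t_def[abs_def])
  let ?h = "\<theta> - \<phi>"
  define \<zeta> where "\<zeta> n = \<phi> + t n *\<^sub>R ?h" for n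
  have conv: "\<zeta> n x = (1 - t n) * \<phi> x + t n * \<theta> x" for n x
    by (simp add: \<zeta>_def algebra_simps)
  have \<zeta>_adm: "\<zeta> n \<in> G_ad \<Omega>t \<beta>1 \<beta>2 \<inter> U_ad \<Omega> S0 S1" for n
  proof -
    have "\<zeta> n \<in> H1 \<Omega>t"
      unfolding \<zeta>_def by (intro T.weak_grad_add(1) T.weak_grad_scale(1) subspace_diff[OF T.subspace_H1] H1_t \<phi> \<theta>)
    moreover have "AE x in T.\<Lambda>. \<bar>\<zeta> n x\<bar> \<le> 1"
      using bound_t[OF \<phi>] bound_t[OF \<theta>]
    proof eventually_elim
      case (elim x)
      then show ?case unfolding conv
        using convexD_alt[of "{-1..1::real}" "\<phi> x" "\<theta> x" "t n"] t[of n] by (auto simp: abs_le_iff)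
    qed
    moreover have "(LINT x|T.\<Lambda>. \<zeta> n x) = (1 - t n) * (LINT x|T.\<Lambda>. \<phi> x) + t n * (LINT x|T.\<Lambda>. \<theta> x)"
      unfolding conv using T.integrable_dom[OF T.H1_square_integrable(1)[OF H1_t[OF \<phi>]]]
        T.integrable_dom[OF T.H1_square_integrable(1)[OF H1_t[OF \<theta>]]] by simp
    moreover have "\<beta>1 * measure lebesgue \<Omega>t \<le> (1 - t n) * X + t n * Y \<and> (1 - t n) * X + t n * Y \<le> \<beta>2 * measure lebesgue \<Omega>t"
      if "X \<in> {\<beta>1 * measure lebesgue \<Omega>t..\<beta>2 * measure lebesgue \<Omega>t}" "Y \<in> {\<beta>1 * measure lebesgue \<Omega>t..\<beta>2 * measure lebesgue \<Omega>t}" for X Y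
      using convexD_alt[of "{\<beta>1 * measure lebesgue \<Omega>t..\<beta>2 * measure lebesgue \<Omega>t}" X Y "t n"] that t[of n] by auto
    moreover have "AE x in lebesgue_on S0. \<zeta> n x = - 1"
    proof -
      have "AE x in lebesgue_on S0. \<phi> x = - 1" "AE x in lebesgue_on S0. \<theta> x = - 1" using \<phi> \<theta> by (auto simp: U_ad_def)
      then show ?thesis by eventually_elim (simp add: conv)
    qed
    moreover have "AE x in lebesgue_on S1. \<zeta> n x = 1"
    proof -
      have "AE x in lebesgue_on S1. \<phi> x = 1" "AE x in lebesgue_on S1. \<theta> x = 1" using \<phi> \<theta> by (auto simp: U_ad_def)
      then show ?thesis by eventually_elim (simp add: conv)
    qed
    moreover have "integrable O.\<Lambda> (\<lambda>x. (1 - t n) * \<phi> x + t n * \<theta> x)"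
      using \<phi> \<theta> by (intro Bochner_Integration.integrable_add integrable_mult_right) (auto simp: U_ad_def)
    then have "integrable O.\<Lambda> (\<zeta> n)" unfolding conv[symmetric] .
    ultimately show ?thesis using \<phi> \<theta> by (simp add: G_ad_def U_ad_def)
  qed
  have Linf: "Linf_norm \<Omega> (\<lambda>x. \<zeta> n x - \<phi> x) < ereal \<delta>" for n
  proof -
    have "Linf_norm \<Omega> (\<lambda>x. \<zeta> n x - \<phi> x) \<le> ereal (t n * 2)"
      unfolding Linf_norm_def
    proof (rule esssup_I)
      have "(\<lambda>x. \<zeta> n x - \<phi> x) \<in> borel_measurable O.\<Lambda>" using meas[OF \<zeta>_adm] meas[OF \<phi>] by (rule borel_measurable_diff)
      then show "(\<lambda>x. ereal \<bar>\<zeta> n x - \<phi> x\<bar>) \<in> borel_measurable O.\<Lambda>" by (intro borel_measurable_ereal borel_measurable_abs)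
      show "AE x in O.\<Lambda>. ereal \<bar>\<zeta> n x - \<phi> x\<bar> \<le> ereal (t n * 2)"
        using bound[OF \<phi>] bound[OF \<theta>]
      proof eventually_elim
        case (elim x)
        then have "\<bar>\<theta> x - \<phi> x\<bar> \<le> 2" by linarith
        then show ?case using t(1)[of n] by (simp add: \<zeta>_def abs_mult)
      qed
    qed
    also have "\<dots> < ereal \<delta>" using t(3)[of n] by simp
    finally show ?thesis .
  qed
  obtain Ka where Ka: "0 \<le> Ka" "\<And>x y. x \<in> {-1..1} \<Longrightarrow> y \<in> {-1..1} \<Longrightarrow> \<bar>a y - a x\<bar> \<le> Ka * \<bar>y - x\<bar> \<and>
      \<bar>a y - a x - deriv a x * (y - x)\<bar> \<le> Ka * (y - x)\<^sup>2 \<and> \<bar>deriv a x\<bar> \<le> Ka \<and> \<bar>a x\<bar> \<le> Ka"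
    using C11_loc_expansion[OF a] by blast
  obtain Kc where Kc: "0 \<le> Kc" "\<And>x y. x \<in> {-1..1} \<Longrightarrow> y \<in> {-1..1} \<Longrightarrow> \<bar>c y - c x\<bar> \<le> Kc * \<bar>y - x\<bar> \<and>
      \<bar>c y - c x - deriv c x * (y - x)\<bar> \<le> Kc * (y - x)\<^sup>2 \<and> \<bar>deriv c x\<bar> \<le> Kc \<and> \<bar>c x\<bar> \<le> Kc"
    using C11_loc_expansion[OF c] by blast
  \<comment> \<open>B bounds both coefficients on [-1,1], and D absorbs the factor 4 demanded by
    \<open>expansion_along_segment\<close>.\<close>
  define B where "B = Ka + Kc"
  define D where "D = 4 * B"
  have D: "0 \<le> D" "4 * Ka \<le> D" "4 * Kc \<le> D" using Ka(1) Kc(1) by (auto simp: D_def B_def)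
  have ec: "elliptic_coefficients \<Omega> (\<lambda>x. a (v x)) (\<lambda>x. c (v x)) C B"
    if "v \<in> G_ad \<Omega>t \<beta>1 \<beta>2 \<inter> U_ad \<Omega> S0 S1" for v
  proof (rule O.elliptic_coefficients_compose[OF lip C_pos aC cC a _ c _ meas[OF that] bound[OF that]])
    show "\<bar>a s\<bar> \<le> B" if "s \<in> {-1..1}" for s using Ka(2)[OF that that] Kc(1) by (simp add: B_def)
    show "\<bar>c s\<bar> \<le> B" if "s \<in> {-1..1}" for s using Kc(2)[OF that that] Ka(1) by (simp add: B_def)
  qed
  interpret E: elliptic_coefficients \<Omega> "\<lambda>x. a (\<phi> x)" "\<lambda>x. c (\<phi> x)" C B by (rule ec[OF \<phi>])
  let ?r = "O.mass_form (\<lambda>x. c (\<phi> x))" and ?q = "O.stiffness_form (\<lambda>x. a (\<phi> x))"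
  obtain e m where sys: "eigensystem (H1 \<Omega>) ?r ?q e m" using E.exists_eigensystem by blast
  have "\<exists>em. eigensystem (H1 \<Omega>) (O.mass_form (\<lambda>x. c (\<zeta> n x))) (O.stiffness_form (\<lambda>x. a (\<zeta> n x))) (fst em) (snd em)" for n
  proof -
    interpret F: elliptic_coefficients \<Omega> "\<lambda>x. a (\<zeta> n x)" "\<lambda>x. c (\<zeta> n x)" C B by (rule ec[OF \<zeta>_adm])
    show ?thesis using F.exists_eigensystem by auto
  qed
  then obtain em where em: "\<And>n. eigensystem (H1 \<Omega>) (O.mass_form (\<lambda>x. c (\<zeta> n x))) (O.stiffness_form (\<lambda>x. a (\<zeta> n x))) (fst (em n)) (snd (em n))"
    by metis
  define mn where "mn n = snd (em n)" for n
  have sysn: "eigensystem (H1 \<Omega>) (O.mass_form (\<lambda>x. c (\<zeta> n x))) (O.stiffness_form (\<lambda>x. a (\<zeta> n x))) (fst (em n)) (mn n)" for n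
    using em[of n] by (simp add: mn_def)
  have seq: "neumann_eigenvalue_sequence \<Omega> a c \<phi> m"
    by (rule eigensystem_neumann_eigenvalue_sequence[OF ec[OF \<phi>] sys])
  have m: "neumann_eigenvalue \<Omega> a c \<phi> = m" by (rule neumann_eigenvalue_eqI[OF seq])
  have mn: "neumann_eigenvalue \<Omega> a c (\<zeta> n) = mn n" for n
    by (rule neumann_eigenvalue_eqI[OF eigensystem_neumann_eigenvalue_sequence[OF ec[OF \<zeta>_adm] sysn]])
  have m_pos: "0 < m (i j)" for j
    by (rule simple_eigenvalue_pos[OF seq E.m_nonneg[OF sys] _ assms(21)]) (use simple[of j] m in simp)
  let ?da = "\<lambda>x. deriv a (\<phi> x) * (\<theta> x - \<phi> x)" and ?dc = "\<lambda>x. deriv c (\<phi> x) * (\<theta> x - \<phi> x)"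
  have \<zeta>_eq: "\<zeta> n x = \<phi> x + t n * (\<theta> x - \<phi> x)" for n x by (simp add: \<zeta>_def)
  have pert: "form_perturbation (H1 \<Omega>) ?r ?q (\<lambda>n. O.mass_form (\<lambda>x. c (\<zeta> n x))) (\<lambda>n. O.stiffness_form (\<lambda>x. a (\<zeta> n x)))
      (O.mass_form ?dc) (O.stiffness_form ?da) t (D / C)"
  proof (rule E.form_perturbationI[OF ec[OF \<zeta>_adm] t(1) t_lim D(1)])
    show "?da \<in> borel_measurable O.\<Lambda>" "?dc \<in> borel_measurable O.\<Lambda>"
      using meas[OF \<phi>] meas[OF \<theta>] C11_loc_measurable(2)[OF a] C11_loc_measurable(2)[OF c]
      by (auto intro!: borel_measurable_times borel_measurable_diff measurable_compose[OF meas[OF \<phi>]])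
    note b = bound[OF \<phi>] bound[OF \<theta>]
    have ea: "\<bar>a (x + s * (y - x)) - a x\<bar> \<le> D * s"
      "\<bar>a (x + s * (y - x)) - a x - s * (deriv a x * (y - x))\<bar> \<le> D * s\<^sup>2"
      "\<bar>deriv a x * (y - x)\<bar> \<le> D"
      if "\<bar>x\<bar> \<le> 1" "\<bar>y\<bar> \<le> 1" "0 < s" "s \<le> 1" for x y s
      using expansion_along_segment[of a Ka D x y s, OF Ka(2) Ka(1) D(2) that] by blast+
    have xc: "\<bar>c (x + s * (y - x)) - c x\<bar> \<le> D * s"
      "\<bar>c (x + s * (y - x)) - c x - s * (deriv c x * (y - x))\<bar> \<le> D * s\<^sup>2"
      "\<bar>deriv c x * (y - x)\<bar> \<le> D"
      if "\<bar>x\<bar> \<le> 1" "\<bar>y\<bar> \<le> 1" "0 < s" "s \<le> 1" for x y s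
      using expansion_along_segment[of c Kc D x y s, OF Kc(2) Kc(1) D(3) that] by blast+
    show "AE x in O.\<Lambda>. \<bar>?da x\<bar> \<le> D"
      using b by eventually_elim (rule ea(3)[OF _ _ zero_less_one order_refl])
    show "AE x in O.\<Lambda>. \<bar>?dc x\<bar> \<le> D"
      using b by eventually_elim (rule xc(3)[OF _ _ zero_less_one order_refl])
    show "AE x in O.\<Lambda>. \<bar>a (\<zeta> n x) - a (\<phi> x)\<bar> \<le> D * t n" for n
      unfolding \<zeta>_eq using b by eventually_elim (rule ea(1)[OF _ _ t(1,2)])
    show "AE x in O.\<Lambda>. \<bar>c (\<zeta> n x) - c (\<phi> x)\<bar> \<le> D * t n" for n
      unfolding \<zeta>_eq using b by eventually_elim (rule xc(1)[OF _ _ t(1,2)])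
    show "AE x in O.\<Lambda>. \<bar>a (\<zeta> n x) - a (\<phi> x) - t n * ?da x\<bar> \<le> D * (t n)\<^sup>2" for n
      unfolding \<zeta>_eq using b by eventually_elim (rule ea(2)[OF _ _ t(1,2)])
    show "AE x in O.\<Lambda>. \<bar>c (\<zeta> n x) - c (\<phi> x) - t n * ?dc x\<bar> \<le> D * (t n)\<^sup>2" for n
      unfolding \<zeta>_eq using b by eventually_elim (rule xc(2)[OF _ _ t(1,2)])
  qed
  \<comment> \<open>The candidate derivative of the eigenvalue with index i j along the segment; w j
    has unit mass, so no denominator appears.\<close>
  define L where "L j = O.stiffness_form ?da (w j) (w j) - m (i j) * O.mass_form ?dc (w j) (w j)" for j
  have deriv: "(\<lambda>n. (mn n (i j) - m (i j)) / t n) \<longlonglongrightarrow> L j" for j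
    unfolding L_def
  proof (rule form_perturbation.eigenvalue_derivative[OF pert sys sysn])
    have w: "w j \<in> neumann_eigenspace \<Omega> a c \<phi> (m (i j))" "\<not> (AE x in O.\<Lambda>. w j x = 0)"
      using eigenfun[of j] by (auto simp: neumann_eigenfunction_def m)
    then show "w j \<in> H1 \<Omega>" by (simp add: O.neumann_eigenspace_iff)
    show "?q (w j) h = m (i j) * ?r (w j) h" if "h \<in> H1 \<Omega>" for h
      using that w(1) by (auto simp: O.neumann_eigenspace_iff)
    show "?r (w j) (w j) = 1"
      using normalized[of j] by (simp add: O.mass_form_def power2_eq_square mult.assoc)
    fix v assume v: "v \<in> H1 \<Omega>" "\<And>h. h \<in> H1 \<Omega> \<Longrightarrow> ?q v h = m (i j) * ?r v h"
    then have vE: "v \<in> neumann_eigenspace \<Omega> a c \<phi> (m (i j))" by (simp add: O.neumann_eigenspace_iff)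
    \<comment> \<open>Simplicity gives one spanning function z. As w j is a nonzero multiple of z,
      every eigenfunction v for this eigenvalue is a multiple of w j.\<close>
    have "has_ae_dimension O.\<Lambda> (neumann_eigenspace \<Omega> a c \<phi> (m (i j))) 1"
      using simple[of j] by (simp add: simple_neumann_eigenvalue_def neumann_multiplicity_def m)
    then obtain z where z: "\<And>v. v \<in> neumann_eigenspace \<Omega> a c \<phi> (m (i j)) \<Longrightarrow> \<exists>r. AE x in O.\<Lambda>. v x = (\<Sum>k<1::nat. r k * z k x)"
      unfolding has_ae_dimension_def by meson
    obtain r1 r2 where r: "AE x in O.\<Lambda>. w j x = r1 * z 0 x" "AE x in O.\<Lambda>. v x = r2 * z 0 x"
      using z[OF w(1)] z[OF vE] by auto
    have "r1 \<noteq> 0" using r(1) w(2) by auto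
    have "AE x in O.\<Lambda>. v x = ((r2 / r1) *\<^sub>R w j) x"
      using r by eventually_elim (use \<open>r1 \<noteq> 0\<close> in simp)
    then show "\<exists>b. ?r (v - b *\<^sub>R w j) (v - b *\<^sub>R w j) = 0"
      using E.mass_diff_zero_iff[OF v(1) E.r.V_scale[of "w j" "r2 / r1"]] w(1) by (auto simp: O.neumann_eigenspace_iff)
  qed
  define \<mu> where "\<mu> = (\<chi> j. m (i j))"
  have \<mu>: "eigenvalue_vector \<Omega> a c i \<phi> = \<mu>" by (simp add: eigenvalue_vector_def \<mu>_def m)
  have \<mu>n: "eigenvalue_vector \<Omega> a c i (\<zeta> n) = (\<chi> j. mn n (i j))" for n by (simp add: eigenvalue_vector_def mn)
  define \<Psi>' where "\<Psi>' = frechet_derivative \<Psi> (at \<mu>)"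
  have \<Psi>_der: "(\<Psi> has_derivative \<Psi>') (at \<mu>)"
  proof -
    have "\<mu> \<in> {y. \<forall>j. y $ j > 0}" using m_pos by (simp add: \<mu>_def)
    then have "\<Psi> differentiable (at \<mu>)" using \<Psi> by (simp add: One_nat_def)
    then show ?thesis by (simp add: \<Psi>'_def frechet_derivative_works)
  qed
  have \<Psi>_lim: "(\<lambda>n. (\<Psi> (\<chi> j. mn n (i j)) - \<Psi> \<mu>) / t n) \<longlonglongrightarrow> \<Psi>' (\<chi> j. L j)"
  proof (rule difference_quotient_tendsto[OF \<Psi>_der t(1) t_lim])
    show "(\<lambda>n. (1 / t n) *\<^sub>R ((\<chi> j. mn n (i j)) - \<mu>)) \<longlonglongrightarrow> (\<chi> j. L j)"
    proof (rule vec_tendstoI)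
      show "(\<lambda>n. ((1 / t n) *\<^sub>R ((\<chi> j. mn n (i j)) - \<mu>)) $ j) \<longlonglongrightarrow> (\<chi> j. L j) $ j" for j
        using deriv[of j] by (simp add: \<mu>_def)
    qed
  qed
  have \<Psi>'_sum: "\<Psi>' (\<chi> j. L j) = (\<Sum>j\<in>UNIV. partial_deriv j \<Psi> \<mu> * L j)"
  proof -
    have lin: "linear \<Psi>'" using \<Psi>_der by (rule has_derivative_linear)
    have "(\<chi> j. L j) = (\<Sum>j\<in>UNIV. L j *\<^sub>R axis j 1)"
      by (simp add: vec_eq_iff axis_def if_distrib[of "\<lambda>y. _ * y"] cong: if_cong)
    then show ?thesis
      unfolding partial_deriv_def \<Psi>'_def[symmetric]
      by (simp add: linear_sum[OF lin] linear_scale[OF lin] mult.commute)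
  qed
  have C11\<psi>: "C11_loc \<psi>0" using \<psi> by (simp add: obstacle_potential_def)
  have GL_lim: "(\<lambda>n. (T.GL_value \<epsilon> \<psi>0 (\<zeta> n) - T.GL_value \<epsilon> \<psi>0 \<phi>) / t n) \<longlonglongrightarrow>
      \<epsilon> * (LINT x|T.\<Lambda>. weak_grad \<Omega>t \<phi> x \<bullet> weak_grad \<Omega>t ?h x) + 1 / \<epsilon> * (LINT x|T.\<Lambda>. deriv \<psi>0 (\<phi> x) * (\<theta> x - \<phi> x))"
    unfolding \<zeta>_def
    by (rule T.GL_value_derivative[OF C11\<psi> H1_t[OF \<phi>] bound_t[OF \<phi>] H1_t[OF \<theta>] bound_t[OF \<theta>] t(1,2) t_lim])
  have cost: "neumann_cost \<Omega> \<Omega>t a c i \<Psi> \<gamma> \<epsilon> \<psi> v = ereal (\<Psi> (eigenvalue_vector \<Omega> a c i v) + \<gamma> * T.GL_value \<epsilon> \<psi>0 v)"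
    if "v \<in> G_ad \<Omega>t \<beta>1 \<beta>2 \<inter> U_ad \<Omega> S0 S1" for v
    by (simp add: neumann_cost_def T.GL_energy_eq[OF \<psi> \<epsilon> H1_t[OF that] bound_t[OF that]])
  \<comment> \<open>Minimality divided by t n > 0 splits into the eigenvalue part and the energy
    part, whose limits exist separately.\<close>
  have "0 \<le> (\<Psi> (\<chi> j. mn n (i j)) - \<Psi> \<mu>) / t n + \<gamma> * ((T.GL_value \<epsilon> \<psi>0 (\<zeta> n) - T.GL_value \<epsilon> \<psi>0 \<phi>) / t n)" for n
  proof -
    have "\<Psi> \<mu> + \<gamma> * T.GL_value \<epsilon> \<psi>0 \<phi> \<le> \<Psi> (\<chi> j. mn n (i j)) + \<gamma> * T.GL_value \<epsilon> \<psi>0 (\<zeta> n)"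
      using le[OF \<zeta>_adm Linf, of n] by (simp add: cost[OF \<phi>] cost[OF \<zeta>_adm] \<mu> \<mu>n)
    then have "0 \<le> ((\<Psi> (\<chi> j. mn n (i j)) - \<Psi> \<mu>) + \<gamma> * (T.GL_value \<epsilon> \<psi>0 (\<zeta> n) - T.GL_value \<epsilon> \<psi>0 \<phi>)) / t n"
      using t(1)[of n] by (simp add: algebra_simps)
    then show ?thesis by (simp add: add_divide_distrib)
  qed
  then have limit: "0 \<le> \<Psi>' (\<chi> j. L j) + \<gamma> * (\<epsilon> * (LINT x|T.\<Lambda>. weak_grad \<Omega>t \<phi> x \<bullet> weak_grad \<Omega>t ?h x) + 1 / \<epsilon> * (LINT x|T.\<Lambda>. deriv \<psi>0 (\<phi> x) * (\<theta> x - \<phi> x)))"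
    by (intro LIMSEQ_le_const[OF tendsto_add[OF \<Psi>_lim tendsto_mult_left[OF GL_lim]]]) auto
  have h: "?h = (\<lambda>y. \<theta> y - \<phi> y)" by (simp add: fun_eq_iff)
  have L: "L j = (LINT x|O.\<Lambda>. deriv a (\<phi> x) * (\<theta> x - \<phi> x) * (norm (weak_grad \<Omega> (w j) x))\<^sup>2) -
      m (i j) * (LINT x|O.\<Lambda>. deriv c (\<phi> x) * (\<theta> x - \<phi> x) * (w j x)\<^sup>2)" for j
    by (simp add: L_def O.stiffness_form_def O.mass_form_def power2_norm_eq_inner) (simp add: power2_eq_square mult.assoc)
  show "0 \<le> \<gamma> * \<epsilon> * (LINT x|lebesgue_on \<Omega>t. weak_grad \<Omega>t \<phi> x \<bullet> weak_grad \<Omega>t (\<lambda>y. \<theta> y - \<phi> y) x)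
        + \<gamma> / \<epsilon> * (LINT x|lebesgue_on \<Omega>t. deriv \<psi>0 (\<phi> x) * (\<theta> x - \<phi> x))
        + (\<Sum>j\<in>UNIV. partial_deriv j \<Psi> (eigenvalue_vector \<Omega> a c i \<phi>) *
            ((LINT x|lebesgue_on \<Omega>. deriv a (\<phi> x) * (\<theta> x - \<phi> x) * (norm (weak_grad \<Omega> (w j) x))\<^sup>2)
             - neumann_eigenvalue \<Omega> a c \<phi> (i j) *
               (LINT x|lebesgue_on \<Omega>. deriv c (\<phi> x) * (\<theta> x - \<phi> x) * (w j x)\<^sup>2)))"
    using limit unfolding \<mu> m L[symmetric] \<Psi>'_sum h by (simp add: distrib_left mult.assoc)
qed

end
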